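(* Let $0<p,q\le\infty$ and $m\in\mathbb{R}$. (1) Suppose $0<p<\infty$ or $p=q=\infty$. If $s\le\tau_{p,q}$, then there exists $a\in\mathcal{S}_{1,1}^{m}$ such that $\Vert T_{[a]}\Vert_{F_p^{s+m,q}\to F_p^{s,q}}=\infty$. (2) If $s\le\tau_p$, then there exists $a\in\mathcal{S}_{1,1}^{m}$ such that $\Vert T_{[a]}\Vert_{B_p^{s+m,q}\to B_p^{s,q}}=\infty$.
   Context: $S=S(\mathbb{R}^d)$ is the Schwartz space, $S'$ the tempered distributions; $\widehat f(\xi)=\int f(x)e^{-2\pi i\langle x,\xi\rangle}dx$. $\tau_{p,q}:=\frac{d}{\min(1,p,q)}-d$ and $\tau_p:=\frac{d}{\min(1,p)}-d$. Symbols: $a\in\mathcal{S}^m_{1,1}$ means that $a$ is a smooth function on $\mathbb{R}^d\times\mathbb{R}^d$ such that for all multi-indices $\alpha,\beta$ there is $c_{\alpha,\beta}$ with $|\partial_\xi^\alpha\partial_x^\beta a(x,\xi)|\le c_{\alpha,\beta}(1+|\xi|)^{m-|\alpha|+|\beta|}$ for all $(x,\xi)$. Littlewood–Paley operators: fix $\phi\in S$ with $\widehat\phi$ supported in $\{2^{-1}\le|\xi|\le 2\}$ and $\sum_{k\in\mathbb{Z}}\widehat{\phi_k}(\xi)=1$ for $\xi\ne0$, where $\phi_k:=2^{kd}\phi(2^k\cdot)$. Let $\widehat\Phi:=1-\sum_{k=1}^\infty\widehat{\phi_k}$. Put $\Pi_0f:=\Phi*f$ and $\Pi_kf:=\phi_k*f$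 for $k\ge1$. Function spaces (subspaces of $S'$ given by finiteness of the (quasi-)norm): for $0<p,q\le\infty$, $s\in\mathbb{R}$, $\|f\|_{B_p^{s,q}}:=\|\Pi_0f\|_{L^p}+\|\{2^{sk}\Pi_kf\}_{k\ge1}\|_{l^q(L^p)}$; for $0<p<\infty$, $0<q\le\infty$, $\|f\|_{F_p^{s,q}}:=\|\Pi_0f\|_{L^p}+\|\{2^{sk}\Pi_kf\}_{k\ge1}\|_{L^p(l^q)}$; and $\|f\|_{F_\infty^{s,\infty}}:=\|f\|_{B_\infty^{s,\infty}}$. The operator $T_{[a]}$: for $f\in S$, $T_{[a]}f(x)=\int a(x,\xi)\widehat f(\xi)e^{2\pi i\langle x,\xi\rangle}d\xi$. For $j,k\ge0$ let $a_{j,k}(x,\xi):=\big(\phi_j*a(\cdot,\xi)\big)(x)\,\widehat{\phi_k}(\xi)$, with $\Phi$ in place of $\phi_0$ when $j=0$ or $k=0$; since $a_{j,k}(x,\cdot)$ has compact support, $T_{[a_{j,k}]}f$ makes sense for every $f\in S'$. For $f\in S'$, $T_{[a]}f:=\lim_{N\to\infty}\sum_{k=0}^N\sum_{j=0}^N T_{[a_{j,k}]}f$ whenever the limit converges in $S'$. $\|T_{[a]}\|_{X\to Y}$ is the operator (quasi-)norm, i.e. the supremum of $\|T_{[a]}f\|_Y/\|f\|_X$ over nonzero $f\in X$ for which $T_{[a]}f$ is defined, with $\|T_{[a]}f\|_Y=\infty$ if $T_{[a]}f\notin Y$. *)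

theory Defs
  imports "HOL-Analysis.Analysis" "HOL-Probability.Essential_Supremum"
begin

section \<open>Smooth functions, Schwartz functions and symbols\<close>

text \<open>A multi-index is encoded by a list of basis vectors: the list
  \<open>[e\<^sub>1, \<dots>, e\<^sub>n]\<close> stands for the iterated partial derivative
  \<open>\<partial>\<^bsub>e\<^sub>1\<^esub> \<dots> \<partial>\<^bsub>e\<^sub>n\<^esub>\<close>, and the order of the multi-index is the length of the list.
  For smooth functions partial derivatives commute, so the order of the entries is irrelevant.\<close>

definition partials :: "'a::euclidean_space list \<Rightarrow> ('a \<Rightarrow> complex) \<Rightarrow> 'a \<Rightarrow> complex" where
  "partials vs f = foldr (\<lambda>v g x. frechet_derivative g (at x) v) vs f"

text \<open>Total differentiability of every iterated partial derivative makes all of them continuous,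
  so this is \<open>C\<^sup>\<infinity>\<close>.\<close>

definition smooth_fun :: "('a::euclidean_space \<Rightarrow> complex) \<Rightarrow> bool" where
  "smooth_fun f \<longleftrightarrow> (\<forall>vs. set vs \<subseteq> Basis \<longrightarrow> (\<forall>x. partials vs f differentiable (at x)))"

definition schwartz :: "('a::euclidean_space \<Rightarrow> complex) set" where
  "schwartz = {f. smooth_fun f \<and>
     (\<forall>N::nat. \<forall>vs. set vs \<subseteq> Basis \<longrightarrow>
        (\<exists>C. \<forall>x. (1 + norm x) ^ N * norm (partials vs f x) \<le> C))}"

definition schwartz_seminorm :: "nat \<Rightarrow> ('a::euclidean_space \<Rightarrow> complex) \<Rightarrow> real" where
  "schwartz_seminorm N f =
     (SUP (vs, x) \<in> {vs. set vs \<subseteq> Basis \<and> length vs \<le> N} \<times> UNIV.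
        (1 + norm x) ^ N * norm (partials vs f x))"

text \<open>Symbols of class \<open>\<S>\<^sup>m\<^bsub>1,1\<^esub>\<close>, as functions of the pair \<open>(x, \<xi>)\<close>; the list
  \<open>\<alpha>\<close> collects the \<open>\<xi>\<close>-derivatives and \<open>\<beta>\<close> the \<open>x\<close>-derivatives.\<close>

definition symbols11 :: "real \<Rightarrow> ('a::euclidean_space \<times> 'a \<Rightarrow> complex) set" where
  "symbols11 m = {a. smooth_fun a \<and>
     (\<forall>\<alpha> \<beta>. set \<alpha> \<subseteq> Basis \<longrightarrow> set \<beta> \<subseteq> Basis \<longrightarrow>
        (\<exists>c. \<forall>x \<xi>. norm (partials (map (\<lambda>e. (0, e)) \<alpha> @ map (\<lambda>e. (e, 0)) \<beta>) a (x, \<xi>))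
                \<le> c * (1 + norm \<xi>) powr (m - real (length \<alpha>) + real (length \<beta>))))}"


section \<open>Tempered distributions\<close>

text \<open>Functionals are total functions in HOL; prescribing the value \<open>0\<close> outside the Schwartz space
  makes a tempered distribution the same thing as its restriction to the Schwartz space.\<close>

definition tempered :: "(('a::euclidean_space \<Rightarrow> complex) \<Rightarrow> complex) set" where
  "tempered = {u.
     (\<forall>\<psi>. \<psi> \<notin> schwartz \<longrightarrow> u \<psi> = 0) \<and>
     (\<forall>\<psi>\<in>schwartz. \<forall>\<eta>\<in>schwartz. u (\<lambda>x. \<psi> x + \<eta> x) = u \<psi> + u \<eta>) \<and>
     (\<forall>c. \<forall>\<psi>\<in>schwartz. u (\<lambda>x. c * \<psi> x) = c * u \<psi>) \<and>
     (\<exists>C N. \<forall>\<psi>\<in>schwartz. norm (u \<psi>) \<le> C * schwartz_seminorm N \<psi>)}"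

definition dist_of :: "('a::euclidean_space \<Rightarrow> complex) \<Rightarrow> ('a \<Rightarrow> complex) \<Rightarrow> complex" where
  "dist_of g \<psi> = (if \<psi> \<in> schwartz then LINT x|lborel. g x * \<psi> x else 0)"

definition fourier :: "('a::euclidean_space \<Rightarrow> complex) \<Rightarrow> 'a \<Rightarrow> complex" where
  "fourier f \<xi> = (LINT x|lborel. f x * exp (- 2 * of_real pi * \<i> * of_real (x \<bullet> \<xi>)))"

definition convolve :: "('a::euclidean_space \<Rightarrow> complex) \<Rightarrow> ('a \<Rightarrow> complex) \<Rightarrow> 'a \<Rightarrow> complex" where
  "convolve f g x = (LINT y|lborel. f (x - y) * g y)"

text \<open>The convolution of a Schwartz function with a tempered distribution is a smooth function.\<close>

definition convolve_dist ::
  "('a::euclidean_space \<Rightarrow> complex) \<Rightarrow> (('a \<Rightarrow> complex) \<Rightarrow> complex) \<Rightarrow> 'a \<Rightarrow> complex" where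
  "convolve_dist f u x = u (\<lambda>y. f (x - y))"


section \<open>Littlewood--Paley decomposition\<close>

definition dyadic_dilate :: "('a::euclidean_space \<Rightarrow> complex) \<Rightarrow> int \<Rightarrow> 'a \<Rightarrow> complex" where
  "dyadic_dilate \<phi> k x = of_real (2 powi (k * int DIM('a))) * \<phi> ((2 powi k) *\<^sub>R x)"

text \<open>The last condition says that \<open>\<Phi>\<close> is the function whose Fourier transform is
  \<open>1 - (\<Sum>k\<ge>1. fourier (\<phi>\<^sub>k))\<close>; it determines the Schwartz function \<open>\<Phi>\<close> uniquely.\<close>

definition littlewood_paley :: "('a::euclidean_space \<Rightarrow> complex) \<Rightarrow> ('a \<Rightarrow> complex) \<Rightarrow> bool" where
  "littlewood_paley \<phi> \<Phi> \<longleftrightarrow>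
     \<phi> \<in> schwartz \<and>
     (\<forall>\<xi>. fourier \<phi> \<xi> \<noteq> 0 \<longrightarrow> 1 / 2 \<le> norm \<xi> \<and> norm \<xi> \<le> 2) \<and>
     (\<forall>\<xi>. \<xi> \<noteq> 0 \<longrightarrow> ((\<lambda>k::int. fourier (dyadic_dilate \<phi> k) \<xi>) has_sum 1) UNIV) \<and>
     \<Phi> \<in> schwartz \<and>
     (\<forall>\<xi>. fourier \<Phi> \<xi> = 1 - (\<Sum>k. fourier (dyadic_dilate \<phi> (int (Suc k))) \<xi>))"

definition lp_kernel :: "('a::euclidean_space \<Rightarrow> complex) \<Rightarrow> ('a \<Rightarrow> complex) \<Rightarrow> nat \<Rightarrow> 'a \<Rightarrow> complex"
  where "lp_kernel \<phi> \<Phi> k = (if k = 0 then \<Phi> else dyadic_dilate \<phi> (int k))"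

definition lp_proj ::
  "('a::euclidean_space \<Rightarrow> complex) \<Rightarrow> ('a \<Rightarrow> complex) \<Rightarrow> nat \<Rightarrow> (('a \<Rightarrow> complex) \<Rightarrow> complex) \<Rightarrow> 'a \<Rightarrow> complex"
  where "lp_proj \<phi> \<Phi> k u = convolve_dist (lp_kernel \<phi> \<Phi> k) u"


section \<open>Besov and Triebel--Lizorkin quasi-norms\<close>

text \<open>Powers with exponent \<open>r > 0\<close>.\<close>

definition enn_powr :: "ennreal \<Rightarrow> real \<Rightarrow> ennreal" where
  "enn_powr x r = (if x = \<infinity> then \<infinity> else ennreal (enn2real x powr r))"

text \<open>The \<open>L\<^sup>p\<close> quasi-norm, \<open>0 < p \<le> \<infinity>\<close>. It is also used for \<open>l\<^sup>q\<close>,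
  with counting measure.\<close>

definition Lp_norm :: "'b measure \<Rightarrow> ennreal \<Rightarrow> ('b \<Rightarrow> ennreal) \<Rightarrow> ennreal" where
  "Lp_norm M p g = (if p = \<infinity> then esssup M g
     else enn_powr (\<integral>\<^sup>+ x. enn_powr (g x) (enn2real p) \<partial>M) (1 / enn2real p))"

definition besov_norm ::
  "('a::euclidean_space \<Rightarrow> complex) \<Rightarrow> ('a \<Rightarrow> complex) \<Rightarrow> real \<Rightarrow> ennreal \<Rightarrow> ennreal \<Rightarrow>
     (('a \<Rightarrow> complex) \<Rightarrow> complex) \<Rightarrow> ennreal" where
  "besov_norm \<phi> \<Phi> s p q u =
     Lp_norm lborel p (\<lambda>x. ennreal (norm (lp_proj \<phi> \<Phi> 0 u x))) +
     Lp_norm (count_space {1::nat..}) q (\<lambda>k. Lp_norm lborel p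
       (\<lambda>x. ennreal (2 powr (s * real k) * norm (lp_proj \<phi> \<Phi> k u x))))"

text \<open>For \<open>p = \<infinity>\<close> only \<open>q = \<infinity>\<close> is meaningful, and then the Triebel--Lizorkin
  quasi-norm is the Besov one by convention.\<close>

definition triebel_lizorkin_norm ::
  "('a::euclidean_space \<Rightarrow> complex) \<Rightarrow> ('a \<Rightarrow> complex) \<Rightarrow> real \<Rightarrow> ennreal \<Rightarrow> ennreal \<Rightarrow>
     (('a \<Rightarrow> complex) \<Rightarrow> complex) \<Rightarrow> ennreal" where
  "triebel_lizorkin_norm \<phi> \<Phi> s p q u = (if p = \<infinity> then besov_norm \<phi> \<Phi> s p q u else
     Lp_norm lborel p (\<lambda>x. ennreal (norm (lp_proj \<phi> \<Phi> 0 u x))) +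
     Lp_norm lborel p (\<lambda>x. Lp_norm (count_space {1::nat..}) q
       (\<lambda>k. ennreal (2 powr (s * real k) * norm (lp_proj \<phi> \<Phi> k u x)))))"


section \<open>Pseudo-differential operators\<close>

definition symbol_piece ::
  "('a::euclidean_space \<Rightarrow> complex) \<Rightarrow> ('a \<Rightarrow> complex) \<Rightarrow> ('a \<times> 'a \<Rightarrow> complex) \<Rightarrow> nat \<Rightarrow> nat \<Rightarrow>
     'a \<times> 'a \<Rightarrow> complex" where
  "symbol_piece \<phi> \<Phi> a j k = (\<lambda>(x, \<xi>).
     convolve (lp_kernel \<phi> \<Phi> j) (\<lambda>y. a (y, \<xi>)) x * fourier (lp_kernel \<phi> \<Phi> k) \<xi>)"

text \<open>\<open>T\<^bsub>[b]\<^esub> u\<close> for a symbol \<open>b\<close> with compact support in \<open>\<xi>\<close> and a tempered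
  distribution \<open>u\<close>: the pairing of the Fourier transform of \<open>u\<close>, which is
  \<open>\<psi> \<mapsto> u (fourier \<psi>)\<close>, with the test function \<open>\<xi> \<mapsto> b (x, \<xi>) exp (2 \<pi> \<i> (x \<bullet> \<xi>))\<close>.
  If \<open>u = dist_of f\<close> with \<open>f\<close> Schwartz, this is
  \<open>\<integral> b (x, \<xi>) fourier f \<xi> exp (2 \<pi> \<i> (x \<bullet> \<xi>)) d\<xi>\<close>.\<close>

definition psdo_compact ::
  "('a::euclidean_space \<times> 'a \<Rightarrow> complex) \<Rightarrow> (('a \<Rightarrow> complex) \<Rightarrow> complex) \<Rightarrow> 'a \<Rightarrow> complex" where
  "psdo_compact b u x =
     u (fourier (\<lambda>\<xi>. b (x, \<xi>) * exp (2 * of_real pi * \<i> * of_real (x \<bullet> \<xi>))))"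

text \<open>\<open>T\<^bsub>[a]\<^esub>\<close> is only partially defined on tempered distributions, hence given as a graph:
  \<open>T\<^bsub>[a]\<^esub> u\<close> is defined with value \<open>v\<close>. For \<open>u = dist_of f\<close> with \<open>f\<close> Schwartz,
  the limit is the usual integral operator.\<close>

definition psdo_graph ::
  "('a::euclidean_space \<Rightarrow> complex) \<Rightarrow> ('a \<Rightarrow> complex) \<Rightarrow> ('a \<times> 'a \<Rightarrow> complex) \<Rightarrow>
     (('a \<Rightarrow> complex) \<Rightarrow> complex) \<Rightarrow> (('a \<Rightarrow> complex) \<Rightarrow> complex) \<Rightarrow> bool" where
  "psdo_graph \<phi> \<Phi> a u v \<longleftrightarrow> u \<in> tempered \<and> v \<in> tempered \<and>
     (\<forall>\<psi>\<in>schwartz.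
        (\<lambda>N. \<Sum>k\<le>N. \<Sum>j\<le>N. dist_of (psdo_compact (symbol_piece \<phi> \<Phi> a j k) u) \<psi>)
          \<longlonglongrightarrow> v \<psi>)"

text \<open>Operator quasi-norm of a partial operator with graph \<open>T\<close> between the spaces of tempered
  distributions with finite \<open>NX\<close> and finite \<open>NY\<close>. The quasi-norm \<open>NY\<close> takes the value
  \<open>\<infinity>\<close> exactly outside the target space.\<close>

definition operator_norm ::
  "((('a::euclidean_space \<Rightarrow> complex) \<Rightarrow> complex) \<Rightarrow> (('a \<Rightarrow> complex) \<Rightarrow> complex) \<Rightarrow> bool) \<Rightarrow>
     ((('a \<Rightarrow> complex) \<Rightarrow> complex) \<Rightarrow> ennreal) \<Rightarrow> ((('a \<Rightarrow> complex) \<Rightarrow> complex) \<Rightarrow> ennreal) \<Rightarrow> ennreal"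
  where
  "operator_norm T NX NY =
     (SUP (u, v) \<in> {(u, v). u \<in> tempered \<and> u \<noteq> (\<lambda>_. 0) \<and> NX u < \<infinity> \<and> T u v}. NY v / NX u)"

definition tau1 :: "nat \<Rightarrow> ennreal \<Rightarrow> real" where
  "tau1 d p = real d / enn2real (min 1 p) - real d"

definition tau2 :: "nat \<Rightarrow> ennreal \<Rightarrow> ennreal \<Rightarrow> real" where
  "tau2 d p q = real d / enn2real (min 1 (min p q)) - real d"

end

theory Submission
  imports Defs "HOL-Probability.Probability"
begin

text \<open>Write \<open>e\<^sub>1\<close> for a unit vector. Ching's symbol
  \<open>a(x, \<xi>) = \<Sum>\<^sub>l 2\<^bsup>lm\<^esup> exp(-2 \<pi> \<i> 2\<^bsup>l\<^esup> x \<bullet> e\<^sub>1) \<eta>(2\<^bsup>-l\<^esup> \<xi>)\<close>, with \<open>\<eta>\<close> a bump at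
  \<open>e\<^sub>1\<close>, lies in the symbol class and maps
  \<open>f = \<Sum>\<^sub>k 2\<^bsup>-km\<^esup> exp(2 \<pi> \<i> 2\<^bsup>k\<^esup> x \<bullet> e\<^sub>1) G\<^sub>k\<close> to \<open>\<Sum>\<^sub>k G\<^sub>k\<close> whenever the spectrum of \<open>G\<^sub>k\<close> lies
  in the ball of radius \<open>2\<^bsup>k\<^esup>/8\<close>. The norm of \<open>f\<close> only sees \<open>2\<^bsup>ks\<^esup> \<bar>G\<^sub>k\<bar>\<close> at frequency \<open>2\<^bsup>k\<^esup>\<close>, while in
  the image the pieces have been moved to low frequencies. One symbol therefore serves all cases,
  and only the \<open>G\<^sub>k\<close> have to be chosen:
  \<^item> \<open>q > 1\<close>, \<open>s \<le> 0\<close>: equal low-frequency bumps, which add up coherently;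
  \<^item> \<open>s \<le> d/p - d\<close>: a single spike of width \<open>2\<^bsup>-k\<^esup>\<close>, whose Littlewood--Paley pieces at all lower
    frequencies have comparable norms (many spikes if \<open>q = \<infinity>\<close> in the Besov scale);
  \<^item> Besov spaces, \<open>q \<le> 1 < p\<close>, \<open>s \<le> 0\<close>: one \<open>G\<^sub>k\<close>, a sum of far apart translates of waves with different
    frequencies below \<open>2\<^bsup>k\<^esup>\<close>;
  \<^item> Triebel--Lizorkin spaces, \<open>q \<le> 1\<close>, \<open>q < p\<close>, \<open>s \<le> d/q - d\<close>: periodic arrays of bumps at lacunary
    scales. Their Fejer-type majorants are trigonometric polynomials which are exactly orthogonal with respect
    to the weights \<open>\<bar>\<psi>(x - y)\<bar>\<^sup>2\<close> for band-limited \<open>\<psi>\<close>, so a law of large numbers replaces their sum by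
    its mean.\<close>

subsection \<open>Schwartz functions\<close>

text \<open>All test functions are Schwartz with compactly supported transform and the families are
  finite, so the limit defining the operator is eventually constant; infinite norm means that for
  every C some family has ratio of norms above C. The input is therefore controlled pointwise, by
  majorants that vary slowly at scale 2^-k: convolution with a Littlewood-Paley kernel of comparable
  scale reproduces such a majorant up to a constant independent of the family. Lower bounds come
  from explicit formulas for the pieces of the image, or from their L2 energy together with a
  pointwise upper bound. In the bump arrays, whose bumps have width 2^-L relative to their spacing,
  the input sees each array once, while the image shows it in T octaves between spacing and width,
  each of which contributes a q-th power of at least a constant times 2^(-dL) when s <= d/q - d. The
  gain is T^(1/q). It survives in L^p because the sum of q-th powers is close to its mean, so that
  its L^(p/q) norm is comparable to that mean.\<close>

definition decays :: "('a::euclidean_space \<Rightarrow> complex) \<Rightarrow> bool" where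
  "decays f \<longleftrightarrow> (\<forall>N::nat. \<exists>C. \<forall>x. (1 + norm x) ^ N * norm (f x) \<le> C)"

definition grows_slowly :: "('a::euclidean_space \<Rightarrow> complex) \<Rightarrow> bool" where
  "grows_slowly f \<longleftrightarrow> (\<exists>C. \<exists>N::nat. \<forall>x. norm (f x) \<le> C * (1 + norm x) ^ N)"

definition pd :: "'a::euclidean_space \<Rightarrow> ('a \<Rightarrow> complex) \<Rightarrow> 'a \<Rightarrow> complex" where
  "pd b f x = frechet_derivative f (at x) b"

text \<open>One predicate for three classes: \<open>P = decays\<close> gives
  \<open>schwartz\<close>, \<open>P = grows_slowly\<close> gives the multipliers
  \<open>slow\<close>, and the trivial \<open>P\<close> gives plain smoothness. Differentiability is
  bundled with \<open>P\<close> so that closure proofs treat both at once.\<close>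

definition smooth_with :: "(('a::euclidean_space \<Rightarrow> complex) \<Rightarrow> bool) \<Rightarrow> ('a \<Rightarrow> complex) set" where
  "smooth_with P = {f. \<forall>vs. set vs \<subseteq> Basis \<longrightarrow>
     P (partials vs f) \<and> (\<forall>x. partials vs f differentiable (at x))}"

lemma partials_Nil [simp]: "partials [] f = f"
  by (simp add: partials_def)

lemma partials_Cons: "partials (v # vs) f = pd v (partials vs f)"
  by (simp add: partials_def pd_def fun_eq_iff)

lemma partials_snoc: "partials (vs @ [v]) f = partials vs (pd v f)"
  by (simp add: partials_def pd_def[abs_def])

lemma schwartz_eq: "schwartz = smooth_with decays"
  unfolding schwartz_def smooth_with_def smooth_fun_def decays_def by blast

text \<open>A set \<open>X\<close> closed under a single partial derivative absorbs the induction
  over lists of basis vectors. Each later membership proof only names a suitable \<open>X\<close>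
  and computes one derivative.\<close>

lemma smooth_with_coinduct:
  assumes "f \<in> X"
    and P: "\<And>f. f \<in> X \<Longrightarrow> P f"
    and D: "\<And>f. f \<in> X \<Longrightarrow> \<exists>f'. (\<forall>x. (f has_derivative f' x) (at x)) \<and> (\<forall>b\<in>Basis. (\<lambda>x. f' x b) \<in> X)"
  shows "f \<in> smooth_with P"
proof -
  have pd: "(\<forall>x. f differentiable (at x)) \<and> (\<forall>b\<in>Basis. pd b f \<in> X)" if f: "f \<in> X" for f
  proof -
    obtain f' where f': "\<And>x. (f has_derivative f' x) (at x)" "\<And>b. b \<in> Basis \<Longrightarrow> (\<lambda>x. f' x b) \<in> X"
      using D[OF f] by blast
    have "pd b f = (\<lambda>x. f' x b)" for b
      by (simp add: pd_def fun_eq_iff frechet_derivative_at[OF f'(1), symmetric])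
    then show ?thesis using f' by (auto simp: differentiable_def)
  qed
  have "partials vs f \<in> X" if "set vs \<subseteq> Basis" "f \<in> X" for vs f
    using that by (induction vs arbitrary: f) (auto simp: partials_Cons pd)
  then show ?thesis
    using assms(1) pd P by (auto simp: smooth_with_def)
qed

lemma smooth_withD:
  assumes "f \<in> smooth_with P"
  shows "P f" "(f has_derivative frechet_derivative f (at x)) (at x)" "f differentiable (at x)"
    "b \<in> Basis \<Longrightarrow> pd b f \<in> smooth_with P"
proof -
  have *: "P (partials vs f) \<and> (\<forall>x. partials vs f differentiable (at x))" if "set vs \<subseteq> Basis" for vs
    using assms that by (auto simp: smooth_with_def)
  show "P f" "f differentiable (at x)" using *[of "[]"] by auto
  then show "(f has_derivative frechet_derivative f (at x)) (at x)"
    using frechet_derivative_works by blast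
  show "pd b f \<in> smooth_with P" if "b \<in> Basis"
    using that *[of "vs @ [b]" for vs] by (auto simp: smooth_with_def partials_snoc)
qed

lemma smooth_with_mono: "(\<And>f. P f \<Longrightarrow> Q f) \<Longrightarrow> smooth_with P \<subseteq> smooth_with Q"
  by (auto simp: smooth_with_def)

text \<open>The Leibniz rule turns a product into a sum of products, so products alone are not
  closed under differentiation. Their finite sums are, and they form the coinduction set of
  \<open>smooth_with_mult\<close>.\<close>

inductive product_span :: "('b \<Rightarrow> complex) set \<Rightarrow> ('b \<Rightarrow> complex) set \<Rightarrow> ('b \<Rightarrow> complex) \<Rightarrow> bool" for S T where
  product: "f \<in> S \<Longrightarrow> g \<in> T \<Longrightarrow> product_span S T (\<lambda>x. f x * g x)"
| plus: "product_span S T f \<Longrightarrow> product_span S T g \<Longrightarrow> product_span S T (\<lambda>x. f x + g x)"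

lemma smooth_with_mult:
  assumes "f \<in> smooth_with P" "g \<in> smooth_with Q"
    and PQ: "\<And>f g. P f \<Longrightarrow> Q g \<Longrightarrow> R (\<lambda>x. f x * g x)"
    and RR: "\<And>f g. R f \<Longrightarrow> R g \<Longrightarrow> R (\<lambda>x. f x + g x)"
  shows "(\<lambda>x. f x * g x) \<in> smooth_with R"
proof (rule smooth_with_coinduct[where X = "Collect (product_span (smooth_with P) (smooth_with Q))"])
  show "(\<lambda>x. f x * g x) \<in> Collect (product_span (smooth_with P) (smooth_with Q))"
    unfolding mem_Collect_eq by (rule product) (use assms in auto)
next
  fix f assume "f \<in> Collect (product_span (smooth_with P) (smooth_with Q))"
  then have "product_span (smooth_with P) (smooth_with Q) f" by simp
  then show "R f"
  proof induction
    case (product f g)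
    show ?case by (rule PQ[OF smooth_withD(1)[OF product(1)] smooth_withD(1)[OF product(2)]])
  qed (rule RR)
next
  fix f assume "f \<in> Collect (product_span (smooth_with P) (smooth_with Q))"
  then have "product_span (smooth_with P) (smooth_with Q) f" by simp
  then show "\<exists>f'. (\<forall>x. (f has_derivative f' x) (at x)) \<and>
      (\<forall>b\<in>Basis. (\<lambda>x. f' x b) \<in> Collect (product_span (smooth_with P) (smooth_with Q)))"
  proof induction
    case (product f g)
    let ?f' = "\<lambda>x h. f x * frechet_derivative g (at x) h + frechet_derivative f (at x) h * g x"
    have "((\<lambda>x. f x * g x) has_derivative ?f' x) (at x)" for x
      by (rule has_derivative_mult[OF smooth_withD(2)[OF product(1)] smooth_withD(2)[OF product(2)]])
    moreover have "product_span (smooth_with P) (smooth_with Q) (\<lambda>x. ?f' x b)" if "b \<in> Basis" for b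
      using that product smooth_withD(4)[of f P b] smooth_withD(4)[of g Q b]
      by (intro product_span.plus product_span.product) (simp_all add: pd_def[abs_def])
    ultimately show ?case by (intro exI[of _ ?f']) auto
  next
    case (plus f g)
    then obtain f' g' where "\<forall>x. (f has_derivative f' x) (at x)" "\<forall>x. (g has_derivative g' x) (at x)"
      "\<forall>b\<in>Basis. product_span (smooth_with P) (smooth_with Q) (\<lambda>x. f' x b)"
      "\<forall>b\<in>Basis. product_span (smooth_with P) (smooth_with Q) (\<lambda>x. g' x b)" by auto
    then show ?case
      by (intro exI[of _ "\<lambda>x h. f' x h + g' x h"] conjI allI ballI has_derivative_add)
        (simp_all add: product_span.intros(2))
  qed
qed

lemma decaysI: "(\<And>N::nat. \<exists>C. \<forall>x. (1 + norm x) ^ N * norm (f x) \<le> C) \<Longrightarrow> decays f"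
  by (simp add: decays_def)

lemma decaysD:
  assumes "decays f"
  obtains C where "C > 0" "\<And>x. (1 + norm x) ^ N * norm (f x) \<le> C"
proof -
  obtain C where "\<And>x. (1 + norm x) ^ N * norm (f x) \<le> C" using assms by (auto simp: decays_def)
  then show ?thesis by (intro that[of "max C 1"]) (auto simp: le_max_iff_disj)
qed

lemma decays_add: "decays f \<Longrightarrow> decays g \<Longrightarrow> decays (\<lambda>x. f x + g x)"
proof (rule decaysI)
  fix N :: nat assume "decays f" "decays g"
  obtain C where C: "\<And>x. (1 + norm x) ^ N * norm (f x) \<le> C" using decaysD[OF \<open>decays f\<close>] by blast
  obtain D where D: "\<And>x. (1 + norm x) ^ N * norm (g x) \<le> D" using decaysD[OF \<open>decays g\<close>] by blast
  have "(1 + norm x) ^ N * norm (f x + g x) \<le> C + D" for x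
  proof -
    have "(1 + norm x) ^ N * norm (f x + g x) \<le> (1 + norm x) ^ N * (norm (f x) + norm (g x))"
      by (intro mult_left_mono norm_triangle_ineq) auto
    also have "\<dots> \<le> C + D" using C[of x] D[of x] by (simp add: distrib_left)
    finally show ?thesis .
  qed
  then show "\<exists>C. \<forall>x. (1 + norm x) ^ N * norm (f x + g x) \<le> C" by blast
qed

lemma decays_mult:
  assumes "decays f" "grows_slowly g"
  shows "decays (\<lambda>x. f x * g x)"
proof (rule decaysI)
  fix N :: nat
  obtain C M where C: "\<And>x. norm (g x) \<le> C * (1 + norm x) ^ M"
    using assms by (auto simp: grows_slowly_def)
  obtain D where D: "D > 0" "\<And>x. (1 + norm x) ^ (N + M) * norm (f x) \<le> D"
    using decaysD[OF \<open>decays f\<close>] by blast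
  have "C \<ge> 0" using order_trans[OF norm_ge_zero C[of 0]] by simp
  have "(1 + norm x) ^ N * norm (f x * g x) \<le> C * D" for x
  proof -
    have "(1 + norm x) ^ N * norm (f x * g x) \<le> (1 + norm x) ^ N * norm (f x) * (C * (1 + norm x) ^ M)"
      using C[of x] by (simp add: norm_mult mult_left_mono mult.assoc)
    also have "\<dots> = C * ((1 + norm x) ^ (N + M) * norm (f x))" by (simp add: power_add)
    also have "\<dots> \<le> C * D" using D \<open>C \<ge> 0\<close> by (intro mult_left_mono) auto
    finally show ?thesis .
  qed
  then show "\<exists>C. \<forall>x. (1 + norm x) ^ N * norm (f x * g x) \<le> C" by blast
qed

lemma decays_imp_grows_slowly: "decays f \<Longrightarrow> grows_slowly f"
proof -
  assume "decays f"
  then obtain C where "\<And>x. (1 + norm x) ^ 0 * norm (f x) \<le> C" by (metis decaysD)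
  then show ?thesis unfolding grows_slowly_def by (intro exI[of _ C] exI[of _ 0]) auto
qed

definition slow :: "('a::euclidean_space \<Rightarrow> complex) set" where
  "slow = smooth_with grows_slowly"

lemma schwartz_imp_slow: "f \<in> schwartz \<Longrightarrow> f \<in> slow"
  unfolding schwartz_eq slow_def using smooth_with_mono[of decays grows_slowly] decays_imp_grows_slowly by blast

lemmas schwartzD = smooth_withD[of _ decays, folded schwartz_eq]

lemma schwartz_mult: "f \<in> schwartz \<Longrightarrow> g \<in> slow \<Longrightarrow> (\<lambda>x. f x * g x) \<in> schwartz"
  unfolding schwartz_eq slow_def by (rule smooth_with_mult[OF _ _ decays_mult decays_add])

lemma schwartz_mult': "g \<in> slow \<Longrightarrow> f \<in> schwartz \<Longrightarrow> (\<lambda>x. g x * f x) \<in> schwartz"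
  using schwartz_mult[of f g] by (simp add: mult.commute)

lemma decays_zero: "decays (\<lambda>x. 0)" by (auto simp: decays_def)

lemma schwartz_add:
  assumes "f \<in> schwartz" "g \<in> schwartz" shows "(\<lambda>x. f x + g x) \<in> schwartz"
  unfolding schwartz_eq
proof (rule smooth_with_coinduct[where X = "{\<lambda>x. f x + g x | f g. f \<in> schwartz \<and> g \<in> schwartz}"])
  fix u assume "u \<in> {\<lambda>x. f x + g x | f g::'a \<Rightarrow> complex. f \<in> schwartz \<and> g \<in> schwartz}"
  then obtain f g where u: "u = (\<lambda>x. f x + g x)" "f \<in> schwartz" "g \<in> schwartz" by auto
  show "decays u" unfolding u(1) by (intro decays_add schwartzD u)
  show "\<exists>f'. (\<forall>x. (u has_derivative f' x) (at x)) \<and> (\<forall>b\<in>Basis. (\<lambda>x. f' x b) \<in> {\<lambda>x. f x + g x | f g. f \<in> schwartz \<and> g \<in> schwartz})"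
    unfolding u
    by (rule exI[of _ "\<lambda>x h. frechet_derivative f (at x) h + frechet_derivative g (at x) h"])
      (use u schwartzD(4)[OF u(2)] schwartzD(4)[OF u(3)] in \<open>force intro!: has_derivative_add schwartzD(2) simp: pd_def[abs_def]\<close>)
qed (use assms in auto)

lemma slow_const: "(\<lambda>x. c) \<in> slow"
  unfolding slow_def
proof (rule smooth_with_coinduct[where X = "range (\<lambda>c x. c)"])
  fix f :: "'a \<Rightarrow> complex" assume "f \<in> range (\<lambda>c x. c)"
  then obtain c where f: "f = (\<lambda>x. c)" by auto
  show "grows_slowly f" unfolding f grows_slowly_def by (intro exI[of _ "norm c"] exI[of _ 0]) auto
  show "\<exists>f'. (\<forall>x. (f has_derivative f' x) (at x)) \<and> (\<forall>b\<in>Basis. (\<lambda>x. f' x b) \<in> range (\<lambda>c x. c))"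
    unfolding f by (intro exI[of _ "\<lambda>x h. 0"]) auto
qed auto

lemma schwartz_cmult: "f \<in> schwartz \<Longrightarrow> (\<lambda>x. c * f x) \<in> schwartz"
  by (rule schwartz_mult'[OF slow_const])

lemma schwartz_zero: "(\<lambda>x. 0) \<in> schwartz"
  unfolding schwartz_eq
proof (rule smooth_with_coinduct[where X = "{\<lambda>x. 0}"])
  fix f :: "'a \<Rightarrow> complex" assume "f \<in> {\<lambda>x. 0}"
  then have f: "f = (\<lambda>x. 0)" by auto
  show "decays f" unfolding f by (rule decays_zero)
  show "\<exists>f'. (\<forall>x. (f has_derivative f' x) (at x)) \<and> (\<forall>b\<in>Basis. (\<lambda>x. f' x b) \<in> {\<lambda>x. 0})"
    unfolding f by (intro exI[of _ "\<lambda>x h. 0"]) auto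
qed auto

lemma schwartz_sum: "(\<And>i. i \<in> I \<Longrightarrow> f i \<in> schwartz) \<Longrightarrow> (\<lambda>x. \<Sum>i\<in>I. f i x) \<in> schwartz"
  by (induction I rule: infinite_finite_induct) (simp_all add: schwartz_zero schwartz_add)

lemma slow_linear: "(\<lambda>x. of_real (x \<bullet> v)) \<in> slow"
  unfolding slow_def
proof (rule smooth_with_coinduct[where X = "insert (\<lambda>x. of_real (x \<bullet> v)) (range (\<lambda>c x. c))"])
  fix f :: "'a \<Rightarrow> complex" assume f: "f \<in> insert (\<lambda>x. of_real (x \<bullet> v)) (range (\<lambda>c x. c))"
  show "grows_slowly f"
  proof (cases "f = (\<lambda>x. of_real (x \<bullet> v))")
    case True
    have "norm (f x) \<le> norm v * (1 + norm x) ^ 1" for x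
      using Cauchy_Schwarz_ineq2[of x v] norm_ge_zero[of v] unfolding True by (simp add: algebra_simps del: norm_ge_zero)
    then show ?thesis unfolding grows_slowly_def by blast
  next
    case False
    then obtain c where f: "f = (\<lambda>x. c)" using f by auto
    show ?thesis unfolding f grows_slowly_def by (intro exI[of _ "norm c"] exI[of _ 0]) auto
  qed
  show "\<exists>f'. (\<forall>x. (f has_derivative f' x) (at x)) \<and> (\<forall>b\<in>Basis. (\<lambda>x. f' x b) \<in> insert (\<lambda>x. of_real (x \<bullet> v)) (range (\<lambda>c x. c)))"
  proof (cases "f = (\<lambda>x. of_real (x \<bullet> v))")
    case True
    show ?thesis unfolding True by (intro exI[of _ "\<lambda>x h. of_real (h \<bullet> v)"]) (auto intro!: derivative_eq_intros)
  next
    case False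
    then obtain c where f: "f = (\<lambda>x. c)" using f by auto
    show ?thesis unfolding f by (intro exI[of _ "\<lambda>x h. 0"]) auto
  qed
qed auto

definition ee :: "real \<Rightarrow> complex" where "ee t = cis (2 * pi * t)"

lemma ee_0 [simp]: "ee 0 = 1" by (simp add: ee_def)
lemma norm_ee [simp]: "norm (ee t) = 1" by (simp add: ee_def)
lemma ee_add: "ee (s + t) = ee s * ee t" by (simp add: ee_def cis_mult distrib_left)
lemma ee_minus: "ee (- t) = cnj (ee t)" by (simp add: ee_def cis_cnj)
lemma ee_nonzero [simp]: "ee t \<noteq> 0" using norm_ee[of t] by fastforce
lemma ee_exp: "ee t = exp (2 * of_real pi * \<i> * of_real t)"
  by (simp add: ee_def cis_conv_exp mult_ac)

lemma continuous_on_ee [continuous_intros]: "continuous_on A f \<Longrightarrow> continuous_on A (\<lambda>x. ee (f x))"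
  unfolding ee_exp by (intro continuous_intros)

lemma borel_measurable_ee [measurable]: "ee \<in> borel_measurable borel"
  by (intro borel_measurable_continuous_onI continuous_intros)

lemma has_derivative_ee [derivative_intros]:
  assumes "(f has_derivative f') (at x within A)"
  shows "((\<lambda>x. ee (f x)) has_derivative (\<lambda>h. 2 * of_real pi * \<i> * of_real (f' h) * ee (f x))) (at x within A)"
proof -
  have "((\<lambda>x. 2 * of_real pi * \<i> * of_real (f x) :: complex) has_derivative (\<lambda>h. 2 * of_real pi * \<i> * of_real (f' h))) (at x within A)"
    by (intro has_derivative_mult_right has_derivative_of_real assms)
  from has_derivative_compose[OF this DERIV_exp[unfolded has_field_derivative_def]]
  show ?thesis by (simp add: ee_exp mult.commute)
qed

lemma fourier_eq: "fourier f \<xi> = (LINT x|lborel. f x * ee (- (x \<bullet> \<xi>)))"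
  by (simp add: fourier_def ee_exp)

lemma slow_ee: "(\<lambda>x. ee (x \<bullet> v)) \<in> slow"
  unfolding slow_def
proof (rule smooth_with_coinduct[where X = "range (\<lambda>c x. c * ee (x \<bullet> v))"])
  fix f :: "'a \<Rightarrow> complex" assume "f \<in> range (\<lambda>c x. c * ee (x \<bullet> v))"
  then obtain c where f: "f = (\<lambda>x. c * ee (x \<bullet> v))" by auto
  show "grows_slowly f" unfolding f grows_slowly_def by (intro exI[of _ "norm c"] exI[of _ 0]) (auto simp: norm_mult)
  show "\<exists>f'. (\<forall>x. (f has_derivative f' x) (at x)) \<and> (\<forall>b\<in>Basis. (\<lambda>x. f' x b) \<in> range (\<lambda>c x. c * ee (x \<bullet> v)))"
  proof (intro exI conjI allI ballI)
    show "(f has_derivative (\<lambda>h. c * (2 * of_real pi * \<i> * of_real (h \<bullet> v) * ee (x \<bullet> v)))) (at x)" for x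
      unfolding f by (rule derivative_eq_intros refl | simp)+
    show "(\<lambda>x. c * (2 * of_real pi * \<i> * of_real (b \<bullet> v) * ee (x \<bullet> v))) \<in> range (\<lambda>c x. c * ee (x \<bullet> v))" for b
      by (rule image_eqI[of _ _ "c * (2 * of_real pi * \<i> * of_real (b \<bullet> v))"]) (auto simp: mult.assoc)
  qed
qed (rule image_eqI[of _ _ 1], auto)

lemma slow_ee': "(\<lambda>x. ee (v \<bullet> x)) \<in> slow"
  using slow_ee[of v] by (simp add: inner_commute)

text \<open>The scalar \<open>k\<close> in the coinduction set \<open>?X\<close> takes up the
  factors \<open>c\<close> that the chain rule produces.\<close>

lemma schwartz_affine:
  assumes "f \<in> schwartz" "c \<noteq> 0" shows "(\<lambda>x. f (c *\<^sub>R x + a)) \<in> schwartz"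
proof -
  let ?X = "{\<lambda>x. k * f (c *\<^sub>R x + a) | k f. f \<in> schwartz}"
  have "(\<lambda>x. k * f (c *\<^sub>R x + a)) \<in> schwartz" if "f \<in> schwartz" for k and f :: "'a \<Rightarrow> complex"
    unfolding schwartz_eq
  proof (rule smooth_with_coinduct[where X = ?X])
    fix u assume "u \<in> ?X"
    then obtain k f where u: "u = (\<lambda>x. k * f (c *\<^sub>R x + a))" and f: "f \<in> schwartz" by auto
    show "decays u"
    proof (rule decaysI)
      fix N :: nat
      obtain C where C: "C > 0" "\<And>x. (1 + norm x) ^ N * norm (f x) \<le> C" using schwartzD(1)[OF f] decaysD by blast
      \<comment> \<open>An affine change of variable alters 1 + |x| by a bounded factor, since |x| =
        |(c x + a) - a| / |c|.\<close>
      define B where "B = 1 + (1 + norm a) / \<bar>c\<bar>"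
      have B: "1 + norm x \<le> B * (1 + norm (c *\<^sub>R x + a))" for x
      proof -
        have "norm x = norm ((c *\<^sub>R x + a) - a) / \<bar>c\<bar>" using assms(2) by simp
        also have "\<dots> \<le> (norm (c *\<^sub>R x + a) + norm a) / \<bar>c\<bar>" by (intro divide_right_mono norm_triangle_ineq4) auto
        also have "\<dots> \<le> (1 + norm a) / \<bar>c\<bar> * (1 + norm (c *\<^sub>R x + a))"
          by (simp add: divide_right_mono field_simps)
        finally show ?thesis unfolding B_def by (simp add: algebra_simps add_increasing)
      qed
      have B0: "B \<ge> 0" unfolding B_def by auto
      have "(1 + norm x) ^ N * norm (u x) \<le> norm k * (B ^ N * C)" for x
      proof -
        have "(1 + norm x) ^ N \<le> (B * (1 + norm (c *\<^sub>R x + a))) ^ N" by (intro power_mono B) auto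
        then have "(1 + norm x) ^ N * norm (u x) \<le> (B * (1 + norm (c *\<^sub>R x + a))) ^ N * norm (u x)"
          by (intro mult_right_mono) auto
        also have "\<dots> = norm k * (B ^ N * ((1 + norm (c *\<^sub>R x + a)) ^ N * norm (f (c *\<^sub>R x + a))))"
          by (simp add: u norm_mult power_mult_distrib mult_ac)
        also have "\<dots> \<le> norm k * (B ^ N * C)" using C B0 by (intro mult_left_mono) auto
        finally show ?thesis .
      qed
      then show "\<exists>C. \<forall>x. (1 + norm x) ^ N * norm (u x) \<le> C" by blast
    qed
    show "\<exists>f'. (\<forall>x. (u has_derivative f' x) (at x)) \<and> (\<forall>b\<in>Basis. (\<lambda>x. f' x b) \<in> ?X)"
    proof (intro exI conjI allI ballI)
      let ?f' = "\<lambda>x. frechet_derivative f (at (c *\<^sub>R x + a))"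
      have "((\<lambda>x. f (c *\<^sub>R x + a)) has_derivative (\<lambda>h. ?f' x (c *\<^sub>R h))) (at x)" for x
        by (rule has_derivative_compose[of "\<lambda>x. c *\<^sub>R x + a" "\<lambda>h. c *\<^sub>R h" x UNIV f "?f' x"])
          (auto intro!: derivative_eq_intros schwartzD f)
      then have "(u has_derivative (\<lambda>h. k * ?f' x (c *\<^sub>R h))) (at x)" for x
        unfolding u by (rule has_derivative_mult_right)
      moreover have "?f' x (c *\<^sub>R h) = c *\<^sub>R ?f' x h" for x h
        using schwartzD(2)[OF f, of "c *\<^sub>R x + a"] has_derivative_linear linear_cmul by blast
      ultimately show "(u has_derivative (\<lambda>h. (k * of_real c) * ?f' x h)) (at x)" for x
        by (simp add: scaleR_conv_of_real mult.assoc)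
      show "(\<lambda>x. (k * of_real c) * ?f' x b) \<in> ?X" if "b \<in> Basis" for b
        using schwartzD(4)[OF f that] by (auto simp: pd_def[abs_def] intro!: exI[of _ "k * of_real c"])
    qed
  qed (use that in auto)
  from this[OF assms(1), of 1] show ?thesis by simp
qed

lemma schwartz_dilate: "f \<in> schwartz \<Longrightarrow> c \<noteq> 0 \<Longrightarrow> (\<lambda>x. f (c *\<^sub>R x)) \<in> schwartz"
  using schwartz_affine[of f c 0] by simp

lemma schwartz_translate: "f \<in> schwartz \<Longrightarrow> (\<lambda>x. f (x - a)) \<in> schwartz"
  using schwartz_affine[of f 1 "- a"] by simp

lemma schwartz_reflect: "f \<in> schwartz \<Longrightarrow> (\<lambda>x. f (a - x)) \<in> schwartz"
  using schwartz_affine[of f "-1" a] by simp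

lemma schwartz_continuous: "f \<in> schwartz \<Longrightarrow> continuous_on A f"
  by (meson schwartzD(3) differentiable_imp_continuous_within continuous_at_imp_continuous_on)

lemma schwartz_measurable [measurable_dest]: "f \<in> schwartz \<Longrightarrow> f \<in> borel_measurable borel"
  by (intro borel_measurable_continuous_onI schwartz_continuous)

lemma measurable_inner_ee [measurable]: "(\<lambda>x::'a::euclidean_space. ee (x \<bullet> v)) \<in> borel_measurable borel"
  by (intro borel_measurable_continuous_onI continuous_intros)

lemma measurable_inner_ee' [measurable]: "(\<lambda>x::'a::euclidean_space. ee (- (x \<bullet> v))) \<in> borel_measurable borel"
  by (intro borel_measurable_continuous_onI continuous_intros)

subsection \<open>The Fourier transform on the Schwartz space\<close>

text \<open>The weight of order 2d is dominated by the product over the coordinates of 1 / (1 +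
  t^2), whose one-dimensional integral is known. This is the origin of the exponent
  \<open>2 * DIM('a)\<close> in all later weights.\<close>

lemma integrable_weight_powr:
  assumes "r \<ge> 2 * real DIM('a)"
  shows "integrable lborel (\<lambda>x::'a::euclidean_space. (1 + norm x) powr - r)"
proof (rule integrableI_bounded)
  have 1: "(\<integral>\<^sup>+x. ennreal (inverse (1 + (x::real)\<^sup>2)) \<partial>lborel) < \<infinity>"
    using integrable_inverse_1_plus_square
    by (simp add: set_integrable_def integrable_iff_bounded)
  have 2: "norm ((1 + norm x) powr - r) \<le> (\<Prod>b\<in>Basis. inverse (1 + (x \<bullet> b)\<^sup>2))" for x :: 'a
  proof -
    have "(1 + norm x) powr - r \<le> (1 + norm x) powr - (2 * real DIM('a))"
      using assms by (intro powr_mono) auto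
    also have "\<dots> = inverse ((1 + norm x) powr real (2 * DIM('a)))" by (simp add: powr_minus)
    also have "\<dots> = inverse ((1 + norm x) ^ (2 * DIM('a)))"
      by (subst powr_realpow) (auto simp: add_pos_nonneg)
    also have "\<dots> = inverse (\<Prod>b\<in>(Basis::'a set). (1 + norm x)\<^sup>2)" by (simp add: power_mult)
    also have "\<dots> \<le> inverse (\<Prod>b\<in>(Basis::'a set). 1 + (x \<bullet> b)\<^sup>2)"
    proof (intro le_imp_inverse_le prod_mono conjI prod_pos)
      fix b :: 'a assume b: "b \<in> Basis"
      have "\<bar>x \<bullet> b\<bar> \<le> norm x" by (rule Basis_le_norm[OF b])
      then have "(x \<bullet> b)\<^sup>2 \<le> (norm x)\<^sup>2" by (simp add: abs_le_square_iff[symmetric])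
      then show "1 + (x \<bullet> b)\<^sup>2 \<le> (1 + norm x)\<^sup>2" using norm_ge_zero[of x] by (simp add: power2_sum del: norm_ge_zero)
    qed (auto simp: add_pos_nonneg)
    finally show ?thesis using prod_inversef[of "\<lambda>b. 1 + (x \<bullet> b)\<^sup>2" Basis] by (simp add: o_def)
  qed
  have "(\<integral>\<^sup>+x. ennreal (norm ((1 + norm (x::'a)) powr - r)) \<partial>lborel)
      \<le> (\<integral>\<^sup>+x. ennreal (\<Prod>b\<in>Basis. inverse (1 + ((x::'a) \<bullet> b)\<^sup>2)) \<partial>lborel)"
    by (intro nn_integral_mono ennreal_leI 2)
  also have "\<dots> = (\<integral>\<^sup>+x. (\<Prod>b\<in>Basis. ennreal (inverse (1 + ((x::'a) \<bullet> b)\<^sup>2))) \<partial>lborel)"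
    by (subst prod_ennreal) auto
  also have "\<dots> = (\<Prod>b\<in>(Basis::'a set). (\<integral>\<^sup>+x. ennreal (inverse (1 + (x::real)\<^sup>2)) \<partial>lborel))"
    by (rule nn_integral_lborel_prod) auto
  also have "\<dots> < \<infinity>" using 1 by (simp add: less_top[symmetric] ennreal_prod_eq_top power_eq_top_ennreal_iff)
  finally show "(\<integral>\<^sup>+x. ennreal (norm ((1 + norm (x::'a)) powr - r)) \<partial>lborel) < \<infinity>" .
qed auto

lemma integrable_weight:
  assumes "N \<ge> 2 * DIM('a)"
  shows "integrable lborel (\<lambda>x::'a::euclidean_space. 1 / (1 + norm x) ^ N)"
proof -
  have "(1 + norm x) powr - real N = 1 / (1 + norm x) ^ N" for x :: 'a
    by (subst powr_minus, subst powr_realpow) (auto simp: add_pos_nonneg field_simps)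
  then show ?thesis using integrable_weight_powr[where 'a='a, of "real N"] assms by simp
qed

lemma schwartz_bound:
  assumes "f \<in> schwartz"
  obtains C where "C > 0" "\<And>x. norm (f x) \<le> C / (1 + norm x) ^ N"
proof -
  obtain C where "C > 0" "\<And>x. (1 + norm x) ^ N * norm (f x) \<le> C"
    using decaysD[OF schwartzD(1)[OF assms]] by blast
  then show ?thesis by (intro that[of C]) (auto simp: field_simps add_pos_nonneg)
qed

lemma schwartz_bounded: assumes "f \<in> schwartz" obtains C where "C > 0" "\<And>x. norm (f x) \<le> C"
  using schwartz_bound[OF assms, of 0] by auto

lemma schwartz_integrable: assumes "f \<in> schwartz" shows "integrable lborel f"
proof -
  obtain C where C: "C > 0" "\<And>x::'a. norm (f x) \<le> C / (1 + norm x) ^ (2 * DIM('a))"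
    using schwartz_bound[OF assms] by blast
  have "integrable lborel (\<lambda>x::'a. C * (1 / (1 + norm x) ^ (2 * DIM('a))))"
    by (intro integrable_mult_right integrable_weight) simp
  then show ?thesis
    by (rule Bochner_Integration.integrable_bound) (use assms C in auto)
qed

lemma integrable_bounded_mult:
  fixes f g :: "'a \<Rightarrow> 'b::{real_normed_algebra,banach,second_countable_topology}"
  assumes "integrable M f" "g \<in> borel_measurable M" "\<And>x. norm (g x) \<le> C"
  shows "integrable M (\<lambda>x. f x * g x)"
proof (rule Bochner_Integration.integrable_bound)
  show "integrable M (\<lambda>x. C *\<^sub>R f x)" by (intro integrable_scaleR_right assms)
  have "norm (f x * g x) \<le> \<bar>C\<bar> * norm (f x)" for x
  proof -
    have "norm (g x) \<le> \<bar>C\<bar>" using assms(3)[of x] by linarith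
    then have "norm (f x) * norm (g x) \<le> norm (f x) * \<bar>C\<bar>" by (intro mult_left_mono) auto
    then show ?thesis using norm_mult_ineq[of "f x" "g x"] by (simp add: mult.commute)
  qed
  then show "AE x in M. norm (f x * g x) \<le> norm (C *\<^sub>R f x)" by simp
qed (use assms in auto)

lemma schwartz_integrable_mult:
  assumes "f \<in> schwartz" "g \<in> borel_measurable borel" "\<And>x. norm (g x) \<le> C"
  shows "integrable lborel (\<lambda>x. f x * g x)"
  by (rule integrable_bounded_mult[OF schwartz_integrable[OF assms(1)] _ assms(3)]) (use assms in auto)

lemma nn_integral_affine:
  fixes f :: "'a::euclidean_space \<Rightarrow> ennreal"
  assumes [measurable]: "f \<in> borel_measurable borel" and c: "c \<noteq> 0"
  shows "(\<integral>\<^sup>+x. f x \<partial>lborel) = ennreal (\<bar>c\<bar> ^ DIM('a)) * (\<integral>\<^sup>+x. f (t + c *\<^sub>R x) \<partial>lborel)"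
  by (subst lborel_affine[OF c, of t])
     (simp add: nn_integral_density nn_integral_distr nn_integral_cmult)

lemma integrable_affine:
  fixes f :: "'a::euclidean_space \<Rightarrow> 'b :: {banach, second_countable_topology}"
  assumes f: "integrable lborel f" and c: "c \<noteq> 0"
  shows "integrable lborel (\<lambda>x. f (t + c *\<^sub>R x))"
  using f f[THEN borel_measurable_integrable] c unfolding integrable_iff_bounded
  by (subst (asm) nn_integral_affine[where c=c and t=t]) (auto simp: ennreal_mult_less_top)

lemma integral_affine:
  fixes f :: "'a::euclidean_space \<Rightarrow> 'b :: {banach, second_countable_topology}"
  assumes [measurable]: "f \<in> borel_measurable borel" and c: "c \<noteq> 0"
  shows "(LINT x|lborel. f x) = (\<bar>c\<bar> ^ DIM('a)) *\<^sub>R (LINT x|lborel. f (t + c *\<^sub>R x))"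
  by (subst lborel_affine[OF c, of t]) (simp add: integral_density integral_distr)

lemma integral_translate:
  fixes f :: "'a::euclidean_space \<Rightarrow> 'b :: {banach, second_countable_topology}"
  assumes "f \<in> borel_measurable borel"
  shows "(LINT x|lborel. f (x + t)) = (LINT x|lborel. f x)"
  using integral_affine[OF assms, of 1 t] by (simp add: add.commute)

lemma integral_reflect:
  fixes f :: "'a::euclidean_space \<Rightarrow> 'b :: {banach, second_countable_topology}"
  assumes "f \<in> borel_measurable borel"
  shows "(LINT x|lborel. f (t - x)) = (LINT x|lborel. f x)"
  using integral_affine[OF assms, of "-1" t] by simp

text \<open>An explicit quadratic error survives integration in a parameter, which a plain little-o
  statement does not; this is how the Fourier transform is differentiated below.\<close>

lemma has_derivative_quadratic:
  assumes "bounded_linear f'" "\<And>y. norm (f y - f x - f' (y - x)) \<le> C * norm (y - x) ^ 2"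
  shows "(f has_derivative f') (at x)"
  unfolding has_derivative_at_alt
proof (intro conjI assms allI impI)
  fix e :: real assume e: "e > 0"
  define D where "D = \<bar>C\<bar> + 1"
  have D: "D > 0" "C \<le> D" by (auto simp: D_def)
  show "\<exists>d>0. \<forall>y. norm (y - x) < d \<longrightarrow> norm (f y - f x - f' (y - x)) \<le> e * norm (y - x)"
  proof (intro exI[of _ "e / D"] conjI allI impI)
    fix y assume "norm (y - x) < e / D"
    then have "D * norm (y - x) \<le> e" using D by (simp add: field_simps)
    then have "D * norm (y - x) * norm (y - x) \<le> e * norm (y - x)" by (intro mult_right_mono) auto
    moreover have "C * norm (y - x) ^ 2 \<le> D * norm (y - x) ^ 2" using D by (intro mult_right_mono) auto
    ultimately show "norm (f y - f x - f' (y - x)) \<le> e * norm (y - x)"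
      using assms(2)[of y] by (simp add: power2_eq_square mult.assoc)
  qed (use e D in auto)
qed

lemma ee_quadratic: "norm (ee t - 1 - 2 * of_real pi * \<i> * of_real t) \<le> 2 * pi\<^sup>2 * t\<^sup>2"
proof -
  have "norm (iexp (2 * pi * t) - (\<Sum>k\<le>1. (\<i> * of_real (2 * pi * t)) ^ k / fact k)) \<le> \<bar>2 * pi * t\<bar> ^ Suc 1 / fact (Suc 1)"
    by (rule iexp_approx1)
  then show ?thesis by (simp add: ee_exp power2_eq_square algebra_simps abs_mult)
qed

text \<open>Replaces integration by parts: every difference quotient has integral zero by
  translation invariance, the quotients tend to the derivative, and the mean value inequality along
  a segment dominates them by the decay of \<open>pd b F\<close>.\<close>

lemma integral_pd_zero:
  assumes F: "F \<in> schwartz" and b: "b \<in> Basis"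
  shows "(LINT x|lborel. pd b F x) = 0"
proof -
  obtain C where C: "C > 0" "\<And>x::'a. norm (pd b F x) \<le> C / (1 + norm x) ^ (2 * DIM('a))"
    using schwartz_bound[OF schwartzD(4)[OF F b]] by blast
  define M where "M = 2 * DIM('a)"
  define q where "q n x = of_real (real (Suc n)) * (F (x + (1 / real (Suc n)) *\<^sub>R b) - F x)" for n x
  have int: "integrable lborel (\<lambda>x. F (x + t *\<^sub>R b))" for t
    using schwartz_affine[OF F, of 1 "t *\<^sub>R b"] by (intro schwartz_integrable) simp
  have deriv: "((\<lambda>t. F (x + t *\<^sub>R b)) has_vector_derivative pd b F (x + t *\<^sub>R b)) (at t within S)" for x t S
  proof -
    have "((\<lambda>t. F (x + t *\<^sub>R b)) has_derivative (\<lambda>h. frechet_derivative F (at (x + t *\<^sub>R b)) (h *\<^sub>R b))) (at t within S)"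
      by (rule has_derivative_compose[of "\<lambda>t. x + t *\<^sub>R b" "\<lambda>h. h *\<^sub>R b"])
        (auto intro!: derivative_eq_intros schwartzD F)
    moreover have "frechet_derivative F (at y) (h *\<^sub>R b) = h *\<^sub>R frechet_derivative F (at y) b" for y h
      using schwartzD(2)[OF F, of y] has_derivative_linear linear_cmul by blast
    ultimately show ?thesis by (simp add: has_vector_derivative_def pd_def)
  qed
  have "(\<lambda>n. LINT x|lborel. q n x) \<longlonglongrightarrow> (LINT x|lborel. pd b F x)"
  proof (rule integral_dominated_convergence[where w = "\<lambda>x. C * 2 ^ M * (1 / (1 + norm x) ^ M)"])
    show "pd b F \<in> borel_measurable lborel" using schwartzD(4)[OF F b] by auto
    show "q n \<in> borel_measurable lborel" for n
      unfolding q_def using int[of "1 / real (Suc n)"] int[of 0] by (auto dest!: borel_measurable_integrable)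
    show "integrable lborel (\<lambda>x::'a. C * 2 ^ M * (1 / (1 + norm x) ^ M))"
      by (intro integrable_mult_right integrable_weight) (simp add: M_def)
    show "AE x in lborel. (\<lambda>n. q n x) \<longlonglongrightarrow> pd b F x"
    proof (rule AE_I2)
      fix x :: 'a
      have "((\<lambda>h. norm (F (x + h *\<^sub>R b) - F x - h *\<^sub>R pd b F x) / norm h) \<longlongrightarrow> 0) (at 0)"
        using deriv[of x 0 UNIV] by (simp add: has_vector_derivative_def has_derivative_at)
      moreover have "filterlim (\<lambda>n. 1 / real (Suc n)) (at 0) sequentially"
        unfolding filterlim_at using LIMSEQ_inverse_real_of_nat by (auto simp: field_simps)
      ultimately have "(\<lambda>n. norm (F (x + (1 / real (Suc n)) *\<^sub>R b) - F x - (1 / real (Suc n)) *\<^sub>R pd b F x) / norm (1 / real (Suc n))) \<longlonglongrightarrow> 0"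
        by (rule filterlim_compose)
      also have "(\<lambda>n. norm (F (x + (1 / real (Suc n)) *\<^sub>R b) - F x - (1 / real (Suc n)) *\<^sub>R pd b F x) / norm (1 / real (Suc n))) = (\<lambda>n. norm (q n x - pd b F x))"
      proof
        fix n
        have "q n x - pd b F x = real (Suc n) *\<^sub>R (F (x + (1 / real (Suc n)) *\<^sub>R b) - F x - (1 / real (Suc n)) *\<^sub>R pd b F x)"
          unfolding q_def scaleR_diff_right[of _ _ "_ *\<^sub>R _"] by (simp add: scaleR_conv_of_real[of "real (Suc n)"] del: of_nat_Suc)
        then show "norm (F (x + (1 / real (Suc n)) *\<^sub>R b) - F x - (1 / real (Suc n)) *\<^sub>R pd b F x) / norm (1 / real (Suc n)) = norm (q n x - pd b F x)"
          by simp
      qed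
      finally show "(\<lambda>n. q n x) \<longlonglongrightarrow> pd b F x"
        by (rule LIM_zero_cancel[OF tendsto_norm_zero_cancel])
    qed
    show "AE x in lborel. norm (q n x) \<le> C * 2 ^ M * (1 / (1 + norm x) ^ M)" for n
    proof (rule AE_I2)
      fix x :: 'a
      let ?t = "1 / real (Suc n)"
      let ?B = "C * 2 ^ M * (1 / (1 + norm x) ^ M)"
      \<comment> \<open>A shift by at most one unit changes 1 + |x| by a factor of at most 2, hence
        the loss of 2^M.\<close>
      have B: "norm (pd b F (x + s *\<^sub>R b)) \<le> C * 2 ^ M * (1 / (1 + norm x) ^ M)" if "s \<in> {0..1}" for s
      proof -
        have "norm (s *\<^sub>R b) \<le> 1" using that b by simp
        then have "norm x \<le> norm (x + s *\<^sub>R b) + 1"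
          using norm_triangle_ineq4[of "x + s *\<^sub>R b" "s *\<^sub>R b"] by simp
        then have "1 + norm x \<le> 2 * (1 + norm (x + s *\<^sub>R b))" 
          using order_trans[OF add_left_mono[of "norm x" "norm (x + s *\<^sub>R b) + 1" 1]] norm_ge_zero[of "x + s *\<^sub>R b"]
          by (simp add: distrib_left del: norm_ge_zero)
        then have "(1 + norm x) ^ M \<le> (2 * (1 + norm (x + s *\<^sub>R b))) ^ M" by (intro power_mono) auto
        then have "C / (1 + norm (x + s *\<^sub>R b)) ^ M \<le> ?B"
          using C(1) unfolding power_mult_distrib by (simp add: field_simps add_pos_nonneg)
        then show ?thesis using C(2)[of "x + s *\<^sub>R b"] by (simp add: M_def)
      qed
      have "norm (F (x + ?t *\<^sub>R b) - F (x + 0 *\<^sub>R b)) \<le> ?B * norm (?t - 0)"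
      proof (rule differentiable_bound[of "{0..1}" "\<lambda>t. F (x + t *\<^sub>R b)" "\<lambda>s h. h *\<^sub>R pd b F (x + s *\<^sub>R b)"])
        show "onorm (\<lambda>h. h *\<^sub>R pd b F (x + s *\<^sub>R b)) \<le> ?B" if "s \<in> {0..1}" for s
        proof (rule onorm_bound)
          show "0 \<le> ?B" using C(1) by simp
          show "norm (h *\<^sub>R pd b F (x + s *\<^sub>R b)) \<le> ?B * norm h" for h
            using mult_left_mono[OF B[OF that], of "norm h"] by (simp add: mult.commute)
        qed
      qed (use deriv in \<open>auto simp: has_vector_derivative_def\<close>)
      then have "real (Suc n) * norm (F (x + ?t *\<^sub>R b) - F x) \<le> real (Suc n) * (?B * norm (?t - 0))"
        by (intro mult_left_mono) (auto simp del: of_nat_Suc)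
      also have "\<dots> = ?B" by (simp del: of_nat_Suc)
      finally show "norm (q n x) \<le> ?B"
        by (simp only: q_def norm_mult norm_of_real abs_of_nat)
    qed
  qed
  moreover have "(LINT x|lborel. q n x) = 0" for n
  proof -
    have "(LINT x|lborel. q n x) = of_real (real (Suc n)) *
        ((LINT x|lborel. F (x + (1 / real (Suc n)) *\<^sub>R b)) - (LINT x|lborel. F x))"
      unfolding q_def using int[of "1 / real (Suc n)"] int[of 0] by simp
    then show ?thesis using integral_translate[of F] F by simp
  qed
  ultimately show ?thesis by (simp add: LIMSEQ_const_iff)
qed

text \<open>The derivative of f times a character integrates to zero; Leibniz' rule splits this
  integral into the two sides.\<close>

lemma fourier_pd:
  assumes f: "f \<in> schwartz" and b: "b \<in> Basis"
  shows "fourier (pd b f) \<xi> = 2 * of_real pi * \<i> * of_real (\<xi> \<bullet> b) * fourier f \<xi>"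
proof -
  let ?F = "\<lambda>x. f x * ee (x \<bullet> (- \<xi>))"
  have F: "?F \<in> schwartz" by (rule schwartz_mult[OF f slow_ee])
  have "(?F has_derivative (\<lambda>h. f x * (2 * of_real pi * \<i> * of_real (h \<bullet> - \<xi>) * ee (x \<bullet> - \<xi>)) + frechet_derivative f (at x) h * ee (x \<bullet> - \<xi>))) (at x)" for x
    by (rule has_derivative_mult[OF schwartzD(2)[OF f]]) (auto intro!: derivative_eq_intros)
  then have "frechet_derivative ?F (at x) = (\<lambda>h. f x * (2 * of_real pi * \<i> * of_real (h \<bullet> - \<xi>) * ee (x \<bullet> - \<xi>)) + frechet_derivative f (at x) h * ee (x \<bullet> - \<xi>))" for x
    by (rule frechet_derivative_at[symmetric])
  then have "pd b ?F x = pd b f x * ee (- (x \<bullet> \<xi>)) - 2 * of_real pi * \<i> * of_real (\<xi> \<bullet> b) * (f x * ee (- (x \<bullet> \<xi>)))" for x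
    by (simp add: pd_def inner_commute)
  then have "0 = (LINT x|lborel. pd b f x * ee (- (x \<bullet> \<xi>)) - 2 * of_real pi * \<i> * of_real (\<xi> \<bullet> b) * (f x * ee (- (x \<bullet> \<xi>))))"
    using integral_pd_zero[OF F b] by simp
  also have "\<dots> = fourier (pd b f) \<xi> - 2 * of_real pi * \<i> * of_real (\<xi> \<bullet> b) * fourier f \<xi>"
    unfolding fourier_eq
    by (subst Bochner_Integration.integral_diff)
      (auto intro!: integrable_mult_right schwartz_integrable_mult[where C=1] f schwartzD(4) b)
  finally show ?thesis by simp
qed

text \<open>The character is expanded to second order under the integral; the error is at most a
  multiple of (x . h)^2 |f x|.\<close>

lemma fourier_has_derivative:
  assumes f: "f \<in> schwartz"
  shows "(fourier f has_derivative
     (\<lambda>h. \<Sum>b\<in>Basis. of_real (h \<bullet> b) * fourier (\<lambda>x. - (2 * of_real pi * \<i>) * of_real (x \<bullet> b) * f x) \<xi>)) (at \<xi>)"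
    (is "(_ has_derivative ?D) _")
proof -
  have xf: "(\<lambda>x. - (2 * of_real pi * \<i>) * of_real (x \<bullet> b) * f x) \<in> schwartz" for b
    using schwartz_cmult[OF schwartz_mult'[OF slow_linear f], of "- (2 * of_real pi * \<i>)" b] by (simp only: mult.assoc)
  have lin: "bounded_linear ?D"
    by (intro bounded_linear_sum bounded_linear_mult_const bounded_linear_compose[OF bounded_linear_of_real] bounded_linear_inner_left)
  \<comment> \<open>Two of the powers pay for the factor (x . h)^2, and the remaining 2d make the
    weight integrable.\<close>
  obtain C where C: "C > 0" "\<And>x::'a. norm (f x) \<le> C / (1 + norm x) ^ (2 * DIM('a) + 2)"
    using schwartz_bound[OF f] by blast
  let ?w = "\<lambda>x::'a. 1 / (1 + norm x) ^ (2 * DIM('a))"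
  let ?I = "LINT x|lborel. C * ?w x"
  have "norm (fourier f \<eta> - fourier f \<xi> - ?D (\<eta> - \<xi>)) \<le> 2 * pi\<^sup>2 * ?I * (norm (\<eta> - \<xi>))\<^sup>2" for \<eta>
  proof -
  define h where "h = \<eta> - \<xi>"
  let ?g = "\<lambda>x. f x * ee (- (x \<bullet> \<eta>)) - f x * ee (- (x \<bullet> \<xi>)) - (\<Sum>b\<in>Basis. of_real (h \<bullet> b) * (- (2 * of_real pi * \<i>) * of_real (x \<bullet> b) * f x * ee (- (x \<bullet> \<xi>))))"
  have eq: "fourier f \<eta> - fourier f \<xi> - ?D h = (LINT x|lborel. ?g x)"
    unfolding fourier_eq
    by (subst Bochner_Integration.integral_diff Bochner_Integration.integral_sum,
      (intro Bochner_Integration.integrable_diff integrable_mult_right Bochner_Integration.integrable_sum schwartz_integrable_mult[where C=1] f xf; simp)+)+ simp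
  have g: "norm (?g x) \<le> 2 * pi\<^sup>2 * (norm h)\<^sup>2 * (C * ?w x)" for x
  proof -
    have "(\<Sum>b\<in>Basis. of_real (h \<bullet> b) * (- (2 * of_real pi * \<i>) * of_real (x \<bullet> b) * f x * ee (- (x \<bullet> \<xi>)))) =
        f x * ee (- (x \<bullet> \<xi>)) * (2 * of_real pi * \<i>) * - of_real (\<Sum>b\<in>Basis. (x \<bullet> b) * (h \<bullet> b))"
      unfolding of_real_sum sum_negf[symmetric] sum_distrib_left by (intro sum.cong) (auto simp: mult_ac)
    also have "\<dots> = f x * ee (- (x \<bullet> \<xi>)) * (2 * of_real pi * \<i>) * of_real (- (x \<bullet> h))"
      by (simp add: euclidean_inner[of x h])
    finally have "?g x = f x * ee (- (x \<bullet> \<xi>)) * (ee (- (x \<bullet> h)) - 1 - 2 * of_real pi * \<i> * of_real (- (x \<bullet> h)))"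
      by (simp add: h_def inner_diff_right ee_add[symmetric] algebra_simps)
    then have "norm (?g x) \<le> norm (f x) * (2 * pi\<^sup>2 * (- (x \<bullet> h))\<^sup>2)"
      using ee_quadratic[of "- (x \<bullet> h)"] by (auto simp: norm_mult intro!: mult_left_mono)
    also have "(- (x \<bullet> h))\<^sup>2 \<le> (1 + norm x)\<^sup>2 * (norm h)\<^sup>2"
    proof -
      have "\<bar>x \<bullet> h\<bar> \<le> norm x * norm h" by (rule Cauchy_Schwarz_ineq2)
      also have "\<dots> \<le> (1 + norm x) * norm h" by (intro mult_right_mono) auto
      finally have "\<bar>x \<bullet> h\<bar>\<^sup>2 \<le> ((1 + norm x) * norm h)\<^sup>2" by (intro power_mono) auto
      then show ?thesis by (simp add: power_mult_distrib)
    qed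
    also have "norm (f x) * (2 * pi\<^sup>2 * ((1 + norm x)\<^sup>2 * (norm h)\<^sup>2)) \<le> C / (1 + norm x) ^ (2 * DIM('a) + 2) * (2 * pi\<^sup>2 * ((1 + norm x)\<^sup>2 * (norm h)\<^sup>2))"
      by (intro mult_right_mono C) auto
    also have "\<dots> = 2 * pi\<^sup>2 * (norm h)\<^sup>2 * (C * ?w x)"
    proof -
      have nz: "1 + norm x \<noteq> 0" using norm_ge_zero[of x] by linarith
      have "C / (z ^ k * z\<^sup>2) * (u * (z\<^sup>2 * v)) = u * v * (C * (1 / z ^ k))" if "z \<noteq> 0" for z u v :: real and k
        using that by (simp add: field_simps)
      from this[OF nz] show ?thesis unfolding power_add .
    qed
    finally show ?thesis by (simp add: mult_left_mono)
  qed
  have "norm (LINT x|lborel. ?g x) \<le> (LINT x|lborel. 2 * pi\<^sup>2 * (norm h)\<^sup>2 * (C * ?w x))"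
    by (rule Bochner_Integration.integral_norm_bound_integral)
      (intro Bochner_Integration.integrable_diff integrable_mult_right Bochner_Integration.integrable_sum schwartz_integrable_mult[where C=1] f xf integrable_weight g; simp)+
  also have "\<dots> = 2 * pi\<^sup>2 * ?I * (norm h)\<^sup>2"
    by (subst Bochner_Integration.integral_mult_right_zero) (simp only: mult_ac)
  finally show ?thesis
    using eq by (simp add: h_def)
  qed
  then show ?thesis by (rule has_derivative_quadratic[OF lin])
qed

lemma norm_fourier_le: "norm (fourier f \<xi>) \<le> (LINT x|lborel. norm (f x))"
proof -
  have "norm (fourier f \<xi>) \<le> (LINT x|lborel. norm (f x * ee (- (x \<bullet> \<xi>))))"
    unfolding fourier_eq by (rule integral_norm_bound)
  then show ?thesis by (simp add: norm_mult)
qed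

text \<open>One power of |\<xi>| is bounded by the coordinates of \<xi>, and each coordinate is one
  derivative of f by \<open>fourier_pd\<close>; since the class is closed under derivatives, the
  induction generalises over f.\<close>

lemma fourier_decays:
  assumes "f \<in> schwartz"
  shows "\<exists>C. \<forall>\<xi>::'a::euclidean_space. (1 + norm \<xi>) ^ N * norm (fourier f \<xi>) \<le> C"
  using assms
proof (induction N arbitrary: f)
  case 0
  then show ?case using norm_fourier_le[of f] by auto
next
  case (Suc N)
  have "\<forall>b\<in>Basis. \<exists>C. \<forall>\<xi>. (1 + norm \<xi>) ^ N * norm (fourier (pd b f) \<xi>) \<le> C"
    using Suc schwartzD(4) by blast
  then obtain C where C: "\<And>b \<xi>. b \<in> Basis \<Longrightarrow> (1 + norm \<xi>) ^ N * norm (fourier (pd b f) \<xi>) \<le> C b"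
    by metis
  obtain C0 where C0: "\<And>\<xi>. (1 + norm \<xi>) ^ N * norm (fourier f \<xi>) \<le> C0" using Suc by blast
  have "(1 + norm \<xi>) ^ Suc N * norm (fourier f \<xi>) \<le> C0 + (\<Sum>b\<in>Basis. C b)" for \<xi>
  proof -
    have *: "\<bar>\<xi> \<bullet> b\<bar> * norm (fourier f \<xi>) \<le> norm (fourier (pd b f) \<xi>)" if "b \<in> Basis" for b
    proof -
      have "1 * (\<bar>\<xi> \<bullet> b\<bar> * norm (fourier f \<xi>)) \<le> (2 * pi) * (\<bar>\<xi> \<bullet> b\<bar> * norm (fourier f \<xi>))"
        using pi_gt3 by (intro mult_right_mono) auto
      then show ?thesis using that Suc.prems by (simp add: fourier_pd norm_mult mult.assoc)
    qed
    have "(1 + norm \<xi>) ^ Suc N * norm (fourier f \<xi>) = (1 + norm \<xi>) ^ N * ((1 + norm \<xi>) * norm (fourier f \<xi>))" by simp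
    also have "\<dots> \<le> (1 + norm \<xi>) ^ N * ((1 + (\<Sum>b\<in>Basis. \<bar>\<xi> \<bullet> b\<bar>)) * norm (fourier f \<xi>))"
      by (intro mult_left_mono mult_right_mono add_left_mono norm_le_l1) auto
    also have "\<dots> = (1 + norm \<xi>) ^ N * norm (fourier f \<xi>) + (\<Sum>b\<in>Basis. (1 + norm \<xi>) ^ N * (\<bar>\<xi> \<bullet> b\<bar> * norm (fourier f \<xi>)))"
      by (simp add: algebra_simps sum_distrib_left sum_distrib_right)
    also have "\<dots> \<le> C0 + (\<Sum>b\<in>Basis. C b)"
    proof (intro add_mono C0 sum_mono)
      fix b :: 'a assume b: "b \<in> Basis"
      have "(1 + norm \<xi>) ^ N * (\<bar>\<xi> \<bullet> b\<bar> * norm (fourier f \<xi>)) \<le> (1 + norm \<xi>) ^ N * norm (fourier (pd b f) \<xi>)"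
        by (intro mult_left_mono * b) auto
      then show "(1 + norm \<xi>) ^ N * (\<bar>\<xi> \<bullet> b\<bar> * norm (fourier f \<xi>)) \<le> C b" using C[OF b, of \<xi>] by linarith
    qed
    finally show ?thesis .
  qed
  then show ?case by blast
qed

lemma fourier_schwartz:
  assumes "f \<in> schwartz" shows "fourier f \<in> schwartz"
  unfolding schwartz_eq
proof (rule smooth_with_coinduct[where X = "fourier ` schwartz"])
  fix g assume "g \<in> fourier ` (schwartz :: ('a \<Rightarrow> complex) set)"
  then obtain f :: "'a \<Rightarrow> complex" where g: "g = fourier f" and f: "f \<in> schwartz" by auto
  show "decays g" unfolding g by (rule decaysI fourier_decays f)+
  show "\<exists>f'. (\<forall>x. (g has_derivative f' x) (at x)) \<and> (\<forall>b\<in>Basis. (\<lambda>x. f' x b) \<in> fourier ` schwartz)"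
    unfolding g
  proof (intro exI conjI allI ballI)
    show "(fourier f has_derivative (\<lambda>h. \<Sum>b\<in>Basis. of_real (h \<bullet> b) * fourier (\<lambda>x. - (2 * of_real pi * \<i>) * of_real (x \<bullet> b) * f x) \<xi>)) (at \<xi>)" for \<xi>
      by (rule fourier_has_derivative[OF f])
    fix c :: 'a assume c: "c \<in> Basis"
    have "(\<lambda>x. - (2 * of_real pi * \<i>) * of_real (x \<bullet> c) * f x) \<in> schwartz"
      using schwartz_cmult[OF schwartz_mult'[OF slow_linear f], of "- (2 * of_real pi * \<i>)" c] by (simp only: mult.assoc)
    moreover have "(\<lambda>\<xi>. \<Sum>b\<in>Basis. of_real (c \<bullet> b) * fourier (\<lambda>x. - (2 * of_real pi * \<i>) * of_real (x \<bullet> b) * f x) \<xi>) = fourier (\<lambda>x. - (2 * of_real pi * \<i>) * of_real (x \<bullet> c) * f x)"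
    proof
      fix \<xi>
      have "(\<Sum>b\<in>Basis. of_real (c \<bullet> b) * fourier (\<lambda>x. - (2 * of_real pi * \<i>) * of_real (x \<bullet> b) * f x) \<xi>) =
        (\<Sum>b\<in>Basis. if b = c then fourier (\<lambda>x. - (2 * of_real pi * \<i>) * of_real (x \<bullet> b) * f x) \<xi> else 0)"
        using c by (intro sum.cong) (auto simp: inner_Basis)
      then show "(\<Sum>b\<in>Basis. of_real (c \<bullet> b) * fourier (\<lambda>x. - (2 * of_real pi * \<i>) * of_real (x \<bullet> b) * f x) \<xi>) = fourier (\<lambda>x. - (2 * of_real pi * \<i>) * of_real (x \<bullet> c) * f x) \<xi>"
        using c by simp
    qed
    ultimately show "(\<lambda>\<xi>. \<Sum>b\<in>Basis. of_real (c \<bullet> b) * fourier (\<lambda>x. - (2 * of_real pi * \<i>) * of_real (x \<bullet> b) * f x) \<xi>) \<in> fourier ` schwartz"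
      by blast
  qed
qed (use assms in auto)

section \<open>Gaussians, inversion and Plancherel\<close>

lemma integral_lborel_prod:
  fixes f :: "'a::euclidean_space \<Rightarrow> real \<Rightarrow> complex"
  assumes f: "\<And>b. b \<in> Basis \<Longrightarrow> integrable lborel (f b)"
  shows "(LINT x|lborel. (\<Prod>b\<in>Basis. f b (x \<bullet> b))) = (\<Prod>b\<in>(Basis::'a set). LINT x|lborel. f b x)"
proof -
  interpret product_sigma_finite "\<lambda>_::'a. lborel :: real measure" ..
  have [measurable]: "f b \<in> borel_measurable borel" if "b \<in> Basis" for b
    using borel_measurable_integrable[OF f[OF that]] by simp
  have "(LINT x|lborel. (\<Prod>b\<in>Basis. f b (x \<bullet> b))) =
      (LINT x|(\<Pi>\<^sub>M b\<in>(Basis::'a set). lborel). (\<Prod>b\<in>Basis. f b ((\<Sum>c\<in>Basis. x c *\<^sub>R c) \<bullet> b)))"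
    by (subst lborel_eq, rule integral_distr) measurable
  also have "\<dots> = (LINT x|(\<Pi>\<^sub>M b\<in>(Basis::'a set). lborel). (\<Prod>b\<in>Basis. f b (x b)))"
    by (intro Bochner_Integration.integral_cong prod.cong) auto
  also have "\<dots> = (\<Prod>b\<in>(Basis::'a set). LINT x|lborel. f b x)"
    by (rule product_integral_prod) (use f in auto)
  finally show ?thesis .
qed

lemma gauss_fourier_1:
  "integrable lborel (\<lambda>t. complex_of_real (exp (- pi * t\<^sup>2)) * ee (- (t * u)))" (is ?I)
  "(LINT t|lborel. complex_of_real (exp (- pi * t\<^sup>2)) * ee (- (t * u))) = of_real (exp (- pi * u\<^sup>2))" (is ?E)
proof -
  \<comment> \<open>The substitution x = c t turns the standard normal density into exp(-pi t^2), so
    the known characteristic function of the normal law gives the transform.\<close>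
  define c where "c = sqrt (2 * pi)"
  have c: "c > 0" "c\<^sup>2 = 2 * pi" by (auto simp: c_def)
  let ?g = "\<lambda>x. complex_of_real (std_normal_density x) * iexp ((- c * u) * x)"
  have eq: "c *\<^sub>R ?g (0 + c * t) = of_real (exp (- pi * t\<^sup>2)) * ee (- (t * u))" for t
  proof -
    have "(- c * u) * (0 + c * t) = - (c\<^sup>2 * (t * u))" by (simp add: power2_eq_square)
    then have 1: "(- c * u) * (0 + c * t) = 2 * pi * (- (t * u))" by (simp add: c)
    have 2: "iexp (2 * pi * v) = ee v" for v by (simp add: ee_exp mult_ac)
    have "(c * t)\<^sup>2 / 2 = pi * t\<^sup>2" by (simp add: power_mult_distrib c)
    then have 3: "std_normal_density (c * t) = exp (- pi * t\<^sup>2) / c"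
      by (simp add: std_normal_density_def c_def)
    show ?thesis unfolding 1 2 using c(1) by (simp add: 3 scaleR_conv_of_real)
  qed
  have int: "integrable lborel ?g"
    by (rule integrable_bounded_mult[where C = 1])
      (use integrable_normal_density[of 1 0] in auto)
  have "integrable lborel (\<lambda>t. c *\<^sub>R ?g (0 + c * t))"
    by (intro integrable_scaleR_right lborel_integrable_real_affine int) (use c in auto)
  then show ?I unfolding eq .
  have "(LINT t|lborel. of_real (exp (- pi * t\<^sup>2)) * ee (- (t * u))) = (LINT t|lborel. c *\<^sub>R ?g (0 + c * t))"
    unfolding eq ..
  also have "\<dots> = (LINT x|lborel. ?g x)"
    using lborel_integral_real_affine[of c ?g 0] c by simp
  also have "\<dots> = char std_normal_distribution (- c * u)"
    unfolding char_def by (subst integral_density) (auto simp: scaleR_conv_of_real)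
  also have "\<dots> = of_real (exp (- pi * u\<^sup>2))"
    using c by (simp add: char_std_normal_distribution power_mult_distrib)
  finally show ?E .
qed

definition gauss :: "'a::euclidean_space \<Rightarrow> complex" where
  "gauss x = of_real (exp (- pi * (norm x)\<^sup>2))"

lemma gauss_prod: "gauss x * ee (- (x \<bullet> u)) = (\<Prod>b\<in>Basis. of_real (exp (- pi * (x \<bullet> b)\<^sup>2)) * ee (- ((x \<bullet> b) * (u \<bullet> b))))"
proof -
  have ee_sum: "ee (\<Sum>b\<in>A. g b) = (\<Prod>b\<in>A. ee (g b))" if "finite A" for A :: "'a set" and g
    using that by induction (auto simp: ee_add)
  have "(norm x)\<^sup>2 = (\<Sum>b\<in>Basis. (x \<bullet> b)\<^sup>2)"
    unfolding power2_norm_eq_inner by (simp add: euclidean_inner[of x x] power2_eq_square)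
  then have "gauss x = (\<Prod>b\<in>Basis. of_real (exp (- pi * (x \<bullet> b)\<^sup>2)))"
    by (simp add: gauss_def sum_distrib_left exp_sum sum_negf[symmetric])
  moreover have "ee (- (x \<bullet> u)) = (\<Prod>b\<in>Basis. ee (- ((x \<bullet> b) * (u \<bullet> b))))"
    by (simp add: euclidean_inner[of x u] ee_sum[symmetric] sum_negf)
  ultimately show ?thesis by (simp add: prod.distrib)
qed

lemma gauss_integrable: "integrable lborel (gauss :: 'a::euclidean_space \<Rightarrow> complex)"
proof -
  interpret product_sigma_finite "\<lambda>_::'a. lborel :: real measure" ..
  let ?f = "\<lambda>t. complex_of_real (exp (- pi * t\<^sup>2)) * ee (- (t * 0))"
  have "integrable (\<Pi>\<^sub>M b\<in>(Basis::'a set). lborel) (\<lambda>x. (\<Prod>b\<in>Basis. ?f (x b)))"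
    by (rule product_integrable_prod) (simp_all only: finite_Basis gauss_fourier_1(1))
  also have "(\<lambda>x. (\<Prod>b\<in>(Basis::'a set). ?f (x b))) = (\<lambda>x. gauss (\<Sum>c\<in>Basis. x c *\<^sub>R c))"
    using gauss_prod[of "\<Sum>c\<in>Basis. x c *\<^sub>R c" "0::'a" for x] by (intro ext) simp
  finally show ?thesis
    by (subst lborel_eq, subst integrable_distr_eq) (auto simp: gauss_def[abs_def])
qed

lemma fourier_gauss: "fourier gauss = (gauss :: 'a::euclidean_space \<Rightarrow> complex)"
proof
  fix u :: 'a
  have "fourier gauss u = (LINT x|lborel. (\<Prod>b\<in>Basis. of_real (exp (- pi * (x \<bullet> b)\<^sup>2)) * ee (- ((x \<bullet> b) * (u \<bullet> b)))))"
    unfolding fourier_eq gauss_prod ..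
  also have "\<dots> = (\<Prod>b\<in>(Basis::'a set). of_real (exp (- pi * (u \<bullet> b)\<^sup>2)))"
    by (subst integral_lborel_prod, rule gauss_fourier_1(1)) (simp only: gauss_fourier_1(2))
  also have "\<dots> = gauss u" using gauss_prod[of u 0] by simp
  finally show "fourier gauss u = gauss u" .
qed

lemma integrable_fourier_kernel:
  assumes f: "integrable lborel f" and g: "integrable lborel g"
  shows "integrable (lborel \<Otimes>\<^sub>M lborel) (\<lambda>(x, \<xi>). f x * g \<xi> * ee (- (\<xi> \<bullet> (x::'a::euclidean_space))))"
proof (rule lborel_pair.Fubini_integrable)
  have [measurable]: "f \<in> borel_measurable borel" "g \<in> borel_measurable borel"
    using borel_measurable_integrable[OF f] borel_measurable_integrable[OF g] by simp_all
  have "(\<lambda>p::'a \<times> 'a. ee (- (snd p \<bullet> fst p))) \<in> borel_measurable borel"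
    by (intro borel_measurable_continuous_onI continuous_intros)
  then have [measurable]: "(\<lambda>p::'a \<times> 'a. ee (- (snd p \<bullet> fst p))) \<in> borel_measurable (lborel \<Otimes>\<^sub>M lborel)"
    by (simp add: lborel_prod)
  show "(\<lambda>(x, \<xi>). f x * g \<xi> * ee (- (\<xi> \<bullet> x))) \<in> borel_measurable (lborel \<Otimes>\<^sub>M lborel)"
    unfolding split_beta' by measurable
  have "integrable lborel (\<lambda>x. norm (f x) * (LINT \<xi>|lborel. norm (g \<xi>)))" using f by simp
  then show "integrable lborel (\<lambda>x. LINT \<xi>|lborel. norm (case (x, \<xi>) of (x, \<xi>) \<Rightarrow> f x * g \<xi> * ee (- (\<xi> \<bullet> x))))"
    by (simp add: norm_mult)
  show "AE x in lborel. integrable lborel (\<lambda>\<xi>. case (x, \<xi>) of (x, \<xi>) \<Rightarrow> f x * g \<xi> * ee (- (\<xi> \<bullet> x)))"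
  proof (rule AE_I2)
    fix x
    have "integrable lborel (\<lambda>\<xi>. f x * (g \<xi> * ee (- (\<xi> \<bullet> x))))"
      by (intro integrable_mult_right integrable_bounded_mult[where C = 1] g) auto
    then show "integrable lborel (\<lambda>\<xi>. case (x, \<xi>) of (x, \<xi>) \<Rightarrow> f x * g \<xi> * ee (- (\<xi> \<bullet> x)))"
      by (simp add: mult.assoc)
  qed
qed

text \<open>Fubini for the kernel f(x) g(\<xi>) e(-x . \<xi>). This multiplication formula carries
  inversion, Plancherel, and the evaluation of \<open>psdo_compact\<close> on functions.\<close>

lemma fourier_swap:
  assumes f: "integrable lborel f" and g: "integrable lborel g"
  shows "(LINT x|lborel. f x * fourier g x) = (LINT \<xi>|lborel. fourier f \<xi> * g (\<xi>::'a::euclidean_space))"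
proof -
  have "(LINT x|lborel. f x * fourier g x) = (LINT x|lborel. LINT \<xi>|lborel. f x * g \<xi> * ee (- (\<xi> \<bullet> x)))"
    by (simp add: fourier_eq mult.assoc)
  also have "\<dots> = (LINT \<xi>|lborel. LINT x|lborel. f x * g \<xi> * ee (- (\<xi> \<bullet> x)))"
    by (rule lborel_pair.Fubini_integral[symmetric]) (use integrable_fourier_kernel[OF f g] in simp)
  also have "\<dots> = (LINT \<xi>|lborel. LINT x|lborel. (f x * ee (- (x \<bullet> \<xi>))) * g \<xi>)"
    by (simp add: mult_ac inner_commute)
  also have "\<dots> = (LINT \<xi>|lborel. fourier f \<xi> * g \<xi>)"
    by (simp add: fourier_eq)
  finally show ?thesis .
qed

lemma fourier_modulate: "fourier (\<lambda>x. ee (x \<bullet> v) * f x) \<xi> = fourier f (\<xi> - v)"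
  by (simp add: fourier_eq inner_diff_right ee_add[symmetric] mult_ac algebra_simps)

lemma fourier_dilate:
  fixes \<xi> :: "'a::euclidean_space"
  assumes "f \<in> borel_measurable borel" "c \<noteq> 0"
  shows "fourier (\<lambda>x. f (c *\<^sub>R x)) \<xi> = fourier f ((1 / c) *\<^sub>R \<xi>) / of_real (\<bar>c\<bar> ^ DIM('a))"
proof -
  have "fourier f ((1 / c) *\<^sub>R \<xi>) = (\<bar>c\<bar> ^ DIM('a)) *\<^sub>R (LINT x|lborel. f (0 + c *\<^sub>R x) * ee (- ((0 + c *\<^sub>R x) \<bullet> ((1 / c) *\<^sub>R \<xi>))))"
    unfolding fourier_eq by (rule integral_affine) (use assms in auto)
  then show ?thesis using assms(2) by (simp add: fourier_eq scaleR_conv_of_real)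
qed

lemma fourier_translate:
  assumes "f \<in> borel_measurable borel"
  shows "fourier (\<lambda>x. f (x - a)) \<xi> = ee (- (a \<bullet> \<xi>)) * fourier f \<xi>"
proof -
  have "(LINT x|lborel. f (x - a) * ee (- (x \<bullet> \<xi>))) = (LINT x|lborel. (\<lambda>x. f (x - a) * ee (- (x \<bullet> \<xi>))) (x + a))"
    by (rule integral_translate[symmetric]) (use assms in measurable)
  also have "\<dots> = (LINT x|lborel. ee (- (a \<bullet> \<xi>)) * (f x * ee (- (x \<bullet> \<xi>))))"
  proof -
    have "ee (- ((x + a) \<bullet> \<xi>)) = ee (- (a \<bullet> \<xi>)) * ee (- (x \<bullet> \<xi>))" for x
      by (simp add: inner_add_left ee_add[symmetric] add.commute)
    then show ?thesis by (simp add: mult_ac)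
  qed
  finally show ?thesis by (simp add: fourier_eq)
qed

text \<open>A dilated Gaussian is inserted as summability factor. After \<open>fourier_swap\<close>
  it becomes a Gaussian approximate identity acting on f, and both sides converge by dominated
  convergence.\<close>

lemma fourier_inversion:
  assumes f: "f \<in> schwartz"
  shows "(LINT \<xi>|lborel. fourier f \<xi> * ee (x \<bullet> \<xi>)) = f (x::'a::euclidean_space)"
proof -
  note F = fourier_schwartz[OF f]
  note [measurable] = schwartz_measurable[OF f]
  have gm[measurable]: "(gauss :: 'a \<Rightarrow> complex) \<in> borel_measurable borel"
    unfolding gauss_def[abs_def] by measurable
  have gn: "norm (gauss y) \<le> 1" for y :: 'a by (simp add: gauss_def)
  define e where "e n = 1 / real (Suc n)" for n
  have e: "e n > 0" for n by (simp add: e_def)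
  have e0: "e \<longlonglongrightarrow> 0" unfolding e_def by (rule LIMSEQ_inverse_real_of_nat[simplified inverse_eq_divide])
  have gauss0: "(\<lambda>n. gauss (e n *\<^sub>R \<xi>)) \<longlonglongrightarrow> 1" for \<xi> :: 'a
  proof -
    have "(\<lambda>n. complex_of_real (exp (- pi * (norm (e n *\<^sub>R \<xi>))\<^sup>2))) \<longlonglongrightarrow> of_real (exp (- pi * (norm (0 *\<^sub>R \<xi>))\<^sup>2))"
      by (intro tendsto_intros e0)
    then show ?thesis by (simp add: gauss_def)
  qed
  have "(\<lambda>n. LINT \<xi>|lborel. fourier f \<xi> * (gauss (e n *\<^sub>R \<xi>) * ee (x \<bullet> \<xi>))) \<longlonglongrightarrow> (LINT \<xi>|lborel. fourier f \<xi> * ee (x \<bullet> \<xi>))"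
  proof (rule integral_dominated_convergence[where w = "\<lambda>\<xi>. norm (fourier f \<xi>)"])
    show "integrable lborel (\<lambda>\<xi>. norm (fourier f \<xi>))" using schwartz_integrable[OF F] by simp
    show "AE \<xi> in lborel. (\<lambda>n. fourier f \<xi> * (gauss (e n *\<^sub>R \<xi>) * ee (x \<bullet> \<xi>))) \<longlonglongrightarrow> fourier f \<xi> * ee (x \<bullet> \<xi>)"
      using tendsto_mult_left[OF tendsto_mult_right[OF gauss0]] by fastforce
    show "AE \<xi> in lborel. norm (fourier f \<xi> * (gauss (e n *\<^sub>R \<xi>) * ee (x \<bullet> \<xi>))) \<le> norm (fourier f \<xi>)" for n
      using gn by (simp add: norm_mult mult_left_le)
  qed (use F in \<open>auto simp: inner_commute[of x]\<close>)
  moreover have "(LINT \<xi>|lborel. fourier f \<xi> * (gauss (e n *\<^sub>R \<xi>) * ee (x \<bullet> \<xi>))) = (LINT y|lborel. f (x + e n *\<^sub>R y) * gauss y)" for n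
  proof -
    have "integrable lborel (\<lambda>\<xi>::'a. gauss (0 + e n *\<^sub>R \<xi>))"
      by (rule integrable_affine[OF gauss_integrable]) (use e[of n] in auto)
    then have int: "integrable lborel (\<lambda>\<xi>. gauss (e n *\<^sub>R \<xi>) * ee (x \<bullet> \<xi>))"
      by (intro integrable_bounded_mult[where C = 1]) (auto simp: inner_commute[of x])
    have "(LINT \<xi>|lborel. fourier f \<xi> * (gauss (e n *\<^sub>R \<xi>) * ee (x \<bullet> \<xi>))) =
        (LINT y|lborel. f y * fourier (\<lambda>\<xi>. gauss (e n *\<^sub>R \<xi>) * ee (x \<bullet> \<xi>)) y)"
      by (rule fourier_swap[symmetric]) (use f int schwartz_integrable in auto)
    also have "\<dots> = (LINT y|lborel. f y * (gauss ((1 / e n) *\<^sub>R (y - x)) / of_real (e n ^ DIM('a))))"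
    proof -
      have "fourier (\<lambda>\<xi>. gauss (e n *\<^sub>R \<xi>) * ee (x \<bullet> \<xi>)) y = fourier (\<lambda>\<xi>. gauss (e n *\<^sub>R \<xi>)) (y - x)" for y
        using fourier_modulate[of x "\<lambda>\<xi>. gauss (e n *\<^sub>R \<xi>)" y] by (simp add: mult.commute inner_commute)
      then show ?thesis using e[of n] by (simp add: fourier_dilate fourier_gauss)
    qed
    also have "\<dots> = (e n ^ DIM('a)) *\<^sub>R (LINT y|lborel. f (x + e n *\<^sub>R y) * (gauss ((1 / e n) *\<^sub>R ((x + e n *\<^sub>R y) - x)) / of_real (e n ^ DIM('a))))"
      using e[of n] f by (subst integral_affine[of _ "e n" x]) auto
    also have "\<dots> = (LINT y|lborel. f (x + e n *\<^sub>R y) * gauss y)"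
      using e[of n] by (simp add: scaleR_conv_of_real)
    finally show ?thesis .
  qed
  moreover have "(\<lambda>n. LINT y|lborel. f (x + e n *\<^sub>R y) * gauss y) \<longlonglongrightarrow> (LINT y|lborel. f x * gauss (y::'a))"
  proof -
    obtain C where C: "\<And>x. norm (f x) \<le> C" using schwartz_bounded[OF f] by blast
    show ?thesis
    proof (rule integral_dominated_convergence[where w = "\<lambda>y::'a. C * norm (gauss y)"])
      show "integrable lborel (\<lambda>y::'a. C * norm (gauss y))"
        by (intro integrable_mult_right integrable_norm gauss_integrable)
      have "(\<lambda>n. f (x + e n *\<^sub>R y)) \<longlonglongrightarrow> f x" for y
      proof -
        have "(\<lambda>n. x + e n *\<^sub>R y) \<longlonglongrightarrow> x + 0 *\<^sub>R y" by (intro tendsto_intros e0)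
        moreover have "isCont f x" using schwartzD(3)[OF f] differentiable_imp_continuous_within by blast
        ultimately show ?thesis using isCont_tendsto_compose by fastforce
      qed
      then show "AE y in lborel. (\<lambda>n. f (x + e n *\<^sub>R y) * gauss y) \<longlonglongrightarrow> f x * gauss y"
        by (intro AE_I2 tendsto_mult_right)
      show "(\<lambda>y. f (x + e n *\<^sub>R y) * gauss y) \<in> borel_measurable lborel" for n by measurable
      show "AE y in lborel. norm (f (x + e n *\<^sub>R y) * gauss y) \<le> C * norm (gauss y)" for n
        using C by (auto simp: norm_mult intro!: mult_right_mono)
    qed (use f in auto)
  qed
  ultimately have "(LINT \<xi>|lborel. fourier f \<xi> * ee (x \<bullet> \<xi>)) = (LINT y|lborel. f x * gauss (y::'a))"
    using LIMSEQ_unique by auto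
  also have "\<dots> = f x * fourier gauss (0::'a)" by (simp add: fourier_eq)
  also have "\<dots> = f x" by (simp add: fourier_gauss) (simp add: gauss_def)
  finally show ?thesis .
qed

definition ifourier :: "('a::euclidean_space \<Rightarrow> complex) \<Rightarrow> 'a \<Rightarrow> complex" where
  "ifourier f x = fourier f (- x)"

lemma ifourier_eq: "ifourier f x = (LINT \<xi>|lborel. f \<xi> * ee (x \<bullet> \<xi>))"
  by (simp add: ifourier_def fourier_eq inner_commute)

lemma ifourier_schwartz: "f \<in> schwartz \<Longrightarrow> ifourier f \<in> schwartz"
  using schwartz_reflect[OF fourier_schwartz, of f 0] by (simp add: ifourier_def[abs_def])

lemma ifourier_fourier: "f \<in> schwartz \<Longrightarrow> ifourier (fourier f) = f"
  by (rule ext) (simp only: ifourier_eq fourier_inversion)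

lemma fourier_ifourier: "f \<in> schwartz \<Longrightarrow> fourier (ifourier f) = f"
proof
  fix \<xi> :: 'a assume f: "f \<in> schwartz"
  have "fourier (ifourier f) \<xi> = (LINT x|lborel. (\<lambda>y. fourier f y * ee (\<xi> \<bullet> y)) (0 - x))"
    by (simp add: fourier_eq[of "ifourier f"] ifourier_def inner_commute)
  also have "\<dots> = (LINT y|lborel. fourier f y * ee (\<xi> \<bullet> y))"
    by (rule integral_reflect) (use fourier_schwartz[OF f] in \<open>auto simp: inner_commute[of \<xi>]\<close>)
  also have "\<dots> = f \<xi>" by (rule fourier_inversion[OF f])
  finally show "fourier (ifourier f) \<xi> = f \<xi>" .
qed

lemma cnj_slow: "f \<in> schwartz \<Longrightarrow> (\<lambda>x. cnj (f x)) \<in> schwartz"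
proof -
  assume "f \<in> schwartz"
  show ?thesis unfolding schwartz_eq
  proof (rule smooth_with_coinduct[where X = "(\<lambda>f x. cnj (f x)) ` schwartz"])
    fix g assume "g \<in> (\<lambda>f x. cnj (f x)) ` (schwartz :: ('a \<Rightarrow> complex) set)"
    then obtain f :: "'a \<Rightarrow> complex" where g: "g = (\<lambda>x. cnj (f x))" and f: "f \<in> schwartz" by auto
    show "decays g" using schwartzD(1)[OF f] by (simp add: decays_def g)
    show "\<exists>f'. (\<forall>x. (g has_derivative f' x) (at x)) \<and> (\<forall>b\<in>Basis. (\<lambda>x. f' x b) \<in> (\<lambda>f x. cnj (f x)) ` schwartz)"
      unfolding g using schwartzD(4)[OF f]
      by (intro exI[of _ "\<lambda>x h. cnj (frechet_derivative f (at x) h)"])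
        (auto intro!: has_derivative_cnj schwartzD(2)[OF f] simp: pd_def[abs_def])
  qed (use \<open>f \<in> schwartz\<close> in auto)
qed

text \<open>By inversion, cnj g is itself a Fourier transform, namely of the conjugate of
  \<open>fourier g\<close>, so the multiplication formula applies.\<close>

lemma plancherel:
  assumes f: "f \<in> schwartz" and g: "g \<in> schwartz"
  shows "(LINT x|lborel. f x * cnj (g x)) = (LINT \<xi>|lborel. fourier f \<xi> * cnj (fourier g \<xi>))"
proof -
  let ?G = "\<lambda>\<xi>. cnj (fourier g \<xi>)"
  have G: "?G \<in> schwartz" by (intro cnj_slow fourier_schwartz g)
  have "cnj (g x) = fourier ?G x" for x
  proof -
    have "fourier ?G x = (LINT \<xi>|lborel. cnj (fourier g \<xi> * ee (x \<bullet> \<xi>)))"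
      by (simp add: fourier_eq[of ?G] ee_minus inner_commute del: Bochner_Integration.integral_cnj)
    also note Bochner_Integration.integral_cnj[of lborel "\<lambda>\<xi>. fourier g \<xi> * ee (x \<bullet> \<xi>)"]
    finally have "cnj (LINT \<xi>|lborel. fourier g \<xi> * ee (x \<bullet> \<xi>)) = fourier ?G x" by (rule sym)
    then show ?thesis by (simp only: fourier_inversion[OF g])
  qed
  then show ?thesis
    using fourier_swap[OF schwartz_integrable[OF f] schwartz_integrable[OF G]] by simp
qed

lemma plancherel_norm:
  assumes f: "f \<in> schwartz"
  shows "(LINT x|lborel. (norm (f x))\<^sup>2) = (LINT \<xi>|lborel. (norm (fourier f \<xi>))\<^sup>2)"
proof -
  have "complex_of_real (LINT x|lborel. (norm (f x))\<^sup>2) = of_real (LINT \<xi>|lborel. (norm (fourier f \<xi>))\<^sup>2)"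
    unfolding integral_complex_of_real[symmetric]
    using plancherel[OF f f] by (simp add: complex_norm_square[symmetric])
  then show ?thesis by (simp only: of_real_eq_iff)
qed

lemma fourier_cmult: "fourier (\<lambda>x. c * f x) \<xi> = c * fourier f \<xi>"
  by (simp add: fourier_eq mult.assoc)

lemma fourier_sum:
  assumes "\<And>i. i \<in> I \<Longrightarrow> f i \<in> schwartz"
  shows "fourier (\<lambda>x. \<Sum>i\<in>I. f i x) \<xi> = (\<Sum>i\<in>I. fourier (f i) \<xi>)"
proof -
  have "integrable lborel (\<lambda>x. f i x * ee (- (x \<bullet> \<xi>)))" if "i \<in> I" for i
    by (rule schwartz_integrable_mult[OF assms[OF that], where C = 1]) auto
  then show ?thesis by (simp add: fourier_eq sum_distrib_right)
qed

lemma ifourier_sum: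
  assumes "\<And>i. i \<in> I \<Longrightarrow> f i \<in> schwartz"
  shows "ifourier (\<lambda>x. \<Sum>i\<in>I. f i x) x = (\<Sum>i\<in>I. ifourier (f i) x)"
  unfolding ifourier_def by (rule fourier_sum[OF assms])

lemma ifourier_cmult: "ifourier (\<lambda>x. c * f x) x = c * ifourier f x"
  by (simp add: ifourier_def fourier_cmult)

lemma ifourier_translate:
  assumes "f \<in> borel_measurable borel"
  shows "ifourier (\<lambda>\<xi>. f (\<xi> - v)) x = ee (x \<bullet> v) * ifourier f x"
  using fourier_translate[OF assms, of v "- x"] by (simp add: ifourier_def inner_commute)

lemma dist_of_eq: "\<psi> \<in> schwartz \<Longrightarrow> dist_of g \<psi> = (LINT x|lborel. g x * \<psi> x)"
  by (simp add: dist_of_def)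

text \<open>Integrability of f makes the seminorm of order 0, a plain supremum, sufficient for
  continuity.\<close>

lemma tempered_dist_of:
  assumes f: "f \<in> schwartz"
  shows "dist_of f \<in> tempered"
proof -
  have int: "integrable lborel (\<lambda>x. f x * \<psi> x)" if "\<psi> \<in> schwartz" for \<psi>
    using schwartz_bounded[OF that] schwartz_integrable_mult[OF f schwartz_measurable[OF that]] by blast
  have "norm (dist_of f \<psi>) \<le> (LINT x|lborel. norm (f x)) * schwartz_seminorm 0 \<psi>" if \<psi>: "\<psi> \<in> schwartz" for \<psi>
  proof -
    obtain C where C: "\<And>x. norm (\<psi> x) \<le> C" using schwartz_bounded[OF \<psi>] by blast
    have le: "norm (\<psi> x) \<le> schwartz_seminorm 0 \<psi>" for x
    proof -
      have "(case ([], x) of (vs, x) \<Rightarrow> (1 + norm x) ^ 0 * norm (partials vs \<psi> x)) \<le> schwartz_seminorm 0 \<psi>"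
        unfolding schwartz_seminorm_def
        by (rule cSUP_upper) (use C in \<open>auto intro!: bdd_aboveI[of _ C]\<close>)
      then show ?thesis by simp
    qed
    have "norm (dist_of f \<psi>) \<le> (LINT x|lborel. norm (f x) * schwartz_seminorm 0 \<psi>)"
      unfolding dist_of_eq[OF \<psi>]
      using int[OF \<psi>] schwartz_integrable[OF f] le
      by (intro Bochner_Integration.integral_norm_bound_integral) (auto simp: norm_mult intro!: mult_left_mono)
    then show ?thesis by simp
  qed
  then have "\<exists>C N. \<forall>\<psi>\<in>schwartz. norm (dist_of f \<psi>) \<le> C * schwartz_seminorm N \<psi>" by blast
  moreover have "dist_of f (\<lambda>x. c * \<psi> x) = c * dist_of f \<psi>" if "\<psi> \<in> schwartz" for c \<psi>
  proof -
    have "(LINT x|lborel. f x * (c * \<psi> x)) = (LINT x|lborel. c * (f x * \<psi> x))" by (simp add: mult_ac)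
    then show ?thesis using that by (simp add: dist_of_eq schwartz_cmult)
  qed
  moreover have "dist_of f (\<lambda>x. \<psi> x + \<eta> x) = dist_of f \<psi> + dist_of f \<eta>" if "\<psi> \<in> schwartz" "\<eta> \<in> schwartz" for \<psi> \<eta>
    using that by (simp add: dist_of_eq schwartz_add distrib_left int)
  ultimately show ?thesis by (auto simp: tempered_def dist_of_def)
qed

section \<open>Littlewood-Paley multipliers\<close>

locale lp_decomposition =
  fixes \<phi> \<Phi> :: "'a::euclidean_space \<Rightarrow> complex"
  assumes lp: "littlewood_paley \<phi> \<Phi>"
begin

abbreviation piece :: "nat \<Rightarrow> ('a \<Rightarrow> complex) \<Rightarrow> 'a \<Rightarrow> complex" where
  "piece k f \<equiv> lp_proj \<phi> \<Phi> k (dist_of f)"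

abbreviation "besov \<equiv> besov_norm \<phi> \<Phi>"

abbreviation "triebel \<equiv> triebel_lizorkin_norm \<phi> \<Phi>"

abbreviation "unbounded m NX NY \<equiv> \<exists>a\<in>symbols11 m. operator_norm (psdo_graph \<phi> \<Phi> a) NX NY = \<infinity>"

definition phi_hat :: "'a \<Rightarrow> complex" where "phi_hat = fourier \<phi>"
definition theta :: "'a \<Rightarrow> complex" where "theta = fourier \<Phi>"
definition lp_hat :: "nat \<Rightarrow> 'a \<Rightarrow> complex" where
  "lp_hat k \<xi> = (if k = 0 then theta \<xi> else phi_hat (\<xi> /\<^sub>R 2 ^ k))"

lemma phi: "\<phi> \<in> schwartz" and Phi: "\<Phi> \<in> schwartz"
  using lp by (auto simp: littlewood_paley_def)

lemma phi_hat: "phi_hat \<in> schwartz" and theta: "theta \<in> schwartz"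
  unfolding phi_hat_def theta_def by (intro fourier_schwartz phi Phi)+

lemma dyadic_dilate_schwartz: "dyadic_dilate \<phi> k \<in> schwartz"
  unfolding dyadic_dilate_def[abs_def] by (intro schwartz_cmult schwartz_dilate phi) auto

lemma lp_kernel_schwartz: "lp_kernel \<phi> \<Phi> k \<in> schwartz"
  by (simp add: lp_kernel_def Phi dyadic_dilate_schwartz)

lemma fourier_dyadic_dilate: "fourier (dyadic_dilate \<phi> k) \<xi> = phi_hat (\<xi> /\<^sub>R (2 powi k))"
proof -
  have "fourier (dyadic_dilate \<phi> k) \<xi> = of_real (2 powi (k * int DIM('a))) * fourier (\<lambda>x. \<phi> (2 powi k *\<^sub>R x)) \<xi>"
    unfolding dyadic_dilate_def[abs_def] by (rule fourier_cmult)
  also have "\<dots> = of_real (2 powi (k * int DIM('a))) * (phi_hat ((1 / 2 powi k) *\<^sub>R \<xi>) / of_real (\<bar>2 powi k\<bar> ^ DIM('a)))"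
    unfolding phi_hat_def using phi by (subst fourier_dilate) auto
  also have "\<dots> = phi_hat (\<xi> /\<^sub>R (2 powi k))"
    by (simp add: power_int_mult inverse_eq_divide)
  finally show ?thesis .
qed

lemma fourier_lp_kernel: "fourier (lp_kernel \<phi> \<Phi> k) = lp_hat k"
  by (auto simp: fun_eq_iff lp_kernel_def lp_hat_def theta_def fourier_dyadic_dilate)

lemma lp_hat_schwartz: "lp_hat k \<in> schwartz"
  unfolding fourier_lp_kernel[symmetric] by (intro fourier_schwartz lp_kernel_schwartz)

text \<open>The set where a continuous function is nonzero is open, so being contained in the closed
  annulus it lies in the open one. The strict inequalities make the multiplier values on dyadic
  spheres exact.\<close>

lemma phi_hat_support:
  assumes "phi_hat \<xi> \<noteq> 0" shows "1 / 2 < norm \<xi>" "norm \<xi> < 2"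
proof -
  have s: "1 / 2 \<le> norm \<xi>" "norm \<xi> \<le> 2" if "phi_hat \<xi> \<noteq> 0" for \<xi>
    using lp that by (auto simp: littlewood_paley_def phi_hat_def)
  have "open {\<xi>. phi_hat \<xi> \<noteq> 0}"
    by (intro open_Collect_neq schwartz_continuous phi_hat continuous_on_const)
  then obtain e where e: "e > 0" "\<And>\<eta>. dist \<eta> \<xi> < e \<Longrightarrow> phi_hat \<eta> \<noteq> 0"
    using assms unfolding open_dist by blast
  have n: "1 / 2 \<le> norm \<xi>" "norm \<xi> \<le> 2" using s[OF assms] by auto
  define t where "t = min (1/2) (e / 4)"
  have t: "t > 0" "t < 1" "t * norm \<xi> < e"
  proof -
    have "t * norm \<xi> \<le> (e / 4) * 2" using n e by (intro mult_mono) (auto simp: t_def)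
    then show "t * norm \<xi> < e" using e by simp
  qed (use e in \<open>auto simp: t_def\<close>)
  have d: "dist ((1 + r) *\<^sub>R \<xi>) \<xi> = \<bar>r\<bar> * norm \<xi>" for r by (simp add: dist_norm scaleR_add_left)
  have "dist ((1 + t) *\<^sub>R \<xi>) \<xi> < e" "dist ((1 + - t) *\<^sub>R \<xi>) \<xi> < e"
    unfolding d using t by simp_all
  note 1 = this[THEN e(2)]
  have "norm \<xi> + t * norm \<xi> \<le> 2"
    using s(2)[OF 1(1)] t unfolding norm_scaleR by (simp add: algebra_simps)
  moreover have "1 / 2 \<le> norm \<xi> - t * norm \<xi>"
    using s(1)[OF 1(2)] t unfolding norm_scaleR by (simp add: algebra_simps)
  moreover have "t * norm \<xi> > 0" by (rule mult_pos_pos) (use t n in linarith)+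
  ultimately show "1 / 2 < norm \<xi>" "norm \<xi> < 2" by auto
qed

lemma lp_sum: "\<xi> \<noteq> 0 \<Longrightarrow> ((\<lambda>k::int. phi_hat (\<xi> /\<^sub>R (2 powi k))) has_sum 1) UNIV"
  using lp by (simp add: littlewood_paley_def fourier_dyadic_dilate)

lemma theta_eq: "theta \<xi> = 1 - (\<Sum>k. phi_hat (\<xi> /\<^sub>R 2 ^ Suc k))"
proof -
  have "phi_hat (\<xi> /\<^sub>R 2 ^ Suc k) = fourier (dyadic_dilate \<phi> (int (Suc k))) \<xi>" for k
    unfolding fourier_dyadic_dilate power_int_of_nat ..
  then show ?thesis using lp by (simp only: littlewood_paley_def theta_def)
qed

text \<open>Below frequency 2^N the series in \<open>theta_eq\<close> has only its first N terms,
  and these are cancelled by the multipliers of index 1 to N.\<close>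

lemma lp_hat_sum:
  assumes "norm \<xi> \<le> 2 ^ N" shows "(\<Sum>k\<le>N. lp_hat k \<xi>) = 1"
proof -
  have "phi_hat (\<xi> /\<^sub>R 2 ^ Suc k) = 0" if "k \<notin> {..<N}" for k
  proof (rule ccontr)
    assume "phi_hat (\<xi> /\<^sub>R 2 ^ Suc k) \<noteq> 0"
    from phi_hat_support(1)[OF this] have "2 ^ k < norm \<xi>" by (simp add: field_simps)
    moreover have "(2::real) ^ N \<le> 2 ^ k" using that by simp
    ultimately show False using assms by linarith
  qed
  then have "(\<Sum>k. phi_hat (\<xi> /\<^sub>R 2 ^ Suc k)) = (\<Sum>k<N. phi_hat (\<xi> /\<^sub>R 2 ^ Suc k))"
    by (intro suminf_finite) auto
  then have "theta \<xi> + (\<Sum>k<N. phi_hat (\<xi> /\<^sub>R 2 ^ Suc k)) = 1" by (simp add: theta_eq)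
  moreover have "(\<Sum>k\<le>N. lp_hat k \<xi>) = lp_hat 0 \<xi> + (\<Sum>k<N. lp_hat (Suc k) \<xi>)"
    by (simp add: sum.atMost_shift)
  ultimately show ?thesis by (simp add: lp_hat_def)
qed

lemma theta_1: "norm \<xi> \<le> 1 \<Longrightarrow> theta \<xi> = 1"
  using lp_hat_sum[of \<xi> 0] by (simp add: lp_hat_def)

text \<open>For |\<xi>| >= 2 the terms with k <= 0 of the two-sided partition of unity vanish, so
  the one-sided sum subtracted in \<open>theta_eq\<close> is already 1.\<close>

lemma theta_0: assumes "2 \<le> norm \<xi>" shows "theta \<xi> = 0"
proof -
  have "\<xi> \<noteq> 0" using assms by auto
  have z: "phi_hat (\<xi> /\<^sub>R (2 powi k)) = 0" if "k \<notin> range (\<lambda>k. int (Suc k))" for k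
  proof (rule ccontr)
    assume "phi_hat (\<xi> /\<^sub>R (2 powi k)) \<noteq> 0"
    from phi_hat_support(2)[OF this] have *: "norm \<xi> / 2 powi k < 2" by (simp add: divide_inverse_commute)
    have "k \<le> 0"
    proof (rule ccontr)
      assume "\<not> k \<le> 0"
      then have "k = int (Suc (nat (k - 1)))" by simp
      then show False using that by blast
    qed
    then have "(2::real) powi k \<le> 2 powi 0" by (intro power_int_increasing) auto
    then have "2 powi k * 2 \<le> norm \<xi>" using assms by simp
    then show False using * by (simp add: field_simps)
  qed
  have "((\<lambda>k::int. phi_hat (\<xi> /\<^sub>R (2 powi k))) has_sum 1) (range (\<lambda>k. int (Suc k)))"
    by (rule has_sum_cong_neutral[THEN iffD1, OF _ _ _ lp_sum[OF \<open>\<xi> \<noteq> 0\<close>]]) (use z in auto)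
  then have "((\<lambda>k. phi_hat (\<xi> /\<^sub>R (2 powi int (Suc k)))) has_sum 1) UNIV"
    by (subst (asm) has_sum_reindex) (auto simp: inj_on_def o_def)
  then have "(\<lambda>k. phi_hat (\<xi> /\<^sub>R 2 ^ Suc k)) sums 1"
    unfolding power_int_of_nat by (rule has_sum_imp_sums)
  then show ?thesis by (simp add: theta_eq sums_iff)
qed

text \<open>On the unit sphere every dilate other than the one with k = 0 vanishes, because the
  annulus is open; the partition of unity leaves the value 1.\<close>

lemma phi_hat_unit: assumes "norm \<xi> = 1" shows "phi_hat \<xi> = 1"
proof -
  have "\<xi> \<noteq> 0" using assms by auto
  have z: "phi_hat (\<xi> /\<^sub>R (2 powi k)) = 0" if "k \<noteq> 0" for k
  proof (rule ccontr)
    assume "phi_hat (\<xi> /\<^sub>R (2 powi k)) \<noteq> 0"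
    note phi_hat_support[OF this]
    moreover define c :: real where "c = 2 powi k"
    ultimately have "1 / 2 < 1 / c" "1 / c < 2" and c: "c > 0"
      using assms by (simp_all add: inverse_eq_divide)
    then have "1 < 2 * c" "c < 2" using c by (simp_all add: field_simps)
    then have *: "1 < 2 * (2::real) powi k" "(2::real) powi k < 2" by (simp_all add: c_def)
    show False
    proof (cases "k > 0")
      case True
      then have "(2::real) powi 1 \<le> 2 powi k" by (intro power_int_increasing) auto
      then show False using * by simp
    next
      case False
      then have "(2::real) powi k \<le> 2 powi (-1)" using that by (intro power_int_increasing) auto
      then show False using * by simp
    qed
  qed
  have "((\<lambda>k::int. phi_hat (\<xi> /\<^sub>R (2 powi k))) has_sum 1) {0}"
    by (rule has_sum_cong_neutral[THEN iffD1, OF _ _ _ lp_sum[OF \<open>\<xi> \<noteq> 0\<close>]]) (use z in auto)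
  moreover have "((\<lambda>k::int. phi_hat (\<xi> /\<^sub>R (2 powi k))) has_sum phi_hat \<xi>) {0}"
    using has_sum_finite[of "{0::int}" "\<lambda>k. phi_hat (\<xi> /\<^sub>R (2 powi k))"] by simp
  ultimately show ?thesis using has_sum_unique by blast
qed

lemma lp_hat_support:
  assumes "lp_hat k \<xi> \<noteq> 0"
  shows "norm \<xi> < 2 * 2 ^ k" "k \<ge> 1 \<Longrightarrow> 2 ^ k < 2 * norm \<xi>"
proof -
  show "norm \<xi> < 2 * 2 ^ k"
  proof (cases "k = 0")
    case True
    then show ?thesis using assms theta_0[of \<xi>] by (force simp: lp_hat_def)
  next
    case False
    then have "phi_hat (\<xi> /\<^sub>R 2 ^ k) \<noteq> 0" using assms by (simp add: lp_hat_def)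
    from phi_hat_support(2)[OF this] show ?thesis by (simp add: field_simps)
  qed
  assume "k \<ge> 1"
  then have "phi_hat (\<xi> /\<^sub>R 2 ^ k) \<noteq> 0" using assms by (simp add: lp_hat_def)
  from phi_hat_support(1)[OF this] show "2 ^ k < 2 * norm \<xi>" by (simp add: field_simps)
qed

text \<open>The frequencies 2^l e are separated exactly by the multipliers, with no error from
  neighbouring bands. This is what makes the decomposition of the symbol in x computable.\<close>

lemma lp_hat_dyadic:
  assumes "norm e = 1" "l \<ge> 1"
  shows "lp_hat j (2 ^ l *\<^sub>R e) = (if j = l then 1 else 0)"
proof (cases "j = l")
  case True
  then show ?thesis using assms by (simp add: lp_hat_def phi_hat_unit)
next
  case False
  have "lp_hat j (2 ^ l *\<^sub>R e) = 0"
  proof (rule ccontr)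
    assume *: "lp_hat j (2 ^ l *\<^sub>R e) \<noteq> 0"
    have "(2::real) ^ l < 2 ^ Suc j" using lp_hat_support(1)[OF *] assms by simp
    then have "l < Suc j" by (rule power_less_imp_less_exp[rotated]) simp
    then have "j \<ge> 1" using assms by simp
    then have "(2::real) ^ j < 2 ^ Suc l" using lp_hat_support(2)[OF *] assms by simp
    then have "j < Suc l" by (rule power_less_imp_less_exp[rotated]) simp
    then show False using False \<open>l < Suc j\<close> by simp
  qed
  then show ?thesis using False by simp
qed

text \<open>Inversion writes f as the transform of the reflected \<open>fourier f\<close>; the
  multiplication formula then moves the transform onto the kernel, and a reflection restores the
  sign.\<close>

lemma lp_proj_dist_of:
  assumes f: "f \<in> schwartz"
  shows "piece k f = ifourier (\<lambda>\<xi>. lp_hat k \<xi> * fourier f \<xi>)"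
proof
  fix x
  let ?K = "lp_kernel \<phi> \<Phi> k"
  note [measurable] = schwartz_measurable[OF lp_kernel_schwartz[of k]]
  have K: "(\<lambda>y. ?K (x - y)) \<in> schwartz" by (intro schwartz_reflect lp_kernel_schwartz)
  have "piece k f x = (LINT y|lborel. ?K (x - y) * ifourier (fourier f) y)"
    by (simp add: lp_proj_def convolve_dist_def dist_of_eq K ifourier_fourier f mult.commute)
  also have "\<dots> = (LINT y|lborel. ?K (x - y) * fourier (\<lambda>\<xi>. fourier f (0 - \<xi>)) y)"
  proof -
    have "ifourier (fourier f) y = fourier (\<lambda>\<xi>. fourier f (0 - \<xi>)) y" for y
    proof -
      have "(LINT \<xi>|lborel. (\<lambda>\<xi>. fourier f \<xi> * ee (y \<bullet> \<xi>)) (0 - \<xi>)) = (LINT \<xi>|lborel. fourier f \<xi> * ee (y \<bullet> \<xi>))"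
        by (rule integral_reflect) (use fourier_schwartz[OF f] in \<open>auto simp: inner_commute[of y]\<close>)
      then show ?thesis unfolding ifourier_eq fourier_eq[of "\<lambda>\<xi>. fourier f (0 - \<xi>)"] by (simp add: inner_commute)
    qed
    then show ?thesis by simp
  qed
  also have "\<dots> = (LINT \<xi>|lborel. fourier (\<lambda>y. ?K (x - y)) \<xi> * fourier f (0 - \<xi>))"
    by (rule fourier_swap) (intro schwartz_integrable K schwartz_reflect fourier_schwartz f)+
  also have "\<dots> = (LINT \<xi>|lborel. (\<lambda>\<xi>. lp_hat k \<xi> * fourier f \<xi> * ee (x \<bullet> \<xi>)) (0 - \<xi>))"
  proof -
    have "fourier (\<lambda>y. ?K (x - y)) \<xi> = lp_hat k (- \<xi>) * ee (x \<bullet> (- \<xi>))" for \<xi>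
    proof -
      have "(LINT y|lborel. (\<lambda>y. ?K y * ee (- ((x - y) \<bullet> \<xi>))) (x - y)) = (LINT y|lborel. ?K y * ee (- ((x - y) \<bullet> \<xi>)))"
      proof (rule integral_reflect)
        have "(\<lambda>y. ee (- ((x - y) \<bullet> \<xi>))) \<in> borel_measurable borel"
          by (intro borel_measurable_continuous_onI continuous_intros)
        then show "(\<lambda>y. ?K y * ee (- ((x - y) \<bullet> \<xi>))) \<in> borel_measurable borel" by measurable
      qed
      also have "\<dots> = (LINT y|lborel. (?K y * ee (- (y \<bullet> (- \<xi>)))) * ee (x \<bullet> (- \<xi>)))"
        by (simp add: inner_diff_left mult.assoc ee_add[symmetric])
      also have "\<dots> = fourier ?K (- \<xi>) * ee (x \<bullet> (- \<xi>))" unfolding fourier_eq by simp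
      finally show ?thesis unfolding fourier_eq[of "\<lambda>y. ?K (x - y)"] by (simp add: fourier_lp_kernel)
    qed
    then show ?thesis by (simp add: mult_ac)
  qed
  also have "\<dots> = (LINT \<xi>|lborel. lp_hat k \<xi> * fourier f \<xi> * ee (x \<bullet> \<xi>))"
    by (rule integral_reflect) (use fourier_schwartz[OF f] lp_hat_schwartz[of k] in \<open>auto simp: inner_commute[of x]\<close>)
  finally show "piece k f x = ifourier (\<lambda>\<xi>. lp_hat k \<xi> * fourier f \<xi>) x"
    by (simp add: ifourier_eq)
qed

lemma lp_proj_schwartz: "f \<in> schwartz \<Longrightarrow> piece k f \<in> schwartz"
  unfolding lp_proj_dist_of
  by (intro ifourier_schwartz schwartz_mult schwartz_imp_slow lp_hat_schwartz fourier_schwartz)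

lemma fourier_lp_proj:
  "f \<in> schwartz \<Longrightarrow> fourier (piece k f) = (\<lambda>\<xi>. lp_hat k \<xi> * fourier f \<xi>)"
  unfolding lp_proj_dist_of
  by (intro fourier_ifourier schwartz_mult schwartz_imp_slow lp_hat_schwartz fourier_schwartz)

text \<open>Rescaling shows that all projections with k >= 1 average f against the same function
  \<phi> at distance 2^-k, which gives pointwise bounds uniform in k.\<close>

lemma lp_proj_conv:
  assumes f: "f \<in> schwartz" and k: "k \<ge> 1"
  shows "piece k f x = (LINT z|lborel. \<phi> z * f (x - z /\<^sub>R 2 ^ k))"
proof -
  let ?K = "lp_kernel \<phi> \<Phi> k"
  note [measurable] = schwartz_measurable[OF lp_kernel_schwartz[of k]] schwartz_measurable[OF f] schwartz_measurable[OF phi]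
  have K: "(\<lambda>y. ?K (x - y)) \<in> schwartz" by (intro schwartz_reflect lp_kernel_schwartz)
  have "piece k f x = (LINT y|lborel. (\<lambda>y. ?K y * f (x - y)) (x - y))"
    by (simp add: lp_proj_def convolve_dist_def dist_of_eq K mult.commute)
  also have "\<dots> = (LINT y|lborel. ?K y * f (x - y))"
    by (rule integral_reflect) measurable
  also have "\<dots> = (\<bar>1 / 2 ^ k\<bar> ^ DIM('a)) *\<^sub>R (LINT z|lborel. ?K (0 + (1 / 2 ^ k) *\<^sub>R z) * f (x - (0 + (1 / 2 ^ k) *\<^sub>R z)))"
    by (rule integral_affine) auto
  also have "\<dots> = (LINT z|lborel. \<phi> z * f (x - z /\<^sub>R 2 ^ k))"
  proof -
    have "?K (0 + (1 / 2 ^ k) *\<^sub>R z) = of_real ((2 ^ k) ^ DIM('a)) * \<phi> z" for z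
      using k by (simp add: lp_kernel_def dyadic_dilate_def power_int_mult)
    then show ?thesis by (simp add: scaleR_conv_of_real inverse_eq_divide power_one_over mult.assoc)
  qed
  finally show ?thesis .
qed

end

section \<open>A lacunary symbol\<close>

lemma Basis_prod_cases:
  assumes "b \<in> (Basis :: ('a::euclidean_space \<times> 'a) set)"
  obtains e where "e \<in> Basis" "b = (e, 0)" | e where "e \<in> Basis" "b = (0, e)"
  using assms by (auto simp: Basis_prod_def)

context lp_decomposition
begin

definition e1 :: 'a where "e1 = (SOME b. b \<in> Basis)"

lemma e1: "e1 \<in> Basis" unfolding e1_def by (rule someI_ex) (use nonempty_Basis in blast)
lemma norm_e1 [simp]: "norm e1 = 1" using e1 by simp

text \<open>The factor 8 makes \<open>eta\<close> equal to 1 within 1/8 of \<open>e1\<close> and 0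
  beyond 1/4. The inner radius matches the spectra permitted in \<open>admissible\<close>; the outer
  one places the dilate of scale 2^l in the annulus from 3/4 to 5/4 times 2^l, and these annuli are
  disjoint.\<close>

definition eta :: "'a \<Rightarrow> complex" where "eta \<xi> = theta (8 *\<^sub>R (\<xi> - e1))"

lemma eta_schwartz: "eta \<in> schwartz"
  using schwartz_affine[OF theta, of 8 "- (8 *\<^sub>R e1)"] by (simp add: eta_def[abs_def] scaleR_diff_right)

lemma eta_1: "norm (\<xi> - e1) \<le> 1 / 8 \<Longrightarrow> eta \<xi> = 1"
  by (simp add: eta_def theta_1)

lemma eta_0: "eta \<xi> \<noteq> 0 \<Longrightarrow> norm (\<xi> - e1) \<le> 1 / 4"
  using theta_0[of "8 *\<^sub>R (\<xi> - e1)"] by (fastforce simp: eta_def)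

definition bump :: "('a \<Rightarrow> complex) \<Rightarrow> bool" where
  "bump g \<longleftrightarrow> g \<in> schwartz \<and> (\<forall>\<xi>. g \<xi> \<noteq> 0 \<longrightarrow> norm (\<xi> - e1) \<le> 1 / 4)"

lemma bump_eta: "bump eta" unfolding bump_def using eta_schwartz eta_0 by blast

lemma bump_pd: assumes "bump g" "b \<in> Basis" shows "bump (pd b g)"
proof -
  have "pd b g \<xi> = 0" if "norm (\<xi> - e1) > 1 / 4" for \<xi>
  proof -
    have "(g has_derivative (\<lambda>_. 0)) (at \<xi>)"
    proof (rule has_derivative_transform_within_open)
      show "((\<lambda>_. 0) has_derivative (\<lambda>_. 0)) (at \<xi>)" by simp
      show "open {\<xi>. norm (\<xi> - e1) > 1 / 4}" by (intro open_Collect_less continuous_intros)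
      show "0 = g \<eta>" if "\<eta> \<in> {\<xi>. norm (\<xi> - e1) > 1 / 4}" for \<eta>
        using that assms(1) by (force simp: bump_def)
    qed (use that in auto)
    then show ?thesis by (simp add: pd_def frechet_derivative_at[symmetric])
  qed
  then show ?thesis using assms schwartzD(4) by (force simp: bump_def)
qed

lemma bump_scale:
  assumes "bump g" "g (\<xi> /\<^sub>R 2 ^ l) \<noteq> 0"
  shows "3 / 4 * 2 ^ l \<le> norm \<xi>" "norm \<xi> \<le> 5 / 4 * 2 ^ l"
proof -
  have 1: "norm (\<xi> /\<^sub>R 2 ^ l - e1) \<le> 1 / 4" using assms by (simp add: bump_def)
  have "norm (\<xi> /\<^sub>R 2 ^ l) \<le> norm (\<xi> /\<^sub>R 2 ^ l - e1) + norm e1"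
    using norm_triangle_ineq[of "\<xi> /\<^sub>R 2 ^ l - e1" e1] by simp
  then have "norm (\<xi> /\<^sub>R 2 ^ l) \<le> 5 / 4" using 1 by simp
  then show "norm \<xi> \<le> 5 / 4 * 2 ^ l" by (simp add: field_simps)
  have "norm e1 \<le> norm (\<xi> /\<^sub>R 2 ^ l) + norm (\<xi> /\<^sub>R 2 ^ l - e1)"
    using norm_triangle_ineq4[of "\<xi> /\<^sub>R 2 ^ l" "\<xi> /\<^sub>R 2 ^ l - e1"] by simp
  then have "3 / 4 \<le> norm (\<xi> /\<^sub>R 2 ^ l)" using 1 by simp
  then show "3 / 4 * 2 ^ l \<le> norm \<xi>" by (simp add: field_simps)
qed

text \<open>Arbitrary coefficients and an arbitrary bump keep the class closed under all partial
  derivatives. The exponent \<open>Suc l\<close> starts the frequencies at 2, so that each of them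
  lies on a sphere covered by \<open>lp_hat_dyadic\<close>.\<close>

definition lacunary :: "(nat \<Rightarrow> complex) \<Rightarrow> ('a \<Rightarrow> complex) \<Rightarrow> 'a \<times> 'a \<Rightarrow> complex" where
  "lacunary c g = (\<lambda>(x, \<xi>). \<Sum>l. c l * ee (- (2 ^ Suc l * (x \<bullet> e1))) * g (\<xi> /\<^sub>R 2 ^ Suc l))"

lemma bump_eq_0:
  assumes "bump g" "norm \<xi> < 2 ^ L" "l \<ge> L" shows "g (\<xi> /\<^sub>R 2 ^ Suc l) = 0"
proof (rule ccontr)
  assume "g (\<xi> /\<^sub>R 2 ^ Suc l) \<noteq> 0"
  from bump_scale(1)[OF assms(1) this] have "3 / 4 * 2 ^ Suc l \<le> norm \<xi>" .
  moreover have "(2::real) ^ L \<le> 2 ^ l" "(2::real) ^ l > 0" "(2::real) ^ Suc l = 2 * 2 ^ l" using assms by simp_all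
  ultimately show False using assms(2) by linarith
qed

lemma lacunary_finite:
  assumes "bump g" "norm \<xi> < 2 ^ L"
  shows "lacunary c g (x, \<xi>) = (\<Sum>l<L. c l * ee (- (2 ^ Suc l * (x \<bullet> e1))) * g (\<xi> /\<^sub>R 2 ^ Suc l))"
  unfolding lacunary_def prod.case
  by (rule suminf_finite) (use bump_eq_0[OF assms] in auto)

text \<open>The series is locally finite: near a given point |\<xi>| stays below some 2^L and only
  the first L terms survive. An x-derivative multiplies the coefficients by the frequency, a
  \<xi>-derivative divides them by it and differentiates the bump, as the class (1,1)
  demands.\<close>

lemma lacunary_has_derivative:
  assumes g: "bump g"
  shows "\<exists>D. (\<forall>p. (lacunary c g has_derivative D p) (at p)) \<and>
    (\<forall>e\<in>Basis. (\<lambda>p. D p (e, 0)) = lacunary (\<lambda>l. c l * (- (2 * of_real pi * \<i>) * of_real (2 ^ Suc l * (e \<bullet> e1)))) g) \<and>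
    (\<forall>e\<in>Basis. (\<lambda>p. D p (0, e)) = lacunary (\<lambda>l. c l * of_real (1 / 2 ^ Suc l)) (pd e g))"
proof -
  define d where "d l p h = c l * (2 * of_real pi * \<i> * of_real (- (2 ^ Suc l * (fst h \<bullet> e1))) * ee (- (2 ^ Suc l * (fst p \<bullet> e1)))) * g (snd p /\<^sub>R 2 ^ Suc l)
    + c l * ee (- (2 ^ Suc l * (fst p \<bullet> e1))) * frechet_derivative g (at (snd p /\<^sub>R 2 ^ Suc l)) (snd h /\<^sub>R 2 ^ Suc l)" for l and p h :: "'a \<times> 'a"
  have "\<exists>L::nat. norm (snd p) < 2 ^ L" for p :: "'a \<times> 'a"
    using real_arch_pow[of 2 "norm (snd p)"] by auto
  then obtain L where L: "norm (snd p) < 2 ^ L p" for p :: "'a \<times> 'a" by metis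
  have gS: "g \<in> schwartz" using g by (simp add: bump_def)
  have lin: "frechet_derivative g (at y) (r *\<^sub>R h) = r *\<^sub>R frechet_derivative g (at y) h" for y r h
    using schwartzD(2)[OF gS, of y] has_derivative_linear linear_cmul by blast
  have "(lacunary c g has_derivative (\<lambda>h. \<Sum>l<L p. d l p h)) (at p)" for p
  proof (rule has_derivative_transform_within_open)
    show "open {q::'a \<times> 'a. norm (snd q) < 2 ^ L p}" by (intro open_Collect_less continuous_intros)
    show "p \<in> {q. norm (snd q) < 2 ^ L p}" using L by simp
    show "(\<Sum>l<L p. c l * ee (- (2 ^ Suc l * (fst q \<bullet> e1))) * g (snd q /\<^sub>R 2 ^ Suc l)) = lacunary c g q"
      if "q \<in> {q. norm (snd q) < 2 ^ L p}" for q
      using lacunary_finite[OF g, of "snd q" "L p" c "fst q"] that by simp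
    show "((\<lambda>q. \<Sum>l<L p. c l * ee (- (2 ^ Suc l * (fst q \<bullet> e1))) * g (snd q /\<^sub>R 2 ^ Suc l)) has_derivative (\<lambda>h. \<Sum>l<L p. d l p h)) (at p)"
    proof (rule has_derivative_sum)
      fix l
      have "((\<lambda>q. g (snd q /\<^sub>R 2 ^ Suc l)) has_derivative (\<lambda>h. frechet_derivative g (at (snd p /\<^sub>R 2 ^ Suc l)) (snd h /\<^sub>R 2 ^ Suc l))) (at p)"
        by (rule has_derivative_compose[of "\<lambda>q. snd q /\<^sub>R 2 ^ Suc l" "\<lambda>h. snd h /\<^sub>R 2 ^ Suc l"])
          (auto intro!: derivative_eq_intros schwartzD(2) gS)
      moreover have "((\<lambda>q. c l * ee (- (2 ^ Suc l * (fst q \<bullet> e1)))) has_derivative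
          (\<lambda>h. c l * (2 * of_real pi * \<i> * of_real (- (2 ^ Suc l * (fst h \<bullet> e1))) * ee (- (2 ^ Suc l * (fst p \<bullet> e1)))))) (at p)"
        by (intro has_derivative_mult_right has_derivative_ee) (auto intro!: derivative_eq_intros)
      ultimately show "((\<lambda>q. c l * ee (- (2 ^ Suc l * (fst q \<bullet> e1))) * g (snd q /\<^sub>R 2 ^ Suc l)) has_derivative d l p) (at p)"
        using has_derivative_mult by (fastforce simp: d_def[abs_def] add.commute)
    qed
  qed
  moreover have "(\<lambda>p. \<Sum>l<L p. d l p (e, 0)) = lacunary (\<lambda>l. c l * (- (2 * of_real pi * \<i>) * of_real (2 ^ Suc l * (e \<bullet> e1)))) g" for e
  proof
    fix p :: "'a \<times> 'a"
    show "(\<Sum>l<L p. d l p (e, 0)) = lacunary (\<lambda>l. c l * (- (2 * of_real pi * \<i>) * of_real (2 ^ Suc l * (e \<bullet> e1)))) g p"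
      using lacunary_finite[OF g L[of p], of "\<lambda>l. c l * (- (2 * of_real pi * \<i>) * of_real (2 ^ Suc l * (e \<bullet> e1)))" "fst p"]
      lin[of _ 0 0] by (simp add: d_def mult_ac)
  qed
  moreover have "(\<lambda>p. \<Sum>l<L p. d l p (0, e)) = lacunary (\<lambda>l. c l * of_real (1 / 2 ^ Suc l)) (pd e g)" if "e \<in> Basis" for e
  proof
    fix p :: "'a \<times> 'a"
    show "(\<Sum>l<L p. d l p (0, e)) = lacunary (\<lambda>l. c l * of_real (1 / 2 ^ Suc l)) (pd e g) p"
      using lacunary_finite[OF bump_pd[OF g that] L[of p], of "\<lambda>l. c l * of_real (1 / 2 ^ Suc l)" "fst p"]
      by (simp add: d_def lin pd_def scaleR_conv_of_real field_simps)
  qed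
  ultimately show ?thesis
    by (intro exI[of _ "\<lambda>p h. \<Sum>l<L p. d l p h"]) auto
qed

lemma pd_lacunary:
  assumes "bump g" "e \<in> Basis"
  shows "pd (e, 0) (lacunary c g) = lacunary (\<lambda>l. c l * (- (2 * of_real pi * \<i>) * of_real (2 ^ Suc l * (e \<bullet> e1)))) g"
    "pd (0, e) (lacunary c g) = lacunary (\<lambda>l. c l * of_real (1 / 2 ^ Suc l)) (pd e g)"
proof -
  obtain D where D: "\<And>p. (lacunary c g has_derivative D p) (at p)"
    "(\<lambda>p. D p (e, 0)) = lacunary (\<lambda>l. c l * (- (2 * of_real pi * \<i>) * of_real (2 ^ Suc l * (e \<bullet> e1)))) g"
    "(\<lambda>p. D p (0, e)) = lacunary (\<lambda>l. c l * of_real (1 / 2 ^ Suc l)) (pd e g)"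
    using lacunary_has_derivative[OF assms(1), of c] assms(2) by blast
  have "pd b (lacunary c g) = (\<lambda>p. D p b)" for b
    by (simp add: fun_eq_iff pd_def frechet_derivative_at[OF D(1), symmetric])
  then show "pd (e, 0) (lacunary c g) = lacunary (\<lambda>l. c l * (- (2 * of_real pi * \<i>) * of_real (2 ^ Suc l * (e \<bullet> e1)))) g"
    "pd (0, e) (lacunary c g) = lacunary (\<lambda>l. c l * of_real (1 / 2 ^ Suc l)) (pd e g)"
    using D(2,3) by simp_all
qed

lemma smooth_lacunary: assumes "bump g" shows "smooth_fun (lacunary c g)"
proof -
  have "lacunary c g \<in> smooth_with (\<lambda>_. True)"
  proof (rule smooth_with_coinduct[where X = "{lacunary c g | c g. bump g}"])
    fix f assume "f \<in> {lacunary c g | c g. bump g}"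
    then obtain c g where f: "f = lacunary c g" and g: "bump g" by auto
    obtain D where D: "\<And>p. (lacunary c g has_derivative D p) (at p)"
      "\<And>e. e \<in> Basis \<Longrightarrow> (\<lambda>p. D p (e, 0)) = lacunary (\<lambda>l. c l * (- (2 * of_real pi * \<i>) * of_real (2 ^ Suc l * (e \<bullet> e1)))) g"
      "\<And>e. e \<in> Basis \<Longrightarrow> (\<lambda>p. D p (0, e)) = lacunary (\<lambda>l. c l * of_real (1 / 2 ^ Suc l)) (pd e g)"
      using lacunary_has_derivative[OF g, of c] by blast
    show "\<exists>f'. (\<forall>x. (f has_derivative f' x) (at x)) \<and> (\<forall>b\<in>Basis. (\<lambda>x. f' x b) \<in> {lacunary c g | c g. bump g})"
      unfolding f
    proof (intro exI conjI allI ballI)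
      show "(lacunary c g has_derivative D p) (at p)" for p by (rule D(1))
      fix b assume "b \<in> (Basis :: ('a \<times> 'a) set)"
      then show "(\<lambda>p. D p b) \<in> {lacunary c g | c g. bump g}"
      proof (cases rule: Basis_prod_cases)
        case (1 e)
        show ?thesis unfolding 1(2) D(2)[OF 1(1)] using g by blast
      next
        case (2 e)
        show ?thesis unfolding 2(2) D(3)[OF 2(1)] using bump_pd[OF g 2(1)] by blast
      qed
    qed
  qed (use assms in auto)
  then show ?thesis by (simp add: smooth_with_def smooth_fun_def)
qed

definition symb :: "real \<Rightarrow> 'a \<times> 'a \<Rightarrow> complex" where
  "symb m = lacunary (\<lambda>l. of_real (2 powr (m * real (Suc l)))) eta"

lemma partials_lacunary_x:
  assumes "bump g" "set \<beta> \<subseteq> Basis"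
  shows "\<exists>K. partials (map (\<lambda>e. (e, 0)) \<beta>) (lacunary c g) = lacunary (\<lambda>l. c l * (K * of_real ((2 ^ Suc l) ^ length \<beta>))) g"
  using assms(2)
proof (induction \<beta>)
  case Nil
  show ?case by (intro exI[of _ 1]) simp
next
  case (Cons e \<beta>)
  then obtain K where "partials (map (\<lambda>e. (e, 0)) \<beta>) (lacunary c g) = lacunary (\<lambda>l. c l * (K * of_real ((2 ^ Suc l) ^ length \<beta>))) g" by auto
  then show ?case using Cons.prems
    by (intro exI[of _ "K * (- (2 * of_real pi * \<i>) * of_real (e \<bullet> e1))"])
      (simp add: partials_Cons pd_lacunary[OF assms(1)] mult_ac)
qed

lemma partials_lacunary_xi:
  assumes "bump g" "set \<alpha> \<subseteq> Basis"
  shows "\<exists>h. bump h \<and> partials (map (\<lambda>e. (0, e)) \<alpha>) (lacunary c g) = lacunary (\<lambda>l. c l * of_real ((1 / 2 ^ Suc l) ^ length \<alpha>)) h"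
  using assms(2)
proof (induction \<alpha>)
  case Nil
  show ?case using assms by (intro exI[of _ g]) simp
next
  case (Cons e \<alpha>)
  then obtain h where "bump h" "partials (map (\<lambda>e. (0, e)) \<alpha>) (lacunary c g) = lacunary (\<lambda>l. c l * of_real ((1 / 2 ^ Suc l) ^ length \<alpha>)) h" by auto
  then show ?case using Cons.prems bump_pd
    by (intro exI[of _ "pd e h"]) (simp add: partials_Cons pd_lacunary mult_ac)
qed

lemma partials_append: "partials (vs @ ws) f = partials vs (partials ws f)"
  by (simp add: partials_def)

text \<open>At each \<xi> at most one term is nonzero, and its scale is comparable to 1 +
  |\<xi>|.\<close>

lemma lacunary_bound:
  assumes g: "bump g"
  shows "\<exists>C. \<forall>x \<xi>. norm (lacunary (\<lambda>l. c * of_real (2 powr (r * real (Suc l)))) g (x, \<xi>)) \<le> C * (1 + norm \<xi>) powr r"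
proof -
  obtain B where B: "B > 0" "\<And>\<xi>. norm (g \<xi>) \<le> B" using g schwartz_bounded by (metis bump_def)
  have "norm (lacunary (\<lambda>l. c * of_real (2 powr (r * real (Suc l)))) g (x, \<xi>)) \<le> norm c * B * 4 powr \<bar>r\<bar> * (1 + norm \<xi>) powr r" for x \<xi>
  proof (cases "\<exists>l. g (\<xi> /\<^sub>R 2 ^ Suc l) \<noteq> 0")
    case False
    then show ?thesis using B by (simp add: lacunary_def)
  next
    case True
    then obtain k where k: "g (\<xi> /\<^sub>R 2 ^ Suc k) \<noteq> 0" by blast
    note kb = bump_scale[OF g k]
    have "g (\<xi> /\<^sub>R 2 ^ Suc l) = 0" if "l \<noteq> k" for l
    proof (rule ccontr)
      assume "g (\<xi> /\<^sub>R 2 ^ Suc l) \<noteq> 0"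
      note lb = bump_scale[OF g this]
      show False
      proof (cases "l < k")
        case True
        then have "(2::real) ^ Suc l * 2 \<le> 2 ^ Suc k" by (metis Suc_leI Suc_le_mono power_Suc2 power_increasing one_le_numeral)
        moreover have "(2::real) ^ Suc l > 0" by simp
        ultimately show False using lb kb by linarith
      next
        case False
        then have "(2::real) ^ Suc k * 2 \<le> 2 ^ Suc l" using that by (metis Suc_leI Suc_le_mono nat_neq_iff power_Suc2 power_increasing one_le_numeral)
        moreover have "(2::real) ^ Suc k > 0" by simp
        ultimately show False using lb kb by linarith
      qed
    qed
    then have "lacunary (\<lambda>l. c * of_real (2 powr (r * real (Suc l)))) g (x, \<xi>) =
        (\<Sum>l\<in>{k}. c * of_real (2 powr (r * real (Suc l))) * ee (- (2 ^ Suc l * (x \<bullet> e1))) * g (\<xi> /\<^sub>R 2 ^ Suc l))"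
      unfolding lacunary_def prod.case by (intro suminf_finite) auto
    then have "norm (lacunary (\<lambda>l. c * of_real (2 powr (r * real (Suc l)))) g (x, \<xi>)) = norm c * norm (g (\<xi> /\<^sub>R 2 ^ Suc k)) * 2 powr (r * real (Suc k))"
      by (simp add: norm_mult)
    also have "\<dots> \<le> norm c * B * 2 powr (r * real (Suc k))"
      using B by (intro mult_right_mono mult_left_mono) auto
    also have "\<dots> \<le> norm c * B * (4 powr \<bar>r\<bar> * (1 + norm \<xi>) powr r)"
    proof (intro mult_left_mono)
      \<comment> \<open>The ratio of 1 + |\<xi>| to the active scale stays between 1/4 and 4; the
        factor 4^|r| then covers both signs of r.\<close>
      define q :: real where "q = (1 + norm \<xi>) / 2 ^ Suc k"
      have one: "1 \<le> (2::real) ^ Suc k" by (rule one_le_power) simp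
      have q: "1 / 4 \<le> q" "q \<le> 4" "q > 0"
        using kb one by (auto simp: q_def field_simps add_pos_nonneg) 
      have "1 \<le> 4 powr \<bar>r\<bar> * q powr r"
      proof (cases "r \<ge> 0")
        case True
        have "1 powr r \<le> (4 * q) powr r" using q True by (intro powr_mono2) auto
        then show ?thesis using True q by (simp add: powr_mult)
      next
        case False
        have "(1::real) powr (- r) \<le> (4 / q) powr (- r)" using q False by (intro powr_mono2) (auto simp: field_simps)
        then show ?thesis using False q by (simp add: powr_divide powr_minus field_simps)
      qed
      then have "2 powr (r * real (Suc k)) * 1 \<le> 2 powr (r * real (Suc k)) * (4 powr \<bar>r\<bar> * q powr r)"
        by (intro mult_left_mono) auto
      also have "\<dots> = 4 powr \<bar>r\<bar> * ((2 ^ Suc k) powr r * q powr r)"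
        by (simp add: powr_realpow[symmetric] powr_powr mult_ac del: power_Suc of_nat_Suc)
      also have "(2 ^ Suc k) powr r * q powr r = (2 ^ Suc k * q) powr r" using q by (simp add: powr_mult)
      also have "2 ^ Suc k * q = 1 + norm \<xi>" by (simp add: q_def)
      finally show "2 powr (r * real (Suc k)) \<le> 4 powr \<bar>r\<bar> * (1 + norm \<xi>) powr r" by simp
    qed (use B in auto)
    finally show ?thesis by (simp add: mult_ac)
  qed
  then show ?thesis by blast
qed

lemma symb_symbol: "symb m \<in> symbols11 m"
proof -
  have "\<exists>c. \<forall>x \<xi>. norm (partials (map (\<lambda>e. (0, e)) \<alpha> @ map (\<lambda>e. (e, 0)) \<beta>) (symb m) (x, \<xi>))
      \<le> c * (1 + norm \<xi>) powr (m - real (length \<alpha>) + real (length \<beta>))"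
    if ab: "set \<alpha> \<subseteq> Basis" "set \<beta> \<subseteq> Basis" for \<alpha> \<beta> :: "'a list"
  proof -
    obtain K where K: "partials (map (\<lambda>e. (e, 0)) \<beta>) (symb m) =
        lacunary (\<lambda>l. of_real (2 powr (m * real (Suc l))) * (K * of_real ((2 ^ Suc l) ^ length \<beta>))) eta"
      using partials_lacunary_x[OF bump_eta ab(2)] unfolding symb_def by blast
    obtain h where h: "bump h" "partials (map (\<lambda>e. (0, e)) \<alpha>) (partials (map (\<lambda>e. (e, 0)) \<beta>) (symb m)) =
        lacunary (\<lambda>l. of_real (2 powr (m * real (Suc l))) * (K * of_real ((2 ^ Suc l) ^ length \<beta>)) * of_real ((1 / 2 ^ Suc l) ^ length \<alpha>)) h"
      unfolding K using partials_lacunary_xi[OF bump_eta ab(1)] by blast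
    have "of_real (2 powr (m * real (Suc l))) * (K * of_real ((2 ^ Suc l) ^ length \<beta>)) * of_real ((1 / 2 ^ Suc l) ^ length \<alpha>) =
        K * of_real (2 powr ((m - real (length \<alpha>) + real (length \<beta>)) * real (Suc l)))" for l
    proof -
      have "(2 ^ Suc l) ^ length \<beta> = 2 powr (real (length \<beta>) * real (Suc l))"
        by (simp add: powr_realpow[symmetric] powr_powr power_mult[symmetric] mult.commute del: power_Suc of_nat_Suc)
      moreover have "(1 / 2 ^ Suc l) ^ length \<alpha> = 2 powr (- real (length \<alpha>) * real (Suc l))"
        by (simp add: powr_realpow[symmetric] powr_powr power_one_over[symmetric] powr_minus field_simps power_mult[symmetric] del: power_Suc of_nat_Suc)
      moreover have "(m - real (length \<alpha>) + real (length \<beta>)) * real (Suc l) =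
          m * real (Suc l) + real (length \<beta>) * real (Suc l) + - real (length \<alpha>) * real (Suc l)"
        by (simp only: algebra_simps)
      ultimately show ?thesis
        by (simp only: powr_add of_real_mult mult_ac)
    qed
    then show ?thesis using lacunary_bound[OF h(1)] by (simp only: partials_append h(2))
  qed
  then show ?thesis using smooth_lacunary[OF bump_eta] by (auto simp: symbols11_def symb_def)
qed


section \<open>The operator on band-limited functions\<close>

text \<open>As a function of x, each term is a single character of frequency -2^(l+1) e1.
  Convolution in x therefore selects the term whose frequency belongs to band j and leaves it
  unchanged, and j = 0 selects nothing.\<close>

lemma symbol_piece_symb:
  "symbol_piece \<phi> \<Phi> (symb m) j k (x, \<xi>) =
    (if j = 0 then 0 else of_real (2 powr (m * real j)) * ee (- (2 ^ j * (x \<bullet> e1)))) * eta (\<xi> /\<^sub>R 2 ^ j) * lp_hat k \<xi>"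
proof -
  obtain L :: nat where L: "norm \<xi> < 2 ^ L" using real_arch_pow[of 2 "norm \<xi>"] by auto
  let ?K = "lp_kernel \<phi> \<Phi> j"
  let ?c = "\<lambda>l. of_real (2 powr (m * real (Suc l))) * eta (\<xi> /\<^sub>R 2 ^ Suc l)"
  note [measurable] = schwartz_measurable[OF lp_kernel_schwartz[of j]]
  have K: "(\<lambda>y. ?K (x - y)) \<in> schwartz" by (intro schwartz_reflect lp_kernel_schwartz)
  have m [measurable]: "(\<lambda>y. ee (- (2 ^ Suc l * (y \<bullet> e1)))) \<in> borel_measurable borel"
      "(\<lambda>y. ee (- (2 ^ Suc l * ((x - y) \<bullet> e1)))) \<in> borel_measurable borel" for l
    by (intro borel_measurable_continuous_onI continuous_intros)+
  have 1: "(LINT y|lborel. ?K (x - y) * ee (- (2 ^ Suc l * (y \<bullet> e1)))) = (if j = Suc l then ee (- (2 ^ Suc l * (x \<bullet> e1))) else 0)" for l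
  proof -
    have "(LINT y|lborel. ?K (x - y) * ee (- (2 ^ Suc l * (y \<bullet> e1)))) = (LINT y|lborel. (\<lambda>y. ?K y * ee (- (2 ^ Suc l * ((x - y) \<bullet> e1)))) (x - y))"
      by simp
    also have "\<dots> = (LINT y|lborel. ?K y * ee (- (2 ^ Suc l * ((x - y) \<bullet> e1))))"
      by (rule integral_reflect) measurable
    also have "\<dots> = (LINT y|lborel. (?K y * ee (- (y \<bullet> (2 ^ Suc l *\<^sub>R (- e1))))) * ee (- (2 ^ Suc l * (x \<bullet> e1))))"
      by (simp add: inner_diff_left right_diff_distrib mult.assoc ee_add[symmetric])
    also have "\<dots> = lp_hat j (2 ^ Suc l *\<^sub>R (- e1)) * ee (- (2 ^ Suc l * (x \<bullet> e1)))"
      unfolding fourier_lp_kernel[symmetric] fourier_eq by simp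
    also have "lp_hat j (2 ^ Suc l *\<^sub>R (- e1)) = (if j = Suc l then 1 else 0)"
      by (rule lp_hat_dyadic) auto
    finally show ?thesis by simp
  qed
  have "convolve ?K (\<lambda>y. symb m (y, \<xi>)) x = (LINT y|lborel. (\<Sum>l<L. ?c l * (?K (x - y) * ee (- (2 ^ Suc l * (y \<bullet> e1))))))"
    unfolding convolve_def symb_def lacunary_finite[OF bump_eta L]
    by (simp add: sum_distrib_left mult_ac)
  also have "\<dots> = (\<Sum>l<L. (LINT y|lborel. ?c l * (?K (x - y) * ee (- (2 ^ Suc l * (y \<bullet> e1))))))"
    by (intro Bochner_Integration.integral_sum integrable_mult_right schwartz_integrable_mult[where C = 1] K) auto
  also have "\<dots> = (\<Sum>l<L. ?c l * (LINT y|lborel. ?K (x - y) * ee (- (2 ^ Suc l * (y \<bullet> e1)))))"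
    by (intro sum.cong refl Bochner_Integration.integral_mult_right_zero)
  also have "\<dots> = (\<Sum>l<L. if l = j - 1 then (if j = 0 then 0 else ?c l * ee (- (2 ^ Suc l * (x \<bullet> e1)))) else 0)"
    unfolding 1 by (intro sum.cong) auto
  also have "\<dots> = (if j = 0 then 0 else of_real (2 powr (m * real j)) * ee (- (2 ^ j * (x \<bullet> e1)))) * eta (\<xi> /\<^sub>R 2 ^ j)"
  proof (cases "j = 0 \<or> j - 1 < L")
    case True
    then show ?thesis by auto
  next
    case False
    then have "eta (\<xi> /\<^sub>R 2 ^ Suc (j - 1)) = 0" by (intro bump_eq_0[OF bump_eta L]) auto
    moreover have "Suc (j - 1) = j" using False by simp
    ultimately show ?thesis using False by simp
  qed
  finally show ?thesis by (simp add: symbol_piece_def fourier_lp_kernel)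
qed

lemma eta_scaled_schwartz: "(\<lambda>\<xi>. eta (\<xi> /\<^sub>R 2 ^ j)) \<in> schwartz"
  by (rule schwartz_dilate[OF eta_schwartz]) simp

lemma psdo_compact_symb:
  assumes f: "f \<in> schwartz"
  shows "psdo_compact (symbol_piece \<phi> \<Phi> (symb m) j k) (dist_of f) x =
    (if j = 0 then 0 else of_real (2 powr (m * real j)) * ee (- (2 ^ j * (x \<bullet> e1)))) *
      ifourier (\<lambda>\<xi>. lp_hat k \<xi> * (eta (\<xi> /\<^sub>R 2 ^ j) * fourier f \<xi>)) x"
proof -
  define c where "c = (if j = 0 then 0 else of_real (2 powr (m * real j)) * ee (- (2 ^ j * (x \<bullet> e1))))"
  let ?h = "\<lambda>\<xi>. c * (eta (\<xi> /\<^sub>R 2 ^ j) * (lp_hat k \<xi> * ee (x \<bullet> \<xi>)))"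
  have h: "?h \<in> schwartz"
    by (rule schwartz_cmult[OF schwartz_mult'[OF schwartz_imp_slow[OF eta_scaled_schwartz] schwartz_mult[OF lp_hat_schwartz slow_ee']]])
  have eq: "(\<lambda>\<xi>. symbol_piece \<phi> \<Phi> (symb m) j k (x, \<xi>) * exp (2 * of_real pi * \<i> * of_real (x \<bullet> \<xi>))) = ?h"
    unfolding symbol_piece_symb ee_exp[symmetric] c_def[symmetric] by (simp add: mult_ac)
  have "psdo_compact (symbol_piece \<phi> \<Phi> (symb m) j k) (dist_of f) x = (LINT y|lborel. f y * fourier ?h y)"
    unfolding psdo_compact_def eq by (rule dist_of_eq[OF fourier_schwartz[OF h]])
  also have "\<dots> = (LINT \<xi>|lborel. fourier f \<xi> * ?h \<xi>)"
    by (intro fourier_swap schwartz_integrable f h)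
  also have "\<dots> = c * ifourier (\<lambda>\<xi>. lp_hat k \<xi> * (eta (\<xi> /\<^sub>R 2 ^ j) * fourier f \<xi>)) x"
    unfolding ifourier_eq Bochner_Integration.integral_mult_right_zero[symmetric] by (simp add: mult_ac)
  finally show ?thesis unfolding c_def .
qed

text \<open>For f with bounded spectrum the double sums are constant from N = J + 1 on: the
  multipliers in \<xi> add up to 1 on the spectrum, and terms of the symbol with j > J + 1 miss it.
  The limit in the space of distributions is then trivial.\<close>

lemma psdo_graph_symb:
  assumes f: "f \<in> schwartz" and J: "\<And>\<xi>. fourier f \<xi> \<noteq> 0 \<Longrightarrow> norm \<xi> \<le> 2 ^ J"
    and g: "g \<in> schwartz"
    and geq: "\<And>x. g x = (\<Sum>j\<in>{1..Suc J}. of_real (2 powr (m * real j)) * ee (- (2 ^ j * (x \<bullet> e1))) *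
        ifourier (\<lambda>\<xi>. eta (\<xi> /\<^sub>R 2 ^ j) * fourier f \<xi>) x)"
  shows "psdo_graph \<phi> \<Phi> (symb m) (dist_of f) (dist_of g)"
  unfolding psdo_graph_def
proof (intro conjI tempered_dist_of f g ballI)
  fix \<psi> :: "'a \<Rightarrow> complex" assume psi: "\<psi> \<in> schwartz"
  define P where "P j k x = psdo_compact (symbol_piece \<phi> \<Phi> (symb m) j k) (dist_of f) x" for j k x
  have fe: "(\<lambda>\<xi>. eta (\<xi> /\<^sub>R 2 ^ j) * fourier f \<xi>) \<in> schwartz" for j
    by (intro schwartz_mult schwartz_imp_slow eta_scaled_schwartz fourier_schwartz f)
  have fe': "(\<lambda>\<xi>. lp_hat k \<xi> * (eta (\<xi> /\<^sub>R 2 ^ j) * fourier f \<xi>)) \<in> schwartz" for j k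
    by (intro schwartz_mult'[OF schwartz_imp_slow] lp_hat_schwartz fe)
  have PS: "P j k \<in> schwartz" for j k
  proof (cases "j = 0")
    case True
    then show ?thesis using schwartz_zero by (simp add: P_def[abs_def] psdo_compact_symb[OF f])
  next
    case False
    have "(\<lambda>x. of_real (2 powr (m * real j)) * (ee (x \<bullet> (2 ^ j *\<^sub>R (- e1))) * ifourier (\<lambda>\<xi>. lp_hat k \<xi> * (eta (\<xi> /\<^sub>R 2 ^ j) * fourier f \<xi>)) x)) \<in> schwartz"
      by (intro schwartz_cmult schwartz_mult'[OF slow_ee] ifourier_schwartz fe')
    then show ?thesis using False by (simp add: P_def[abs_def] psdo_compact_symb[OF f] mult.assoc)
  qed
  have int: "integrable lborel (\<lambda>x. P j k x * \<psi> x)" for j k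
    using schwartz_integrable[OF schwartz_mult[OF PS schwartz_imp_slow[OF psi]]] .
  have "(\<Sum>k\<le>N. \<Sum>j\<le>N. dist_of (P j k) \<psi>) = dist_of g \<psi>" if N: "N \<ge> Suc J" for N
  proof -
    have "(\<Sum>k\<le>N. \<Sum>j\<le>N. P j k x) = g x" for x
    proof -
      have vanish: "eta (\<xi> /\<^sub>R 2 ^ j) * fourier f \<xi> = 0" if "j > Suc J" for j \<xi>
      proof (rule ccontr)
        assume "eta (\<xi> /\<^sub>R 2 ^ j) * fourier f \<xi> \<noteq> 0"
        then have "3 / 4 * 2 ^ j \<le> norm \<xi>" "norm \<xi> \<le> 2 ^ J"
          using bump_scale(1)[OF bump_eta, where \<xi> = \<xi> and l = j] J by auto
        moreover have "(2::real) ^ Suc (Suc J) \<le> 2 ^ j" using that by (intro power_increasing) auto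
        moreover have "(2::real) ^ J > 0" by simp
        ultimately show False by simp
      qed
      have sum1: "(\<Sum>k\<le>N. lp_hat k \<xi> * (eta (\<xi> /\<^sub>R 2 ^ j) * fourier f \<xi>)) = eta (\<xi> /\<^sub>R 2 ^ j) * fourier f \<xi>" for j \<xi>
      proof (cases "fourier f \<xi> = 0")
        case False
        have "(2::real) ^ J \<le> 2 ^ N" using N by simp
        then have "norm \<xi> \<le> 2 ^ N" using J[OF False] by linarith
        then show ?thesis by (simp add: sum_distrib_right[symmetric] lp_hat_sum)
      qed simp
      have "(\<Sum>k\<le>N. \<Sum>j\<le>N. P j k x) = (\<Sum>j\<le>N. \<Sum>k\<le>N. P j k x)" by (rule sum.swap)
      also have "\<dots> = (\<Sum>j\<le>N. (if j = 0 then 0 else of_real (2 powr (m * real j)) * ee (- (2 ^ j * (x \<bullet> e1)))) *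
          ifourier (\<lambda>\<xi>. eta (\<xi> /\<^sub>R 2 ^ j) * fourier f \<xi>) x)"
      proof (rule sum.cong[OF refl])
        fix j
        have "(\<Sum>k\<le>N. ifourier (\<lambda>\<xi>. lp_hat k \<xi> * (eta (\<xi> /\<^sub>R 2 ^ j) * fourier f \<xi>)) x) = ifourier (\<lambda>\<xi>. eta (\<xi> /\<^sub>R 2 ^ j) * fourier f \<xi>) x"
          unfolding ifourier_sum[OF fe', symmetric] sum1 ..
        then show "(\<Sum>k\<le>N. P j k x) = (if j = 0 then 0 else of_real (2 powr (m * real j)) * ee (- (2 ^ j * (x \<bullet> e1)))) *
            ifourier (\<lambda>\<xi>. eta (\<xi> /\<^sub>R 2 ^ j) * fourier f \<xi>) x"
          unfolding P_def psdo_compact_symb[OF f] sum_distrib_left[symmetric] by simp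
      qed
      also have "\<dots> = (\<Sum>j\<in>{1..Suc J}. (if j = 0 then 0 else of_real (2 powr (m * real j)) * ee (- (2 ^ j * (x \<bullet> e1)))) *
          ifourier (\<lambda>\<xi>. eta (\<xi> /\<^sub>R 2 ^ j) * fourier f \<xi>) x)"
      proof (rule sum.mono_neutral_right)
        show "\<forall>j\<in>{..N} - {1..Suc J}. (if j = 0 then 0 else of_real (2 powr (m * real j)) * ee (- (2 ^ j * (x \<bullet> e1)))) *
          ifourier (\<lambda>\<xi>. eta (\<xi> /\<^sub>R 2 ^ j) * fourier f \<xi>) x = 0"
        proof
          fix j assume "j \<in> {..N} - {1..Suc J}"
          then consider "j = 0" | "j > Suc J" by fastforce
          then show "(if j = 0 then 0 else of_real (2 powr (m * real j)) * ee (- (2 ^ j * (x \<bullet> e1)))) *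
            ifourier (\<lambda>\<xi>. eta (\<xi> /\<^sub>R 2 ^ j) * fourier f \<xi>) x = 0"
          proof cases
            case 2
            then show ?thesis unfolding vanish[OF 2] by (simp add: ifourier_eq)
          qed simp
        qed
      qed (use N in auto)
      also have "\<dots> = g x" unfolding geq by (intro sum.cong) auto
      finally show ?thesis .
    qed
    then have "dist_of g \<psi> = (LINT x|lborel. (\<Sum>k\<le>N. \<Sum>j\<le>N. P j k x * \<psi> x))"
      by (simp add: dist_of_eq[OF psi] sum_distrib_right[symmetric])
    also have "\<dots> = (\<Sum>k\<le>N. \<Sum>j\<le>N. (LINT x|lborel. P j k x * \<psi> x))"
      using int by (simp add: Bochner_Integration.integral_sum)
    finally show ?thesis by (simp add: dist_of_eq[OF psi])
  qed
  then have "eventually (\<lambda>N. (\<Sum>k\<le>N. \<Sum>j\<le>N. dist_of (P j k) \<psi>) = dist_of g \<psi>) sequentially"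
    by (rule eventually_sequentiallyI)
  then show "(\<lambda>N. \<Sum>k\<le>N. \<Sum>j\<le>N. dist_of (psdo_compact (symbol_piece \<phi> \<Phi> (symb m) j k) (dist_of f)) \<psi>) \<longlonglongrightarrow> dist_of g \<psi>"
    unfolding P_def[abs_def] by (rule tendsto_eventually)
qed

definition modulated :: "real \<Rightarrow> nat set \<Rightarrow> (nat \<Rightarrow> 'a \<Rightarrow> complex) \<Rightarrow> 'a \<Rightarrow> complex" where
  "modulated m I G x = (\<Sum>k\<in>I. of_real (2 powr (- m * real k)) * (ee (x \<bullet> (2 ^ k *\<^sub>R e1)) * G k x))"

text \<open>Radius 2^k/8 keeps the spectrum of the k-th modulated term where the dilated
  \<open>eta\<close> is 1. The condition k >= 4 keeps these spectra away from the low-frequency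
  multiplier, so that the zeroth piece of the input vanishes.\<close>

definition admissible :: "nat set \<Rightarrow> (nat \<Rightarrow> 'a \<Rightarrow> complex) \<Rightarrow> bool" where
  "admissible I G \<longleftrightarrow> finite I \<and> (\<forall>k\<in>I. k \<ge> 4 \<and> G k \<in> schwartz \<and> (\<forall>\<xi>. fourier (G k) \<xi> \<noteq> 0 \<longrightarrow> norm \<xi> \<le> 2 ^ k / 8))"

lemma modulated_term:
  assumes "admissible I G" "k \<in> I"
  shows "(\<lambda>x. of_real (2 powr (- m * real k)) * (ee (x \<bullet> (2 ^ k *\<^sub>R e1)) * G k x)) \<in> schwartz"
  by (intro schwartz_cmult schwartz_mult'[OF slow_ee]) (use assms in \<open>auto simp: admissible_def\<close>)

lemma modulated_schwartz: "admissible I G \<Longrightarrow> modulated m I G \<in> schwartz"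
  unfolding modulated_def[abs_def] by (intro schwartz_sum modulated_term)

lemma fourier_modulated:
  assumes "admissible I G"
  shows "fourier (modulated m I G) \<xi> = (\<Sum>k\<in>I. of_real (2 powr (- m * real k)) * fourier (G k) (\<xi> - 2 ^ k *\<^sub>R e1))"
  unfolding modulated_def[abs_def]
  by (subst fourier_sum[OF modulated_term[OF assms]]) (simp_all only: fourier_cmult fourier_modulate)

lemma admissible_support:
  assumes "admissible I G" "k \<in> I" "fourier (G k) (\<xi> - 2 ^ k *\<^sub>R e1) \<noteq> 0"
  shows "norm (\<xi> /\<^sub>R 2 ^ k - e1) \<le> 1 / 8" "7 / 8 * 2 ^ k \<le> norm \<xi>" "norm \<xi> \<le> 9 / 8 * 2 ^ k"
proof -
  have 1: "norm (\<xi> - 2 ^ k *\<^sub>R e1) \<le> 2 ^ k / 8" using assms by (auto simp: admissible_def)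
  have "\<xi> /\<^sub>R 2 ^ k - e1 = (\<xi> - 2 ^ k *\<^sub>R e1) /\<^sub>R 2 ^ k" by (simp add: scaleR_diff_right)
  then have "norm (\<xi> /\<^sub>R 2 ^ k - e1) = norm (\<xi> - 2 ^ k *\<^sub>R e1) / 2 ^ k"
    by (simp only: norm_scaleR abs_inverse divide_inverse_commute) simp
  also have "\<dots> \<le> (2 ^ k / 8) / 2 ^ k" by (intro divide_right_mono 1) simp
  finally show "norm (\<xi> /\<^sub>R 2 ^ k - e1) \<le> 1 / 8" by simp
  have "norm (2 ^ k *\<^sub>R e1) = 2 ^ k" by simp
  then show "7 / 8 * 2 ^ k \<le> norm \<xi>" "norm \<xi> \<le> 9 / 8 * 2 ^ k"
    using 1 norm_triangle_ineq2[of "2 ^ k *\<^sub>R e1" \<xi>] norm_triangle_ineq2[of \<xi> "2 ^ k *\<^sub>R e1"]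
    by (simp_all add: norm_minus_commute)
qed

text \<open>The j-th term of the symbol picks the j-th summand of the input, and its oscillation and
  its factor 2^(jm) undo the modulation and the normalisation, leaving \<open>G j\<close>.\<close>

lemma psdo_graph_modulated:
  assumes G: "admissible I G"
  shows "psdo_graph \<phi> \<Phi> (symb m) (dist_of (modulated m I G)) (dist_of (\<lambda>x. \<Sum>k\<in>I. G k x))"
proof -
  have fin: "finite I" and GS: "\<And>k. k \<in> I \<Longrightarrow> G k \<in> schwartz" and I4: "\<And>k. k \<in> I \<Longrightarrow> k \<ge> 4"
    using G by (auto simp: admissible_def)
  obtain J where J: "\<And>k. k \<in> I \<Longrightarrow> k < J" using fin by (meson finite_nat_set_iff_bounded)
  \<comment> \<open>The modulated spectra lie between 7/8 and 9/8 times 2^k, the support of the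
    dilated \<open>eta\<close> between 3/4 and 5/4 times 2^j; these ranges meet only for j =
    k.\<close>
  have coef: "eta (\<xi> /\<^sub>R 2 ^ j) * fourier (modulated m I G) \<xi> =
     (if j \<in> I then of_real (2 powr (- m * real j)) * fourier (G j) (\<xi> - 2 ^ j *\<^sub>R e1) else 0)" for j \<xi>
  proof -
    have "eta (\<xi> /\<^sub>R 2 ^ j) * (of_real (2 powr (- m * real k)) * fourier (G k) (\<xi> - 2 ^ k *\<^sub>R e1)) =
      (if k = j then of_real (2 powr (- m * real k)) * fourier (G k) (\<xi> - 2 ^ k *\<^sub>R e1) else 0)" if k: "k \<in> I" for k
    proof (cases "fourier (G k) (\<xi> - 2 ^ k *\<^sub>R e1) = 0")
      case False
      note s = admissible_support[OF G k False]
      show ?thesis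
      proof (cases "k = j")
        case True
        then show ?thesis using eta_1[OF s(1)] by simp
      next
        case ne: False
        have "eta (\<xi> /\<^sub>R 2 ^ j) = 0"
        proof (rule ccontr)
          assume "eta (\<xi> /\<^sub>R 2 ^ j) \<noteq> 0"
          note t = bump_scale[OF bump_eta this]
          have pos: "(2::real) ^ j > 0" "(2::real) ^ k > 0" by simp_all
          consider "Suc j \<le> k" | "Suc k \<le> j" using ne by linarith
          then show False
          proof cases
            case 1
            then have "(2::real) ^ Suc j \<le> 2 ^ k" by (rule power_increasing) simp
            then show False using s t pos by simp
          next
            case 2
            then have "(2::real) ^ Suc k \<le> 2 ^ j" by (rule power_increasing) simp
            then show False using s t pos by simp
          qed
        qed
        then show ?thesis using ne by simp
      qed
    next
      case True
      then show ?thesis by (cases "k = j") auto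
    qed
    then have "eta (\<xi> /\<^sub>R 2 ^ j) * fourier (modulated m I G) \<xi> = (\<Sum>k\<in>I. if k = j then of_real (2 powr (- m * real k)) * fourier (G k) (\<xi> - 2 ^ k *\<^sub>R e1) else 0)"
      unfolding fourier_modulated[OF G] sum_distrib_left by (intro sum.cong) auto
    then show ?thesis using fin by (simp add: sum.delta')
  qed
  show ?thesis
  proof (rule psdo_graph_symb[where J = J])
    show "modulated m I G \<in> schwartz" by (rule modulated_schwartz[OF G])
    show "(\<lambda>x. \<Sum>k\<in>I. G k x) \<in> schwartz" by (intro schwartz_sum GS)
    show "norm \<xi> \<le> 2 ^ J" if nz: "fourier (modulated m I G) \<xi> \<noteq> 0" for \<xi>
    proof -
      obtain k where k: "k \<in> I" "fourier (G k) (\<xi> - 2 ^ k *\<^sub>R e1) \<noteq> 0"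
        using nz unfolding fourier_modulated[OF G] by (metis (no_types, lifting) mult_zero_right sum.neutral)
      have "(2::real) ^ Suc k \<le> 2 ^ J" using J[OF k(1)] by (intro power_increasing) auto
      then show ?thesis using admissible_support(3)[OF G k] zero_less_power[of "2::real" k] by (simp del: zero_less_power)
    qed
    fix x
    have summand: "of_real (2 powr (m * real j)) * ee (- (2 ^ j * (x \<bullet> e1))) * ifourier (\<lambda>\<xi>. eta (\<xi> /\<^sub>R 2 ^ j) * fourier (modulated m I G) \<xi>) x = (if j \<in> I then G j x else 0)" for j
    proof (cases "j \<in> I")
      case True
      have "ifourier (\<lambda>\<xi>. eta (\<xi> /\<^sub>R 2 ^ j) * fourier (modulated m I G) \<xi>) x = of_real (2 powr (- m * real j)) * (ee (x \<bullet> (2 ^ j *\<^sub>R e1)) * G j x)"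
        using True fourier_schwartz[OF GS[OF True]]
        by (simp add: coef ifourier_cmult ifourier_translate ifourier_fourier GS)
      then show ?thesis using True
        by (simp add: ee_minus powr_minus mult_ac)
          (simp add: mult.assoc[symmetric] complex_norm_square[symmetric] flip: of_real_mult)
    next
      case False
      then show ?thesis by (simp add: coef ifourier_eq)
    qed
    show "(\<Sum>k\<in>I. G k x) = (\<Sum>j = 1..Suc J. of_real (2 powr (m * real j)) * ee (- (2 ^ j * (x \<bullet> e1))) *
        ifourier (\<lambda>\<xi>. eta (\<xi> /\<^sub>R 2 ^ j) * fourier (modulated m I G) \<xi>) x)"
    proof -
      have sub: "I \<subseteq> {1..Suc J}" using J I4 by fastforce
      have "(\<Sum>j = 1..Suc J. if j \<in> I then G j x else 0) = (\<Sum>j\<in>{1..Suc J} \<inter> I. G j x)"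
        by (simp add: sum.inter_restrict)
      also have "{1..Suc J} \<inter> I = I" using sub by blast
      finally show ?thesis unfolding summand by simp
    qed
  qed
qed

section \<open>Pointwise control of Littlewood-Paley pieces\<close>

text \<open>Takes the place of a maximal inequality. A majorant that changes by at most (1 + A
  |z|)^M under translation by z is reproduced by averaging at distance 2^-k, as long as A is at most
  comparable to 2^k; the constant is a moment of \<phi>. The factor 2 in the bound for A admits the
  band just below the scale of the majorant.\<close>

lemma lp_proj_bound:
  "\<exists>C>0. \<forall>k\<ge>1. \<forall>f\<in>schwartz. \<forall>w A. (\<forall>x. norm (f x) \<le> w x) \<longrightarrow> (\<forall>x z. w (x - z) \<le> w x * (1 + A * norm z) ^ M) \<longrightarrow>
     0 \<le> A \<longrightarrow> A \<le> 2 * 2 ^ k \<longrightarrow> (\<forall>x. norm (piece k f x) \<le> C * w x)"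
proof -
  define C where "C = (LINT z|lborel. norm (\<phi> z) * (1 + 2 * norm z) ^ M)"
  obtain B where B: "B > 0" "\<And>x::'a. norm (\<phi> x) \<le> B / (1 + norm x) ^ (2 * DIM('a) + M)"
    using schwartz_bound[OF phi] by blast
  note [measurable] = schwartz_measurable[OF phi]
  have int: "integrable lborel (\<lambda>z. norm (\<phi> z) * (1 + 2 * norm z) ^ M)"
  proof (rule Bochner_Integration.integrable_bound)
    show "integrable lborel (\<lambda>z::'a. B * 2 ^ M * (1 / (1 + norm z) ^ (2 * DIM('a))))"
      by (intro integrable_mult_right integrable_weight) simp
    have "norm (\<phi> z) * (1 + 2 * norm z) ^ M \<le> B * 2 ^ M * (1 / (1 + norm z) ^ (2 * DIM('a)))" for z
    proof -
      have "(1 + 2 * norm z) ^ M \<le> (2 * (1 + norm z)) ^ M" by (intro power_mono) auto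
      then have "norm (\<phi> z) * (1 + 2 * norm z) ^ M \<le> B / (1 + norm z) ^ (2 * DIM('a) + M) * (2 * (1 + norm z)) ^ M"
        using B by (intro mult_mono) auto
      also have "\<dots> = B * 2 ^ M * (1 / (1 + norm z) ^ (2 * DIM('a)))"
      proof -
        have "1 + norm z \<noteq> 0" using norm_ge_zero[of z] by linarith
        then show ?thesis unfolding power_add power_mult_distrib by simp
      qed
      finally show ?thesis .
    qed
    then show "AE z in lborel. norm (norm (\<phi> z) * (1 + 2 * norm z) ^ M) \<le> norm (B * 2 ^ M * (1 / (1 + norm z) ^ (2 * DIM('a))))"
      using B(1) by simp
  qed measurable
  have main: "norm (piece k f x) \<le> C * w x"
    if k: "k \<ge> 1" and f: "f \<in> schwartz" and w: "\<And>x. norm (f x) \<le> w x" "\<And>x z. w (x - z) \<le> w x * (1 + A * norm z) ^ M"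
      and A: "0 \<le> A" "A \<le> 2 * 2 ^ k" for k f w A x
  proof -
    note [measurable] = schwartz_measurable[OF f]
    obtain D where D: "\<And>x. norm (f x) \<le> D" using schwartz_bounded[OF f] by blast
    have w0: "0 \<le> w x" using order_trans[OF norm_ge_zero w(1)] .
    have "norm (\<phi> z * f (x - z /\<^sub>R 2 ^ k)) \<le> norm (\<phi> z) * (1 + 2 * norm z) ^ M * w x" for z
    proof -
      have "norm (f (x - z /\<^sub>R 2 ^ k)) \<le> w x * (1 + A * norm (z /\<^sub>R 2 ^ k)) ^ M"
        using w order_trans by blast
      also have "\<dots> \<le> w x * (1 + 2 * norm z) ^ M"
      proof (intro mult_left_mono power_mono add_left_mono w0)
        have "A * norm (z /\<^sub>R 2 ^ k) \<le> (2 * 2 ^ k) * norm (z /\<^sub>R 2 ^ k)" by (intro mult_right_mono A) auto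
        also have "(2 * 2 ^ k) * norm (z /\<^sub>R 2 ^ k) = 2 * norm z" by simp
        finally show "A * norm (z /\<^sub>R 2 ^ k) \<le> 2 * norm z" .
      qed (use A in auto)
      finally have "norm (\<phi> z) * norm (f (x - z /\<^sub>R 2 ^ k)) \<le> norm (\<phi> z) * (w x * (1 + 2 * norm z) ^ M)"
        by (rule mult_left_mono) simp
      then show ?thesis by (simp only: norm_mult mult_ac)
    qed
    then have "norm (LINT z|lborel. \<phi> z * f (x - z /\<^sub>R 2 ^ k)) \<le> (LINT z|lborel. norm (\<phi> z) * (1 + 2 * norm z) ^ M * w x)"
      using D by (intro Bochner_Integration.integral_norm_bound_integral integrable_mult_left int schwartz_integrable_mult[where C = D] phi) auto
    then show ?thesis by (simp add: lp_proj_conv[OF f k] C_def)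
  qed
  have "C \<ge> 0" unfolding C_def by (intro integral_nonneg_AE) auto
  show ?thesis
  proof (intro exI[of _ "C + 1"] conjI allI impI ballI)
    show "C + 1 > 0" using \<open>C \<ge> 0\<close> by simp
    fix k and f :: "'a \<Rightarrow> complex" and w A x
    assume "1 \<le> k" "f \<in> schwartz" "\<forall>x. norm (f x) \<le> w x" "\<forall>x z. w (x - z) \<le> w x * (1 + A * norm z) ^ M" "0 \<le> A" "A \<le> 2 * 2 ^ k"
    then have "norm (piece k f x) \<le> C * w x" "0 \<le> w x"
      using main order_trans[OF norm_ge_zero] by blast+
    then show "norm (piece k f x) \<le> (C + 1) * w x" by (simp add: distrib_right)
  qed
qed

end

subsection \<open>Quasi-norms\<close>

lemma enn_powr_ennreal: "0 \<le> y \<Longrightarrow> enn_powr (ennreal y) r = ennreal (y powr r)"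
  by (simp add: enn_powr_def)

lemma enn_powr_0 [simp]: "enn_powr 0 r = 0" by (simp add: enn_powr_def)

lemma enn_powr_mono:
  assumes "x \<le> y" "0 \<le> r" shows "enn_powr x r \<le> enn_powr y r"
proof (cases "y = \<infinity>")
  case False
  then have "y < top" by (simp add: top.not_eq_extremum)
  moreover from this have "x < top" using assms(1) by (rule le_less_trans[rotated])
  ultimately show ?thesis using assms
    by (auto simp: enn_powr_def top.not_eq_extremum intro!: ennreal_leI powr_mono2 enn2real_mono)
qed (simp add: enn_powr_def)

lemma enn2real_pos: "0 < p \<Longrightarrow> p \<noteq> \<infinity> \<Longrightarrow> 0 < enn2real p"
  by (simp add: enn2real_positive_iff top.not_eq_extremum)

lemma Lp_norm_finite: "p \<noteq> \<infinity> \<Longrightarrow> Lp_norm M p g = enn_powr (\<integral>\<^sup>+x. enn_powr (g x) (enn2real p) \<partial>M) (1 / enn2real p)"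
  by (simp add: Lp_norm_def)

lemma Lp_norm_mono:
  assumes "\<And>x. g x \<le> h x" "g \<in> borel_measurable M \<or> p \<noteq> \<infinity>"
  shows "Lp_norm M p g \<le> Lp_norm M p h"
proof (cases "p = \<infinity>")
  case True
  then show ?thesis using assms by (auto simp: Lp_norm_def intro: esssup_mono)
next
  case False
  then show ?thesis using assms
    by (auto simp: Lp_norm_finite intro!: enn_powr_mono nn_integral_mono)
qed

lemma Lp_norm_le:
  assumes p: "p > 0" "p \<noteq> \<infinity>" and u: "\<And>x. 0 \<le> u x" and B: "0 \<le> B"
    and le: "(\<integral>\<^sup>+x. ennreal (u x powr enn2real p) \<partial>M) \<le> ennreal (B powr enn2real p)"
  shows "Lp_norm M p (\<lambda>x. ennreal (u x)) \<le> ennreal B"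
proof -
  note r = enn2real_pos[OF p]
  have "Lp_norm M p (\<lambda>x. ennreal (u x)) \<le> enn_powr (ennreal (B powr enn2real p)) (1 / enn2real p)"
    unfolding Lp_norm_finite[OF p(2)] using le r by (intro enn_powr_mono) (auto simp: enn_powr_ennreal u)
  also have "\<dots> = ennreal B" using r B by (simp add: enn_powr_ennreal powr_powr)
  finally show ?thesis .
qed

lemma Lp_norm_ge:
  assumes p: "p > 0" "p \<noteq> \<infinity>" and u: "\<And>x. 0 \<le> u x" and B: "0 \<le> B"
    and ge: "ennreal (B powr enn2real p) \<le> (\<integral>\<^sup>+x. ennreal (u x powr enn2real p) \<partial>M)"
  shows "ennreal B \<le> Lp_norm M p (\<lambda>x. ennreal (u x))"
proof -
  note r = enn2real_pos[OF p]
  have "ennreal B = enn_powr (ennreal (B powr enn2real p)) (1 / enn2real p)" using r B by (simp add: enn_powr_ennreal powr_powr)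
  also have "\<dots> \<le> Lp_norm M p (\<lambda>x. ennreal (u x))"
    unfolding Lp_norm_finite[OF p(2)] using ge r by (intro enn_powr_mono) (auto simp: enn_powr_ennreal u)
  finally show ?thesis .
qed

lemma Lp_norm_top_le:
  assumes "u \<in> borel_measurable M" "\<And>x. u x \<le> B"
  shows "Lp_norm M \<infinity> (\<lambda>x. ennreal (u x)) \<le> ennreal B"
  using assms by (auto simp: Lp_norm_def intro!: esssup_I ennreal_leI)

lemma Lp_norm_zero: "Lp_norm M p (\<lambda>x. 0) = 0"
proof -
  have "esssup M (\<lambda>x. 0::ennreal) \<le> 0" by (rule esssup_I) auto
  then show ?thesis by (simp add: Lp_norm_def)
qed

lemma esssup_count_space_ge: "l \<in> A \<Longrightarrow> a l \<le> esssup (count_space A) (a :: _ \<Rightarrow> ennreal)"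
  using esssup_AE[of a "count_space A"] by (simp add: AE_count_space)

text \<open>One formula covers q = \<infinity> as well: there \<open>enn2real q\<close> is 0, the
  exponent 1/0 is 0, and a positive cardinality to the power 0 is 1. The set must be nonempty for
  this, as 0 powr 0 is 0.\<close>

lemma lq_norm_le:
  assumes q: "q > 0" and S: "finite S" "S \<noteq> {}" "\<And>l. l \<notin> S \<Longrightarrow> l \<in> A \<Longrightarrow> a l = 0" "\<And>l. l \<in> S \<Longrightarrow> a l \<le> ennreal b" and b: "0 \<le> b"
  shows "Lp_norm (count_space A) q a \<le> ennreal (real (card S) powr (1 / enn2real q) * b)"
proof (cases "q = \<infinity>")
  case True
  have "a l \<le> ennreal b" if "l \<in> A" for l using S b that by (cases "l \<in> S") auto
  then show ?thesis using True S
    by (auto simp: Lp_norm_def AE_count_space card_gt_0_iff intro!: esssup_I)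
next
  case False
  let ?r = "enn2real q"
  note r = enn2real_pos[OF q False]
  have "(\<integral>\<^sup>+l. enn_powr (a l) ?r \<partial>count_space A) \<le> (\<integral>\<^sup>+l. enn_powr (a l) ?r * indicator S l \<partial>count_space A)"
    using S by (intro nn_integral_mono) (auto simp: indicator_def)
  also have "\<dots> \<le> (\<integral>\<^sup>+l. ennreal (b powr ?r) * indicator S l \<partial>count_space A)"
  proof (rule nn_integral_mono)
    fix l
    show "enn_powr (a l) ?r * indicator S l \<le> ennreal (b powr ?r) * indicator S l"
      using enn_powr_mono[OF S(4), of l ?r] r b by (auto simp: indicator_def enn_powr_ennreal)
  qed
  also have "\<dots> \<le> (\<integral>\<^sup>+l. ennreal (b powr ?r) * indicator S l \<partial>count_space UNIV)"
  proof -
    have "(\<integral>\<^sup>+l. ennreal (b powr ?r) * indicator S l \<partial>count_space A) = (\<integral>\<^sup>+l. ennreal (b powr ?r) * indicator S l * indicator A l \<partial>count_space UNIV)"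
      by (simp add: nn_integral_count_space_indicator)
    also have "\<dots> \<le> (\<integral>\<^sup>+l. ennreal (b powr ?r) * indicator S l \<partial>count_space UNIV)"
      by (intro nn_integral_mono) (auto simp: indicator_def)
    finally show ?thesis .
  qed
  also have "\<dots> = ennreal (b powr ?r) * of_nat (card S)"
    using S by (simp add: nn_integral_cmult)
  also have "\<dots> = ennreal (b powr ?r * real (card S))"
    by (simp add: ennreal_mult ennreal_of_nat_eq_real_of_nat)
  finally have "Lp_norm (count_space A) q a \<le> enn_powr (ennreal (b powr ?r * real (card S))) (1 / ?r)"
    unfolding Lp_norm_finite[OF False] using r by (intro enn_powr_mono) auto
  also have "\<dots> = ennreal (real (card S) powr (1 / ?r) * b)"
    using r b by (simp add: enn_powr_ennreal powr_mult powr_powr mult.commute)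
  finally show ?thesis .
qed

lemma lq_norm_ge:
  assumes q: "q > 0" and S: "finite S" "S \<noteq> {}" "S \<subseteq> A" "\<And>l. l \<in> S \<Longrightarrow> ennreal b \<le> a l" and b: "0 \<le> b"
  shows "ennreal (real (card S) powr (1 / enn2real q) * b) \<le> Lp_norm (count_space A) q a"
proof (cases "q = \<infinity>")
  case True
  obtain l where "l \<in> S" using S by auto
  then have "ennreal b \<le> esssup (count_space A) a"
    using S esssup_count_space_ge[of l A a] order_trans by blast
  then show ?thesis using True S by (simp add: Lp_norm_def card_gt_0_iff)
next
  case False
  let ?r = "enn2real q"
  note r = enn2real_pos[OF q False]
  have "ennreal (b powr ?r * real (card S)) = ennreal (b powr ?r) * of_nat (card S)"
    by (simp add: ennreal_mult ennreal_of_nat_eq_real_of_nat)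
  also have "\<dots> = (\<integral>\<^sup>+l. ennreal (b powr ?r) * indicator S l \<partial>count_space A)"
    using S by (simp add: nn_integral_cmult)
  also have "\<dots> \<le> (\<integral>\<^sup>+l. enn_powr (a l) ?r \<partial>count_space A)"
  proof (rule nn_integral_mono)
    fix l
    show "ennreal (b powr ?r) * indicator S l \<le> enn_powr (a l) ?r"
      using enn_powr_mono[OF S(4), of l ?r] r b by (auto simp: indicator_def enn_powr_ennreal)
  qed
  finally have "enn_powr (ennreal (b powr ?r * real (card S))) (1 / ?r) \<le> Lp_norm (count_space A) q a"
    unfolding Lp_norm_finite[OF False] using r by (intro enn_powr_mono) auto
  moreover have "enn_powr (ennreal (b powr ?r * real (card S))) (1 / ?r) = ennreal (real (card S) powr (1 / ?r) * b)"
    using r b by (simp add: enn_powr_ennreal powr_mult powr_powr mult.commute)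
  ultimately show ?thesis by simp
qed

text \<open>A finite norm C is contradicted by the witness for C + 1. The output norm is positive,
  so \<open>zero\<close> excludes u = 0; an input norm of 0 would already make the quotient
  infinite.\<close>

lemma operator_norm_eq_top:
  assumes ex: "\<And>C::real. C > 0 \<Longrightarrow> \<exists>u v A B. T u v \<and> u \<in> tempered \<and> NX u \<le> ennreal A \<and> ennreal B \<le> NY v \<and> 0 \<le> A \<and> C * A < B"
    and zero: "\<And>v. T (\<lambda>_. 0) v \<Longrightarrow> NY v = 0"
  shows "operator_norm T NX NY = \<infinity>"
proof (rule ccontr)
  assume "operator_norm T NX NY \<noteq> \<infinity>"
  then obtain C where C: "operator_norm T NX NY = ennreal C" "0 \<le> C" by (cases "operator_norm T NX NY") auto
  then obtain u v A B where uv: "T u v" "u \<in> tempered" "NX u \<le> ennreal A" "ennreal B \<le> NY v" "0 \<le> A" "(C + 1) * A < B"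
    using ex[of "C + 1"] by auto
  have B: "0 < B" using uv(5,6) C(2) by (smt (verit) mult_nonneg_nonneg)
  then have "NY v \<noteq> 0" using uv(4) by auto
  then have "u \<noteq> (\<lambda>_. 0)" using zero uv(1) by blast
  moreover have fin: "NX u < \<infinity>" using uv(3) by (simp add: le_less_trans)
  ultimately have "NY v / NX u \<le> ennreal C"
    unfolding C(1)[symmetric] operator_norm_def using uv(1,2) by (intro SUP_upper2[of "(u, v)"]) auto
  moreover have "NX u \<noteq> 0"
  proof
    assume "NX u = 0"
    then have "NY v / NX u = \<infinity>" using \<open>NY v \<noteq> 0\<close> by (simp add: ennreal_divide_zero)
    with \<open>NY v / NX u \<le> ennreal C\<close> show False by (simp add: top_unique)
  qed
  ultimately have "NY v \<le> ennreal C * NX u"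
    using fin by (metis ennreal_divide_times infinity_ennreal_def less_irrefl mult.commute mult_right_mono ennreal_mult_divide_eq ennreal_times_divide mult_le_mono zero_le)
  also have "\<dots> \<le> ennreal C * ennreal A" by (intro mult_left_mono uv) auto
  also have "\<dots> = ennreal (C * A)" using C uv by (simp add: ennreal_mult)
  finally have "ennreal B \<le> ennreal (C * A)" using uv(4) by (rule order_trans[rotated])
  then have "B \<le> C * A" using B C uv by (simp add: ennreal_le_iff2)
  then show False using uv(5,6) by (simp add: distrib_right)
qed

text \<open>Polynomial bump of width 1/a, the standard majorant for dilated Schwartz
  functions.\<close>

definition wgt :: "nat \<Rightarrow> real \<Rightarrow> 'a::euclidean_space \<Rightarrow> real" where
  "wgt M a x = 1 / (1 + a * norm x) ^ M"

lemma wgt_pos: "0 \<le> a \<Longrightarrow> 0 < wgt M a x"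
  by (simp add: wgt_def add_pos_nonneg)

lemma wgt_measurable [measurable]: "wgt M a \<in> borel_measurable borel"
  unfolding wgt_def[abs_def] by measurable

text \<open>Peetre's inequality, from 1 + a|x| <= (1 + a|x - z|) (1 + a|z|). It supplies the slow
  variation that \<open>lp_proj_bound\<close> asks of a majorant.\<close>

lemma wgt_peetre:
  assumes "0 \<le> a" "a \<le> A"
  shows "wgt M a (x - z) \<le> wgt M a x * (1 + A * norm z) ^ M"
proof -
  have "norm x \<le> norm (x - z) + norm z" using norm_triangle_ineq[of "x - z" z] by simp
  then have "a * norm x \<le> a * norm (x - z) + a * norm z" using assms mult_left_mono by (fastforce simp: distrib_left[symmetric])
  moreover have "0 \<le> (a * norm (x - z)) * (a * norm z)" using assms by (intro mult_nonneg_nonneg) auto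
  ultimately have "1 + a * norm x \<le> (1 + a * norm (x - z)) * (1 + a * norm z)"
    by (simp add: algebra_simps)
  also have "\<dots> \<le> (1 + a * norm (x - z)) * (1 + A * norm z)"
    using assms by (intro mult_left_mono add_left_mono mult_right_mono) auto
  finally have "(1 + a * norm x) ^ M \<le> ((1 + a * norm (x - z)) * (1 + A * norm z)) ^ M"
    using assms by (intro power_mono) auto
  moreover have "1 + a * norm x > 0" "1 + a * norm (x - z) > 0" using assms by (auto intro!: add_pos_nonneg)
  ultimately show ?thesis unfolding power_mult_distrib by (simp add: wgt_def field_simps)
qed

text \<open>Only M depends on p: it is taken so large that the p-th power of the weight is
  integrable, and scaling gives the power of a. For p = \<infinity> the exponent is d/0 = 0, which
  is the right one.\<close>

lemma wgt_Lp:
  assumes p: "p > 0"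
  shows "\<exists>M A. A > 0 \<and> 2 * DIM('a) \<le> M \<and> (\<forall>a c. \<forall>u::'a::euclidean_space \<Rightarrow> real. 0 < a \<longrightarrow> 0 \<le> c \<longrightarrow> u \<in> borel_measurable borel \<longrightarrow>
     (\<forall>x. 0 \<le> u x \<and> u x \<le> c * wgt M a x) \<longrightarrow>
     Lp_norm lborel p (\<lambda>x. ennreal (u x)) \<le> ennreal (c * A * a powr (- real DIM('a) / enn2real p)))"
proof (cases "p = \<infinity>")
  case True
  show ?thesis
  proof (intro exI[of _ "2 * DIM('a)"] exI[of _ 1] conjI allI impI)
    fix a c :: real and u :: "'a \<Rightarrow> real"
    assume a: "0 < a" and c: "0 \<le> c" and u: "u \<in> borel_measurable borel" "\<forall>x. 0 \<le> u x \<and> u x \<le> c * wgt (2 * DIM('a)) a x"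
    have "wgt (2 * DIM('a)) a x \<le> 1" for x :: 'a
    proof -
      have "1 \<le> (1 + a * norm x) ^ (2 * DIM('a))" using a by (intro one_le_power) simp
      then show ?thesis using divide_left_mono[of 1 _ 1] by (simp add: wgt_def)
    qed
    then have "u x \<le> c" for x using u(2) c by (meson mult_left_le order_trans)
    then show "Lp_norm lborel p (\<lambda>x. ennreal (u x)) \<le> ennreal (c * 1 * a powr (- real DIM('a) / enn2real p))"
      using Lp_norm_top_le[of u lborel c] u True a by simp
  qed auto
next
  case False
  define r where "r = enn2real p"
  have r: "r > 0" using enn2real_pos[OF p False] by (simp add: r_def)
  define M where "M = 2 * DIM('a) + nat \<lceil>2 * real DIM('a) / r\<rceil>"
  have M: "real M * r \<ge> 2 * real DIM('a)"
  proof -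
    have "2 * real DIM('a) / r \<le> real (nat \<lceil>2 * real DIM('a) / r\<rceil>)" by (rule real_nat_ceiling_ge)
    also have "\<dots> \<le> real M" by (simp add: M_def)
    finally show ?thesis using r by (simp add: field_simps)
  qed
  define I where "I = (LINT x|lborel. (1 + norm (x::'a)) powr - (real M * r))"
  have int: "integrable lborel (\<lambda>x::'a. (1 + norm x) powr - (real M * r))" by (rule integrable_weight_powr[OF M])
  have I: "I \<ge> 0" unfolding I_def by (intro integral_nonneg_AE) auto
  define A where "A = (I + 1) powr (1 / r)"
  show ?thesis
  proof (intro exI[of _ M] exI[of _ A] conjI allI impI)
    show "A > 0" using I by (simp add: A_def)
    show "2 * DIM('a) \<le> M" by (simp add: M_def)
    fix a c :: real and u :: "'a \<Rightarrow> real"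
    assume a: "0 < a" and c: "0 \<le> c" and u: "u \<in> borel_measurable borel" "\<forall>x. 0 \<le> u x \<and> u x \<le> c * wgt M a x"
    have "(\<integral>\<^sup>+x. ennreal (u x powr r) \<partial>lborel) \<le> (\<integral>\<^sup>+x. ennreal (c powr r * (1 + norm (a *\<^sub>R (x::'a))) powr - (real M * r)) \<partial>lborel)"
    proof (intro nn_integral_mono ennreal_leI)
      fix x
      have "u x powr r \<le> (c * wgt M a x) powr r" using u r by (intro powr_mono2) auto
      also have "\<dots> = c powr r * (wgt M a x) powr r" using c wgt_pos[of a M x] a by (simp add: powr_mult)
      also have "wgt M a x powr r = (1 + norm (a *\<^sub>R x)) powr - (real M * r)"
      proof -
        have pos: "1 + a * norm x > 0" using a by (auto intro!: add_pos_nonneg)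
        have "wgt M a x = (1 + a * norm x) powr - real M"
          using pos by (simp add: wgt_def powr_minus powr_realpow field_simps)
        then show ?thesis using a by (simp add: powr_powr)
      qed
      finally show "u x powr r \<le> c powr r * (1 + norm (a *\<^sub>R x)) powr - (real M * r)" .
    qed
    also have "\<dots> = ennreal (c powr r) * (\<integral>\<^sup>+x. ennreal ((1 + norm (0 + a *\<^sub>R (x::'a))) powr - (real M * r)) \<partial>lborel)"
      by (simp add: ennreal_mult nn_integral_cmult)
    also have "(\<integral>\<^sup>+x. ennreal ((1 + norm (0 + a *\<^sub>R (x::'a))) powr - (real M * r)) \<partial>lborel) = ennreal (I / a ^ DIM('a))"
    proof -
      have "ennreal I = (\<integral>\<^sup>+x. ennreal ((1 + norm (x::'a)) powr - (real M * r)) \<partial>lborel)"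
        unfolding I_def by (rule nn_integral_eq_integral[symmetric]) (use int in auto)
      also have "\<dots> = ennreal (\<bar>a\<bar> ^ DIM('a)) * (\<integral>\<^sup>+x. ennreal ((1 + norm (0 + a *\<^sub>R (x::'a))) powr - (real M * r)) \<partial>lborel)"
        by (rule nn_integral_affine) (use a in auto)
      finally have "ennreal I / ennreal (a ^ DIM('a)) = ennreal (a ^ DIM('a)) * (\<integral>\<^sup>+x. ennreal ((1 + norm (0 + a *\<^sub>R (x::'a))) powr - (real M * r)) \<partial>lborel) / ennreal (a ^ DIM('a))"
        using a by simp
      also have "\<dots> = (\<integral>\<^sup>+x. ennreal ((1 + norm (0 + a *\<^sub>R (x::'a))) powr - (real M * r)) \<partial>lborel)"
        by (subst mult.commute[of "ennreal (a ^ DIM('a))"], rule ennreal_mult_divide_eq) (use a in auto)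
      finally show ?thesis using a I by (simp add: divide_ennreal)
    qed
    also have "ennreal (c powr r) * ennreal (I / a ^ DIM('a)) = ennreal (c powr r * (I / a ^ DIM('a)))"
      by (rule ennreal_mult[symmetric]) (use a I in auto)
    also have "\<dots> \<le> ennreal ((c * A * a powr (- real DIM('a) / r)) powr r)"
    proof (rule ennreal_leI)
      have "(c * A * a powr (- real DIM('a) / r)) powr r = c powr r * (I + 1) * a powr (- real DIM('a))"
        using r c I a by (simp add: powr_mult A_def powr_powr)
      also have "\<dots> = c powr r * ((I + 1) / a ^ DIM('a))" using a by (simp add: powr_minus powr_realpow field_simps)
      also have "\<dots> \<ge> c powr r * (I / a ^ DIM('a))" using a by (intro mult_left_mono divide_right_mono) auto
      finally show "c powr r * (I / a ^ DIM('a)) \<le> (c * A * a powr (- real DIM('a) / r)) powr r" .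
    qed
    finally show "Lp_norm lborel p (\<lambda>x. ennreal (u x)) \<le> ennreal (c * A * a powr (- real DIM('a) / enn2real p))"
      unfolding r_def using u c by (intro Lp_norm_le p False) (auto simp: A_def)
  qed
qed

context lp_decomposition
begin

lemma lp_proj_zero: "lp_proj \<phi> \<Phi> k (\<lambda>_. 0) = (\<lambda>_. 0)"
  by (simp add: lp_proj_def convolve_dist_def fun_eq_iff)

lemma besov_norm_zero: "besov s p q (\<lambda>_. 0) = 0"
  by (simp add: besov_norm_def lp_proj_zero Lp_norm_zero)

lemma triebel_lizorkin_norm_zero: "triebel s p q (\<lambda>_. 0) = 0"
  by (simp add: triebel_lizorkin_norm_def lp_proj_zero Lp_norm_zero besov_norm_zero)

lemma psdo_graph_zero: "psdo_graph \<phi> \<Phi> a (\<lambda>_. 0) v \<Longrightarrow> v = (\<lambda>_. 0)"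
proof
  fix \<psi> :: "'a \<Rightarrow> complex"
  assume a: "psdo_graph \<phi> \<Phi> a (\<lambda>_. 0) v"
  show "v \<psi> = 0"
  proof (cases "\<psi> \<in> schwartz")
    case True
    then have "(\<lambda>N. \<Sum>k\<le>N. \<Sum>j\<le>N. dist_of (psdo_compact (symbol_piece \<phi> \<Phi> a j k) (\<lambda>_. 0)) \<psi>) \<longlonglongrightarrow> v \<psi>"
      using a by (simp add: psdo_graph_def)
    moreover have "dist_of (psdo_compact b (\<lambda>_. 0)) \<psi> = 0" for b
      by (simp add: psdo_compact_def dist_of_def)
    ultimately show ?thesis by (simp add: LIMSEQ_const_iff)
  next
    case False
    then show ?thesis using a by (simp add: psdo_graph_def tempered_def)
  qed
qed

text \<open>The reals \<open>A\<close> and \<open>B\<close> separate the two norms, so that each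
  example proves an upper and a lower estimate independently.\<close>

abbreviation "exceeds C m NX NY \<equiv> \<exists>I G A B. admissible I G \<and> NX (dist_of (modulated m I G)) \<le> ennreal A \<and>
  ennreal B \<le> NY (dist_of (\<lambda>x. \<Sum>k\<in>I. G k x)) \<and> 0 \<le> A \<and> C * A < B"

lemma operator_norm_modulated:
  assumes ex: "\<And>C::real. C > 0 \<Longrightarrow> exceeds C m NX NY"
    and zero: "NY (\<lambda>_. 0) = 0"
  shows "unbounded m NX NY"
proof (rule bexI[OF _ symb_symbol], rule operator_norm_eq_top)
  fix C :: real assume "C > 0"
  then obtain I G A B where "admissible I G" "NX (dist_of (modulated m I G)) \<le> ennreal A"
      "ennreal B \<le> NY (dist_of (\<lambda>x. \<Sum>k\<in>I. G k x))" "0 \<le> A" "C * A < B" using ex by blast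
  then show "\<exists>u v A B. psdo_graph \<phi> \<Phi> (symb m) u v \<and> u \<in> tempered \<and> NX u \<le> ennreal A \<and> ennreal B \<le> NY v \<and> 0 \<le> A \<and> C * A < B"
    using psdo_graph_modulated tempered_dist_of modulated_schwartz by blast
next
  fix v assume "psdo_graph \<phi> \<Phi> (symb m) (\<lambda>_. 0) v"
  then show "NY v = 0" using psdo_graph_zero zero by blast
qed

lemma lp_proj_sum:
  assumes "\<And>i. i \<in> I \<Longrightarrow> f i \<in> schwartz"
  shows "piece l (\<lambda>x. \<Sum>i\<in>I. c i * f i x) x = (\<Sum>i\<in>I. c i * piece l (f i) x)"
proof -
  have 1: "(\<lambda>x. c i * f i x) \<in> schwartz" if "i \<in> I" for i using that assms by (intro schwartz_cmult)
  have 2: "(\<lambda>\<xi>. c i * (lp_hat l \<xi> * fourier (f i) \<xi>)) \<in> schwartz" if "i \<in> I" for i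
    using that assms by (intro schwartz_cmult schwartz_mult schwartz_imp_slow lp_hat_schwartz fourier_schwartz)
  have "piece l (\<lambda>x. \<Sum>i\<in>I. c i * f i x) = ifourier (\<lambda>\<xi>. \<Sum>i\<in>I. c i * (lp_hat l \<xi> * fourier (f i) \<xi>))"
    by (simp add: lp_proj_dist_of schwartz_sum 1 fourier_sum fourier_cmult sum_distrib_left mult_ac)
  then show ?thesis
    by (simp add: ifourier_sum[OF 2] ifourier_cmult lp_proj_dist_of assms)
qed

lemma lp_proj_vanish:
  assumes "f \<in> schwartz" "\<And>\<xi>. lp_hat l \<xi> * fourier f \<xi> = 0"
  shows "piece l f x = 0"
  by (simp add: lp_proj_dist_of assms ifourier_eq)

abbreviation "localized s m f C I w \<equiv> (\<forall>x. piece 0 f x = 0) \<and>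
  (\<forall>l\<ge>1. \<forall>x. 2 powr ((s + m) * real l) * norm (piece l f x) \<le>
    C * (\<Sum>k\<in>{k\<in>I. k \<le> l + 1 \<and> l \<le> k + 1}. 2 powr (s * real k) * w k x))"

text \<open>The k-th modulated term has its spectrum in a thin annulus of radius 2^k, which meets
  only the bands k - 1, k, k + 1. The constant is chosen before the family, so it stays fixed while
  the examples grow.\<close>

lemma modulated_lp_proj:
  "\<exists>C>0. \<forall>I G w. admissible I G \<longrightarrow> (\<forall>k\<in>I. \<forall>x. norm (G k x) \<le> w k x) \<longrightarrow>
     (\<forall>k\<in>I. \<forall>x z. w k (x - z) \<le> w k x * (1 + 2 ^ k * norm z) ^ M) \<longrightarrow>
     localized s m (modulated m I G) C I w"
proof -
  obtain C where C: "C > 0" "\<And>k f w A x. 1 \<le> k \<Longrightarrow> f \<in> schwartz \<Longrightarrow> (\<And>x. norm (f x) \<le> w x) \<Longrightarrow>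
      (\<And>x z. w (x - z) \<le> w x * (1 + A * norm z) ^ M) \<Longrightarrow> 0 \<le> A \<Longrightarrow> A \<le> 2 * 2 ^ k \<Longrightarrow>
      norm (piece k f x) \<le> C * w x"
    using lp_proj_bound[of M] by blast
  \<comment> \<open>The second factor pays for replacing the weight of band l by that of the
    neighbouring index k.\<close>
  define D where "D = C * 2 powr \<bar>s + m\<bar>"
  have "localized s m (modulated m I G) D I w"
    if G: "admissible I G" and w: "\<And>k x. k \<in> I \<Longrightarrow> norm (G k x) \<le> w k x"
      "\<And>k x z. k \<in> I \<Longrightarrow> w k (x - z) \<le> w k x * (1 + 2 ^ k * norm z) ^ M" for I G w
  proof -
    have I4: "4 \<le> k" and GS: "G k \<in> schwartz" if "k \<in> I" for k using G that by (auto simp: admissible_def)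
    have fin: "finite I" using G by (simp add: admissible_def)
    let ?f = "\<lambda>k x. ee (x \<bullet> (2 ^ k *\<^sub>R e1)) * G k x"
    have fS: "?f k \<in> schwartz" if "k \<in> I" for k by (intro schwartz_mult'[OF slow_ee] GS that)
    have far: "lp_hat l \<xi> * fourier (?f k) \<xi> = 0" if k: "k \<in> I" and l: "\<not> (k \<le> l + 1 \<and> l \<le> k + 1)" for k l \<xi>
    proof (rule ccontr)
      assume *: "lp_hat l \<xi> * fourier (?f k) \<xi> \<noteq> 0"
      moreover have "fourier (?f k) \<xi> = fourier (G k) (\<xi> - 2 ^ k *\<^sub>R e1)" by (rule fourier_modulate)
      ultimately have "fourier (G k) (\<xi> - 2 ^ k *\<^sub>R e1) \<noteq> 0" by auto
      note s = admissible_support[OF G k this]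
      note t = lp_hat_support[of l \<xi>]
      have pos: "(2::real) ^ l > 0" "(2::real) ^ k > 0" by simp_all
      consider "Suc (Suc l) \<le> k" | "Suc (Suc k) \<le> l" using l by linarith
      then show False
      proof cases
        case 1
        then have "(2::real) ^ Suc (Suc l) \<le> 2 ^ k" by (rule power_increasing) simp
        then show False using s t * pos by simp
      next
        case 2
        then have "(2::real) ^ Suc (Suc k) \<le> 2 ^ l" by (rule power_increasing) simp
        then show False using s t 2 * pos by simp
      qed
    qed
    have pf: "piece l (modulated m I G) x = (\<Sum>k\<in>I. of_real (2 powr (- m * real k)) * piece l (?f k) x)" for l x
      unfolding modulated_def[abs_def] by (rule lp_proj_sum[OF fS])
    have "piece 0 (modulated m I G) x = 0" for x
      unfolding pf
    proof (intro sum.neutral ballI)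
      fix k assume k: "k \<in> I"
      then have "\<not> (k \<le> 0 + 1 \<and> 0 \<le> k + 1)" using I4[OF k] by simp
      then show "of_real (2 powr (- m * real k)) * piece 0 (?f k) x = 0"
        using lp_proj_vanish[OF fS[OF k] far[OF k]] by simp
    qed
    moreover have "2 powr ((s + m) * real l) * norm (piece l (modulated m I G) x) \<le>
        D * (\<Sum>k\<in>{k\<in>I. k \<le> l + 1 \<and> l \<le> k + 1}. 2 powr (s * real k) * w k x)" if l: "l \<ge> 1" for l x
    proof -
      let ?J = "{k\<in>I. k \<le> l + 1 \<and> l \<le> k + 1}"
      have "piece l (modulated m I G) x = (\<Sum>k\<in>?J. of_real (2 powr (- m * real k)) * piece l (?f k) x)"
        unfolding pf
      proof (rule sum.mono_neutral_right)
        show "\<forall>k\<in>I - ?J. of_real (2 powr (- m * real k)) * piece l (?f k) x = 0"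
          using lp_proj_vanish[OF fS far] by auto
      qed (use fin in auto)
      then have "norm (piece l (modulated m I G) x) \<le> (\<Sum>k\<in>?J. 2 powr (- m * real k) * norm (piece l (?f k) x))"
        using norm_sum[of "\<lambda>k. of_real (2 powr (- m * real k)) * piece l (?f k) x" ?J] by (simp add: norm_mult)
      then have "2 powr ((s + m) * real l) * norm (piece l (modulated m I G) x) \<le>
          2 powr ((s + m) * real l) * (\<Sum>k\<in>?J. 2 powr (- m * real k) * norm (piece l (?f k) x))"
        by (intro mult_left_mono) auto
      also have "\<dots> = (\<Sum>k\<in>?J. (2 powr ((s + m) * real l) * 2 powr (- m * real k)) * norm (piece l (?f k) x))"
        by (simp add: sum_distrib_left mult_ac)
      also have "\<dots> \<le> (\<Sum>k\<in>?J. (2 powr \<bar>s + m\<bar> * 2 powr (s * real k)) * (C * w k x))"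
      proof (rule sum_mono)
        fix k assume k: "k \<in> ?J"
        show "(2 powr ((s + m) * real l) * 2 powr (- m * real k)) * norm (piece l (?f k) x) \<le>
          (2 powr \<bar>s + m\<bar> * 2 powr (s * real k)) * (C * w k x)"
        proof (rule mult_mono)
        have "(s + m) * (real l - real k) \<le> \<bar>s + m\<bar> * 1"
        proof -
          have "(s + m) * (real l - real k) \<le> \<bar>s + m\<bar> * \<bar>real l - real k\<bar>" by (metis abs_ge_self abs_mult)
          also have "\<dots> \<le> \<bar>s + m\<bar> * 1" using k by (intro mult_left_mono) auto
          finally show ?thesis .
        qed
        then have "(s + m) * real l + - m * real k \<le> \<bar>s + m\<bar> + s * real k" by (simp add: algebra_simps)
        then show "2 powr ((s + m) * real l) * 2 powr (- m * real k) \<le> 2 powr \<bar>s + m\<bar> * 2 powr (s * real k)"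
          unfolding powr_add[symmetric] by (intro powr_mono) auto
        have "(2::real) ^ k \<le> 2 ^ Suc l" using k by (intro power_increasing) auto
        then show "norm (piece l (?f k) x) \<le> C * w k x"
          using k l w by (intro C(2)[where A = "2 ^ k"] fS) (auto simp: norm_mult)
        qed auto
      qed
      also have "\<dots> = D * (\<Sum>k\<in>?J. 2 powr (s * real k) * w k x)"
        by (simp add: D_def sum_distrib_left mult_ac)
      finally show ?thesis .
    qed
    ultimately show ?thesis by blast
  qed
  moreover have "D > 0" using C by (simp add: D_def)
  ultimately show ?thesis by (intro exI[of _ D]) blast
qed

end

subsection \<open>Coherent bumps\<close>

lemma powr_growth:
  assumes "\<alpha> < (1::real)"
  shows "\<exists>K\<ge>1. D * real K powr \<alpha> < real K"
proof -
  define x where "x = (\<bar>D\<bar> + 1) powr (1 / (1 - \<alpha>))"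
  define K where "K = nat \<lceil>x\<rceil> + 1"
  have "x > 0" by (simp add: x_def)
  have K: "real K \<ge> x" "K \<ge> 1" unfolding K_def by (auto intro: order_trans[OF real_nat_ceiling_ge])
  have "D < \<bar>D\<bar> + 1" by simp
  also have "\<dots> = x powr (1 - \<alpha>)" using assms by (simp add: x_def powr_powr)
  also have "\<dots> \<le> real K powr (1 - \<alpha>)" using K assms \<open>x > 0\<close> by (intro powr_mono2) auto
  finally have "D * real K powr \<alpha> < real K powr (1 - \<alpha>) * real K powr \<alpha>" using K by (intro mult_strict_right_mono) auto
  also have "\<dots> = real K" using K by (simp add: powr_add[symmetric])
  finally show ?thesis using K by blast
qed

lemma content_ball_powr:
  assumes "r > 0" "a > 0"
  shows "measure lborel (ball (c::'a::euclidean_space) (r / a)) powr t = (unit_ball_vol (real DIM('a)) * r ^ DIM('a)) powr t * a powr (- real DIM('a) * t)"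
proof -
  have "measure lborel (ball c (r / a)) = (unit_ball_vol (real DIM('a)) * r ^ DIM('a)) * a powr (- real DIM('a))"
    using content_ball[of "r / a" c] assms by (simp add: power_divide powr_minus powr_realpow field_simps)
  then show ?thesis using assms by (simp add: powr_mult powr_powr)
qed

text \<open>For p = \<infinity> the power of the measure is 1 by the default value of 1/0, and the
  claim holds because a ball is not a null set.\<close>

lemma Lp_norm_ge_ball:
  assumes p: "p > 0" and u: "u \<in> borel_measurable borel" "\<And>x. 0 \<le> u x" "\<And>x. x \<in> ball (c::'a::euclidean_space) r \<Longrightarrow> \<delta> \<le> u x"
    and pos: "r > 0" "\<delta> > 0"
  shows "ennreal (\<delta> * measure lborel (ball c r) powr (1 / enn2real p)) \<le> Lp_norm lborel p (\<lambda>x. ennreal (u x))"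
proof (cases "p = \<infinity>")
  case True
  have m: "measure lborel (ball c r) > 0" using content_ball_pos pos by simp
  have "ennreal \<delta> \<le> esssup lborel (\<lambda>x. ennreal (u x))"
  proof (rule ccontr)
    assume "\<not> ennreal \<delta> \<le> esssup lborel (\<lambda>x. ennreal (u x))"
    then have lt: "esssup lborel (\<lambda>x. ennreal (u x)) < ennreal \<delta>" by simp
    have "AE x in lborel. x \<notin> ball c r"
      using esssup_AE[of "\<lambda>x. ennreal (u x)" lborel]
    proof eventually_elim
      case (elim x)
      then have "ennreal (u x) < ennreal \<delta>" using lt by (rule le_less_trans)
      then show ?case using u(3)[of x] ennreal_leI[of \<delta> "u x"] by (auto simp: not_le[symmetric])
    qed
    then have "emeasure lborel (ball c r) = 0" by (subst (asm) AE_iff_measurable[of "ball c r"]) auto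
    then show False using m by (simp add: measure_def)
  qed
  then show ?thesis using True m by (simp add: Lp_norm_def)
next
  case False
  note R = enn2real_pos[OF p False]
  show ?thesis
  proof (rule Lp_norm_ge[OF p False u(2)])
    have "ennreal ((\<delta> * measure lborel (ball c r) powr (1 / enn2real p)) powr enn2real p) = ennreal (\<delta> powr enn2real p) * emeasure lborel (ball c r)"
      using R pos emeasure_lborel_ball_finite[of c r]
      by (simp add: powr_mult powr_powr ennreal_mult emeasure_eq_ennreal_measure)
    also have "\<dots> = (\<integral>\<^sup>+x. ennreal (\<delta> powr enn2real p) * indicator (ball c r) x \<partial>lborel)"
      by (simp add: nn_integral_cmult_indicator)
    also have "\<dots> \<le> (\<integral>\<^sup>+x. ennreal (u x powr enn2real p) \<partial>lborel)"
      using u pos R by (intro nn_integral_mono) (auto simp: indicator_def intro!: ennreal_leI powr_mono2)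
    finally show "ennreal ((\<delta> * measure lborel (ball c r) powr (1 / enn2real p)) powr enn2real p) \<le> (\<integral>\<^sup>+x. ennreal (u x powr enn2real p) \<partial>lborel)" .
  qed (use pos in auto)
qed

text \<open>The centre is moved off the origin if necessary and the radius kept below |c|/3. Under
  dyadic dilation such balls are pairwise disjoint, which \<open>single_spike\<close>
  exploits.\<close>

lemma schwartz_nonzero_ball:
  assumes g: "g \<in> schwartz" and nz: "g x0 \<noteq> 0"
  obtains c r \<delta> where "r > 0" "\<delta> > 0" "3 * r \<le> norm (c::'a::euclidean_space)" "\<And>x. x \<in> ball c r \<Longrightarrow> \<delta> \<le> norm (g x)"
proof -
  define \<delta> where "\<delta> = norm (g x0) / 2"
  have "open {x. \<delta> < norm (g x)}"
    by (intro open_Collect_less continuous_on_norm schwartz_continuous g continuous_intros)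
  moreover have "x0 \<in> {x. \<delta> < norm (g x)}" using nz by (simp add: \<delta>_def)
  ultimately obtain e where e: "e > 0" "ball x0 e \<subseteq> {x. \<delta> < norm (g x)}" by (meson open_contains_ball)
  obtain b :: 'a where b: "b \<in> Basis" using nonempty_Basis by blast
  define c where "c = (if x0 = 0 then (e / 2) *\<^sub>R b else x0)"
  have c: "c \<noteq> 0" "norm (c - x0) \<le> e / 2" using e b by (auto simp: c_def)
  define r where "r = min (e / 2) (norm c / 3)"
  have "ball c r \<subseteq> ball x0 e"
  proof
    fix x assume "x \<in> ball c r"
    then have "norm (c - x) < e / 2" by (simp add: r_def dist_norm)
    then show "x \<in> ball x0 e" using norm_triangle_ineq[of "x0 - c" "c - x"] c(2) by (simp add: dist_norm norm_minus_commute)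
  qed
  then have "x \<in> ball c r \<Longrightarrow> \<delta> \<le> norm (g x)" for x using e by fastforce
  then show ?thesis using e c nz by (intro that[of r \<delta> c]) (auto simp: r_def \<delta>_def)
qed

lemma Lp_norm_dilate_pos:
  assumes g: "g \<in> schwartz" "g x0 \<noteq> 0" and p: "p > 0"
  obtains \<kappa> where "\<kappa> > 0" "\<And>\<mu> a. 0 \<le> \<mu> \<Longrightarrow> 0 < a \<Longrightarrow>
     ennreal (\<mu> * \<kappa> * a powr (- real DIM('a) / enn2real p)) \<le> Lp_norm lborel p (\<lambda>x. ennreal (\<mu> * norm (g (a *\<^sub>R (x::'a::euclidean_space)))))"
proof -
  obtain c r \<delta> where cr: "r > 0" "\<delta> > 0" "3 * r \<le> norm c" "\<And>x. x \<in> ball c r \<Longrightarrow> \<delta> \<le> norm (g x)"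
    by (rule schwartz_nonzero_ball[OF g]) (rule that)
  note [measurable] = schwartz_measurable[OF g(1)]
  let ?V = "(unit_ball_vol (real DIM('a)) * r ^ DIM('a)) powr (1 / enn2real p)"
  show ?thesis
  proof (rule that[of "\<delta> * ?V"])
    have "unit_ball_vol (real DIM('a)) * r ^ DIM('a) > 0" using cr by (intro mult_pos_pos) auto
    then have "?V > 0" unfolding powr_gt_zero by linarith
    then show "\<delta> * ?V > 0" using cr(2) by (intro mult_pos_pos)
    fix \<mu> a :: real assume \<mu>: "0 \<le> \<mu>" and a: "0 < a"
    show "ennreal (\<mu> * (\<delta> * ?V) * a powr (- real DIM('a) / enn2real p)) \<le> Lp_norm lborel p (\<lambda>x. ennreal (\<mu> * norm (g (a *\<^sub>R x))))"
    proof (cases "\<mu> = 0")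
      case False
      have "ennreal ((\<mu> * \<delta>) * measure lborel (ball (c /\<^sub>R a) (r / a)) powr (1 / enn2real p)) \<le> Lp_norm lborel p (\<lambda>x. ennreal (\<mu> * norm (g (a *\<^sub>R x))))"
      proof (rule Lp_norm_ge_ball[OF p])
        fix x assume "x \<in> ball (c /\<^sub>R a) (r / a)"
        then have "a * norm (c /\<^sub>R a - x) < r" using a by (simp add: dist_norm field_simps)
        also have "a * norm (c /\<^sub>R a - x) = norm (a *\<^sub>R (c /\<^sub>R a - x))" using a by simp
        also have "a *\<^sub>R (c /\<^sub>R a - x) = c - a *\<^sub>R x" using a by (simp add: scaleR_diff_right)
        finally have "a *\<^sub>R x \<in> ball c r" by (simp add: dist_norm)
        then show "\<mu> * \<delta> \<le> \<mu> * norm (g (a *\<^sub>R x))" using cr(4) \<mu> by (intro mult_left_mono) auto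
      qed (use cr \<mu> a False in auto)
      then show ?thesis unfolding content_ball_powr[OF cr(1) a] by (simp add: mult_ac)
    qed simp
  qed
qed

context lp_decomposition
begin

lemma besov_norm_le:
  assumes q: "q > 0" and S: "finite S" "S \<noteq> {}" "S \<subseteq> {1..}"
    and z: "\<And>x. lp_proj \<phi> \<Phi> 0 u x = 0" "\<And>l x. l \<notin> S \<Longrightarrow> l \<ge> 1 \<Longrightarrow> lp_proj \<phi> \<Phi> l u x = 0"
    and b: "0 \<le> b" "\<And>l. l \<in> S \<Longrightarrow> Lp_norm lborel p (\<lambda>x. ennreal (2 powr (\<sigma> * real l) * norm (lp_proj \<phi> \<Phi> l u x))) \<le> ennreal b"
  shows "besov \<sigma> p q u \<le> ennreal (real (card S) powr (1 / enn2real q) * b)"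
  using lq_norm_le[OF q S(1,2), of "{1..}" "\<lambda>l. Lp_norm lborel p (\<lambda>x. ennreal (2 powr (\<sigma> * real l) * norm (lp_proj \<phi> \<Phi> l u x)))" b] z b
  by (simp add: besov_norm_def Lp_norm_zero)

lemma triebel_lizorkin_norm_le:
  assumes q: "q > 0" and p: "p \<noteq> \<infinity>" and S: "finite S" "S \<noteq> {}" "S \<subseteq> {1..}"
    and z: "\<And>x. lp_proj \<phi> \<Phi> 0 u x = 0" "\<And>l x. l \<notin> S \<Longrightarrow> l \<ge> 1 \<Longrightarrow> lp_proj \<phi> \<Phi> l u x = 0"
    and b: "\<And>l x. l \<in> S \<Longrightarrow> 2 powr (\<sigma> * real l) * norm (lp_proj \<phi> \<Phi> l u x) \<le> b x"
    and B: "Lp_norm lborel p (\<lambda>x. ennreal (real (card S) powr (1 / enn2real q) * b x)) \<le> B"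
  shows "triebel \<sigma> p q u \<le> B"
proof -
  have b0: "0 \<le> b x" for x
  proof -
    obtain l where "l \<in> S" using S by auto
    then show ?thesis using order_trans[OF _ b[of l x]] by simp
  qed
  have "triebel \<sigma> p q u = Lp_norm lborel p (\<lambda>x. Lp_norm (count_space {1..}) q (\<lambda>k. ennreal (2 powr (\<sigma> * real k) * norm (lp_proj \<phi> \<Phi> k u x))))"
    using p by (simp add: triebel_lizorkin_norm_def z Lp_norm_zero)
  also have "\<dots> \<le> Lp_norm lborel p (\<lambda>x. ennreal (real (card S) powr (1 / enn2real q) * b x))"
    using p z b b0 by (intro Lp_norm_mono lq_norm_le q S) (auto intro!: ennreal_leI)
  finally show ?thesis using B by (rule order_trans)
qed

lemma norms_ge_0:
  "Lp_norm lborel p (\<lambda>x. ennreal (norm (lp_proj \<phi> \<Phi> 0 u x))) \<le> besov \<sigma> p q u"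
  "Lp_norm lborel p (\<lambda>x. ennreal (norm (lp_proj \<phi> \<Phi> 0 u x))) \<le> triebel \<sigma> p q u"
  by (auto simp: besov_norm_def triebel_lizorkin_norm_def)

lemma besov_norm_ge:
  assumes q: "q > 0" and S: "finite S" "S \<noteq> {}" "S \<subseteq> {1..}" and b: "0 \<le> b"
    "\<And>l. l \<in> S \<Longrightarrow> ennreal b \<le> Lp_norm lborel p (\<lambda>x. ennreal (2 powr (\<sigma> * real l) * norm (lp_proj \<phi> \<Phi> l u x)))"
  shows "ennreal (real (card S) powr (1 / enn2real q) * b) \<le> besov \<sigma> p q u"
  using lq_norm_ge[OF q S b(2) b(1)] by (simp add: besov_norm_def add_increasing)

definition nbhd :: "nat set \<Rightarrow> nat set" where
  "nbhd I = {l. l \<ge> 1 \<and> (\<exists>k\<in>I. k \<le> l + 1 \<and> l \<le> k + 1)}"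

lemma nbhd:
  assumes "finite I" "I \<noteq> {}" "\<And>k. k \<in> I \<Longrightarrow> k \<ge> 4"
  shows "finite (nbhd I)" "nbhd I \<noteq> {}" "nbhd I \<subseteq> {1..}" "card (nbhd I) \<le> 3 * card I"
proof -
  have sub: "nbhd I \<subseteq> (\<Union>k\<in>I. {k - 1, k, k + 1})" by (auto simp: nbhd_def)
  show fin: "finite (nbhd I)" by (rule finite_subset[OF sub]) (use assms(1) in auto)
  obtain k where "k \<in> I" using assms by auto
  then have "k \<in> nbhd I" using assms(3)[of k] by (auto simp: nbhd_def intro!: bexI[of _ k])
  then show "nbhd I \<noteq> {}" by auto
  show "nbhd I \<subseteq> {1..}" by (auto simp: nbhd_def)
  have "card (nbhd I) \<le> card (\<Union>k\<in>I. {k - 1, k, k + 1})" using sub assms(1) by (intro card_mono) auto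
  also have "\<dots> \<le> (\<Sum>k\<in>I. card {k - 1, k, k + 1})" by (rule card_UN_le[OF assms(1)])
  also have "\<dots> \<le> (\<Sum>k\<in>I. 3)" by (intro sum_mono) (auto simp: card_insert_if)
  finally show "card (nbhd I) \<le> 3 * card I" by (simp add: mult.commute)
qed

text \<open>Two indices both within 1 of l differ by at most 2, so a gap of 4 leaves a single
  majorant in each band.\<close>

lemma modulated_sparse:
  assumes bd': "\<forall>l\<ge>1. \<forall>x. 2 powr ((s + m) * real l) * norm (piece l f x) \<le>
        C * (\<Sum>k\<in>{k\<in>I. k \<le> l + 1 \<and> l \<le> k + 1}. 2 powr (s * real k) * w k x)"
    and sparse': "\<forall>k\<in>I. \<forall>k'\<in>I. k < k' \<longrightarrow> k + 4 \<le> k'"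
  shows "l \<notin> nbhd I \<Longrightarrow> l \<ge> 1 \<Longrightarrow> piece l f x = 0"
    "l \<in> nbhd I \<Longrightarrow> \<exists>k\<in>I. \<forall>x. 2 powr ((s + m) * real l) * norm (piece l f x) \<le> C * (2 powr (s * real k) * w k x)"
proof -
  note bd = bd'[rule_format] and sparse = sparse'[rule_format]
  assume l: "l \<notin> nbhd I" "l \<ge> 1"
  then have "{k\<in>I. k \<le> l + 1 \<and> l \<le> k + 1} = {}" by (auto simp: nbhd_def)
  then have "2 powr ((s + m) * real l) * norm (piece l f x) \<le> 0" using bd[OF l(2), of x] by (simp only: sum.empty mult_zero_right)
  then show "piece l f x = 0" by (simp add: mult_le_0_iff)
next
  note bd = bd'[rule_format] and sparse = sparse'[rule_format]
  assume l: "l \<in> nbhd I"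
  then obtain k where k: "k \<in> I" "k \<le> l + 1" "l \<le> k + 1" "l \<ge> 1" by (auto simp: nbhd_def)
  have "{k\<in>I. k \<le> l + 1 \<and> l \<le> k + 1} = {k}"
  proof -
    have "k' = k" if "k' \<in> I" "k' \<le> l + 1" "l \<le> k' + 1" for k'
      using sparse[OF k(1) that(1)] sparse[OF that(1) k(1)] k that by linarith
    then show ?thesis using k by blast
  qed
  then show "\<exists>k\<in>I. \<forall>x. 2 powr ((s + m) * real l) * norm (piece l f x) \<le> C * (2 powr (s * real k) * w k x)"
    using bd[OF k(4)] k(1) by (intro bexI[of _ k]) auto
qed

text \<open>Stretching \<Phi> by 2 shrinks the spectrum into the unit ball, where
  \<open>theta\<close> is 1, so that the low-frequency projection fixes \<open>psi0\<close>.\<close>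

definition psi0 :: "'a \<Rightarrow> complex" where "psi0 x = \<Phi> ((1 / 2) *\<^sub>R x)"

lemma psi0_schwartz: "psi0 \<in> schwartz"
  unfolding psi0_def[abs_def] by (intro schwartz_dilate Phi) auto

lemma fourier_psi0: "fourier psi0 \<xi> = 2 ^ DIM('a) * theta (2 *\<^sub>R \<xi>)"
  unfolding psi0_def[abs_def] using Phi by (subst fourier_dilate) (auto simp: theta_def power_one_over)

lemma psi0_support: "fourier psi0 \<xi> \<noteq> 0 \<Longrightarrow> norm \<xi> \<le> 1"
  using theta_0[of "2 *\<^sub>R \<xi>"] by (fastforce simp: fourier_psi0)

lemma psi0_nonzero: "\<exists>x. psi0 x \<noteq> 0"
proof (rule ccontr)
  assume "\<not> (\<exists>x. psi0 x \<noteq> 0)"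
  then have "fourier psi0 0 = 0" by (simp add: fourier_eq)
  then show False by (simp add: fourier_psi0 theta_1)
qed

text \<open>The K input terms occupy separate bands with the same normalised size, so the input norm
  grows like K^(1/q). After the operator all of them are multiples of \<open>psi0\<close> with
  coefficients at least 1, as s <= 0, and the low-frequency part alone grows like K.\<close>

lemma coherent:
  assumes p: "p > 0" and q: "q > 1" and s: "s \<le> 0"
  shows "unbounded m (besov (s + m) p q) (besov s p q)"
    and "p \<noteq> \<infinity> \<Longrightarrow> unbounded m (triebel (s + m) p q) (triebel s p q)"
proof -
  have proj: "piece 0 psi0 = psi0"
  proof -
    have "(\<lambda>\<xi>. lp_hat 0 \<xi> * fourier psi0 \<xi>) = fourier psi0"
    proof
      fix \<xi>
      show "lp_hat 0 \<xi> * fourier psi0 \<xi> = fourier psi0 \<xi>"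
      using psi0_support[of \<xi>] theta_1[of \<xi>] by (cases "fourier psi0 \<xi> = 0") (auto simp: lp_hat_def)
    qed
    then show ?thesis by (simp add: lp_proj_dist_of psi0_schwartz ifourier_fourier)
  qed
  obtain x0 where x0: "psi0 x0 \<noteq> 0" using psi0_nonzero by blast
  obtain \<kappa> where \<kappa>: "\<kappa> > 0" "\<And>\<mu> a. 0 \<le> \<mu> \<Longrightarrow> 0 < a \<Longrightarrow>
     ennreal (\<mu> * \<kappa> * a powr (- real DIM('a) / enn2real p)) \<le> Lp_norm lborel p (\<lambda>x. ennreal (\<mu> * norm (psi0 (a *\<^sub>R x))))"
    by (rule Lp_norm_dilate_pos[OF psi0_schwartz x0 p]) (rule that)
  obtain M A where A1: "A > 0" "\<forall>a c. \<forall>u::'a \<Rightarrow> real. 0 < a \<longrightarrow> 0 \<le> c \<longrightarrow> u \<in> borel_measurable borel \<longrightarrow>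
     (\<forall>x. 0 \<le> u x \<and> u x \<le> c * wgt M a x) \<longrightarrow>
     Lp_norm lborel p (\<lambda>x. ennreal (u x)) \<le> ennreal (c * A * a powr (- real DIM('a) / enn2real p))"
    using wgt_Lp[OF p, where 'a='a] by blast
  have A2: "Lp_norm lborel p (\<lambda>x. ennreal (u x)) \<le> ennreal (c * A)"
    if "0 \<le> c" "u \<in> borel_measurable borel" "\<And>x. 0 \<le> u x \<and> u x \<le> c * wgt M 1 (x::'a)" for c u
    using A1(2)[rule_format, of 1 c u] that by simp
  note A = A1(1) A2
  obtain C0 where C0: "C0 > 0" "\<And>x. norm (psi0 x) \<le> C0 * wgt M 1 x"
    using schwartz_bound[OF psi0_schwartz, of M] by (auto simp: wgt_def)
  \<comment> \<open>The factor 2^(-sk) cancels the smoothness weight, so that every band of the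
    input contributes equally.\<close>
  define G where "G k x = of_real (2 powr (- s * real k)) * psi0 x" for k x
  define w where "w k x = 2 powr (- s * real k) * (C0 * wgt M 1 (x::'a))" for k x
  obtain C where C: "C > 0" "\<And>I. admissible I G \<Longrightarrow>
     localized s m (modulated m I G) C I w"
  proof -
    have 1: "norm (G k x) \<le> w k x" for k x
      using C0(2)[of x] by (simp add: G_def w_def norm_mult)
    have 2: "w k (x - z) \<le> w k x * (1 + 2 ^ k * norm z) ^ M" for k x z
      using wgt_peetre[of 1 "2 ^ k" M x z] C0(1) by (simp add: w_def mult_left_mono mult.assoc)
    obtain C where C: "C > 0" "\<And>I G w. admissible I G \<Longrightarrow> (\<forall>k\<in>I. \<forall>x. norm (G k x) \<le> w k x) \<Longrightarrow>
       (\<forall>k\<in>I. \<forall>x z. w k (x - z) \<le> w k x * (1 + 2 ^ k * norm z) ^ M) \<Longrightarrow>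
       localized s m (modulated m I G) C I w"
      using modulated_lp_proj[where M = M and m = m and s = s] by blast
    show ?thesis by (rule that[OF C(1) C(2)]) (use 1 2 in blast)+
  qed
  define I where "I K = (\<lambda>i. 4 * i) ` {1..K}" for K :: nat
  have I: "finite (I K)" "card (I K) = K" "\<And>k. k \<in> I K \<Longrightarrow> k \<ge> 4" "\<forall>k\<in>I K. \<forall>k'\<in>I K. k < k' \<longrightarrow> k + 4 \<le> k'" for K
    by (auto simp: I_def card_image inj_on_def)
  have adm: "admissible (I K) G" for K
    unfolding admissible_def
  proof (intro conjI ballI allI impI I)
    fix k \<xi> assume k: "k \<in> I K"
    show "G k \<in> schwartz" unfolding G_def[abs_def] by (intro schwartz_cmult psi0_schwartz)
    assume "fourier (G k) \<xi> \<noteq> 0"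
    then have "norm \<xi> \<le> 1" unfolding G_def[abs_def] fourier_cmult by (intro psi0_support) auto
    moreover have "(2::real) ^ 4 \<le> 2 ^ k" using I(3)[OF k] by (intro power_increasing) auto
    ultimately show "norm \<xi> \<le> 2 ^ k / 8" by simp
  qed
  define q' where "q' = 1 / enn2real q"
  \<comment> \<open>For q = \<infinity> the exponent is 1/0 = 0, again the correct value.\<close>
  have q': "0 \<le> q'" "q' < 1"
  proof -
    show "0 \<le> q'" by (simp add: q'_def)
    show "q' < 1"
    proof (cases "q = \<infinity>")
      case False
      then have "enn2real 1 < enn2real q" using q by (intro enn2real_less_iff[THEN iffD2]) (auto simp: top.not_eq_extremum)
      then show ?thesis by (simp add: q'_def)
    qed (simp add: q'_def)
  qed
  have q0: "q > 0" using q by (meson less_trans zero_less_one)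
  define X where "X = C * (C0 * A)"
  have X: "X > 0" using C C0 A by (simp add: X_def)
  have nb: "finite (nbhd (I K))" "nbhd (I K) \<noteq> {}" "nbhd (I K) \<subseteq> {1..}" "real (card (nbhd (I K))) powr q' \<le> (3 * real K) powr q'" if "K \<ge> 1" for K
  proof -
    have "I K \<noteq> {}" using that by (auto simp: I_def)
    note nbhd[OF I(1)[of K] this I(3)]
    then show "finite (nbhd (I K))" "nbhd (I K) \<noteq> {}" "nbhd (I K) \<subseteq> {1..}" "real (card (nbhd (I K))) powr q' \<le> (3 * real K) powr q'"
      using q' by (auto intro!: powr_mono2 simp: I(2) of_nat_mono[of _ "3 * K", simplified])
  qed
  have proj0: "piece 0 (modulated m (I K) G) x = 0"
    and projl: "l \<notin> nbhd (I K) \<Longrightarrow> l \<ge> 1 \<Longrightarrow> piece l (modulated m (I K) G) x = 0"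
    and projn: "l \<in> nbhd (I K) \<Longrightarrow> 2 powr ((s + m) * real l) * norm (piece l (modulated m (I K) G) x) \<le> C * C0 * wgt M 1 x" for K l x
  proof -
    note bd = C(2)[OF adm[of K]]
    note sp = modulated_sparse[where f = "modulated m (I K) G" and w = w and C = C and I = "I K" and s = s and m = m,
      OF conjunct2[OF bd] I(4)]
    show "piece 0 (modulated m (I K) G) x = 0" using bd by blast
    show "l \<notin> nbhd (I K) \<Longrightarrow> l \<ge> 1 \<Longrightarrow> piece l (modulated m (I K) G) x = 0"
      by (rule sp(1))
    assume "l \<in> nbhd (I K)"
    then obtain k where "2 powr ((s + m) * real l) * norm (piece l (modulated m (I K) G) x) \<le> C * (2 powr (s * real k) * w k x)"
      using sp(2) by blast
    also have "\<dots> = C * C0 * wgt M 1 x" by (simp add: w_def powr_minus field_simps)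
    finally show "2 powr ((s + m) * real l) * norm (piece l (modulated m (I K) G) x) \<le> C * C0 * wgt M 1 x" .
  qed
  have ms: "piece l (modulated m (I K) G) \<in> borel_measurable borel" for l K
    by (intro schwartz_measurable lp_proj_schwartz modulated_schwartz adm)
  have up_B: "besov (s + m) p q (dist_of (modulated m (I K) G)) \<le> ennreal ((3 * real K) powr q' * X)" if K: "K \<ge> 1" for K
  proof -
    have "besov (s + m) p q (dist_of (modulated m (I K) G)) \<le> ennreal (real (card (nbhd (I K))) powr (1 / enn2real q) * X)"
    proof (rule besov_norm_le[OF q0 nb(1-3)[OF K] proj0 projl])
      fix l assume "l \<in> nbhd (I K)"
      then show "Lp_norm lborel p (\<lambda>x. ennreal (2 powr ((s + m) * real l) * norm (piece l (modulated m (I K) G) x))) \<le> ennreal X"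
        using A(2)[of "C * C0" "\<lambda>x. 2 powr ((s + m) * real l) * norm (piece l (modulated m (I K) G) x)"] projn[of l K] ms[of l K] C C0
        by (simp add: X_def mult.assoc)
    qed (use X in auto)
    also have "\<dots> \<le> ennreal ((3 * real K) powr q' * X)"
      using nb(4)[OF K] X by (intro ennreal_leI mult_right_mono) (auto simp: q'_def)
    finally show ?thesis .
  qed
  have up_F: "triebel (s + m) p q (dist_of (modulated m (I K) G)) \<le> ennreal ((3 * real K) powr q' * X)" if K: "K \<ge> 1" and pfin: "p \<noteq> \<infinity>" for K
  proof (rule triebel_lizorkin_norm_le[OF q0 pfin nb(1-3)[OF K] proj0 projl projn])
    have "real (card (nbhd (I K))) powr q' * (C * C0 * wgt M 1 x) \<le> ((3 * real K) powr q' * (C * C0)) * wgt M 1 x" for x :: 'a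
      using nb(4)[OF K] C C0 wgt_pos[of 1 M x] by (simp add: mult_right_mono mult_left_mono mult.assoc)
    moreover have "0 \<le> real (card (nbhd (I K))) powr q' * (C * C0 * wgt M 1 x)" for x :: 'a
      using C C0 wgt_pos[of 1 M x] by simp
    ultimately have "Lp_norm lborel p (\<lambda>x. ennreal (real (card (nbhd (I K))) powr q' * (C * C0 * wgt M 1 (x::'a)))) \<le> ennreal ((3 * real K) powr q' * (C * C0) * A)"
      using C C0 by (intro A(2)) auto
    then show "Lp_norm lborel p (\<lambda>x. ennreal (real (card (nbhd (I K))) powr (1 / enn2real q) * (C * C0 * wgt M 1 (x::'a)))) \<le> ennreal ((3 * real K) powr q' * X)"
      by (simp add: X_def q'_def mult.assoc)
  qed
  have low: "ennreal (real K * \<kappa>) \<le> Lp_norm lborel p (\<lambda>x. ennreal (norm (piece 0 (\<lambda>x. \<Sum>k\<in>I K. G k x) x)))" for K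
  proof -
    define S where "S = (\<Sum>k\<in>I K. 2 powr (- s * real k))"
    have "real K = (\<Sum>k\<in>I K. 1)" by (simp add: I(2))
    also have "\<dots> \<le> S" unfolding S_def using s by (intro sum_mono) (auto simp: mult_nonpos_nonneg ge_one_powr_ge_zero)
    finally have S: "real K \<le> S" .
    have "piece 0 (\<lambda>x. \<Sum>k\<in>I K. G k x) x = of_real S * psi0 x" for x
      unfolding G_def lp_proj_sum[OF psi0_schwartz] proj S_def by (simp add: sum_distrib_right)
    then have "(\<lambda>x. ennreal (norm (piece 0 (\<lambda>x. \<Sum>k\<in>I K. G k x) x))) = (\<lambda>x. ennreal (S * norm (psi0 (1 *\<^sub>R x))))"
      using S by (simp add: norm_mult)
    moreover have "ennreal (real K * \<kappa>) \<le> ennreal (S * \<kappa> * 1 powr (- real DIM('a) / enn2real p))"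
      using S \<kappa> by (intro ennreal_leI) simp
    ultimately show ?thesis using \<kappa>(2)[of S 1] S by (simp only:) (erule order_trans, simp)
  qed
  have choose: "\<exists>K\<ge>1. D * ((3 * real K) powr q' * X) < real K * \<kappa>" if "D > 0" for D
  proof -
    obtain K where K: "K \<ge> 1" "(D * 3 powr q' * X / \<kappa>) * real K powr q' < real K" using powr_growth[OF q'(2)] by blast
    then have "D * 3 powr q' * X * real K powr q' < real K * \<kappa>" using \<kappa>(1) by (simp add: field_simps)
    then show ?thesis using K(1) by (intro exI[of _ K]) (simp add: powr_mult mult_ac)
  qed
  show "unbounded m (besov (s + m) p q) (besov s p q)"
  proof (rule operator_norm_modulated[where NY = "besov s p q", OF _ besov_norm_zero])
    fix D :: real assume "D > 0"
    then obtain K where "K \<ge> 1" "D * ((3 * real K) powr q' * X) < real K * \<kappa>" using choose by blast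
    then show "exceeds D m (besov (s + m) p q) (besov s p q)"
      using adm[of K] up_B[of K] order_trans[OF low[of K] norms_ge_0(1)] X
      by (intro exI[of _ "I K"] exI[of _ G] exI[of _ "(3 * real K) powr q' * X"] exI[of _ "real K * \<kappa>"]) simp
  qed
  assume pfin: "p \<noteq> \<infinity>"
  show "unbounded m (triebel (s + m) p q) (triebel s p q)"
  proof (rule operator_norm_modulated[where NY = "triebel s p q", OF _ triebel_lizorkin_norm_zero])
    fix D :: real assume "D > 0"
    then obtain K where "K \<ge> 1" "D * ((3 * real K) powr q' * X) < real K * \<kappa>" using choose by blast
    then show "exceeds D m (triebel (s + m) p q) (triebel s p q)"
      using adm[of K] up_F[of K] pfin order_trans[OF low[of K] norms_ge_0(2)] X
      by (intro exI[of _ "I K"] exI[of _ G] exI[of _ "(3 * real K) powr q' * X"] exI[of _ "real K * \<kappa>"]) simp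
  qed
qed


subsection \<open>Spikes\<close>

text \<open>Up to the factor 2^(\<sigma>k) an L1-normalised dilate of \<Phi>. The 16 puts its
  spectrum into radius 2 * 2^k / 16 = 2^k / 8, the limit set by \<open>admissible\<close>.\<close>

definition spike :: "real \<Rightarrow> nat \<Rightarrow> 'a \<Rightarrow> complex" where
  "spike \<sigma> k x = of_real (2 powr (\<sigma> * real k) * (2 ^ k / 16) ^ DIM('a)) * \<Phi> ((2 ^ k / 16) *\<^sub>R x)"

lemma spike_schwartz: "spike \<sigma> k \<in> schwartz"
  unfolding spike_def[abs_def] by (intro schwartz_cmult schwartz_dilate Phi) auto

lemma fourier_spike: "fourier (spike \<sigma> k) \<xi> = of_real (2 powr (\<sigma> * real k)) * theta ((16 / 2 ^ k) *\<^sub>R \<xi>)"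
proof -
  have "fourier (spike \<sigma> k) \<xi> = of_real (2 powr (\<sigma> * real k) * (2 ^ k / 16) ^ DIM('a)) * (theta ((1 / (2 ^ k / 16)) *\<^sub>R \<xi>) / of_real (\<bar>2 ^ k / 16\<bar> ^ DIM('a)))"
    unfolding spike_def[abs_def] fourier_cmult using Phi by (subst fourier_dilate) (auto simp: theta_def)
  then show ?thesis by (simp add: power_divide)
qed

lemma admissible_spike:
  assumes "finite I" "\<And>k. k \<in> I \<Longrightarrow> k \<ge> 4"
  shows "admissible I (spike \<sigma>)"
  unfolding admissible_def
proof (intro conjI ballI allI impI assms spike_schwartz)
  fix k \<xi> assume "fourier (spike \<sigma> k) \<xi> \<noteq> 0"
  then have "theta ((16 / 2 ^ k) *\<^sub>R \<xi>) \<noteq> 0" by (simp add: fourier_spike)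
  then have "\<not> 2 \<le> norm ((16 / 2 ^ k) *\<^sub>R \<xi>)" using theta_0 by blast
  then show "norm \<xi> \<le> 2 ^ k / 8" by (simp add: field_simps)
qed

text \<open>At frequencies far below 2^k the spike is indistinguishable from a point mass, so its
  pieces are the kernels themselves. The offset 5 brings |\<xi>| < 2 * 2^j into the ball where the
  dilated \<open>theta\<close> is 1.\<close>

lemma lp_proj_spike:
  assumes "j + 5 \<le> k"
  shows "piece j (spike \<sigma> k) x = of_real (2 powr (\<sigma> * real k)) * lp_kernel \<phi> \<Phi> j x"
proof -
  have "lp_hat j \<xi> * fourier (spike \<sigma> k) \<xi> = of_real (2 powr (\<sigma> * real k)) * fourier (lp_kernel \<phi> \<Phi> j) \<xi>" for \<xi>
  proof (cases "lp_hat j \<xi> = 0")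
    case False
    have "(2::real) ^ (j + 5) \<le> 2 ^ k" by (rule power_increasing[OF assms]) simp
    then have "norm ((16 / 2 ^ k) *\<^sub>R \<xi>) \<le> 1" using lp_hat_support(1)[OF False] by (simp add: power_add field_simps)
    then show ?thesis by (simp add: fourier_spike theta_1 fourier_lp_kernel)
  qed (simp add: fourier_lp_kernel)
  then show ?thesis
    by (simp add: lp_proj_dist_of spike_schwartz ifourier_cmult ifourier_fourier lp_kernel_schwartz)
qed

text \<open>With \<tau> = d/p - d the bounding profile has an L^p norm independent of k. This bound
  and the next one are named because two examples share them.\<close>

definition spike_norm_bound :: "ennreal \<Rightarrow> real \<Rightarrow> nat \<Rightarrow> real \<Rightarrow> bool" where
  "spike_norm_bound p \<tau> M X \<longleftrightarrow> (\<forall>k c u. 0 \<le> c \<longrightarrow> u \<in> borel_measurable borel \<longrightarrow>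
     (\<forall>x. 0 \<le> u x \<and> u x \<le> c * (2 powr (\<tau> * real k) * (2 ^ k / 16) ^ DIM('a) * wgt M (2 ^ k / 16) (x::'a))) \<longrightarrow>
     Lp_norm lborel p (\<lambda>x. ennreal (u x)) \<le> ennreal (c * X))"

definition spike_proj_bound :: "real \<Rightarrow> real \<Rightarrow> real \<Rightarrow> nat \<Rightarrow> real \<Rightarrow> bool" where
  "spike_proj_bound m s \<tau> M D \<longleftrightarrow> (\<forall>I. finite I \<longrightarrow> (\<forall>k\<in>I. k \<ge> 4) \<longrightarrow> (\<forall>k\<in>I. \<forall>k'\<in>I. k < k' \<longrightarrow> k + 4 \<le> k') \<longrightarrow>
      (\<forall>x. piece 0 (modulated m I (spike (\<tau> - s))) x = 0) \<and>
      (\<forall>l x. l \<notin> nbhd I \<longrightarrow> l \<ge> 1 \<longrightarrow> piece l (modulated m I (spike (\<tau> - s))) x = 0) \<and>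
      (\<forall>l\<in>nbhd I. \<exists>k\<in>I. \<forall>x. 2 powr ((s + m) * real l) * norm (piece l (modulated m I (spike (\<tau> - s))) x) \<le>
        D * (2 powr (\<tau> * real k) * (2 ^ k / 16) ^ DIM('a) * wgt M (2 ^ k / 16) x)))"

text \<open>The spike is taken with \<sigma> = \<tau> - s: the smoothness weight restores
  2^(\<tau>k), exactly the height for which concentration at width 2^-k leaves the L^p norm
  unchanged.\<close>

lemma modulated_spike_bounds:
  assumes p: "p > 0" and \<tau>: "\<tau> = real DIM('a) / enn2real p - real DIM('a)"
  shows "\<exists>X M D. X > 0 \<and> D > 0 \<and> spike_norm_bound p \<tau> M X \<and> spike_proj_bound m s \<tau> M D"
proof -
  obtain M A where A: "A > 0" "\<forall>a c. \<forall>u::'a \<Rightarrow> real. 0 < a \<longrightarrow> 0 \<le> c \<longrightarrow> u \<in> borel_measurable borel \<longrightarrow>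
     (\<forall>x. 0 \<le> u x \<and> u x \<le> c * wgt M a x) \<longrightarrow>
     Lp_norm lborel p (\<lambda>x. ennreal (u x)) \<le> ennreal (c * A * a powr (- real DIM('a) / enn2real p))"
    using wgt_Lp[OF p, where 'a='a] by blast
  obtain C0 where C0: "C0 > 0" "\<And>x. norm (\<Phi> x) \<le> C0 * wgt M 1 x"
    using schwartz_bound[OF Phi, of M] by (auto simp: wgt_def)
  define w where "w k x = 2 powr ((\<tau> - s) * real k) * (2 ^ k / 16) ^ DIM('a) * (C0 * wgt M (2 ^ k / 16) (x::'a))" for k x
  obtain C where C: "C > 0" "\<And>I G w. admissible I G \<Longrightarrow> (\<forall>k\<in>I. \<forall>x. norm (G k x) \<le> w k x) \<Longrightarrow>
       (\<forall>k\<in>I. \<forall>x z. w k (x - z) \<le> w k x * (1 + 2 ^ k * norm z) ^ M) \<Longrightarrow>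
       localized s m (modulated m I G) C I w"
    using modulated_lp_proj[where M = M and m = m and s = s] by blast
  have 1: "norm (spike (\<tau> - s) k x) \<le> w k x" for k x
  proof -
    have "norm (\<Phi> ((2 ^ k / 16) *\<^sub>R x)) \<le> C0 * wgt M (2 ^ k / 16) x"
      using C0(2)[of "(2 ^ k / 16) *\<^sub>R x"] by (simp add: wgt_def)
    then have "2 powr ((\<tau> - s) * real k) * (2 ^ k / 16) ^ DIM('a) * norm (\<Phi> ((2 ^ k / 16) *\<^sub>R x)) \<le> w k x"
      unfolding w_def by (rule mult_left_mono) simp
    then show ?thesis by (simp add: spike_def norm_mult norm_divide norm_power)
  qed
  have 2: "w k (x - z) \<le> w k x * (1 + 2 ^ k * norm z) ^ M" for k x z
    using wgt_peetre[of "2 ^ k / 16" "2 ^ k" M x z] C0(1) by (simp add: w_def mult_left_mono mult.assoc divide_right_mono)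
  have "spike_norm_bound p \<tau> M (A * 16 powr \<tau>)"
    unfolding spike_norm_bound_def
  proof (intro allI impI)
    fix k :: nat and c :: real and u :: "'a \<Rightarrow> real"
    assume c: "0 \<le> c" and u: "u \<in> borel_measurable borel" "\<forall>x. 0 \<le> u x \<and> u x \<le> c * (2 powr (\<tau> * real k) * (2 ^ k / 16) ^ DIM('a) * wgt M (2 ^ k / 16) x)"
    let ?a = "2 ^ k / 16 :: real"
    have "Lp_norm lborel p (\<lambda>x. ennreal (u x)) \<le> ennreal (c * (2 powr (\<tau> * real k) * ?a ^ DIM('a)) * A * ?a powr (- real DIM('a) / enn2real p))"
      using u c by (intro A(2)[rule_format]) (auto simp: mult.assoc)
    also have "c * (2 powr (\<tau> * real k) * ?a ^ DIM('a)) * A * ?a powr (- real DIM('a) / enn2real p) = c * (A * 16 powr \<tau>)"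
    proof -
      \<comment> \<open>The height a^d and the L^p scaling of a bump of width 1/a combine to
        a^(-\<tau>); dividing by 16 in a = 2^k/16 leaves the stray constant 16^\<tau>.\<close>
      have "?a ^ DIM('a) * ?a powr (- real DIM('a) / enn2real p) = ?a powr (- \<tau>)"
        by (simp add: \<tau> powr_realpow[symmetric] powr_add[symmetric])
      also have "\<dots> = 2 powr (- \<tau> * real k) * 16 powr \<tau>"
        by (simp add: powr_divide powr_realpow[symmetric] powr_powr powr_minus field_simps)
      finally have "2 powr (\<tau> * real k) * (?a ^ DIM('a) * ?a powr (- real DIM('a) / enn2real p)) = 16 powr \<tau>"
        by (simp add: powr_minus)
      then show ?thesis by (simp only: mult_ac)
    qed
    finally show "Lp_norm lborel p (\<lambda>x. ennreal (u x)) \<le> ennreal (c * (A * 16 powr \<tau>))" .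
  qed
  moreover have "spike_proj_bound m s \<tau> M (C * C0)"
    unfolding spike_proj_bound_def
  proof (rule allI, intro impI)
    fix I :: "nat set" assume I: "finite I" "\<forall>k\<in>I. k \<ge> 4" and sparse: "\<forall>k\<in>I. \<forall>k'\<in>I. k < k' \<longrightarrow> k + 4 \<le> k'"
    let ?f = "modulated m I (spike (\<tau> - s))"
    have bd: "localized s m ?f C I w"
      by (rule C(2)[OF admissible_spike[OF I(1) I(2)[rule_format]]]) (use 1 2 in blast)+
    note sp = modulated_sparse[OF conjunct2[OF bd] sparse]
    have eq: "C * (2 powr (s * real k) * w k x) = C * C0 * (2 powr (\<tau> * real k) * (2 ^ k / 16) ^ DIM('a) * wgt M (2 ^ k / 16) x)" for k x
    proof -
      have "2 powr (\<tau> * real k) = 2 powr (s * real k) * 2 powr ((\<tau> - s) * real k)"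
        by (simp add: powr_add[symmetric] algebra_simps)
      then show ?thesis by (simp add: w_def)
    qed
    show "(\<forall>x. piece 0 ?f x = 0) \<and>
      (\<forall>l x. l \<notin> nbhd I \<longrightarrow> l \<ge> 1 \<longrightarrow> piece l ?f x = 0) \<and>
      (\<forall>l\<in>nbhd I. \<exists>k\<in>I. \<forall>x. 2 powr ((s + m) * real l) * norm (piece l ?f x) \<le>
        C * C0 * (2 powr (\<tau> * real k) * (2 ^ k / 16) ^ DIM('a) * wgt M (2 ^ k / 16) x))"
      using bd sp unfolding eq by blast
  qed
  ultimately show ?thesis using A C C0
    by (intro exI[of _ "A * 16 powr \<tau>"] exI[of _ M] exI[of _ "C * C0"]) simp
qed

lemma phi_nonzero: "\<exists>x. \<phi> x \<noteq> 0"
proof (rule ccontr)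
  assume "\<not> (\<exists>x. \<phi> x \<noteq> 0)"
  then have "phi_hat e1 = 0" by (simp add: phi_hat_def fourier_eq)
  then show False by (simp add: phi_hat_unit)
qed

text \<open>Band l of the image, weighted by 2^(ls), has L^p norm at least a constant times
  2^((\<tau>-s)(k-l)) >= 1, for every l up to k - 5. In the Besov scale n such bands give n^(1/q).
  In the Triebel-Lizorkin scale they concentrate on disjoint sets and give n^(1/p) whatever q
  is.\<close>

lemma single_spike:
  assumes p: "p > 0" and q: "q > 0" and s: "s \<le> real DIM('a) / enn2real p - real DIM('a)"
  shows "q \<noteq> \<infinity> \<Longrightarrow> unbounded m (besov (s + m) p q) (besov s p q)"
    and "p \<noteq> \<infinity> \<Longrightarrow> unbounded m (triebel (s + m) p q) (triebel s p q)"
proof -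
  define \<tau> where "\<tau> = real DIM('a) / enn2real p - real DIM('a)"
  obtain X M D where X: "X > 0" "D > 0" and XL': "spike_norm_bound p \<tau> M X" and XP': "spike_proj_bound m s \<tau> M D"
    using modulated_spike_bounds[OF p \<tau>_def, of m s] by blast
  note XL = XL'[unfolded spike_norm_bound_def, rule_format]
  note XP = XP'[unfolded spike_proj_bound_def, THEN spec, THEN mp, THEN mp, THEN mp]
  define G where "G = spike (\<tau> - s)"
  define f where "f k = modulated m {k} G" for k
  define q' where "q' = 1 / enn2real q"
  have adm: "admissible {k} G" if "k \<ge> 4" for k unfolding G_def using that by (intro admissible_spike) auto
  have nb: "finite (nbhd {k})" "nbhd {k} \<noteq> {}" "nbhd {k} \<subseteq> {1..}" "real (card (nbhd {k})) powr q' \<le> 3 powr q'" if "k \<ge> 4" for k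
    using nbhd[of "{k}"] that by (auto simp: q'_def intro!: powr_mono2)
  have bd: "piece 0 (f k) x = 0" "l \<notin> nbhd {k} \<Longrightarrow> l \<ge> 1 \<Longrightarrow> piece l (f k) x = 0"
    "l \<in> nbhd {k} \<Longrightarrow> 2 powr ((s + m) * real l) * norm (piece l (f k) x) \<le>
        D * (2 powr (\<tau> * real k) * (2 ^ k / 16) ^ DIM('a) * wgt M (2 ^ k / 16) x)" if "k \<ge> 4" for k l x
    using XP[of "{k}"] that by (auto simp: f_def G_def)
  have ms: "piece l (f k) \<in> borel_measurable borel" if "k \<ge> 4" for k l
    unfolding f_def by (intro schwartz_measurable lp_proj_schwartz modulated_schwartz adm that)
  have out: "norm (piece j (\<lambda>x. \<Sum>k\<in>{k}. G k x) x) = 2 powr ((\<tau> - s) * real k) * 2 ^ (j * DIM('a)) * norm (\<phi> (2 ^ j *\<^sub>R x))"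
    if "1 \<le> j" "j + 5 \<le> k" for j k x
    using that by (simp add: G_def lp_proj_spike lp_kernel_def dyadic_dilate_def norm_mult power_int_mult power_mult norm_power)
  \<comment> \<open>This is where s <= \<tau> enters: the power at the spike's own scale dominates
    the one at band j.\<close>
  have gain: "2 powr (\<tau> * real j) \<le> 2 powr (s * real j) * 2 powr ((\<tau> - s) * real k)" if "j \<le> k" for j k
  proof -
    have "(\<tau> - s) * real j \<le> (\<tau> - s) * real k" using that s by (intro mult_left_mono) (auto simp: \<tau>_def)
    then show ?thesis unfolding powr_add[symmetric] by (intro powr_mono) (auto simp: algebra_simps)
  qed
  \<comment> \<open>Scaling identity for the kernel of band j: with the exponent \<tau> its L^p norm
    does not depend on j.\<close>
  have dil: "2 powr (\<tau> * real j) * 2 ^ (j * DIM('a)) * (2 ^ j) powr (- real DIM('a) / enn2real p) = 1" for j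
    unfolding \<tau>_def by (simp add: powr_realpow[symmetric] powr_powr powr_add[symmetric] field_simps)
  obtain x0 where x0: "\<phi> x0 \<noteq> 0" using phi_nonzero by blast
  show "unbounded m (besov (s + m) p q) (besov s p q)"
    if qfin: "q \<noteq> \<infinity>"
  proof (rule operator_norm_modulated[where NY = "besov s p q", OF _ besov_norm_zero])
    fix C :: real assume C: "C > 0"
    obtain \<kappa> where \<kappa>: "\<kappa> > 0" "\<And>\<mu> a. 0 \<le> \<mu> \<Longrightarrow> 0 < a \<Longrightarrow>
       ennreal (\<mu> * \<kappa> * a powr (- real DIM('a) / enn2real p)) \<le> Lp_norm lborel p (\<lambda>x. ennreal (\<mu> * norm (\<phi> (a *\<^sub>R x))))"
      by (rule Lp_norm_dilate_pos[OF phi x0 p]) (rule that)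
    have q': "q' > 0" using enn2real_pos[OF q qfin] by (simp add: q'_def)
    \<comment> \<open>Threshold for n^(1/q): the constant input bound times C, divided by the lower
      bound of one band.\<close>
    define Y where "Y = C * (3 powr q' * (D * X)) / \<kappa>"
    define n where "n = nat \<lceil>Y powr (1 / q')\<rceil> + 1"
    have Y: "Y > 0" using C X \<kappa> by (simp add: Y_def)
    have "Y powr (1 / q') < real n"
    proof -
      have "Y powr (1 / q') \<le> real (nat \<lceil>Y powr (1 / q')\<rceil>)" by (rule real_nat_ceiling_ge)
      also have "\<dots> < real n" by (simp add: n_def)
      finally show ?thesis .
    qed
    then have "(Y powr (1 / q')) powr q' < real n powr q'" using q' by (intro powr_less_mono2) auto
    then have n: "Y < real n powr q'" using Y q' by (simp add: powr_powr)
    \<comment> \<open>All bands 1 to n stay five octaves below the spike, where its pieces are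
      explicit.\<close>
    define k where "k = n + 5"
    have k: "k \<ge> 4" by (simp add: k_def)
    have "besov (s + m) p q (dist_of (f k)) \<le> ennreal (real (card (nbhd {k})) powr (1 / enn2real q) * (D * X))"
    proof (rule besov_norm_le[OF q nb(1-3)[OF k] bd(1,2)[OF k]])
      fix l assume l: "l \<in> nbhd {k}"
      show "Lp_norm lborel p (\<lambda>x. ennreal (2 powr ((s + m) * real l) * norm (piece l (f k) x))) \<le> ennreal (D * X)"
        by (rule XL[where k = k]) (use X bd(3)[OF k l] ms[OF k, of l] in auto)
    qed (use X in auto)
    also have "\<dots> \<le> ennreal (3 powr q' * (D * X))"
      using nb(4)[OF k] X by (intro ennreal_leI mult_right_mono) (auto simp: q'_def)
    finally have 1: "besov (s + m) p q (dist_of (f k)) \<le> ennreal (3 powr q' * (D * X))" .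
    have "ennreal (real (card {1..n}) powr (1 / enn2real q) * \<kappa>) \<le> besov s p q (dist_of (\<lambda>x. \<Sum>k\<in>{k}. G k x))"
    proof (rule besov_norm_ge[OF q])
      fix l assume l: "l \<in> {1..n}"
      let ?\<mu> = "2 powr (s * real l) * (2 powr ((\<tau> - s) * real k) * 2 ^ (l * DIM('a)))"
      have "\<kappa> = \<kappa> * (2 powr (\<tau> * real l) * 2 ^ (l * DIM('a)) * (2 ^ l) powr (- real DIM('a) / enn2real p))" unfolding dil by simp
      also have "\<dots> \<le> \<kappa> * ((2 powr (s * real l) * 2 powr ((\<tau> - s) * real k)) * 2 ^ (l * DIM('a)) * (2 ^ l) powr (- real DIM('a) / enn2real p))"
        using l \<kappa> by (intro mult_left_mono mult_right_mono gain) (auto simp: k_def)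
      also have "\<dots> = ?\<mu> * \<kappa> * (2 ^ l) powr (- real DIM('a) / enn2real p)" by (simp only: mult_ac)
      finally have "ennreal \<kappa> \<le> ennreal (?\<mu> * \<kappa> * (2 ^ l) powr (- real DIM('a) / enn2real p))" by (rule ennreal_leI)
      also have "\<dots> \<le> Lp_norm lborel p (\<lambda>x. ennreal (?\<mu> * norm (\<phi> (2 ^ l *\<^sub>R x))))" by (rule \<kappa>(2)) auto
      also have "\<dots> = Lp_norm lborel p (\<lambda>x. ennreal (2 powr (s * real l) * norm (piece l (\<lambda>x. \<Sum>k\<in>{k}. G k x) x)))"
        using l by (subst out) (auto simp: k_def mult.assoc)
      finally show "ennreal \<kappa> \<le> Lp_norm lborel p (\<lambda>x. ennreal (2 powr (s * real l) * norm (piece l (\<lambda>x. \<Sum>k\<in>{k}. G k x) x)))" .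
    qed (use \<kappa> in \<open>auto simp: n_def\<close>)
    then have 2: "ennreal (real n powr q' * \<kappa>) \<le> besov s p q (dist_of (\<lambda>x. \<Sum>k\<in>{k}. G k x))"
      by (simp add: q'_def)
    have "C * (3 powr q' * (D * X)) < real n powr q' * \<kappa>" using n \<kappa>(1) by (simp add: Y_def field_simps)
    then show "exceeds C m (besov (s + m) p q) (besov s p q)"
      using adm[OF k] 1 2 X unfolding f_def
      by (intro exI[of _ "{k}"] exI[of _ G] exI[of _ "3 powr q' * (D * X)"] exI[of _ "real n powr q' * \<kappa>"] conjI) auto
  qed
  show "unbounded m (triebel (s + m) p q) (triebel s p q)"
    if pfin: "p \<noteq> \<infinity>"
  proof (rule operator_norm_modulated[where NY = "triebel s p q", OF _ triebel_lizorkin_norm_zero])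
    fix C :: real assume C: "C > 0"
    define P where "P = enn2real p"
    have P: "P > 0" using enn2real_pos[OF p pfin] by (simp add: P_def)
    obtain c r \<delta> where cr: "r > 0" "\<delta> > 0" "3 * r \<le> norm c" "\<And>x. x \<in> ball c r \<Longrightarrow> \<delta> \<le> norm (\<phi> x)"
      by (rule schwartz_nonzero_ball[OF phi x0]) (rule that)
    define V where "V = unit_ball_vol (real DIM('a)) * r ^ DIM('a)"
    have V: "V > 0" unfolding V_def using cr by (intro mult_pos_pos) auto
    define Y where "Y = (C * (3 powr q' * D * X)) powr P / (\<delta> powr P * V)"
    define n where "n = nat \<lceil>Y\<rceil> + 1"
    have n: "Y < real n" using real_nat_ceiling_ge[of Y] by (simp add: n_def)
    define k where "k = n + 5"
    have k: "k \<ge> 4" by (simp add: k_def)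
    have 1: "triebel (s + m) p q (dist_of (f k)) \<le> ennreal (3 powr q' * D * X)"
    proof (rule triebel_lizorkin_norm_le[OF q pfin nb(1-3)[OF k] bd[OF k]])
      let ?b = "\<lambda>x::'a. D * (2 powr (\<tau> * real k) * (2 ^ k / 16) ^ DIM('a) * wgt M (2 ^ k / 16) x)"
      have "0 \<le> ?b x" for x using X wgt_pos[of "2 ^ k / 16" M x] by (simp add: less_imp_le)
      then have "0 \<le> real (card (nbhd {k})) powr q' * ?b x \<and> real (card (nbhd {k})) powr q' * ?b x \<le> 3 powr q' * ?b x" for x
        using nb(4)[OF k] by (auto intro: mult_right_mono)
      then have "Lp_norm lborel p (\<lambda>x. ennreal (real (card (nbhd {k})) powr q' * ?b x)) \<le> ennreal ((3 powr q' * D) * X)"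
        using X by (intro XL[where k = k]) (auto simp: mult.assoc)
      then show "Lp_norm lborel p (\<lambda>x. ennreal (real (card (nbhd {k})) powr (1 / enn2real q) * ?b x)) \<le> ennreal (3 powr q' * D * X)"
        by (simp add: q'_def)
    qed
    define u where "u x = Lp_norm (count_space {1..}) q (\<lambda>l. ennreal (2 powr (s * real l) * norm (piece l (\<lambda>x. \<Sum>k\<in>{k}. G k x) x)))" for x
    \<comment> \<open>On \<open>Q l\<close> the l-th kernel is bounded below; the powers of 2^l in
      \<open>b l\<close> and in the volume of \<open>Q l\<close> cancel, so each l contributes the
      same amount to the integral of the p-th power.\<close>
    define Q where "Q l = ball (c /\<^sub>R 2 ^ l) (r / 2 ^ l)" for l :: nat
    define b where "b l = \<delta> * (2 ^ l) powr (real DIM('a) / P)" for l :: nat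
    have b0: "b l \<ge> 0" for l using cr by (simp add: b_def)
    have Qscale: "2 ^ l *\<^sub>R x \<in> ball c r" if "x \<in> Q l" for l x
    proof -
      have "2 ^ l * norm (c /\<^sub>R 2 ^ l - x) < r" using that by (simp add: Q_def dist_norm field_simps)
      also have "2 ^ l * norm (c /\<^sub>R 2 ^ l - x) = norm (2 ^ l *\<^sub>R (c /\<^sub>R 2 ^ l - x))" by simp
      also have "2 ^ l *\<^sub>R (c /\<^sub>R 2 ^ l - x) = c - 2 ^ l *\<^sub>R x" by (simp add: scaleR_diff_right)
      finally show ?thesis by (simp add: dist_norm)
    qed
    \<comment> \<open>By 3r <= |c|, points of \<open>Q l\<close> satisfy 2^l |x| between 2/3 and 4/3
      of |c|; doubling leaves this range.\<close>
    have disj: "l = l'" if "x \<in> Q l" "x \<in> Q l'" for l l' x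
    proof -
      have *: "2 / 3 * norm c < 2 ^ l * norm x \<and> 2 ^ l * norm x < 4 / 3 * norm c" if "x \<in> Q l" for l
      proof -
        have "norm (c - 2 ^ l *\<^sub>R x) < norm c / 3" using Qscale[OF that] cr(3) by (simp add: dist_norm)
        then show ?thesis using norm_triangle_ineq2[of c "2 ^ l *\<^sub>R x"] norm_triangle_ineq2[of "2 ^ l *\<^sub>R x" c]
          by (simp add: norm_minus_commute)
      qed
      have F: False if "x \<in> Q i" "x \<in> Q i'" "Suc i \<le> i'" for i i'
      proof -
        have "(2::real) ^ Suc i \<le> 2 ^ i'" using that(3) by (rule power_increasing) simp
        then have "2 ^ Suc i * norm x \<le> 2 ^ i' * norm x" by (rule mult_right_mono) simp
        then show False using *[OF that(1)] *[OF that(2)] by simp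
      qed
      show ?thesis using F[OF that] F[OF that(2,1)] by (meson linorder_neqE_nat Suc_leI)
    qed
    have ub: "ennreal (b l) \<le> u x" if l: "l \<in> {1..n}" and x: "x \<in> Q l" for l x
    proof -
      have "(2 ^ l) powr (real DIM('a) / P) = 2 powr (\<tau> * real l) * 2 ^ (l * DIM('a))"
        unfolding \<tau>_def P_def by (simp add: powr_realpow[symmetric] powr_powr powr_add[symmetric] field_simps)
      also have "\<dots> \<le> (2 powr (s * real l) * 2 powr ((\<tau> - s) * real k)) * 2 ^ (l * DIM('a))"
        using l by (intro mult_right_mono gain) (auto simp: k_def)
      finally have "b l \<le> norm (\<phi> (2 ^ l *\<^sub>R x)) * ((2 powr (s * real l) * 2 powr ((\<tau> - s) * real k)) * 2 ^ (l * DIM('a)))"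
        unfolding b_def using cr(2,4) Qscale[OF x] by (intro mult_mono) auto
      also have "\<dots> = 2 powr (s * real l) * norm (piece l (\<lambda>x. \<Sum>k\<in>{k}. G k x) x)"
        using l by (subst out) (auto simp: k_def mult_ac)
      finally have "ennreal (real (card {l}) powr (1 / enn2real q) * b l) \<le> u x"
        unfolding u_def using l b0 by (intro lq_norm_ge q) (auto intro!: ennreal_leI)
      then show ?thesis by simp
    qed
    have "ennreal (real n * (\<delta> powr P * V)) = (\<Sum>l\<in>{1..n}. ennreal (\<delta> powr P * V))"
      using V ennreal_mult[of "real n" "\<delta> powr P * V"] by (simp add: ennreal_of_nat_eq_real_of_nat)
    also have "\<dots> = (\<Sum>l\<in>{1..n}. ennreal (b l powr P) * emeasure lborel (Q l))"
    proof (rule sum.cong[OF refl])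
      fix l
      have "measure lborel (Q l) = V * (2 ^ l) powr (- real DIM('a))"
        using content_ball_powr[OF cr(1), of "2 ^ l" "c /\<^sub>R 2 ^ l" 1] V by (simp add: Q_def V_def[symmetric])
      moreover have "b l powr P = \<delta> powr P * (2 ^ l) powr (real DIM('a))"
        using P cr by (simp add: b_def powr_mult powr_powr)
      ultimately have "b l powr P * measure lborel (Q l) = \<delta> powr P * V"
        by (simp add: powr_minus)
      moreover have "emeasure lborel (Q l) = ennreal (measure lborel (Q l))"
        unfolding Q_def by (rule emeasure_eq_ennreal_measure) (use emeasure_lborel_ball_finite in \<open>auto simp: less_top[symmetric]\<close>)
      ultimately show "ennreal (\<delta> powr P * V) = ennreal (b l powr P) * emeasure lborel (Q l)"
        by (simp add: ennreal_mult'[symmetric])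
    qed
    also have "\<dots> = (\<integral>\<^sup>+x. (\<Sum>l\<in>{1..n}. ennreal (b l powr P) * indicator (Q l) x) \<partial>lborel)"
    proof -
      have [measurable]: "Q l \<in> sets lborel" for l by (simp add: Q_def)
      have "(\<integral>\<^sup>+x. (\<Sum>l\<in>{1..n}. ennreal (b l powr P) * indicator (Q l) x) \<partial>lborel) = (\<Sum>l\<in>{1..n}. \<integral>\<^sup>+x. ennreal (b l powr P) * indicator (Q l) x \<partial>lborel)"
        by (rule nn_integral_sum) measurable
      then show ?thesis by (simp only: nn_integral_cmult_indicator[OF \<open>Q _ \<in> sets lborel\<close>])
    qed
    also have "\<dots> \<le> (\<integral>\<^sup>+x. enn_powr (u x) P \<partial>lborel)"
    proof (rule nn_integral_mono)
      fix x
      show "(\<Sum>l\<in>{1..n}. ennreal (b l powr P) * indicator (Q l) x) \<le> enn_powr (u x) P"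
      proof (cases "\<exists>l\<in>{1..n}. x \<in> Q l")
        case True
        then obtain l where l: "l \<in> {1..n}" "x \<in> Q l" by blast
        have "(\<Sum>l\<in>{1..n}. ennreal (b l powr P) * indicator (Q l) x) = (\<Sum>i\<in>{1..n}. if i = l then ennreal (b l powr P) else 0)"
          using l disj by (intro sum.cong) (auto simp: indicator_def)
        also have "\<dots> = enn_powr (ennreal (b l)) P" using l b0 by (simp add: enn_powr_ennreal)
        also have "\<dots> \<le> enn_powr (u x) P" using ub[OF l] P by (intro enn_powr_mono) auto
        finally show ?thesis .
      qed (auto simp: indicator_def)
    qed
    finally have int: "ennreal (real n * (\<delta> powr P * V)) \<le> (\<integral>\<^sup>+x. enn_powr (u x) P \<partial>lborel)" .
    have "ennreal ((real n * (\<delta> powr P * V)) powr (1 / P)) = enn_powr (ennreal (real n * (\<delta> powr P * V))) (1 / P)"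
      using V by (simp add: enn_powr_ennreal)
    also have "\<dots> \<le> Lp_norm lborel p u"
      unfolding Lp_norm_finite[OF pfin] P_def[symmetric] using int P by (intro enn_powr_mono) auto
    also have "\<dots> \<le> triebel s p q (dist_of (\<lambda>x. \<Sum>k\<in>{k}. G k x))"
      using pfin by (simp add: triebel_lizorkin_norm_def u_def[abs_def])
    finally have 2: "ennreal ((real n * (\<delta> powr P * V)) powr (1 / P)) \<le> triebel s p q (dist_of (\<lambda>x. \<Sum>k\<in>{k}. G k x))" .
    have "(C * (3 powr q' * D * X)) powr P < real n * (\<delta> powr P * V)"
      using n V cr(2) by (simp add: Y_def divide_less_eq)
    then have "((C * (3 powr q' * D * X)) powr P) powr (1 / P) < (real n * (\<delta> powr P * V)) powr (1 / P)"
      using P by (intro powr_less_mono2) auto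
    then have "C * (3 powr q' * D * X) < (real n * (\<delta> powr P * V)) powr (1 / P)"
      using P C X by (simp add: powr_powr)
    then show "exceeds C m (triebel (s + m) p q) (triebel s p q)"
      using adm[OF k] 1 2 X unfolding f_def
      by (intro exI[of _ "{k}"] exI[of _ G] exI[of _ "3 powr q' * D * X"] exI[of _ "(real n * (\<delta> powr P * V)) powr (1 / P)"] conjI) auto
  qed
qed

text \<open>For q = \<infinity> many bands count no more than one, so the gain must come from
  addition. Spikes at K separated scales keep the input norm bounded, being a supremum over bands,
  while their low-frequency parts are positive multiples of the same \<Phi> and add up to at least
  K.\<close>

lemma coherent_spikes:
  assumes p: "p > 0" and s: "s \<le> real DIM('a) / enn2real p - real DIM('a)"
  shows "unbounded m (besov (s + m) p \<infinity>) (besov s p \<infinity>)"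
proof (rule operator_norm_modulated[where NY = "besov s p \<infinity>", OF _ besov_norm_zero])
  fix C :: real assume C: "C > 0"
  define \<tau> where "\<tau> = real DIM('a) / enn2real p - real DIM('a)"
  obtain X M D where X: "X > 0" "D > 0" and XL': "spike_norm_bound p \<tau> M X" and XP': "spike_proj_bound m s \<tau> M D"
    using modulated_spike_bounds[OF p \<tau>_def, of m s] by blast
  note XL = XL'[unfolded spike_norm_bound_def, rule_format]
  note XP = XP'[unfolded spike_proj_bound_def, THEN spec, THEN mp, THEN mp, THEN mp]
  define G where "G = spike (\<tau> - s)"
  have "\<exists>x. \<Phi> x \<noteq> 0" using psi0_nonzero by (auto simp: psi0_def)
  then obtain x0 where x0: "\<Phi> x0 \<noteq> 0" by blast
  obtain \<kappa> where \<kappa>: "\<kappa> > 0" "\<And>\<mu> a. 0 \<le> \<mu> \<Longrightarrow> 0 < a \<Longrightarrow>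
     ennreal (\<mu> * \<kappa> * a powr (- real DIM('a) / enn2real p)) \<le> Lp_norm lborel p (\<lambda>x. ennreal (\<mu> * norm (\<Phi> (a *\<^sub>R x))))"
    by (rule Lp_norm_dilate_pos[OF Phi x0 p]) (rule that)
  define K where "K = nat \<lceil>C * (D * X) / \<kappa>\<rceil> + 1"
  have "C * (D * X) / \<kappa> < real K" using real_nat_ceiling_ge[of "C * (D * X) / \<kappa>"] by (simp add: K_def)
  then have K: "C * (D * X) < real K * \<kappa>" using \<kappa>(1) by (simp add: field_simps)
  \<comment> \<open>The indices start at 8, since the formula for the zeroth piece of a spike needs
    k >= 5.\<close>
  define I where "I = (\<lambda>i. 4 * i + 4) ` {1..K}"
  have I: "finite I" "card I = K" "\<And>k. k \<in> I \<Longrightarrow> k \<ge> 8" "\<forall>k\<in>I. \<forall>k'\<in>I. k < k' \<longrightarrow> k + 4 \<le> k'" "I \<noteq> {}"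
    by (auto simp: I_def card_image inj_on_def K_def)
  have I4: "\<And>k. k \<in> I \<Longrightarrow> k \<ge> 4" using I(3) by force
  have adm: "admissible I G" unfolding G_def by (intro admissible_spike I I4)
  note nb = nbhd[OF I(1,5) I4]
  have "\<forall>k\<in>I. k \<ge> 4" using I4 by blast
  note bd = XP[OF I(1) this I(4), folded G_def]
  have "besov (s + m) p \<infinity> (dist_of (modulated m I G)) \<le> ennreal (real (card (nbhd I)) powr (1 / enn2real \<infinity>) * (D * X))"
  proof (rule besov_norm_le[OF _ nb(1-3)])
    fix l assume "l \<in> nbhd I"
    then obtain k where k: "k \<in> I" "\<And>x. 2 powr ((s + m) * real l) * norm (piece l (modulated m I G) x) \<le>
        D * (2 powr (\<tau> * real k) * (2 ^ k / 16) ^ DIM('a) * wgt M (2 ^ k / 16) x)" using bd by blast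
    have [measurable]: "piece l (modulated m I G) \<in> borel_measurable borel"
      by (intro schwartz_measurable lp_proj_schwartz modulated_schwartz adm)
    show "Lp_norm lborel p (\<lambda>x. ennreal (2 powr ((s + m) * real l) * norm (piece l (modulated m I G) x))) \<le> ennreal (D * X)"
      by (rule XL[where k = k]) (use X k(2) in auto)
  qed (use bd X in auto)
  also have "real (card (nbhd I)) powr (1 / enn2real \<infinity>) = 1" using nb by (simp add: card_gt_0_iff)
  finally have 1: "besov (s + m) p \<infinity> (dist_of (modulated m I G)) \<le> ennreal (D * X)" by simp
  define S where "S = (\<Sum>k\<in>I. 2 powr ((\<tau> - s) * real k))"
  have "real K = (\<Sum>k\<in>I. 1)" by (simp add: I(2))
  also have "\<dots> \<le> S" unfolding S_def using s by (intro sum_mono) (auto simp: \<tau>_def ge_one_powr_ge_zero)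
  finally have S: "real K \<le> S" .
  have "piece 0 (\<lambda>x. \<Sum>k\<in>I. G k x) x = of_real S * \<Phi> x" for x
  proof -
    have "piece 0 (\<lambda>x. \<Sum>k\<in>I. 1 * G k x) x = (\<Sum>k\<in>I. 1 * piece 0 (G k) x)"
      unfolding G_def by (rule lp_proj_sum) (rule spike_schwartz)
    also have "\<dots> = (\<Sum>k\<in>I. of_real (2 powr ((\<tau> - s) * real k)) * \<Phi> x)"
      using I(3) by (intro sum.cong) (fastforce simp: G_def lp_proj_spike lp_kernel_def)+
    finally show ?thesis by (simp add: S_def sum_distrib_right)
  qed
  then have "(\<lambda>x. ennreal (norm (piece 0 (\<lambda>x. \<Sum>k\<in>I. G k x) x))) = (\<lambda>x. ennreal (S * norm (\<Phi> (1 *\<^sub>R x))))"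
    using S by (simp add: norm_mult)
  moreover have "ennreal (real K * \<kappa>) \<le> ennreal (S * \<kappa> * 1 powr (- real DIM('a) / enn2real p))"
    using S \<kappa> by (intro ennreal_leI) simp
  ultimately have "ennreal (real K * \<kappa>) \<le> Lp_norm lborel p (\<lambda>x. ennreal (norm (piece 0 (\<lambda>x. \<Sum>k\<in>I. G k x) x)))"
    using \<kappa>(2)[of S 1] S by (simp only:) (erule order_trans, simp)
  then have "ennreal (real K * \<kappa>) \<le> besov s p \<infinity> (dist_of (\<lambda>x. \<Sum>k\<in>I. G k x))"
    using norms_ge_0(1) by (rule order_trans)
  then show "exceeds C m (besov (s + m) p \<infinity>) (besov s p \<infinity>)"
    using adm 1 X K by (intro exI[of _ I] exI[of _ G] exI[of _ "D * X"] exI[of _ "real K * \<kappa>"]) auto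
qed

end

subsection \<open>Translated waves\<close>

text \<open>The point t is replaced by its integer part c at the cost of a factor 4. On each side of
  c the distances |i - c| are distinct, so each half is bounded by the full series.\<close>

lemma sum_inverse_square_bound:
  "\<exists>Z>0. \<forall>n t. (\<Sum>i<n. 1 / (1 + \<bar>t - real i\<bar>)\<^sup>2) \<le> Z"
proof -
  define g where "g k = 4 / (1 + real k)\<^sup>2" for k :: nat
  have sg: "summable g"
    using inverse_squares_sums[THEN sums_summable, THEN summable_mult, of 4]
    by (simp add: g_def[abs_def] add.commute)
  have g0: "g k \<ge> 0" for k by (simp add: g_def)
  have *: "(\<Sum>i\<in>A. g (h i)) \<le> suminf g" if "finite A" "inj_on h A" for A :: "nat set" and h
  proof -
    have "(\<Sum>i\<in>A. g (h i)) = (\<Sum>k\<in>h ` A. g k)" by (rule sum.reindex[OF that(2), symmetric, unfolded o_def])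
    also have "\<dots> \<le> suminf g" using that g0 by (intro sum_le_suminf sg) auto
    finally show ?thesis .
  qed
  have "(\<Sum>i<n. 1 / (1 + \<bar>t - real i\<bar>)\<^sup>2) \<le> 2 * suminf g + 1" for n t
  proof -
    define c where "c = \<lfloor>t\<rfloor>"
    have bound: "1 / (1 + \<bar>t - real i\<bar>)\<^sup>2 \<le> g (nat \<bar>int i - c\<bar>)" for i
    proof -
      have "real_of_int c \<le> t" "t < real_of_int c + 1" unfolding c_def by linarith+
      then have "\<bar>real i - real_of_int c\<bar> \<le> \<bar>t - real i\<bar> + 1" by (auto simp: abs_if)
      then have "1 + \<bar>real i - real_of_int c\<bar> \<le> 2 * (1 + \<bar>t - real i\<bar>)" by (simp add: abs_if split: if_splits)
      then have "(1 + \<bar>real i - c\<bar>)\<^sup>2 \<le> (2 * (1 + \<bar>t - real i\<bar>))\<^sup>2" by (intro power_mono) auto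
      then have "(1 + \<bar>real i - c\<bar>)\<^sup>2 \<le> 4 * (1 + \<bar>t - real i\<bar>)\<^sup>2" by (simp only: power_mult_distrib) simp
      moreover have "1 + \<bar>real i - c\<bar> > 0" "1 + \<bar>t - real i\<bar> > 0" by linarith+
      ultimately have "1 / (1 + \<bar>t - real i\<bar>)\<^sup>2 \<le> 4 / (1 + \<bar>real i - c\<bar>)\<^sup>2" by (simp add: divide_le_eq le_divide_eq)
      moreover have "real (nat \<bar>int i - c\<bar>) = \<bar>real i - c\<bar>" by simp
      ultimately show ?thesis by (simp only: g_def)
    qed
    have "(\<Sum>i<n. 1 / (1 + \<bar>t - real i\<bar>)\<^sup>2) \<le> (\<Sum>i<n. g (nat \<bar>int i - c\<bar>))" by (intro sum_mono bound)
    also have "\<dots> = (\<Sum>i\<in>{..<n} \<inter> {i. c \<le> int i}. g (nat \<bar>int i - c\<bar>)) + (\<Sum>i\<in>{..<n} \<inter> {i. int i < c}. g (nat \<bar>int i - c\<bar>))"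
      by (subst sum.union_disjoint[symmetric]) (auto intro!: sum.cong)
    also have "\<dots> \<le> suminf g + suminf g"
      by (intro add_mono *) (auto simp: inj_on_def)
    finally show ?thesis by simp
  qed
  moreover have "2 * suminf g + 1 > 0" using suminf_nonneg[OF sg g0] by simp
  ultimately show ?thesis by blast
qed

lemma schwartz_square_integrable:
  assumes "f \<in> schwartz" shows "integrable lborel (\<lambda>x. (norm (f x))\<^sup>2)"
  using integrable_norm[OF schwartz_integrable[OF schwartz_mult[OF assms schwartz_imp_slow[OF assms]]]]
  by (simp add: norm_mult power2_eq_square)

lemma wgt_le_1: "0 \<le> a \<Longrightarrow> wgt M a x \<le> 1"
proof -
  assume "0 \<le> a"
  then have "1 \<le> (1 + a * norm x) ^ M" by (intro one_le_power) simp
  then show ?thesis by (simp add: wgt_def divide_le_eq_1)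
qed

lemma wgt_integrable:
  "2 * DIM('a) \<le> M \<Longrightarrow> integrable lborel (wgt M 1 :: 'a::euclidean_space \<Rightarrow> real)"
  using integrable_weight[where 'a='a, of M] by (simp add: wgt_def[abs_def])

lemma wgt_integral_pos:
  assumes "2 * DIM('a) \<le> M" shows "(LINT x|lborel. wgt M 1 (x::'a::euclidean_space)) > 0"
proof -
  have "(LINT x|lborel. wgt M 1 (x::'a)) \<noteq> 0"
  proof
    assume "(LINT x|lborel. wgt M 1 (x::'a)) = 0"
    then have "AE x in lborel. wgt M 1 (x::'a) = 0"
      using wgt_integrable[OF assms] wgt_pos[of 1 M]
      by (subst (asm) integral_nonneg_eq_0_iff_AE) (auto intro: less_imp_le)
    moreover have "wgt M 1 (x::'a) \<noteq> 0" for x using wgt_pos[of 1 M x] by simp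
    ultimately have "AE x in (lborel :: 'a measure). False" by simp
    then have "ae_filter (lborel :: 'a measure) = bot" by (simp add: eventually_False)
    then show False by (simp add: ae_filter_eq_bot_iff)
  qed
  moreover have "(LINT x|lborel. wgt M 1 (x::'a)) \<ge> 0"
    using wgt_pos[of 1 M] by (intro integral_nonneg_AE) (auto intro: less_imp_le)
  ultimately show ?thesis by linarith
qed

text \<open>Replaces Hoelder's inequality: where \<open>u \<le> t\<close> use \<open>u\<^sup>a \<le> t\<^sup>a\<close>, elsewhere
  \<open>u\<^sup>a \<le> t\<^bsup>a - r\<^esup> u\<^sup>r\<close>.\<close>

lemma powr_split:
  fixes u t a r :: real
  assumes "0 \<le> u" "0 < t" "0 \<le> a" "a \<le> r" "0 < r"
  shows "u powr a \<le> t powr a + t powr (a - r) * u powr r"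
proof (cases "u \<le> t")
  case True
  then have "u powr a \<le> t powr a" using assms by (intro powr_mono2) auto
  then show ?thesis by (simp add: add_increasing2)
next
  case False
  then have "u powr (a - r) \<le> t powr (a - r)" using assms by (intro powr_mono2') auto
  then have "u powr (a - r) * u powr r \<le> t powr (a - r) * u powr r" by (rule mult_right_mono) simp
  moreover have "u powr (a - r) * u powr r = u powr a" using False assms by (simp add: powr_add[symmetric])
  ultimately show ?thesis by (simp add: add_increasing)
qed

text \<open>A lower bound for a weighted mean is lifted to the r-th moment by splitting at height
  t.\<close>

lemma powr_moment_lower:
  fixes U w :: "'b \<Rightarrow> real"
  assumes w: "integrable M w" "\<And>x. 0 \<le> w x" "\<And>x. w x \<le> 1" and J: "(LINT x|M. w x) > 0"
    and U: "U \<in> borel_measurable M" "\<And>x. 0 \<le> U x" and r: "r \<ge> 1" and A: "A > 0" "ennreal A \<le> (\<integral>\<^sup>+x. ennreal (U x * w x) \<partial>M)"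
  shows "ennreal ((LINT x|M. w x) * (A / (2 * (LINT x|M. w x))) powr r) \<le> (\<integral>\<^sup>+x. ennreal (U x powr r) \<partial>M)"
proof -
  let ?J = "LINT x|M. w x"
  \<comment> \<open>With this height the part of U below t accounts for at most A/2 of the weighted
    mean, leaving A/2 for the r-th powers.\<close>
  define t where "t = A / (2 * ?J)"
  have t: "t > 0" using A J by (simp add: t_def)
  note [measurable] = U(1) borel_measurable_integrable[OF w(1)]
  let ?Y = "\<integral>\<^sup>+x. ennreal (U x powr r) \<partial>M"
  have "(\<integral>\<^sup>+x. ennreal (U x * w x) \<partial>M) \<le> (\<integral>\<^sup>+x. (ennreal (t * w x) + ennreal (t powr (1 - r)) * ennreal (U x powr r)) \<partial>M)"
  proof (rule nn_integral_mono)
    fix x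
    have "U x * w x \<le> (t + t powr (1 - r) * U x powr r) * w x"
      using powr_split[of "U x" t 1 r] U(2)[of x] t r w(2)[of x] by (intro mult_right_mono) auto
    also have "\<dots> = t * w x + (t powr (1 - r) * U x powr r) * w x" by (simp add: algebra_simps)
    also have "(t powr (1 - r) * U x powr r) * w x \<le> t powr (1 - r) * U x powr r" using w(2)[of x] w(3)[of x] by (intro mult_left_le) auto
    finally show "ennreal (U x * w x) \<le> ennreal (t * w x) + ennreal (t powr (1 - r)) * ennreal (U x powr r)"
      using t w(2)[of x] by (simp add: ennreal_mult[symmetric] ennreal_plus[symmetric] ennreal_leI del: ennreal_plus)
  qed
  also have "\<dots> = (\<integral>\<^sup>+x. ennreal (t * w x) \<partial>M) + ennreal (t powr (1 - r)) * ?Y"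
    by (simp add: nn_integral_add nn_integral_cmult)
  also have "(\<integral>\<^sup>+x. ennreal (t * w x) \<partial>M) = ennreal (LINT x|M. t * w x)"
    using t w by (intro nn_integral_eq_integral) auto
  also have "(LINT x|M. t * w x) = A / 2" using J by (simp add: t_def)
  finally have le: "ennreal A \<le> ennreal (A / 2) + ennreal (t powr (1 - r)) * ?Y" using A(2) by (rule order_trans[rotated])
  show ?thesis
  proof (cases ?Y)
    case (real y)
    have "ennreal A \<le> ennreal (A / 2 + t powr (1 - r) * y)" using le real A by (simp add: ennreal_mult[symmetric])
    then have "A \<le> A / 2 + t powr (1 - r) * y" using A real by (subst (asm) ennreal_le_iff) auto
    then have "A / 2 \<le> t powr (1 - r) * y" by simp
    then have "t powr (r - 1) * (A / 2) \<le> t powr (r - 1) * (t powr (1 - r) * y)" by (rule mult_left_mono) simp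
    also have "\<dots> = (t powr (r - 1) * t powr (1 - r)) * y" by (simp only: mult.assoc)
    also have "t powr (r - 1) * t powr (1 - r) = 1" using t by (simp add: powr_add[symmetric])
    finally have "t powr (r - 1) * (t * ?J) \<le> y" using J by (simp add: t_def)
    moreover have "t powr r = t powr (r - 1) * t" using t powr_mult_base[of t "r - 1"] by (simp add: mult.commute)
    ultimately have "?J * t powr r \<le> y" by (simp only: mult_ac)
    then show ?thesis unfolding real(2) t_def by (rule ennreal_leI)
  qed simp
qed

text \<open>The majorant gives |P|^2 <= H |P| w, so an energy bound becomes a bound for the weighted
  mean of |P|, and from there for the L^p norm. The constant serves all P at once, as the pieces
  vary with their frequency.\<close>

lemma Lp_norm_lower:
  assumes p: "p > 1" and M: "2 * DIM('a) \<le> M" and H: "H > 0" and c0: "c0 > 0"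
  shows "\<exists>\<kappa>>0. \<forall>P::'a::euclidean_space \<Rightarrow> complex. P \<in> borel_measurable borel \<longrightarrow> (\<forall>x. norm (P x) \<le> H * wgt M 1 x) \<longrightarrow>
     c0 \<le> (LINT x|lborel. (norm (P x))\<^sup>2) \<longrightarrow> (\<forall>\<mu>\<ge>0. ennreal (\<mu> * \<kappa>) \<le> Lp_norm lborel p (\<lambda>x. ennreal (\<mu> * norm (P x))))"
proof -
  define J where "J = (LINT x|lborel. wgt M 1 (x::'a))"
  have J: "J > 0" unfolding J_def by (rule wgt_integral_pos[OF M])
  note wi = wgt_integrable[OF M]
  have sq: "integrable lborel (\<lambda>x. norm (P x))" "integrable lborel (\<lambda>x. (norm (P x))\<^sup>2)" "(norm (P x))\<^sup>2 \<le> norm (P x) * (H * wgt M 1 x)"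
    if P: "P \<in> borel_measurable borel" "\<And>x. norm (P x) \<le> H * wgt M 1 x" for P :: "'a \<Rightarrow> complex" and x
  proof -
    show "(norm (P x))\<^sup>2 \<le> norm (P x) * (H * wgt M 1 x)" for x
      using P(2)[of x] by (simp add: power2_eq_square mult_left_mono)
    have HW: "integrable lborel (\<lambda>x::'a. H * wgt M 1 x)" using wi by simp
    show "integrable lborel (\<lambda>x. norm (P x))"
      by (rule Bochner_Integration.integrable_bound[OF HW]) (use P in \<open>auto intro: order_trans[OF _ abs_ge_self]\<close>)
    have "integrable lborel (\<lambda>x::'a. H * H * wgt M 1 x)" using wi by simp
    then show "integrable lborel (\<lambda>x. (norm (P x))\<^sup>2)"
    proof (rule Bochner_Integration.integrable_bound)
      have "(norm (P x))\<^sup>2 \<le> H * H * wgt M 1 x" for x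
      proof -
        have "norm (P x) \<le> H" using order_trans[OF P(2)[of x] mult_left_mono[OF wgt_le_1[of 1 M x], of H]] H by simp
        then have "norm (P x) * norm (P x) \<le> H * (H * wgt M 1 x)" using P(2)[of x] H by (intro mult_mono) auto
        then show ?thesis by (simp add: power2_eq_square mult.assoc)
      qed
      then show "AE x in lborel. norm ((norm (P x))\<^sup>2) \<le> norm (H * H * wgt M 1 x)"
        by (auto intro: order_trans[OF _ abs_ge_self])
    qed (use P in auto)
  qed
  show ?thesis
  proof (cases "p = \<infinity>")
    case True
    show ?thesis
    proof (intro exI[of _ "c0 / (H * J)"] conjI allI impI)
      show "c0 / (H * J) > 0" using c0 H J by simp
      fix P :: "'a \<Rightarrow> complex" and \<mu> :: real
      assume P: "P \<in> borel_measurable borel" "\<forall>x. norm (P x) \<le> H * wgt M 1 x" "c0 \<le> (LINT x|lborel. (norm (P x))\<^sup>2)" and \<mu>: "0 \<le> \<mu>"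
      let ?E = "esssup lborel (\<lambda>x. ennreal (\<mu> * norm (P x)))"
      have "ennreal (\<mu> * (c0 / (H * J))) \<le> ?E"
      proof (cases ?E)
        case (real e)
        have "AE x in lborel. \<mu> * norm (P x) \<le> e"
          using esssup_AE[of "\<lambda>x. ennreal (\<mu> * norm (P x))" lborel] real \<mu> by (auto simp: ennreal_le_iff)
        then have "AE x in lborel. \<mu> * (norm (P x))\<^sup>2 \<le> e * H * wgt M 1 x"
        proof eventually_elim
          case (elim x)
          have "\<mu> * (norm (P x))\<^sup>2 \<le> \<mu> * (norm (P x) * (H * wgt M 1 x))" using sq(3)[of P x] P \<mu> by (intro mult_left_mono) auto
          also have "\<dots> \<le> e * (H * wgt M 1 x)"
            using elim H wgt_pos[of 1 M x] by (simp only: mult.assoc[symmetric]) (auto intro!: mult_right_mono simp: mult.assoc less_imp_le)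
          finally show ?case by (simp add: mult.assoc)
        qed
        then have "(LINT x|lborel. \<mu> * (norm (P x))\<^sup>2) \<le> (LINT x|lborel. e * H * wgt M 1 (x::'a))"
          using sq(2)[of P] P wi by (intro integral_mono_AE) auto
        then have "\<mu> * (LINT x|lborel. (norm (P x))\<^sup>2) \<le> e * H * J" by (simp add: J_def)
        then have "\<mu> * c0 \<le> e * H * J" using mult_left_mono[OF P(3) \<mu>] by linarith
        then show ?thesis unfolding real using H J by (intro ennreal_leI) (simp add: field_simps)
      qed simp
      then show "ennreal (\<mu> * (c0 / (H * J))) \<le> Lp_norm lborel p (\<lambda>x. ennreal (\<mu> * norm (P x)))" using True by (simp add: Lp_norm_def)
    qed
  next
    case False
    define r where "r = enn2real p"
    have "enn2real 1 < enn2real p"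
      using p False by (intro enn2real_less_iff[THEN iffD2]) (auto simp: top.not_eq_extremum)
    then have r: "r > 1" by (simp add: r_def)
    have p0: "p > 0" using p by (meson less_trans zero_less_one)
    define B where "B = J * (c0 / H / (2 * J)) powr r"
    have B: "B > 0" using c0 H J by (simp add: B_def)
    show ?thesis
    proof (intro exI[of _ "B powr (1 / r)"] conjI allI impI)
      show "B powr (1 / r) > 0" using B by simp
      fix P :: "'a \<Rightarrow> complex" and \<mu> :: real
      assume P: "P \<in> borel_measurable borel" "\<forall>x. norm (P x) \<le> H * wgt M 1 x" "c0 \<le> (LINT x|lborel. (norm (P x))\<^sup>2)" and \<mu>: "0 \<le> \<mu>"
      note [measurable] = P(1)
      have w: "0 \<le> wgt M 1 x" "wgt M 1 x \<le> 1" for x :: 'a using wgt_pos[of 1 M x] wgt_le_1[of 1 M x] by auto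
      have int: "integrable lborel (\<lambda>x. norm (P x) * wgt M 1 x)"
        by (rule Bochner_Integration.integrable_bound[OF sq(1)[of P]]) (use P w in \<open>auto simp: mult_left_le\<close>)
      have "(LINT x|lborel. (norm (P x))\<^sup>2) \<le> (LINT x|lborel. H * (norm (P x) * wgt M 1 x))"
        using sq(2,3)[of P] P int by (intro integral_mono) (auto simp: mult_ac)
      then have "c0 / H \<le> (LINT x|lborel. norm (P x) * wgt M 1 x)" using P(3) H by (simp add: field_simps)
      then have "ennreal (c0 / H) \<le> (\<integral>\<^sup>+x. ennreal (norm (P x) * wgt M 1 x) \<partial>lborel)"
        using w by (subst nn_integral_eq_integral[OF int]) (auto intro: ennreal_leI)
      then have "ennreal B \<le> (\<integral>\<^sup>+x. ennreal (norm (P x) powr r) \<partial>lborel)"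
        unfolding B_def J_def using w J c0 H r by (intro powr_moment_lower wi) (auto simp: J_def)
      then have "ennreal (\<mu> powr r) * ennreal B \<le> ennreal (\<mu> powr r) * (\<integral>\<^sup>+x. ennreal (norm (P x) powr r) \<partial>lborel)"
        by (rule mult_left_mono) simp
      also have "\<dots> = (\<integral>\<^sup>+x. ennreal (\<mu> powr r) * ennreal (norm (P x) powr r) \<partial>lborel)" by (rule nn_integral_cmult[symmetric]) measurable
      also have "\<dots> = (\<integral>\<^sup>+x. ennreal ((\<mu> * norm (P x)) powr r) \<partial>lborel)" using \<mu> by (simp add: powr_mult ennreal_mult)
      finally show "ennreal (\<mu> * B powr (1 / r)) \<le> Lp_norm lborel p (\<lambda>x. ennreal (\<mu> * norm (P x)))"
        using \<mu> B r by (intro Lp_norm_ge p0 False) (auto simp: powr_mult powr_powr ennreal_mult r_def[symmetric])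
    qed
  qed
qed

context lp_decomposition
begin

lemma phi_hat_near_e1: "\<exists>j0. \<forall>\<zeta>. norm (\<zeta> - e1) \<le> 1 / 2 ^ j0 \<longrightarrow> 1 / 2 \<le> norm (phi_hat \<zeta>)"
proof -
  have "open {\<zeta>. 1 / 2 < norm (phi_hat \<zeta>)}"
    by (intro open_Collect_less continuous_on_norm schwartz_continuous phi_hat continuous_intros)
  moreover have "e1 \<in> {\<zeta>. 1 / 2 < norm (phi_hat \<zeta>)}" by (simp add: phi_hat_unit)
  ultimately obtain e where e: "e > 0" "ball e1 e \<subseteq> {\<zeta>. 1 / 2 < norm (phi_hat \<zeta>)}" by (meson open_contains_ball)
  obtain j0 where "(1 / 2) ^ j0 < e" using real_arch_pow_inv[of e "1/2"] e by auto
  then have "norm (\<zeta> - e1) \<le> 1 / 2 ^ j0 \<Longrightarrow> \<zeta> \<in> ball e1 e" for \<zeta>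
    by (simp add: dist_norm norm_minus_commute power_one_over)
  then show ?thesis using e(2) by (intro exI[of _ j0]) fastforce
qed

lemma lp_proj_translate:
  assumes "f \<in> schwartz" "l \<ge> 1"
  shows "piece l (\<lambda>x. f (x - y)) x = piece l f (x - y)"
  using assms by (simp add: lp_proj_conv schwartz_translate algebra_simps)

text \<open>A fixed envelope modulated to frequency u. Its modulus does not depend on u, hence the
  uniformity in \<open>lp_proj_mode_bound\<close>.\<close>

definition mode :: "'a \<Rightarrow> 'a \<Rightarrow> complex" where
  "mode u x = ee (x \<bullet> u) * psi0 x"

lemma mode_schwartz: "mode u \<in> schwartz"
  unfolding mode_def[abs_def] by (intro schwartz_mult'[OF slow_ee] psi0_schwartz)

lemma fourier_mode: "fourier (mode u) \<xi> = fourier psi0 (\<xi> - u)"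
  unfolding mode_def[abs_def] by (rule fourier_modulate)

lemma lp_proj_mode_bound: "\<exists>C>0. \<forall>l\<ge>1. \<forall>u x. norm (piece l (mode u) x) \<le> C * wgt R 1 x"
proof -
  obtain C1 where C1: "C1 > 0" "\<And>k f w A x. 1 \<le> k \<Longrightarrow> f \<in> schwartz \<Longrightarrow> (\<And>x. norm (f x) \<le> w x) \<Longrightarrow>
      (\<And>x z. w (x - z) \<le> w x * (1 + A * norm z) ^ R) \<Longrightarrow> 0 \<le> A \<Longrightarrow> A \<le> 2 * 2 ^ k \<Longrightarrow>
      norm (piece k f x) \<le> C1 * w x"
    using lp_proj_bound[of R] by blast
  obtain C0 where C0: "C0 > 0" "\<And>x. norm (psi0 x) \<le> C0 / (1 + norm x) ^ R"
    using schwartz_bound[OF psi0_schwartz] by blast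
  have "norm (piece l (mode u) x) \<le> C1 * (C0 * wgt R 1 x)" if l: "1 \<le> l" for l u x
  proof (rule C1(2)[OF l mode_schwartz, where A = 1])
    show "norm (mode u x) \<le> C0 * wgt R 1 x" for x using C0(2)[of x] by (simp add: mode_def norm_mult wgt_def)
    show "C0 * wgt R 1 (x - z) \<le> C0 * wgt R 1 x * (1 + 1 * norm z) ^ R" for x z :: 'a
      using mult_left_mono[OF wgt_peetre[of 1 1 R x z], of C0] C0(1) by (simp add: mult.assoc)
    show "(1::real) \<le> 2 * 2 ^ l" using one_le_power[of "2::real" l] by linarith
  qed simp
  then show ?thesis using C0 C1 by (intro exI[of _ "C1 * C0"]) (auto simp: mult.assoc)
qed

abbreviation "wave j \<equiv> mode (2 ^ j *\<^sub>R e1)"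

lemma psi0_energy: "(LINT \<xi>|lborel. (norm (fourier psi0 \<xi>))\<^sup>2) > 0"
proof -
  obtain x0 where x0: "fourier psi0 x0 \<noteq> 0"
  proof -
    have "fourier psi0 0 \<noteq> 0" by (simp add: fourier_psi0 theta_1)
    then show ?thesis using that by blast
  qed
  obtain c r \<delta> where cr: "r > 0" "\<delta> > 0" "3 * r \<le> norm c" "\<And>x. x \<in> ball c r \<Longrightarrow> \<delta> \<le> norm (fourier psi0 x)"
    by (rule schwartz_nonzero_ball[OF fourier_schwartz[OF psi0_schwartz] x0]) (rule that)
  note F = fourier_schwartz[OF psi0_schwartz]
  note int = schwartz_square_integrable[OF F]
  have ii: "integrable lborel (\<lambda>\<xi>. \<delta>\<^sup>2 * indicat_real (ball c r) \<xi>)"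
    by (intro integrable_mult_right integrable_real_indicator) (use emeasure_lborel_ball_finite[of c r] in auto)
  have "0 < \<delta>\<^sup>2 * measure lborel (ball c r)" using cr content_ball_pos by simp
  also have "\<dots> = (LINT \<xi>|lborel. \<delta>\<^sup>2 * indicat_real (ball c r) \<xi>)"
    by (subst Bochner_Integration.integral_mult_right_zero) (simp del: indicator_simps)
  also have "\<dots> \<le> (LINT \<xi>|lborel. (norm (fourier psi0 \<xi>))\<^sup>2)"
    using cr by (intro integral_mono[OF ii int]) (auto simp: indicator_def intro!: power_mono)
  finally show ?thesis .
qed

text \<open>After rescaling by 2^j the spectrum lies within 2^-j of \<open>e1\<close>, where the
  multiplier is at least 1/2; Plancherel turns this into the factor 1/4.\<close>

lemma wave_energy:
  assumes j0: "\<And>\<zeta>. norm (\<zeta> - e1) \<le> 1 / 2 ^ j0 \<Longrightarrow> 1 / 2 \<le> norm (phi_hat \<zeta>)" and j: "j0 \<le> j" "1 \<le> j"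
  shows "(LINT \<xi>|lborel. (norm (fourier psi0 \<xi>))\<^sup>2) / 4 \<le> (LINT x|lborel. (norm (piece j (wave j) x))\<^sup>2)"
proof -
  let ?P = "piece j (wave j)"
  note F = fourier_schwartz[OF psi0_schwartz]
  have Fm: "(\<lambda>\<xi>. fourier psi0 (\<xi> - 2 ^ j *\<^sub>R e1)) \<in> schwartz" by (intro schwartz_translate F)
  have "(LINT \<xi>|lborel. (norm (fourier psi0 \<xi>))\<^sup>2) / 4 = (LINT \<xi>|lborel. (norm (fourier psi0 (\<xi> - 2 ^ j *\<^sub>R e1)))\<^sup>2 / 4)"
    using integral_translate[of "\<lambda>\<xi>. (norm (fourier psi0 \<xi>))\<^sup>2" "- (2 ^ j *\<^sub>R e1)"] F by simp
  also have "\<dots> \<le> (LINT \<xi>|lborel. (norm (fourier ?P \<xi>))\<^sup>2)"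
  proof (rule integral_mono)
    show "integrable lborel (\<lambda>\<xi>. (norm (fourier ?P \<xi>))\<^sup>2)"
      by (intro schwartz_square_integrable fourier_schwartz lp_proj_schwartz mode_schwartz)
    show "integrable lborel (\<lambda>\<xi>. (norm (fourier psi0 (\<xi> - 2 ^ j *\<^sub>R e1)))\<^sup>2 / 4)" using schwartz_square_integrable[OF Fm] by simp
    fix \<xi>
    show "(norm (fourier psi0 (\<xi> - 2 ^ j *\<^sub>R e1)))\<^sup>2 / 4 \<le> (norm (fourier ?P \<xi>))\<^sup>2"
    proof (cases "fourier psi0 (\<xi> - 2 ^ j *\<^sub>R e1) = 0")
      case False
      then have "norm (\<xi> - 2 ^ j *\<^sub>R e1) \<le> 1" by (rule psi0_support)
      moreover have "\<xi> /\<^sub>R 2 ^ j - e1 = (\<xi> - 2 ^ j *\<^sub>R e1) /\<^sub>R 2 ^ j" by (simp add: scaleR_diff_right)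
      then have "norm (\<xi> /\<^sub>R 2 ^ j - e1) = norm (\<xi> - 2 ^ j *\<^sub>R e1) / 2 ^ j" by (simp only: norm_scaleR abs_inverse divide_inverse_commute) simp
      ultimately have "norm (\<xi> /\<^sub>R 2 ^ j - e1) \<le> 1 / 2 ^ j" by (simp add: divide_right_mono)
      also have "\<dots> \<le> 1 / 2 ^ j0" using j by (intro divide_left_mono power_increasing) auto
      finally have "1 / 2 \<le> norm (phi_hat (\<xi> /\<^sub>R 2 ^ j))" by (rule j0)
      then have "(1 / 2) * norm (fourier psi0 (\<xi> - 2 ^ j *\<^sub>R e1)) \<le> norm (phi_hat (\<xi> /\<^sub>R 2 ^ j)) * norm (fourier psi0 (\<xi> - 2 ^ j *\<^sub>R e1))"
        by (rule mult_right_mono) simp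
      also have "\<dots> = norm (fourier ?P \<xi>)"
        using j by (simp add: fourier_lp_proj[OF mode_schwartz] fourier_mode lp_hat_def norm_mult)
      finally have "(1 / 2) * norm (fourier psi0 (\<xi> - 2 ^ j *\<^sub>R e1)) \<le> norm (fourier ?P \<xi>)" .
      then have "((1 / 2) * norm (fourier psi0 (\<xi> - 2 ^ j *\<^sub>R e1)))\<^sup>2 \<le> (norm (fourier ?P \<xi>))\<^sup>2" by (intro power_mono) auto
      then show ?thesis by (simp add: power_divide)
    qed simp
  qed
  also have "\<dots> = (LINT x|lborel. (norm (?P x))\<^sup>2)"
    by (rule plancherel_norm[symmetric]) (intro lp_proj_schwartz mode_schwartz)
  finally show ?thesis .
qed

lemma lp_proj_wave_far:
  assumes "j + 2 \<le> j' \<or> j' + 2 \<le> j" "1 \<le> j" "1 \<le> j'"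
  shows "lp_hat j \<xi> * fourier (wave j') \<xi> = 0"
proof (rule ccontr)
  assume *: "lp_hat j \<xi> * fourier (wave j') \<xi> \<noteq> 0"
  then have "norm (\<xi> - 2 ^ j' *\<^sub>R e1) \<le> 1" by (auto simp: fourier_mode intro: psi0_support)
  moreover have "norm (2 ^ j' *\<^sub>R e1) = 2 ^ j'" by simp
  ultimately have 1: "norm \<xi> \<le> 2 ^ j' + 1" "2 ^ j' \<le> norm \<xi> + 1"
    using norm_triangle_ineq2[of \<xi> "2 ^ j' *\<^sub>R e1"] norm_triangle_ineq2[of "2 ^ j' *\<^sub>R e1" \<xi>] by (simp_all add: norm_minus_commute)
  have 2: "norm \<xi> < 2 * 2 ^ j" "2 ^ j < 2 * norm \<xi>" using lp_hat_support[of j \<xi>] * assms by auto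
  have 3: "(2::real) ^ 1 \<le> 2 ^ j" "(2::real) ^ 1 \<le> 2 ^ j'" using assms by (intro power_increasing; simp)+
  from assms(1) show False
  proof
    assume "j + 2 \<le> j'"
    then have "(2::real) ^ (j + 2) \<le> 2 ^ j'" by (rule power_increasing) simp
    then show False using 1 2 3 by simp
  next
    assume "j' + 2 \<le> j"
    then have "(2::real) ^ (j' + 2) \<le> 2 ^ j" by (rule power_increasing) simp
    then show False using 1 2 3 by simp
  qed
qed

text \<open>All waves enter the input inside one band, and translation keeps them from piling up:
  its norm grows like n^(1/p). In the image they fall into n different bands and give n^(1/q), which
  is at least n and hence larger.\<close>

lemma translated_waves:
  assumes p: "p > 1" and q: "0 < q" "q \<le> 1" and s: "s \<le> 0"
  shows "unbounded m (besov (s + m) p q) (besov s p q)"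
proof (rule operator_norm_modulated[where NY = "besov s p q", OF _ besov_norm_zero])
  fix C :: real assume C: "C > 0"
  have p0: "p > 0" using p by (meson less_trans zero_less_one)
  define M where "M = 2 * DIM('a)"
  have M: "2 * DIM('a) \<le> M" "2 \<le> M" using DIM_positive[where 'a='a] by (auto simp: M_def)
  obtain j0 where j0: "\<And>\<zeta>. norm (\<zeta> - e1) \<le> 1 / 2 ^ j0 \<Longrightarrow> 1 / 2 \<le> norm (phi_hat \<zeta>)" using phi_hat_near_e1 by blast
  obtain C0 where C0: "C0 > 0" "\<And>x. norm (psi0 x) \<le> C0 * wgt M 1 x"
    using schwartz_bound[OF psi0_schwartz, of M] by (auto simp: wgt_def)
  obtain C1 where C1: "C1 > 0" "\<And>l u x. l \<ge> 1 \<Longrightarrow> norm (piece l (mode u) x) \<le> C1 * wgt M 1 x"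
    using lp_proj_mode_bound[of M] by blast
  define c0 where "c0 = (LINT \<xi>|lborel. (norm (fourier psi0 \<xi>))\<^sup>2) / 4"
  have c0: "c0 > 0" using psi0_energy by (simp add: c0_def)
  have "\<exists>\<kappa>>0. \<forall>P::'a \<Rightarrow> complex. P \<in> borel_measurable borel \<longrightarrow> (\<forall>x. norm (P x) \<le> C1 * wgt M 1 x) \<longrightarrow>
     c0 \<le> (LINT x|lborel. (norm (P x))\<^sup>2) \<longrightarrow> (\<forall>\<mu>\<ge>0. ennreal (\<mu> * \<kappa>) \<le> Lp_norm lborel p (\<lambda>x. ennreal (\<mu> * norm (P x))))"
    by (rule Lp_norm_lower[OF p M(1)]) (use C1 c0 in auto)
  then obtain \<kappa> where \<kappa>1: "\<kappa> > 0" "\<forall>P::'a \<Rightarrow> complex. P \<in> borel_measurable borel \<longrightarrow> (\<forall>x. norm (P x) \<le> C1 * wgt M 1 x) \<longrightarrow>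
     c0 \<le> (LINT x|lborel. (norm (P x))\<^sup>2) \<longrightarrow> (\<forall>\<mu>\<ge>0. ennreal (\<mu> * \<kappa>) \<le> Lp_norm lborel p (\<lambda>x. ennreal (\<mu> * norm (P x))))" by blast
  note \<kappa> = \<kappa>1(1) \<kappa>1(2)[rule_format]
  obtain Z where Z: "Z > 0" "\<And>n t. (\<Sum>i<n. 1 / (1 + \<bar>t - real i\<bar>)\<^sup>2) \<le> Z" using sum_inverse_square_bound by blast
  obtain D where D: "D > 0" "\<And>I G w. admissible I G \<Longrightarrow> (\<forall>k\<in>I. \<forall>x. norm (G k x) \<le> w k x) \<Longrightarrow>
       (\<forall>k\<in>I. \<forall>x z. w k (x - z) \<le> w k x * (1 + 2 ^ k * norm z) ^ M) \<Longrightarrow>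
       localized s m (modulated m I G) D I w"
    using modulated_lp_proj[where M = M and m = m and s = s] by blast
  define J where "J = (LINT x|lborel. wgt M 1 (x::'a))"
  have J: "J > 0" unfolding J_def by (rule wgt_integral_pos[OF M(1)])
  define \<alpha> where "\<alpha> = 1 / enn2real p"
  have \<alpha>: "0 \<le> \<alpha>" "\<alpha> < 1"
  proof -
    show "0 \<le> \<alpha>" by (simp add: \<alpha>_def)
    show "\<alpha> < 1"
    proof (cases "p = \<infinity>")
      case False
      then have "enn2real 1 < enn2real p" using p by (intro enn2real_less_iff[THEN iffD2]) (auto simp: top.not_eq_extremum)
      then show ?thesis by (simp add: \<alpha>_def)
    qed (simp add: \<alpha>_def)
  qed
  define q' where "q' = 1 / enn2real q"
  have qfin: "q \<noteq> \<infinity>" using q by (auto simp: top_unique)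
  have q': "q' \<ge> 1"
  proof -
    have "enn2real q \<le> enn2real 1" using q by (intro enn2real_mono) auto
    then show ?thesis using enn2real_pos[OF q(1) qfin] by (simp add: q'_def)
  qed
  define Y where "Y = D * C0 * (Z + 1) powr (1 - \<alpha>) * J powr \<alpha>"
  have Y: "Y > 0" using D C0 Z J by (simp add: Y_def)
  obtain n :: nat where n: "n \<ge> 1" "(C * (3 powr q' * Y) / \<kappa>) * real n powr \<alpha> < real n" using powr_growth[OF \<alpha>(2)] by blast
  \<comment> \<open>Step 2 puts the waves into bands that do not see each other; the offset
    \<open>j0\<close> makes \<open>wave_energy\<close> applicable.\<close>
  define f where "f i = 2 * i + j0 + 1" for i :: nat
  \<comment> \<open>Then 2^k / 8 = 2 * 2^(f n), which exceeds every spectrum 2^(f i) + 1.\<close>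
  define k where "k = f n + 4"
  have k4: "k \<ge> 4" by (simp add: k_def)
  define t where "t i x = wave (f i) (x - real i *\<^sub>R e1)" for i x
  define G where "G k x = of_real (2 powr (- s * real k)) * (\<Sum>i<n. t i x)" for k x
  define W where "W x = (\<Sum>i<n. wgt M 1 (x - real i *\<^sub>R e1))" for x :: 'a
  have tS: "t i \<in> schwartz" for i unfolding t_def[abs_def] by (intro schwartz_translate mode_schwartz)
  have ft: "fourier (t i) \<xi> = ee (- ((real i *\<^sub>R e1) \<bullet> \<xi>)) * fourier (wave (f i)) \<xi>" for i \<xi>
    unfolding t_def[abs_def] by (rule fourier_translate) (rule schwartz_measurable[OF mode_schwartz])
  have GS: "G k \<in> schwartz" unfolding G_def[abs_def] by (intro schwartz_cmult schwartz_sum tS)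
  have adm: "admissible {k} G"
    unfolding admissible_def
  proof (intro conjI ballI allI impI)
    fix k' \<xi> assume k': "k' \<in> {k}"
    show "4 \<le> k'" "G k' \<in> schwartz" using k' k4 GS by auto
    assume "fourier (G k') \<xi> \<noteq> 0"
    then have "(\<Sum>i<n. fourier (t i) \<xi>) \<noteq> 0"
      unfolding G_def[abs_def] fourier_cmult fourier_sum[OF tS] by simp
    then obtain i where i: "i < n" "fourier (t i) \<xi> \<noteq> 0" by (meson lessThan_iff sum.not_neutral_contains_not_neutral)
    then have "norm (\<xi> - 2 ^ f i *\<^sub>R e1) \<le> 1" by (auto simp: ft fourier_mode intro: psi0_support)
    then have "norm \<xi> \<le> 2 ^ f i + 1" using norm_triangle_ineq2[of \<xi> "2 ^ f i *\<^sub>R e1"] by simp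
    moreover have "(2::real) ^ f i \<le> 2 ^ f n" using i by (intro power_increasing) (auto simp: f_def)
    moreover have "(1::real) \<le> 2 ^ f n" by simp
    moreover have "(2::real) ^ k' / 8 = 2 * 2 ^ f n" using k' by (simp add: k_def power_add)
    ultimately show "norm \<xi> \<le> 2 ^ k' / 8" by linarith
  qed simp
  have nb: "finite (nbhd {k})" "nbhd {k} \<noteq> {}" "nbhd {k} \<subseteq> {1..}" "real (card (nbhd {k})) powr q' \<le> 3 powr q'"
    using nbhd[of "{k}"] k4 by (auto simp: q'_def intro!: powr_mono2)
  define w where "w k x = 2 powr (- s * real k) * (C0 * W x)" for k :: nat and x
  have bd: "localized s m (modulated m {k} G) D {k} w"
  proof (rule D(2)[OF adm])
    show "\<forall>k\<in>{k}. \<forall>x. norm (G k x) \<le> w k x"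
    proof (intro ballI allI)
      fix k' x
      have "norm (\<Sum>i<n. t i x) \<le> (\<Sum>i<n. C0 * wgt M 1 (x - real i *\<^sub>R e1))"
        using C0(2) by (intro sum_norm_le) (simp add: t_def mode_def norm_mult)
      then have "norm (\<Sum>i<n. t i x) \<le> C0 * W x" by (simp only: W_def sum_distrib_left)
      then have "2 powr (- s * real k') * norm (\<Sum>i<n. t i x) \<le> w k' x" unfolding w_def by (rule mult_left_mono) simp
      then show "norm (G k' x) \<le> w k' x" by (simp only: G_def norm_mult norm_of_real) simp
    qed
    show "\<forall>k\<in>{k}. \<forall>x z. w k (x - z) \<le> w k x * (1 + 2 ^ k * norm z) ^ M"
    proof (intro ballI allI)
      fix k' x z
      have "W (x - z) \<le> W x * (1 + 2 ^ k' * norm z) ^ M"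
        unfolding W_def sum_distrib_right
      proof (rule sum_mono)
        fix i
        show "wgt M 1 (x - z - real i *\<^sub>R e1) \<le> wgt M 1 (x - real i *\<^sub>R e1) * (1 + 2 ^ k' * norm z) ^ M"
          using wgt_peetre[of 1 "2 ^ k'" M "x - real i *\<^sub>R e1" z] by (simp add: algebra_simps)
      qed
      then have "2 powr (- s * real k') * C0 * W (x - z) \<le> 2 powr (- s * real k') * C0 * (W x * (1 + 2 ^ k' * norm z) ^ M)"
        using C0(1) by (intro mult_left_mono) auto
      then show "w k' (x - z) \<le> w k' x * (1 + 2 ^ k' * norm z) ^ M"
        by (simp add: w_def mult.assoc)
    qed
  qed
  note sp = modulated_sparse[OF conjunct2[OF bd], simplified]
  have W0: "0 \<le> W x" for x unfolding W_def using wgt_pos[of 1 M] by (intro sum_nonneg) (auto intro: less_imp_le)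
  \<comment> \<open>Unit spacing of the translates suffices: in the direction \<open>e1\<close> the
    weights are dominated by inverse squares of distances to integers.\<close>
  have WZ: "W x \<le> Z" for x
  proof -
    have "W x \<le> (\<Sum>i<n. 1 / (1 + \<bar>x \<bullet> e1 - real i\<bar>)\<^sup>2)"
      unfolding W_def
    proof (rule sum_mono)
      fix i
      let ?y = "x - real i *\<^sub>R e1"
      have "?y \<bullet> e1 = x \<bullet> e1 - real i" using e1 by (simp add: inner_diff_left)
      then have a: "\<bar>x \<bullet> e1 - real i\<bar> \<le> norm ?y" using Basis_le_norm[OF e1, of ?y] by simp
      have "(1 + \<bar>x \<bullet> e1 - real i\<bar>)\<^sup>2 \<le> (1 + norm ?y)\<^sup>2" using a by (intro power_mono) auto
      also have "\<dots> \<le> (1 + norm ?y) ^ M" using M(2) by (intro power_increasing) auto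
      finally show "wgt M 1 ?y \<le> 1 / (1 + \<bar>x \<bullet> e1 - real i\<bar>)\<^sup>2"
        unfolding wgt_def by (intro divide_left_mono mult_pos_pos zero_less_power) (auto intro!: add_pos_nonneg)
    qed
    then show ?thesis using Z(2)[where n = n and t = "x \<bullet> e1"] by linarith
  qed
  have Wm [measurable]: "W \<in> borel_measurable borel" unfolding W_def[abs_def] by measurable
  have Wint: "integrable lborel W" "(LINT x|lborel. W x) = real n * J"
  proof -
    have 1: "integrable lborel (\<lambda>x::'a. wgt M 1 (x - y))" for y
      using integrable_affine[OF wgt_integrable[OF M(1)], of 1 "- y"] by (simp add: algebra_simps)
    then show "integrable lborel W" unfolding W_def[abs_def] by (intro Bochner_Integration.integrable_sum)
    have "(LINT x|lborel. wgt M 1 (x - y)) = J" for y :: 'a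
      using integral_translate[of "wgt M 1 :: 'a \<Rightarrow> real" "- y"] by (simp add: J_def)
    then show "(LINT x|lborel. W x) = real n * J" unfolding W_def[abs_def] using 1 by (subst Bochner_Integration.integral_sum) auto
  qed
  \<comment> \<open>Interpolation between the supremum bound by Z and the integral n J: the r-th
    power of W is at most (Z + 1)^(r-1) W. At p = \<infinity> the exponent \<alpha> is 0.\<close>
  have WL: "Lp_norm lborel p (\<lambda>x. ennreal (c * W x)) \<le> ennreal (c * ((Z + 1) powr (1 - \<alpha>) * (real n * J) powr \<alpha>))" if c: "0 \<le> c" for c
  proof (cases "p = \<infinity>")
    case True
    have "c * W x \<le> c * (Z + 1)" for x using WZ[of x] c by (intro mult_left_mono) auto
    then have "Lp_norm lborel p (\<lambda>x. ennreal (c * W x)) \<le> ennreal (c * (Z + 1))"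
      unfolding True by (intro Lp_norm_top_le) auto
    then show ?thesis using True Z J n by (simp add: \<alpha>_def)
  next
    case False
    define r where "r = enn2real p"
    have r: "r > 1" using \<alpha> enn2real_pos[OF p0 False] by (simp add: \<alpha>_def r_def)
    show ?thesis
    proof (rule Lp_norm_le[OF p0 False])
      show "0 \<le> c * W x" for x using c W0 by simp
      have "(\<integral>\<^sup>+x. ennreal ((c * W x) powr enn2real p) \<partial>lborel) \<le> (\<integral>\<^sup>+x. ennreal (c powr r * (Z + 1) powr (r - 1) * W x) \<partial>lborel)"
      proof (intro nn_integral_mono ennreal_leI)
        fix x
        have "W x powr (r - 1) \<le> (Z + 1) powr (r - 1)" using W0[of x] WZ[of x] r by (intro powr_mono2) auto
        then have "W x powr (r - 1) * W x \<le> (Z + 1) powr (r - 1) * W x" using W0[of x] by (rule mult_right_mono)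
        then have "W x powr r \<le> (Z + 1) powr (r - 1) * W x" using powr_mult_base[of "W x" "r - 1"] W0[of x] by (simp add: mult.commute)
        then have "c powr r * W x powr r \<le> c powr r * ((Z + 1) powr (r - 1) * W x)" by (rule mult_left_mono) simp
        then show "(c * W x) powr enn2real p \<le> c powr r * (Z + 1) powr (r - 1) * W x" using c W0[of x] by (simp add: powr_mult r_def mult.assoc)
      qed
      also have "\<dots> = ennreal (c powr r * (Z + 1) powr (r - 1) * (real n * J))"
        using Wint W0 Z by (subst nn_integral_eq_integral) auto
      also have "c powr r * (Z + 1) powr (r - 1) * (real n * J) = (c * ((Z + 1) powr (1 - \<alpha>) * (real n * J) powr \<alpha>)) powr enn2real p"
      proof -
        have "(1 - \<alpha>) * r = r - 1" "\<alpha> * r = 1" using r by (auto simp: \<alpha>_def r_def[symmetric] field_simps)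
        then show ?thesis using c Z J n by (simp add: powr_mult powr_powr r_def[symmetric])
      qed
      finally show "(\<integral>\<^sup>+x. ennreal ((c * W x) powr enn2real p) \<partial>lborel) \<le> ennreal ((c * ((Z + 1) powr (1 - \<alpha>) * (real n * J) powr \<alpha>)) powr enn2real p)" .
    qed (use c in auto)
  qed
  have "besov (s + m) p q (dist_of (modulated m {k} G)) \<le> ennreal (real (card (nbhd {k})) powr (1 / enn2real q) * (Y * real n powr \<alpha>))"
  proof (rule besov_norm_le[OF q(1) nb(1-3)])
    fix l assume l: "l \<in> nbhd {k}"
    have "2 powr ((s + m) * real l) * norm (piece l (modulated m {k} G) x) \<le> D * C0 * W x" for x
    proof -
      have eq: "2 powr (s * real k) * w k x = C0 * W x" by (simp add: w_def powr_minus)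
      show ?thesis using sp(2)[OF l, rule_format, of x] unfolding eq by (simp only: mult.assoc)
    qed
    moreover have "piece l (modulated m {k} G) \<in> borel_measurable borel"
      by (intro schwartz_measurable lp_proj_schwartz modulated_schwartz adm)
    ultimately have "Lp_norm lborel p (\<lambda>x. ennreal (2 powr ((s + m) * real l) * norm (piece l (modulated m {k} G) x))) \<le> Lp_norm lborel p (\<lambda>x. ennreal (D * C0 * W x))"
      by (intro Lp_norm_mono ennreal_leI) auto
    also have "\<dots> \<le> ennreal (D * C0 * ((Z + 1) powr (1 - \<alpha>) * (real n * J) powr \<alpha>))" by (rule WL) (use D C0 in auto)
    also have "D * C0 * ((Z + 1) powr (1 - \<alpha>) * (real n * J) powr \<alpha>) = Y * real n powr \<alpha>"
      using J by (simp add: Y_def powr_mult)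
    finally show "Lp_norm lborel p (\<lambda>x. ennreal (2 powr ((s + m) * real l) * norm (piece l (modulated m {k} G) x))) \<le> ennreal (Y * real n powr \<alpha>)" .
  qed (use bd sp Y in auto)
  also have "\<dots> \<le> ennreal (3 powr q' * (Y * real n powr \<alpha>))"
    using nb(4) Y by (intro ennreal_leI mult_right_mono) (auto simp: q'_def)
  finally have 1: "besov (s + m) p q (dist_of (modulated m {k} G)) \<le> ennreal (3 powr q' * (Y * real n powr \<alpha>))" .
  have "ennreal (real (card (f ` {..<n})) powr (1 / enn2real q) * \<kappa>) \<le> besov s p q (dist_of (\<lambda>x. \<Sum>k\<in>{k}. G k x))"
  proof (rule besov_norm_ge[OF q(1)])
    fix l assume "l \<in> f ` {..<n}"
    then obtain i where i: "i < n" "l = f i" by auto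
    have l1: "l \<ge> 1" using i by (simp add: f_def)
    have pr: "piece l (\<lambda>x. \<Sum>k\<in>{k}. G k x) x = of_real (2 powr (- s * real k)) * piece l (t i) x" for x
    proof -
      have "piece l (\<lambda>x. \<Sum>k\<in>{k}. G k x) x = (\<Sum>i'<n. of_real (2 powr (- s * real k)) * piece l (t i') x)"
        unfolding G_def sum_distrib_left using lp_proj_sum[OF tS, where I = "{..<n}" and c = "\<lambda>_. of_real (2 powr (- s * real k))"] by simp
      also have "\<dots> = (\<Sum>i'<n. if i' = i then of_real (2 powr (- s * real k)) * piece l (t i) x else 0)"
      proof (rule sum.cong[OF refl])
        fix i'
        show "of_real (2 powr (- s * real k)) * piece l (t i') x = (if i' = i then of_real (2 powr (- s * real k)) * piece l (t i) x else 0)"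
        proof (cases "i' = i")
          case False
          have "lp_hat l \<xi> * fourier (wave (f i')) \<xi> = 0" for \<xi>
            using False i by (intro lp_proj_wave_far) (auto simp: f_def)
          then have "lp_hat l \<xi> * fourier (t i') \<xi> = 0" for \<xi> by (simp add: ft)
          then show ?thesis using False lp_proj_vanish[OF tS] by simp
        qed simp
      qed
      finally show ?thesis using i by simp
    qed
    let ?P = "piece l (t i)"
    have Pm: "?P \<in> borel_measurable borel" by (intro schwartz_measurable lp_proj_schwartz tS)
    have tr: "?P x = piece l (wave l) (x - real i *\<^sub>R e1)" for x
      unfolding t_def i(2)[symmetric] by (rule lp_proj_translate[OF mode_schwartz l1])
    let ?Q = "piece l (wave l)"
    have Qm: "?Q \<in> borel_measurable borel" by (intro schwartz_measurable lp_proj_schwartz mode_schwartz)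
    have "ennreal (1 * \<kappa>) \<le> ennreal (2 powr (s * (real l - real k)) * \<kappa>)"
    proof -
      have "l \<le> k" using i by (simp add: k_def f_def)
      then have "1 \<le> 2 powr (s * (real l - real k))" using s by (intro ge_one_powr_ge_zero) (auto intro: mult_nonpos_nonpos)
      then show ?thesis using \<kappa>(1) by (intro ennreal_leI mult_right_mono) auto
    qed
    also have "\<dots> \<le> Lp_norm lborel p (\<lambda>x. ennreal (2 powr (s * (real l - real k)) * norm (?Q x)))"
    proof (rule \<kappa>(2)[OF Qm])
      show "norm (?Q x) \<le> C1 * wgt M 1 x" for x by (rule C1(2)[OF l1])
      show "c0 \<le> (LINT x|lborel. (norm (?Q x))\<^sup>2)" unfolding c0_def
        by (rule wave_energy[OF j0]) (use i in \<open>auto simp: f_def\<close>)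
    qed simp
    also have "\<dots> = Lp_norm lborel p (\<lambda>x. ennreal (2 powr (s * (real l - real k)) * norm (?Q (x - real i *\<^sub>R e1))))"
    proof (cases "p = \<infinity>")
      case False
      have "(\<integral>\<^sup>+x. enn_powr (ennreal (2 powr (s * (real l - real k)) * norm (?Q x))) (enn2real p) \<partial>lborel) =
          (\<integral>\<^sup>+x. enn_powr (ennreal (2 powr (s * (real l - real k)) * norm (?Q (x - real i *\<^sub>R e1)))) (enn2real p) \<partial>lborel)"
        using Qm nn_integral_affine[of "\<lambda>x. ennreal ((2 powr (s * (real l - real k)) * norm (?Q x)) powr enn2real p)" 1 "- (real i *\<^sub>R e1)"]
        by (simp add: enn_powr_ennreal)
      then show ?thesis by (simp only: Lp_norm_finite[OF False])
    next
      case True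
      let ?u = "\<lambda>x. ennreal (2 powr (s * (real l - real k)) * norm (?Q x))"
      \<comment> \<open>The essential supremum is unchanged by translation because null sets
        are.\<close>
      have ae: "(AE x in lborel. P (x - y)) \<longleftrightarrow> (AE x in lborel. P x)" if "Measurable.pred borel P" for P and y :: 'a
      proof -
        have "(AE x in distr lborel borel ((+) (- y)). P x) \<longleftrightarrow> (AE x in lborel. P (- y + x))"
          using that by (intro AE_distr_iff) auto
        then show ?thesis unfolding lborel_distr_plus by (simp add: algebra_simps)
      qed
      have m1: "?u \<in> borel_measurable lborel" "(\<lambda>x. ?u (x - real i *\<^sub>R e1)) \<in> borel_measurable lborel"
        using Qm by auto
      have "(AE x in lborel. ?u (x - real i *\<^sub>R e1) \<le> z) \<longleftrightarrow> (AE x in lborel. ?u x \<le> z)" for z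
        using Qm by (intro ae[of "\<lambda>x. ?u x \<le> z"]) measurable
      then have "esssup lborel (\<lambda>x. ?u (x - real i *\<^sub>R e1)) = esssup lborel ?u"
        by (simp only: esssup_eq_AE[OF m1(1)] esssup_eq_AE[OF m1(2)])
      then show ?thesis using True by (simp add: Lp_norm_def)
    qed
    also have "\<dots> = Lp_norm lborel p (\<lambda>x. ennreal (2 powr (s * real l) * norm (piece l (\<lambda>x. \<Sum>k\<in>{k}. G k x) x)))"
    proof -
      have "2 powr (s * (real l - real k)) = 2 powr (s * real l) * 2 powr (- s * real k)"
        by (simp add: powr_add[symmetric] algebra_simps)
      then show ?thesis unfolding pr tr by (simp add: norm_mult mult.assoc)
    qed
    finally show "ennreal \<kappa> \<le> Lp_norm lborel p (\<lambda>x. ennreal (2 powr (s * real l) * norm (piece l (\<lambda>x. \<Sum>k\<in>{k}. G k x) x)))" by simp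
  qed (use n \<kappa> in \<open>auto simp: f_def lessThan_empty_iff\<close>)
  also have "card (f ` {..<n}) = n" by (simp add: card_image inj_on_def f_def)
  finally have 2: "ennreal (real n powr q' * \<kappa>) \<le> besov s p q (dist_of (\<lambda>x. \<Sum>k\<in>{k}. G k x))" by (simp add: q'_def)
  have "C * (3 powr q' * (Y * real n powr \<alpha>)) < real n powr q' * \<kappa>"
  proof -
    have "C * (3 powr q' * (Y * real n powr \<alpha>)) < real n * \<kappa>" using n(2) \<kappa>(1) by (simp add: field_simps)
    also have "\<dots> \<le> real n powr q' * \<kappa>" using n(1) q' \<kappa>(1) powr_mono[of 1 q' "real n"] by (intro mult_right_mono) auto
    finally show ?thesis .
  qed
  then show "exceeds C m (besov (s + m) p q) (besov s p q)"
    using adm 1 2 Y by (intro exI[of _ "{k}"] exI[of _ G] exI[of _ "3 powr q' * (Y * real n powr \<alpha>)"] exI[of _ "real n powr q' * \<kappa>"] conjI) auto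
qed

end

subsection \<open>Lattice sums and Fejer kernels\<close>

definition lattice :: "'a::euclidean_space set" where
  "lattice = {v. \<forall>b\<in>Basis. v \<bullet> b \<in> \<int>}"

definition cube :: "nat \<Rightarrow> 'a::euclidean_space set" where
  "cube R = {v\<in>lattice. \<forall>b\<in>Basis. \<bar>v \<bullet> b\<bar> \<le> real R}"

lemma lattice_diff: "u \<in> lattice \<Longrightarrow> v \<in> lattice \<Longrightarrow> u - v \<in> lattice"
  by (auto simp: lattice_def inner_diff_left)

lemma lattice_add: "u \<in> lattice \<Longrightarrow> v \<in> lattice \<Longrightarrow> u + v \<in> lattice"
  by (auto simp: lattice_def inner_add_left)

lemma lattice_Basis: "b \<in> Basis \<Longrightarrow> b \<in> lattice"
  by (auto simp: lattice_def inner_Basis)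

lemma lattice_scale: "u \<in> lattice \<Longrightarrow> real n *\<^sub>R u \<in> lattice"
  by (auto simp: lattice_def)

lemma lattice_norm_ge_1:
  assumes "v \<in> lattice" "v \<noteq> 0" shows "1 \<le> norm v"
proof -
  obtain b where b: "b \<in> Basis" "v \<bullet> b \<noteq> 0" using assms(2) euclidean_eq_iff[of v 0] by auto
  then have "v \<bullet> b \<in> \<int>" using assms(1) by (simp add: lattice_def)
  then obtain n :: int where n: "v \<bullet> b = of_int n" by (auto elim: Ints_cases)
  then have "n \<noteq> 0" using b by auto
  then have "1 \<le> \<bar>v \<bullet> b\<bar>" unfolding n by (simp flip: of_int_abs)
  then show ?thesis using Basis_le_norm[OF b(1), of v] by linarith
qed

text \<open>Integer coordinates parametrise the lattice points, which reduces counting to a product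
  of intervals.\<close>

lemma cube_bij:
  "bij_betw (\<lambda>\<nu>. \<Sum>b\<in>Basis. of_int (\<nu> b) *\<^sub>R b) (PiE Basis (\<lambda>_. {- int R..int R})) (cube R :: 'a::euclidean_space set)"
proof (rule bij_betwI')
  have inner: "(\<Sum>c\<in>Basis. of_int (\<nu> c) *\<^sub>R c) \<bullet> b = of_int (\<nu> b)" if "b \<in> Basis" for \<nu> :: "'a \<Rightarrow> int" and b
    using that by simp
  show "((\<Sum>b\<in>Basis. of_int (\<mu> b) *\<^sub>R b) = (\<Sum>b\<in>Basis. of_int (\<nu> b) *\<^sub>R b)) = (\<mu> = \<nu>)"
    if "\<mu> \<in> PiE Basis (\<lambda>_. {- int R..int R})" "\<nu> \<in> PiE Basis (\<lambda>_. {- int R..int R})" for \<mu> \<nu> :: "'a \<Rightarrow> int"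
  proof
    assume eq: "(\<Sum>b\<in>Basis. of_int (\<mu> b) *\<^sub>R b) = (\<Sum>b\<in>Basis. of_int (\<nu> b) *\<^sub>R b)"
    have "\<mu> b = \<nu> b" if "b \<in> Basis" for b
      using arg_cong[OF eq, of "\<lambda>v. v \<bullet> b"] inner[OF that, of \<mu>] inner[OF that, of \<nu>] by simp
    then show "\<mu> = \<nu>" using that by (intro PiE_ext) auto
  qed simp
  show "(\<Sum>b\<in>Basis. of_int (\<nu> b) *\<^sub>R b) \<in> cube R" if "\<nu> \<in> PiE Basis (\<lambda>_. {- int R..int R})" for \<nu> :: "'a \<Rightarrow> int"
  proof -
    have "\<bar>real_of_int (\<nu> b)\<bar> \<le> real R" if "b \<in> Basis" for b
    proof -
      have "\<nu> b \<in> {- int R..int R}" using that \<open>\<nu> \<in> _\<close> by (auto dest: PiE_mem)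
      then have "\<bar>\<nu> b\<bar> \<le> int R" by auto
      then show ?thesis by linarith
    qed
    then show ?thesis by (auto simp: cube_def lattice_def)
  qed
  show "\<exists>\<nu>\<in>PiE Basis (\<lambda>_. {- int R..int R}). v = (\<Sum>b\<in>Basis. of_int (\<nu> b) *\<^sub>R b)" if v: "v \<in> cube R" for v :: 'a
  proof (intro bexI[of _ "restrict (\<lambda>b. \<lfloor>v \<bullet> b\<rfloor>) Basis"])
    have fl: "of_int \<lfloor>v \<bullet> b\<rfloor> = v \<bullet> b" if "b \<in> Basis" for b
      using v that by (auto simp: cube_def lattice_def elim: Ints_cases)
    show "v = (\<Sum>b\<in>Basis. of_int (restrict (\<lambda>b. \<lfloor>v \<bullet> b\<rfloor>) Basis b) *\<^sub>R b)"
      by (subst euclidean_representation[symmetric, of v]) (intro sum.cong, auto simp: fl)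
    show "restrict (\<lambda>b. \<lfloor>v \<bullet> b\<rfloor>) Basis \<in> PiE Basis (\<lambda>_. {- int R..int R})"
    proof (rule restrict_PiE_iff[THEN iffD2], intro ballI)
      fix b :: 'a assume b: "b \<in> Basis"
      then have "\<bar>v \<bullet> b\<bar> \<le> real R" using v by (simp add: cube_def)
      then have "\<bar>of_int \<lfloor>v \<bullet> b\<rfloor>\<bar> \<le> real R" by (simp only: fl[OF b])
      then show "\<lfloor>v \<bullet> b\<rfloor> \<in> {- int R..int R}" by auto
    qed
  qed
qed

lemma finite_cube: "finite (cube R :: 'a::euclidean_space set)"
  and card_cube: "card (cube R :: 'a::euclidean_space set) = (2 * R + 1) ^ DIM('a)"
proof -
  have "finite (PiE (Basis :: 'a set) (\<lambda>_. {- int R..int R}))" by (intro finite_PiE) auto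
  then show "finite (cube R :: 'a set)" using bij_betw_finite[OF cube_bij[of R, where 'a='a]] by blast
  have "card (cube R :: 'a set) = card (PiE (Basis :: 'a set) (\<lambda>_. {- int R..int R}))"
    using bij_betw_same_card[OF cube_bij[of R, where 'a='a]] by simp
  also have "\<dots> = (2 * R + 1) ^ DIM('a)" by (simp add: card_PiE nat_add_distrib nat_mult_distrib)
  finally show "card (cube R :: 'a set) = (2 * R + 1) ^ DIM('a)" .
qed

lemma cube_mono: "r \<le> R \<Longrightarrow> cube r \<subseteq> cube R"
  by (force simp: cube_def)

lemma cube_norm: "v \<in> lattice \<Longrightarrow> norm v \<le> real R \<Longrightarrow> v \<in> cube R"
  using Basis_le_norm order_trans by (fastforce simp: cube_def)

text \<open>Summation by parts: multiplying by 1 - e(x . b) replaces the coefficients by their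
  differences. The margin of 1 between r and R keeps the shifted support inside the cube.\<close>

lemma lattice_shift:
  fixes g :: "'a::euclidean_space \<Rightarrow> complex"
  assumes supp: "\<And>v. v \<in> lattice \<Longrightarrow> g v \<noteq> 0 \<Longrightarrow> v \<in> cube r" and R: "r + 1 \<le> R" and b: "b \<in> Basis"
  shows "(1 - ee (x \<bullet> b)) * (\<Sum>v\<in>cube R. g v * ee (x \<bullet> v)) = (\<Sum>v\<in>cube R. (g v - g (v - b)) * ee (x \<bullet> v))"
proof -
  have 1: "(\<Sum>v\<in>cube R. g v * ee (x \<bullet> v)) = (\<Sum>v\<in>cube r. g v * ee (x \<bullet> v))"
    using supp R cube_mono[of r R] by (intro sum.mono_neutral_right finite_cube) (auto simp: cube_def)
  have bb: "\<bar>b \<bullet> c\<bar> \<le> 1" if "c \<in> Basis" for c using that b by (simp add: inner_Basis)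
  have "(\<Sum>v\<in>cube R. g (v - b) * ee (x \<bullet> v)) = (\<Sum>v\<in>(\<lambda>u. u + b) ` cube r. g (v - b) * ee (x \<bullet> v))"
  proof (rule sum.mono_neutral_right[OF finite_cube])
    show "(\<lambda>u. u + b) ` cube r \<subseteq> cube R"
    proof
      fix v assume "v \<in> (\<lambda>u. u + b) ` cube r"
      then obtain u where u: "u \<in> cube r" "v = u + b" by auto
      have "\<bar>v \<bullet> c\<bar> \<le> real R" if "c \<in> Basis" for c
      proof -
        have "\<bar>v \<bullet> c\<bar> \<le> \<bar>u \<bullet> c\<bar> + \<bar>b \<bullet> c\<bar>" unfolding u by (simp add: inner_add_left)
        also have "\<dots> \<le> real r + 1" using u(1) that bb[OF that] by (intro add_mono) (auto simp: cube_def)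
        also have "\<dots> \<le> real R" using R by linarith
        finally show ?thesis .
      qed
      then show "v \<in> cube R" using u lattice_add[OF _ lattice_Basis[OF b]] by (auto simp: cube_def)
    qed
    show "\<forall>v\<in>cube R - (\<lambda>u. u + b) ` cube r. g (v - b) * ee (x \<bullet> v) = 0"
    proof
      fix v assume v: "v \<in> cube R - (\<lambda>u. u + b) ` cube r"
      then have "v - b \<in> lattice" using lattice_diff[OF _ lattice_Basis[OF b]] by (auto simp: cube_def)
      moreover have "v - b \<notin> cube r" using v by (metis DiffD2 diff_add_cancel image_eqI)
      ultimately show "g (v - b) * ee (x \<bullet> v) = 0" using supp by auto
    qed
  qed
  also have "\<dots> = (\<Sum>u\<in>cube r. g u * ee (x \<bullet> (u + b)))"
    by (subst sum.reindex) (auto simp: inj_on_def)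
  also have "\<dots> = ee (x \<bullet> b) * (\<Sum>u\<in>cube r. g u * ee (x \<bullet> u))"
    by (simp add: inner_add_right ee_add sum_distrib_left mult_ac)
  finally show ?thesis by (simp add: left_diff_distrib sum_subtractf 1)
qed

definition fdiff :: "real \<Rightarrow> 'a \<Rightarrow> ('a::euclidean_space \<Rightarrow> complex) \<Rightarrow> 'a \<Rightarrow> complex" where
  "fdiff h b g \<xi> = g \<xi> - g (\<xi> - h *\<^sub>R b)"

lemma fdiff_schwartz: "g \<in> schwartz \<Longrightarrow> fdiff h b g \<in> schwartz"
proof -
  assume g: "g \<in> schwartz"
  have "(\<lambda>\<xi>. g \<xi> + (- 1) * g (\<xi> - h *\<^sub>R b)) \<in> schwartz" by (intro schwartz_add schwartz_cmult schwartz_translate g)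
  then show ?thesis by (simp add: fdiff_def[abs_def])
qed

lemma pd_fdiff:
  assumes g: "g \<in> schwartz" shows "pd b (fdiff h b g) = fdiff h b (pd b g)"
proof
  fix \<xi>
  have "((\<lambda>\<xi>. g (\<xi> - h *\<^sub>R b)) has_derivative (\<lambda>k. frechet_derivative g (at (\<xi> - h *\<^sub>R b)) k)) (at \<xi>)"
    by (rule has_derivative_compose[of "\<lambda>\<xi>. \<xi> - h *\<^sub>R b" "\<lambda>k. k"]) (auto intro!: derivative_eq_intros schwartzD(2) g)
  then have "(fdiff h b g has_derivative (\<lambda>k. frechet_derivative g (at \<xi>) k - frechet_derivative g (at (\<xi> - h *\<^sub>R b)) k)) (at \<xi>)"
    unfolding fdiff_def[abs_def] by (intro has_derivative_diff schwartzD(2) g)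
  then show "pd b (fdiff h b g) \<xi> = fdiff h b (pd b g) \<xi>"
    by (simp add: pd_def fdiff_def frechet_derivative_at[symmetric])
qed

lemma schwartz_line_bound:
  assumes F: "F \<in> schwartz" and B: "\<And>y. norm (pd b F y) \<le> B"
  shows "norm (fdiff h b F \<xi>) \<le> B * \<bar>h\<bar>"
proof -
  have B0: "0 \<le> B" using order_trans[OF norm_ge_zero B] .
  have lin: "frechet_derivative F (at y) (k *\<^sub>R b) = k *\<^sub>R pd b F y" for y k
    unfolding pd_def using schwartzD(2)[OF F, of y] has_derivative_linear linear_cmul by blast
  have "norm (F (\<xi> - 0 *\<^sub>R b) - F (\<xi> - h *\<^sub>R b)) \<le> B * norm (0 - h)"
  proof (rule differentiable_bound[of UNIV "\<lambda>t. F (\<xi> - t *\<^sub>R b)" "\<lambda>t k. (- k) *\<^sub>R pd b F (\<xi> - t *\<^sub>R b)"])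
    fix t :: real
    have "((\<lambda>t. F (\<xi> - t *\<^sub>R b)) has_derivative (\<lambda>k. frechet_derivative F (at (\<xi> - t *\<^sub>R b)) ((- k) *\<^sub>R b))) (at t)"
      by (rule has_derivative_compose[of "\<lambda>t. \<xi> - t *\<^sub>R b" "\<lambda>k. (- k) *\<^sub>R b"]) (auto intro!: derivative_eq_intros schwartzD(2) F)
    then show "((\<lambda>t. F (\<xi> - t *\<^sub>R b)) has_derivative (\<lambda>k. (- k) *\<^sub>R pd b F (\<xi> - t *\<^sub>R b))) (at t within UNIV)"
      unfolding lin by simp
    show "onorm (\<lambda>k. (- k) *\<^sub>R pd b F (\<xi> - t *\<^sub>R b)) \<le> B"
    proof (rule onorm_bound[OF B0])
      show "norm ((- k) *\<^sub>R pd b F (\<xi> - t *\<^sub>R b)) \<le> B * norm k" for k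
        using mult_left_mono[OF B[of "\<xi> - t *\<^sub>R b"], of "norm k"] by (simp add: mult.commute)
    qed
  qed auto
  then show ?thesis by (simp add: fdiff_def)
qed

lemma fdiff_power:
  assumes "g \<in> schwartz" "b \<in> Basis"
  shows "(fdiff h b ^^ N) g \<in> schwartz \<and> pd b ((fdiff h b ^^ N) g) = (fdiff h b ^^ N) (pd b g)"
  by (induction N) (simp_all add: assms fdiff_schwartz pd_fdiff)

text \<open>Differences commute with derivatives, so each of the N differences yields a factor h in
  exchange for one derivative.\<close>

lemma fdiff_power_bound:
  assumes "g \<in> schwartz" "b \<in> Basis"
  shows "\<exists>C>0. \<forall>h \<xi>. norm ((fdiff h b ^^ N) g \<xi>) \<le> C * \<bar>h\<bar> ^ N"
  using assms(1)
proof (induction N arbitrary: g)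
  case 0
  obtain C where "C > 0" "\<And>x. norm (g x) \<le> C" using schwartz_bounded[OF 0] by blast
  then show ?case by (intro exI[of _ C]) simp
next
  case (Suc N)
  obtain C where C: "C > 0" "\<And>h \<xi>. norm ((fdiff h b ^^ N) (pd b g) \<xi>) \<le> C * \<bar>h\<bar> ^ N"
    using Suc.IH[OF schwartzD(4)[OF Suc.prems assms(2)]] by blast
  have "norm ((fdiff h b ^^ Suc N) g \<xi>) \<le> C * \<bar>h\<bar> ^ Suc N" for h \<xi>
  proof -
    have "norm (fdiff h b ((fdiff h b ^^ N) g) \<xi>) \<le> (C * \<bar>h\<bar> ^ N) * \<bar>h\<bar>"
      using fdiff_power[OF Suc.prems assms(2), where h = h and N = N] C(2) by (intro schwartz_line_bound) auto
    then show ?thesis by (simp add: mult_ac)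
  qed
  then show ?case using C(1) by blast
qed

text \<open>N summations by parts gain n^-N, while the number of lattice points, of order n^d, is
  offset by the normalisation.\<close>

lemma lattice_sum_decay:
  fixes g :: "'a::euclidean_space \<Rightarrow> complex"
  assumes g: "g \<in> schwartz" "\<And>\<xi>. 2 \<le> norm \<xi> \<Longrightarrow> g \<xi> = 0" and b: "b \<in> Basis"
  shows "\<exists>C>0. \<forall>n\<ge>1. \<forall>x. norm (1 - ee (x \<bullet> b)) ^ N * norm (of_real (1 / real n ^ DIM('a)) * (\<Sum>v\<in>cube (2 * n). g (v /\<^sub>R real n) * ee (x \<bullet> v))) \<le> C / real n ^ N"
proof -
  obtain C where C: "C > 0" "\<And>h \<xi>. norm ((fdiff h b ^^ N) g \<xi>) \<le> C * \<bar>h\<bar> ^ N"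
    using fdiff_power_bound[OF g(1) b] by blast
  have "norm (1 - ee (x \<bullet> b)) ^ N * norm (of_real (1 / real n ^ DIM('a)) * (\<Sum>v\<in>cube (2 * n). g (v /\<^sub>R real n) * ee (x \<bullet> v))) \<le>
      (real (5 + 2 * N) ^ DIM('a) * C) / real n ^ N" if n: "n \<ge> 1" for n and x :: 'a
  proof -
    \<comment> \<open>The coefficients are supported in |v| < 2n and each difference enlarges the
      support by one lattice step.\<close>
    define R where "R = 2 * n + N"
    define G :: "nat \<Rightarrow> 'a \<Rightarrow> complex" where "G i v = (fdiff (1 / real n) b ^^ i) g (v /\<^sub>R real n)" for i v
    have step: "G (Suc i) v = G i v - G i (v - b)" for i v
      by (simp add: G_def fdiff_def scaleR_diff_right inverse_eq_divide)
    have supp: "v \<in> cube (2 * n + i)" if "v \<in> lattice" "G i v \<noteq> 0" for v i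
      using that
    proof (induction i arbitrary: v)
      case 0
      then have "norm (v /\<^sub>R real n) < 2" using g(2)[of "v /\<^sub>R real n"] by (force simp: G_def)
      then show ?case using 0 n by (intro cube_norm) (auto simp: field_simps)
    next
      case (Suc i)
      have "G i v \<noteq> 0 \<or> G i (v - b) \<noteq> 0" using Suc.prems(2) unfolding step by auto
      then have "v \<in> cube (2 * n + i) \<or> v - b \<in> cube (2 * n + i)"
        using Suc.IH Suc.prems(1) lattice_diff[OF Suc.prems(1) lattice_Basis[OF b]] by blast
      then show ?case
      proof
        assume "v \<in> cube (2 * n + i)"
        then show ?thesis using cube_mono[of "2 * n + i" "2 * n + Suc i"] by auto
      next
        assume a: "v - b \<in> cube (2 * n + i)"
        have "\<bar>v \<bullet> c\<bar> \<le> real (2 * n + Suc i)" if "c \<in> Basis" for c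
        proof -
          have "\<bar>(v - b) \<bullet> c\<bar> \<le> real (2 * n + i)" using a that by (simp add: cube_def)
          moreover have "\<bar>b \<bullet> c\<bar> \<le> 1" using that b by (simp add: inner_Basis)
          ultimately show ?thesis by (simp add: inner_diff_left)
        qed
        then show ?thesis using Suc.prems(1) by (simp add: cube_def)
      qed
    qed
    have iter: "(1 - ee (x \<bullet> b)) ^ i * (\<Sum>v\<in>cube R. G 0 v * ee (x \<bullet> v)) = (\<Sum>v\<in>cube R. G i v * ee (x \<bullet> v))" if "i \<le> N" for i
      using that
    proof (induction i)
      case (Suc i)
      have "2 * n + i + 1 \<le> R" using Suc.prems by (simp add: R_def)
      then have "(1 - ee (x \<bullet> b)) * (\<Sum>v\<in>cube R. G i v * ee (x \<bullet> v)) = (\<Sum>v\<in>cube R. G (Suc i) v * ee (x \<bullet> v))"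
        unfolding step by (intro lattice_shift[where r = "2 * n + i"] supp b)
      then show ?case using Suc by (simp only: power_Suc mult.assoc Suc_leD)
    qed simp
    have "(\<Sum>v\<in>cube (2 * n). g (v /\<^sub>R real n) * ee (x \<bullet> v)) = (\<Sum>v\<in>cube R. G 0 v * ee (x \<bullet> v))"
      using supp[where i = 0] cube_mono[of "2 * n" R]
      by (subst sum.mono_neutral_left[OF finite_cube, of "cube (2 * n)" R]) (auto simp: G_def R_def cube_def)
    then have "norm (1 - ee (x \<bullet> b)) ^ N * norm (\<Sum>v\<in>cube (2 * n). g (v /\<^sub>R real n) * ee (x \<bullet> v)) = norm (\<Sum>v\<in>cube R. G N v * ee (x \<bullet> v))"
      using iter[of N] by (simp flip: norm_power norm_mult)
    also have "\<dots> \<le> (\<Sum>v\<in>(cube R :: 'a set). C * \<bar>1 / real n\<bar> ^ N)"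
      using C(2)[of "1 / real n"] by (intro sum_norm_le) (simp add: norm_mult G_def)
    also have "\<dots> = real ((2 * R + 1) ^ DIM('a)) * (C / real n ^ N)"
      by (simp add: card_cube power_one_over)
    also have "\<dots> \<le> (real (5 + 2 * N) * real n) ^ DIM('a) * (C / real n ^ N)"
    proof (rule mult_right_mono)
      have "2 * R + 1 \<le> 5 * n + 2 * e" if "N \<le> e" for e using that n by (simp add: R_def)
      from this[of "N * n"] have "2 * R + 1 \<le> (5 + 2 * N) * n" using n by (simp add: distrib_right mult.assoc)
      then have "real ((2 * R + 1) ^ DIM('a)) \<le> real (((5 + 2 * N) * n) ^ DIM('a))" by (intro of_nat_mono power_mono) auto
      then show "real ((2 * R + 1) ^ DIM('a)) \<le> (real (5 + 2 * N) * real n) ^ DIM('a)" by simp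
    qed (use C in auto)
    finally have "norm (1 - ee (x \<bullet> b)) ^ N * norm (\<Sum>v\<in>cube (2 * n). g (v /\<^sub>R real n) * ee (x \<bullet> v)) / real n ^ DIM('a) \<le>
        (real (5 + 2 * N) * real n) ^ DIM('a) * (C / real n ^ N) / real n ^ DIM('a)"
      by (rule divide_right_mono) simp
    also have "\<dots> = (real (5 + 2 * N) ^ DIM('a) * C) / real n ^ N" using n unfolding power_mult_distrib by simp
    finally show ?thesis by (simp add: norm_mult norm_divide norm_power)
  qed
  then show ?thesis using C(1) by (intro exI[of _ "real (5 + 2 * N) ^ DIM('a) * C"]) auto
qed

text \<open>A periodic substitute for the distance to the integer lattice: it vanishes exactly there
  and is Lipschitz.\<close>

definition gap :: "'a::euclidean_space \<Rightarrow> real" where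
  "gap x = (\<Sum>b\<in>Basis. norm (1 - ee (x \<bullet> b)))"

lemma gap_nonneg: "0 \<le> gap x" by (simp add: gap_def sum_nonneg)

lemma norm_one_minus_ee: "norm (1 - ee t) \<le> 2 * pi * \<bar>t\<bar>"
proof -
  have "norm (iexp (2 * pi * t) - (\<Sum>k\<le>0. (\<i> * of_real (2 * pi * t)) ^ k / fact k)) \<le> \<bar>2 * pi * t\<bar> ^ Suc 0 / fact (Suc 0)"
    by (rule iexp_approx1)
  then show ?thesis by (simp add: ee_exp norm_minus_commute abs_mult mult_ac)
qed

lemma norm_one_minus_ee_add: "norm (1 - ee (s + t)) \<le> norm (1 - ee s) + norm (1 - ee t)"
proof -
  have eq: "1 - ee (s + t) = (1 - ee s) + ee s * (1 - ee t)" by (simp add: ee_add algebra_simps)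
  show ?thesis unfolding eq using norm_triangle_ineq[of "1 - ee s" "ee s * (1 - ee t)"] by (simp add: norm_mult)
qed

lemma gap_shift: "gap (x::'a::euclidean_space) \<le> gap (x - z) + 2 * pi * real DIM('a) * norm z"
proof -
  have "gap x \<le> (\<Sum>b\<in>Basis. norm (1 - ee ((x - z) \<bullet> b)) + 2 * pi * norm z)"
    unfolding gap_def
  proof (rule sum_mono)
    fix b :: 'a assume b: "b \<in> Basis"
    have "x \<bullet> b = (x - z) \<bullet> b + z \<bullet> b" by (simp add: inner_diff_left)
    then have "norm (1 - ee (x \<bullet> b)) \<le> norm (1 - ee ((x - z) \<bullet> b)) + norm (1 - ee (z \<bullet> b))"
      using norm_one_minus_ee_add[of "(x - z) \<bullet> b" "z \<bullet> b"] by simp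
    also have "norm (1 - ee (z \<bullet> b)) \<le> 2 * pi * norm z"
      using mult_left_mono[OF Basis_le_norm[OF b, of z], of "2 * pi"] by (intro order_trans[OF norm_one_minus_ee]) simp
    finally show "norm (1 - ee (x \<bullet> b)) \<le> norm (1 - ee ((x - z) \<bullet> b)) + 2 * pi * norm z" by simp
  qed
  also have "\<dots> = gap (x - z) + 2 * pi * real DIM('a) * norm z" by (simp add: gap_def sum.distrib)
  finally show ?thesis .
qed

text \<open>The coordinate with the largest |1 - e(x . b)| controls \<open>gap\<close> up to the
  factor d, so decay in that one direction is enough. Exponent 0 covers the points close to the
  lattice.\<close>

lemma lattice_sum_gap_decay:
  fixes g :: "'a::euclidean_space \<Rightarrow> complex"
  assumes g: "g \<in> schwartz" "\<And>\<xi>. 2 \<le> norm \<xi> \<Longrightarrow> g \<xi> = 0"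
  shows "\<exists>C>0. \<forall>n\<ge>1. \<forall>x. norm (of_real (1 / real n ^ DIM('a)) * (\<Sum>v\<in>cube (2 * n). g (v /\<^sub>R real n) * ee (x \<bullet> v))) \<le> C / (1 + real n * gap x) ^ N"
proof -
  define Q :: "'a \<Rightarrow> nat \<Rightarrow> real \<Rightarrow> bool" where "Q b N C \<longleftrightarrow> 0 < C \<and> (\<forall>n\<ge>1. \<forall>x. norm (1 - ee (x \<bullet> b)) ^ N *
    norm (of_real (1 / real n ^ DIM('a)) * (\<Sum>v\<in>cube (2 * n). g (v /\<^sub>R real n) * ee (x \<bullet> v))) \<le> C / real n ^ N)" for b N C
  define C where "C b N = (SOME C. Q b N C)" for b N
  have Q: "Q b N (C b N)" if b: "b \<in> Basis" for b N
    unfolding C_def by (rule someI_ex) (use lattice_sum_decay[OF g b, of N] in \<open>simp only: Q_def\<close>)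
  have C: "C b N > 0" "n \<ge> 1 \<Longrightarrow> norm (1 - ee (x \<bullet> b)) ^ N * norm (of_real (1 / real n ^ DIM('a)) * (\<Sum>v\<in>cube (2 * n). g (v /\<^sub>R real n) * ee (x \<bullet> v))) \<le> C b N / real n ^ N"
    if "b \<in> Basis" for b N n and x :: 'a
    using Q[OF that] unfolding Q_def by (blast+)
  define B where "B = (\<Sum>b\<in>Basis. C b 0 + C b N)"
  have CB: "C b 0 \<le> B" "C b N \<le> B" if "b \<in> Basis" for b
  proof -
    have "C b 0 + C b N \<le> B" unfolding B_def
      using that C(1) by (intro member_le_sum) (auto intro: add_nonneg_nonneg less_imp_le)
    then show "C b 0 \<le> B" "C b N \<le> B" using C(1)[OF that, of 0] C(1)[OF that, of N] by linarith+
  qed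
  obtain b0 :: 'a where b0: "b0 \<in> Basis" using nonempty_Basis by blast
  have B: "B > 0" using CB(1)[OF b0] C(1)[OF b0, of 0] by linarith
  have "norm (of_real (1 / real n ^ DIM('a)) * (\<Sum>v\<in>cube (2 * n). g (v /\<^sub>R real n) * ee (x \<bullet> v))) \<le> ((1 + real DIM('a)) ^ N * B) / (1 + real n * gap x) ^ N"
    if n: "n \<ge> 1" for n and x :: 'a
  proof -
    let ?W = "norm (of_real (1 / real n ^ DIM('a)) * (\<Sum>v\<in>cube (2 * n). g (v /\<^sub>R real n) * ee (x \<bullet> v)))"
    let ?S = "(\<lambda>b. norm (1 - ee (x \<bullet> b))) ` Basis"
    have "Max ?S \<in> ?S" by (intro Max_in) auto
    then obtain b where b: "b \<in> Basis" "Max ?S = norm (1 - ee (x \<bullet> b))" by blast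
    have b2: "norm (1 - ee (x \<bullet> c)) \<le> norm (1 - ee (x \<bullet> b))" if "c \<in> Basis" for c
      unfolding b(2)[symmetric] using that by (intro Max_ge) auto
    define y where "y = real n * norm (1 - ee (x \<bullet> b))"
    have "gap x \<le> real DIM('a) * norm (1 - ee (x \<bullet> b))"
      unfolding gap_def using sum_mono[of Basis "\<lambda>c. norm (1 - ee (x \<bullet> c))" "\<lambda>_. norm (1 - ee (x \<bullet> b))"] b2 by simp
    then have "real n * gap x \<le> real DIM('a) * y" unfolding y_def mult.left_commute[of "real DIM('a)"] by (rule mult_left_mono) simp
    also have "\<dots> \<le> real DIM('a) * max 1 y" by (intro mult_left_mono) auto
    finally have "1 + real n * gap x \<le> (1 + real DIM('a)) * max 1 y" by (simp add: distrib_right)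
    then have "(1 + real n * gap x) ^ N \<le> ((1 + real DIM('a)) * max 1 y) ^ N"
      using gap_nonneg[of x] by (intro power_mono) auto
    then have "(1 + real n * gap x) ^ N * ?W \<le> ((1 + real DIM('a)) * max 1 y) ^ N * ?W" by (rule mult_right_mono) simp
    also have "\<dots> = (1 + real DIM('a)) ^ N * (max 1 y ^ N * ?W)" unfolding power_mult_distrib by (simp add: mult.assoc)
    also have "max 1 y ^ N * ?W \<le> B"
    proof (cases "y \<le> 1")
      case True
      then show ?thesis using C(2)[OF b(1) n, of x 0] CB(1)[OF b(1)] by (simp add: max_def)
    next
      case False
      have "y ^ N * ?W = real n ^ N * (norm (1 - ee (x \<bullet> b)) ^ N * ?W)" unfolding y_def power_mult_distrib by (simp add: mult.assoc)
      also have "\<dots> \<le> real n ^ N * (C b N / real n ^ N)" by (intro mult_left_mono C(2) b n) auto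
      also have "\<dots> = C b N" using n by simp
      finally show ?thesis using False CB(2)[OF b(1)] by (simp add: max_def)
    qed
    finally have "(1 + real n * gap x) ^ N * ?W \<le> (1 + real DIM('a)) ^ N * B" by (simp add: mult_left_mono)
    moreover have "0 < (1 + real n * gap x) ^ N" using gap_nonneg[of x] by (intro zero_less_power add_pos_nonneg) auto
    ultimately show ?thesis by (simp add: le_divide_eq mult.commute)
  qed
  then show ?thesis using B by (intro exI[of _ "(1 + real DIM('a)) ^ N * B"]) auto
qed

definition dirichlet :: "nat \<Rightarrow> real \<Rightarrow> complex" where
  "dirichlet n t = (\<Sum>a<n. ee (real a * t))"

text \<open>A single Fejer kernel has zeros and cannot majorise anything. Adding its translate by
  1/(2n), half the spacing of the zeros, removes them.\<close>

definition fejer :: "nat \<Rightarrow> real \<Rightarrow> real" where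
  "fejer n t = ((norm (dirichlet n t))\<^sup>2 + (norm (dirichlet n (t + 1 / (2 * real n))))\<^sup>2) / (real n)\<^sup>2"

definition fejer_coeff :: "nat \<Rightarrow> nat \<times> nat \<Rightarrow> complex" where
  "fejer_coeff n = (\<lambda>(a, a'). (1 + ee ((real a - real a') / (2 * real n))) / of_real ((real n)\<^sup>2))"

lemma dirichlet_geometric: "dirichlet n t * (1 - ee t) = 1 - ee (real n * t)"
proof -
  have "ee (real a * t) = ee t ^ a" for a
    by (induction a) (simp_all add: distrib_right ee_add)
  then show ?thesis unfolding dirichlet_def by (simp add: one_diff_power_eq mult.commute)
qed

text \<open>With z = e(nt), the geometric sums have numerators 1 - z and 1 + z, as the half shift
  changes the sign of z. By the parallelogram identity their squares add up to 4, so both kernels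
  cannot be small together.\<close>

lemma fejer_bounds:
  assumes n: "n \<ge> 1"
  shows "0 \<le> fejer n t" "fejer n t \<le> 2" "1 / (4 * (1 + real n * norm (1 - ee t))\<^sup>2) \<le> fejer n t"
proof -
  show "0 \<le> fejer n t" by (simp add: fejer_def)
  have "norm (dirichlet n t) \<le> real n" for t unfolding dirichlet_def using norm_sum[of "\<lambda>a. ee (real a * t)" "{..<n}"] by simp
  then have "(norm (dirichlet n t))\<^sup>2 \<le> (real n)\<^sup>2" for t by (intro power_mono) auto
  then have "(norm (dirichlet n t))\<^sup>2 + (norm (dirichlet n (t + 1 / (2 * real n))))\<^sup>2 \<le> (real n)\<^sup>2 + (real n)\<^sup>2" by (intro add_mono)
  then show "fejer n t \<le> 2" using n by (simp add: fejer_def divide_le_eq)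
  let ?r = "norm (1 - ee t)"
  let ?s = "t + 1 / (2 * real n)"
  define z where "z = ee (real n * t)"
  have nz: "norm z = 1" by (simp add: z_def)
  \<comment> \<open>Bounds the denominators of both geometric sums; the shift adds at most 2 pi /
    (2n), which is below 4/n.\<close>
  define B where "B = ?r + 4 / real n"
  have r2: "norm (1 - ee ?s) \<le> B"
  proof -
    have "norm (1 - ee ?s) \<le> ?r + norm (1 - ee (1 / (2 * real n)))" by (rule norm_one_minus_ee_add)
    also have "norm (1 - ee (1 / (2 * real n))) \<le> 2 * pi * \<bar>1 / (2 * real n)\<bar>" by (rule norm_one_minus_ee)
    also have "\<dots> \<le> 4 / real n" using n pi_less_4 by (simp add: field_simps)
    finally show ?thesis by (simp add: B_def)
  qed
  have "norm (dirichlet n t) * ?r = norm (1 - z)"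
    using arg_cong[OF dirichlet_geometric[of n t], of norm] by (simp add: norm_mult z_def)
  then have 1: "norm (1 - z) \<le> norm (dirichlet n t) * B" using mult_left_mono[of ?r B "norm (dirichlet n t)"] by (simp add: B_def)
  have "ee (real n * ?s) = - z"
  proof -
    have "real n * ?s = real n * t + 1 / 2" using n by (simp add: distrib_left)
    moreover have "ee (1 / 2) = - 1" by (simp add: ee_def)
    ultimately show ?thesis by (simp add: ee_add z_def)
  qed
  then have "norm (dirichlet n ?s) * norm (1 - ee ?s) = norm (1 + z)"
    using arg_cong[OF dirichlet_geometric[of n ?s], of norm] by (simp add: norm_mult)
  then have 2: "norm (1 + z) \<le> norm (dirichlet n ?s) * B" using mult_left_mono[OF r2, of "norm (dirichlet n ?s)"] by simp
  have "(norm (1 - z))\<^sup>2 + (norm (1 + z))\<^sup>2 = 2 * (1 + (norm z)\<^sup>2)"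
    unfolding cmod_power2 by (simp add: power2_eq_square algebra_simps)
  then have "4 = (norm (1 - z))\<^sup>2 + (norm (1 + z))\<^sup>2" using nz by simp
  also have "\<dots> \<le> (norm (dirichlet n t) * B)\<^sup>2 + (norm (dirichlet n ?s) * B)\<^sup>2"
    by (intro add_mono power_mono 1 2) auto
  also have "\<dots> = fejer n t * (real n * B)\<^sup>2"
    using n unfolding fejer_def power_mult_distrib by (simp add: field_simps)
  also have "(real n * B)\<^sup>2 \<le> (4 * (1 + real n * ?r))\<^sup>2"
    using n by (intro power_mono) (auto simp: B_def distrib_left)
  finally have "4 \<le> fejer n t * (4 * (1 + real n * ?r))\<^sup>2" using \<open>0 \<le> fejer n t\<close> by (simp add: mult_left_mono)
  then have "1 \<le> fejer n t * (4 * (1 + real n * ?r)\<^sup>2)" unfolding power_mult_distrib by simp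
  moreover have "0 < 4 * (1 + real n * ?r)\<^sup>2" by (intro mult_pos_pos zero_less_power add_pos_nonneg) auto
  ultimately show "1 / (4 * (1 + real n * ?r)\<^sup>2) \<le> fejer n t" by (simp only: divide_le_eq) simp
qed

lemma fejer_expansion:
  "of_real (fejer n t) = (\<Sum>\<kappa>\<in>{..<n} \<times> {..<n}. fejer_coeff n \<kappa> * ee ((real (fst \<kappa>) - real (snd \<kappa>)) * t))"
proof -
  have sq: "of_real ((norm (dirichlet n u))\<^sup>2) = (\<Sum>\<kappa>\<in>{..<n} \<times> {..<n}. ee ((real (fst \<kappa>) - real (snd \<kappa>)) * u))" for u
    unfolding complex_norm_square dirichlet_def cnj_sum sum_product sum.cartesian_product
    by (intro sum.cong) (auto simp: ee_minus[symmetric] ee_add[symmetric] left_diff_distrib)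
  have "(of_real (fejer n t) :: complex) = (of_real ((norm (dirichlet n t))\<^sup>2) + of_real ((norm (dirichlet n (t + 1 / (2 * real n))))\<^sup>2)) / of_real ((real n)\<^sup>2)"
    by (simp add: fejer_def)
  also have "\<dots> = (\<Sum>\<kappa>\<in>{..<n} \<times> {..<n}. (ee ((real (fst \<kappa>) - real (snd \<kappa>)) * t) + ee ((real (fst \<kappa>) - real (snd \<kappa>)) * (t + 1 / (2 * real n)))) / of_real ((real n)\<^sup>2))"
    unfolding sq sum.distrib[symmetric] sum_divide_distrib ..
  also have "\<dots> = (\<Sum>\<kappa>\<in>{..<n} \<times> {..<n}. fejer_coeff n \<kappa> * ee ((real (fst \<kappa>) - real (snd \<kappa>)) * t))"
    by (intro sum.cong refl) (auto simp: fejer_coeff_def ee_add distrib_left distrib_right[of 1] add_divide_distrib mult.commute)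
  finally show ?thesis .
qed

lemma lq_sum_le:
  assumes q: "q > 0" "q \<noteq> \<infinity>" and S: "finite S" "S \<subseteq> A" "\<And>l. l \<in> A \<Longrightarrow> l \<notin> S \<Longrightarrow> a l = 0" "\<And>l. l \<in> S \<Longrightarrow> a l \<le> ennreal (b l)" "\<And>l. l \<in> S \<Longrightarrow> 0 \<le> b l"
  shows "Lp_norm (count_space A) q a \<le> ennreal ((\<Sum>l\<in>S. b l powr enn2real q) powr (1 / enn2real q))"
proof -
  note r = enn2real_pos[OF q]
  have "(\<integral>\<^sup>+l. enn_powr (a l) (enn2real q) \<partial>count_space A) = (\<Sum>l\<in>S. enn_powr (a l) (enn2real q))"
    using S by (intro nn_integral_count_space') auto
  also have "\<dots> \<le> (\<Sum>l\<in>S. ennreal (b l powr enn2real q))"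
  proof (rule sum_mono)
    fix l assume l: "l \<in> S"
    show "enn_powr (a l) (enn2real q) \<le> ennreal (b l powr enn2real q)"
      using enn_powr_mono[OF S(4)[OF l], of "enn2real q"] r S(5)[OF l] by (simp add: enn_powr_ennreal)
  qed
  also have "\<dots> = ennreal (\<Sum>l\<in>S. b l powr enn2real q)" by (intro sum_ennreal) auto
  finally have "Lp_norm (count_space A) q a \<le> enn_powr (ennreal (\<Sum>l\<in>S. b l powr enn2real q)) (1 / enn2real q)"
    unfolding Lp_norm_finite[OF q(2)] using r by (intro enn_powr_mono) auto
  then show ?thesis by (simp add: enn_powr_ennreal sum_nonneg)
qed

lemma lq_sum_ge:
  assumes q: "q > 0" "q \<noteq> \<infinity>" and S: "finite S" "S \<subseteq> A" and b: "\<And>l. 0 \<le> b l"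
  shows "ennreal ((\<Sum>l\<in>S. b l powr enn2real q) powr (1 / enn2real q)) \<le> Lp_norm (count_space A) q (\<lambda>l. ennreal (b l))"
proof -
  note r = enn2real_pos[OF q]
  have "ennreal (\<Sum>l\<in>S. b l powr enn2real q) = (\<Sum>l\<in>S. ennreal (b l powr enn2real q))" by (intro sum_ennreal[symmetric]) auto
  also have "\<dots> = (\<Sum>l\<in>S. (if l \<in> S then ennreal (b l powr enn2real q) else 0))" by (intro sum.cong) auto
  also have "\<dots> = (\<integral>\<^sup>+l. (if l \<in> S then ennreal (b l powr enn2real q) else 0) \<partial>count_space A)"
    using S by (intro nn_integral_count_space'[symmetric]) auto
  also have "\<dots> \<le> (\<integral>\<^sup>+l. enn_powr (ennreal (b l)) (enn2real q) \<partial>count_space A)"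
    using b by (intro nn_integral_mono) (auto simp: enn_powr_ennreal)
  finally have "enn_powr (ennreal (\<Sum>l\<in>S. b l powr enn2real q)) (1 / enn2real q) \<le> Lp_norm (count_space A) q (\<lambda>l. ennreal (b l))"
    unfolding Lp_norm_finite[OF q(2)] using r by (intro enn_powr_mono) auto
  then show ?thesis by (simp add: enn_powr_ennreal sum_nonneg)
qed

lemma ee_sum: "ee (\<Sum>i\<in>A. f i) = (\<Prod>i\<in>A. ee (f i))"
  by (induction A rule: infinite_finite_induct) (auto simp: ee_add)

definition fejer_prod :: "nat \<Rightarrow> 'a::euclidean_space \<Rightarrow> real" where
  "fejer_prod n x = (\<Prod>b\<in>Basis. fejer n (x \<bullet> b))"

lemma fejer_prod_measurable [measurable]: "fejer_prod n \<in> borel_measurable borel"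
  unfolding fejer_prod_def[abs_def] fejer_def dirichlet_def divide_inverse
  by (intro borel_measurable_continuous_onI continuous_intros)

lemma fejer_prod_bounds:
  fixes x :: "'a::euclidean_space"
  assumes n: "n \<ge> 1"
  shows "0 \<le> fejer_prod n x" "fejer_prod n x \<le> 2 ^ DIM('a)" "1 / (4 ^ DIM('a) * (1 + real n * gap x) ^ (2 * DIM('a))) \<le> fejer_prod n x"
proof -
  show "0 \<le> fejer_prod n x" unfolding fejer_prod_def by (intro prod_nonneg fejer_bounds(1)[OF n])
  have "fejer_prod n x \<le> (\<Prod>b\<in>(Basis::'a set). 2)"
    unfolding fejer_prod_def by (intro prod_mono conjI fejer_bounds[OF n])
  then show "fejer_prod n x \<le> 2 ^ DIM('a)" by simp
  have "(\<Prod>b\<in>(Basis::'a set). 1 / (4 * (1 + real n * gap x)\<^sup>2)) \<le> fejer_prod n x"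
    unfolding fejer_prod_def
  proof (rule prod_mono)
    fix b :: 'a assume b: "b \<in> Basis"
    have "norm (1 - ee (x \<bullet> b)) \<le> gap x" unfolding gap_def using b by (intro member_le_sum) auto
    then have "(1 + real n * norm (1 - ee (x \<bullet> b)))\<^sup>2 \<le> (1 + real n * gap x)\<^sup>2" by (intro power_mono add_left_mono mult_left_mono) auto
    moreover have "0 < (1 + real n * norm (1 - ee (x \<bullet> b)))\<^sup>2" by (intro zero_less_power add_pos_nonneg) auto
    ultimately have "1 / (4 * (1 + real n * gap x)\<^sup>2) \<le> 1 / (4 * (1 + real n * norm (1 - ee (x \<bullet> b)))\<^sup>2)"
      by (intro divide_left_mono mult_pos_pos) auto
    then show "0 \<le> 1 / (4 * (1 + real n * gap x)\<^sup>2) \<and> 1 / (4 * (1 + real n * gap x)\<^sup>2) \<le> fejer n (x \<bullet> b)"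
      using fejer_bounds(3)[OF n, of "x \<bullet> b"] by simp
  qed
  then show "1 / (4 ^ DIM('a) * (1 + real n * gap x) ^ (2 * DIM('a))) \<le> fejer_prod n x"
    by (simp add: power_one_over[symmetric] power_divide power_mult_distrib power_mult)
qed

text \<open>The diagonal terms a = a' form the mean (2/n)^d. All other frequencies are nonzero
  lattice vectors, hence at least 1 in norm, and this is what separates them after lacunary
  dilation.\<close>

lemma fejer_prod_expansion:
  assumes n: "n \<ge> 1"
  shows "\<exists>S c (lam :: ('a \<Rightarrow> nat \<times> nat) \<Rightarrow> 'a::euclidean_space). finite S \<and> (\<forall>\<kappa>\<in>S. 1 \<le> norm (lam \<kappa>) \<and> norm (lam \<kappa>) \<le> real n * real DIM('a)) \<and>
    (\<forall>x. complex_of_real (fejer_prod n x - (2 / real n) ^ DIM('a)) = (\<Sum>\<kappa>\<in>S. c \<kappa> * ee (x \<bullet> lam \<kappa>)))"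
proof -
  define T :: "('a \<Rightarrow> nat \<times> nat) set" where "T = PiE Basis (\<lambda>_. {..<n} \<times> {..<n})"
  \<comment> \<open>The index tuples of frequency zero.\<close>
  define D :: "('a \<Rightarrow> nat \<times> nat) set" where "D = PiE Basis (\<lambda>_. (\<lambda>a. (a, a)) ` {..<n})"
  define c where "c \<kappa> = (\<Prod>b\<in>(Basis::'a set). fejer_coeff n (\<kappa> b))" for \<kappa>
  define lam where "lam \<kappa> = (\<Sum>b\<in>(Basis::'a set). (real (fst (\<kappa> b)) - real (snd (\<kappa> b))) *\<^sub>R b)" for \<kappa>
  have T: "finite T" unfolding T_def by (intro finite_PiE) auto
  have inner: "lam \<kappa> \<bullet> b = real (fst (\<kappa> b)) - real (snd (\<kappa> b))" if "b \<in> Basis" for \<kappa> b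
    using that unfolding lam_def by simp
  have exp: "complex_of_real (fejer_prod n x) = (\<Sum>\<kappa>\<in>T. c \<kappa> * ee (x \<bullet> lam \<kappa>))" for x
  proof -
    have "complex_of_real (fejer_prod n x) = (\<Prod>b\<in>Basis. \<Sum>\<kappa>\<in>{..<n} \<times> {..<n}. fejer_coeff n \<kappa> * ee ((real (fst \<kappa>) - real (snd \<kappa>)) * (x \<bullet> b)))"
      by (simp add: fejer_prod_def fejer_expansion)
    also have "\<dots> = (\<Sum>\<kappa>\<in>T. \<Prod>b\<in>Basis. fejer_coeff n (\<kappa> b) * ee ((real (fst (\<kappa> b)) - real (snd (\<kappa> b))) * (x \<bullet> b)))"
      unfolding T_def by (rule prod_sum_PiE) auto
    also have "\<dots> = (\<Sum>\<kappa>\<in>T. c \<kappa> * ee (x \<bullet> lam \<kappa>))"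
      by (intro sum.cong refl) (simp add: prod.distrib c_def lam_def inner_sum_right ee_sum)
    finally show ?thesis .
  qed
  have zero: "lam \<kappa> = 0 \<longleftrightarrow> \<kappa> \<in> D" if \<kappa>: "\<kappa> \<in> T" for \<kappa>
  proof
    assume l: "lam \<kappa> = 0"
    have "\<kappa> b \<in> (\<lambda>a. (a, a)) ` {..<n}" if b: "b \<in> Basis" for b
    proof -
      have "fst (\<kappa> b) = snd (\<kappa> b)" using inner[OF b, of \<kappa>] l by simp
      moreover have "\<kappa> b \<in> {..<n} \<times> {..<n}" using \<kappa> b by (auto simp: T_def dest: PiE_mem)
      ultimately show ?thesis by (cases "\<kappa> b") auto
    qed
    then show "\<kappa> \<in> D" using \<kappa> by (auto simp: D_def T_def PiE_iff)
  next
    assume "\<kappa> \<in> D"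
    then have "fst (\<kappa> b) = snd (\<kappa> b)" if "b \<in> Basis" for b using that by (force simp: D_def dest: PiE_mem)
    then show "lam \<kappa> = 0" by (simp add: lam_def)
  qed
  have DT: "D \<subseteq> T" unfolding D_def T_def by (intro PiE_mono) auto
  have cD: "(\<Sum>\<kappa>\<in>D. c \<kappa>) = of_real ((2 / real n) ^ DIM('a))"
  proof -
    have "(\<Sum>\<kappa>\<in>D. c \<kappa>) = (\<Prod>b\<in>(Basis::'a set). \<Sum>\<kappa>\<in>(\<lambda>a. (a, a)) ` {..<n}. fejer_coeff n \<kappa>)"
      unfolding D_def c_def by (rule prod_sum_PiE[symmetric]) auto
    also have "(\<Sum>\<kappa>\<in>(\<lambda>a. (a, a)) ` {..<n}. fejer_coeff n \<kappa>) = of_real (2 / real n)"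
      using n by (subst sum.reindex) (auto simp: inj_on_def fejer_coeff_def power2_eq_square)
    finally show ?thesis by simp
  qed
  have "complex_of_real (fejer_prod n x - (2 / real n) ^ DIM('a)) = (\<Sum>\<kappa>\<in>T - D. c \<kappa> * ee (x \<bullet> lam \<kappa>))" for x
  proof -
    have "(\<Sum>\<kappa>\<in>D. c \<kappa> * ee (x \<bullet> lam \<kappa>)) = (\<Sum>\<kappa>\<in>D. c \<kappa>)"
    proof (rule sum.cong[OF refl])
      fix \<kappa> assume "\<kappa> \<in> D"
      then have "lam \<kappa> = 0" using zero DT by blast
      then show "c \<kappa> * ee (x \<bullet> lam \<kappa>) = c \<kappa>" by simp
    qed
    then show ?thesis by (simp only: of_real_diff exp cD[symmetric] sum_diff[OF T DT])
  qed
  moreover have "1 \<le> norm (lam \<kappa>) \<and> norm (lam \<kappa>) \<le> real n * real DIM('a)" if \<kappa>: "\<kappa> \<in> T - D" for \<kappa>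
  proof
    show "1 \<le> norm (lam \<kappa>)"
    proof (rule lattice_norm_ge_1)
      show "lam \<kappa> \<in> lattice" by (auto simp: lattice_def inner)
      show "lam \<kappa> \<noteq> 0" using zero \<kappa> by auto
    qed
    have "norm (lam \<kappa>) \<le> (\<Sum>b\<in>(Basis::'a set). real n)"
      unfolding lam_def
    proof (rule sum_norm_le)
      fix b :: 'a assume b: "b \<in> Basis"
      have "\<kappa> b \<in> {..<n} \<times> {..<n}" using \<kappa> b by (auto simp: T_def dest: PiE_mem)
      then show "norm ((real (fst (\<kappa> b)) - real (snd (\<kappa> b))) *\<^sub>R b) \<le> real n" using b by (cases "\<kappa> b") (auto simp: abs_le_iff)
    qed
    then show "norm (lam \<kappa>) \<le> real n * real DIM('a)" by (simp add: mult.commute)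
  qed
  ultimately show ?thesis using T by (intro exI[of _ "T - D"] exI[of _ c] exI[of _ lam]) auto
qed

context lp_decomposition
begin

text \<open>Two copies of the spectrum of \<open>psi0\<close>, each in the unit ball up to
  translation by \<mu>, are disjoint once |\<mu>| > 2; Plancherel makes the integral zero
  exactly.\<close>

lemma psi0_orthogonal:
  assumes "2 < norm \<mu>"
  shows "(LINT x|lborel. ee (x \<bullet> \<mu>) * of_real ((norm (psi0 (x - y)))\<^sup>2)) = 0"
proof -
  let ?g = "\<lambda>x. psi0 (x - y)"
  have g: "?g \<in> schwartz" by (intro schwartz_translate psi0_schwartz)
  have f: "(\<lambda>x. ee (x \<bullet> \<mu>) * ?g x) \<in> schwartz" by (intro schwartz_mult'[OF slow_ee] g)
  have z: "fourier ?g (\<xi> - \<mu>) * cnj (fourier ?g \<xi>) = 0" for \<xi>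
  proof (rule ccontr)
    assume "\<not> ?thesis"
    then have "fourier psi0 (\<xi> - \<mu>) \<noteq> 0" "fourier psi0 \<xi> \<noteq> 0"
      by (auto simp: fourier_translate schwartz_measurable psi0_schwartz)
    then have "norm (\<xi> - \<mu>) \<le> 1" "norm \<xi> \<le> 1" using psi0_support by auto
    then show False using assms norm_triangle_ineq4[of \<xi> "\<xi> - \<mu>"] by simp
  qed
  have "(LINT x|lborel. ee (x \<bullet> \<mu>) * ?g x * cnj (?g x)) = 0"
    unfolding plancherel[OF f g] fourier_modulate z by simp
  then show ?thesis by (simp only: complex_norm_square mult.assoc)
qed

text \<open>The weak law: every product of two different terms consists of frequencies beyond 2 and
  integrates to zero, so the second moment of the sum is only the sum of the second moments, of
  order card I instead of its square.\<close>

lemma fluctuation_energy: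
  fixes lam :: "'i \<Rightarrow> 'a"
  assumes I: "finite I" and S: "finite S" and U: "\<And>k. k \<in> I \<Longrightarrow> U k \<in> borel_measurable borel" "\<And>k x. k \<in> I \<Longrightarrow> \<bar>U k x\<bar> \<le> B"
    and exp: "\<And>k x. k \<in> I \<Longrightarrow> complex_of_real (U k x) = (\<Sum>\<kappa>\<in>S. c \<kappa> * ee (x \<bullet> (N k *\<^sub>R lam \<kappa>)))"
    and sep: "\<And>k k' \<kappa> \<kappa>'. k \<in> I \<Longrightarrow> k' \<in> I \<Longrightarrow> k \<noteq> k' \<Longrightarrow> \<kappa> \<in> S \<Longrightarrow> \<kappa>' \<in> S \<Longrightarrow> 2 < norm (N k *\<^sub>R lam \<kappa> + N k' *\<^sub>R lam \<kappa>')"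
  shows "(\<integral>\<^sup>+x. ennreal ((\<Sum>k\<in>I. U k x)\<^sup>2 * (norm (psi0 (x - y)))\<^sup>2) \<partial>lborel) \<le> ennreal (real (card I) * B\<^sup>2 * (LINT x|lborel. (norm (psi0 x))\<^sup>2))"
proof -
  let ?\<rho> = "\<lambda>x. (norm (psi0 (x - y)))\<^sup>2"
  have \<rho>S: "(\<lambda>x. psi0 (x - y)) \<in> schwartz" by (intro schwartz_translate psi0_schwartz)
  have \<rho>: "integrable lborel ?\<rho>" by (rule schwartz_square_integrable[OF \<rho>S])
  note [measurable] = schwartz_measurable[OF \<rho>S]
  have E: "(LINT x|lborel. ?\<rho> x) = (LINT x|lborel. (norm (psi0 x))\<^sup>2)"
    using integral_translate[of "\<lambda>x. (norm (psi0 x))\<^sup>2" "- y"] schwartz_measurable[OF psi0_schwartz] by simp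
  have int: "integrable lborel (\<lambda>x. U k x * U k' x * ?\<rho> x)" if "k \<in> I" "k' \<in> I" for k k'
  proof (rule Bochner_Integration.integrable_bound)
    show "integrable lborel (\<lambda>x. B\<^sup>2 * ?\<rho> x)" using \<rho> by simp
    note [measurable] = U(1)[OF that(1)] U(1)[OF that(2)]
    show "(\<lambda>x. U k x * U k' x * ?\<rho> x) \<in> borel_measurable lborel" by measurable
    have "\<bar>U k x * U k' x\<bar> \<le> B\<^sup>2" for x
      unfolding abs_mult power2_eq_square using U(2)[OF that(1), of x] U(2)[OF that(2), of x] by (intro mult_mono) auto
    then show "AE x in lborel. norm (U k x * U k' x * ?\<rho> x) \<le> norm (B\<^sup>2 * ?\<rho> x)"
      by (auto simp: abs_mult[of _ "?\<rho> _"] intro!: mult_right_mono)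
  qed
  have off: "(LINT x|lborel. U k x * U k' x * ?\<rho> x) = 0" if k: "k \<in> I" "k' \<in> I" "k \<noteq> k'" for k k'
  proof -
    have "complex_of_real (U k x * U k' x * ?\<rho> x) =
        (\<Sum>\<kappa>\<in>S. \<Sum>\<kappa>'\<in>S. (c \<kappa> * c \<kappa>') * (ee (x \<bullet> (N k *\<^sub>R lam \<kappa> + N k' *\<^sub>R lam \<kappa>')) * of_real (?\<rho> x)))" for x
      unfolding of_real_mult exp[OF k(1)] exp[OF k(2)] sum_product
      by (simp add: inner_add_right ee_add sum_distrib_right sum_distrib_left mult_ac)
    moreover have "integrable lborel (\<lambda>x. ee (x \<bullet> \<mu>) * complex_of_real (?\<rho> x))" for \<mu>
    proof (rule Bochner_Integration.integrable_bound[OF \<rho>])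
      show "(\<lambda>x. ee (x \<bullet> \<mu>) * complex_of_real (?\<rho> x)) \<in> borel_measurable lborel" by measurable
    qed (auto simp: norm_mult norm_power)
    ultimately have "complex_of_real (LINT x|lborel. U k x * U k' x * ?\<rho> x) =
        (\<Sum>\<kappa>\<in>S. \<Sum>\<kappa>'\<in>S. (c \<kappa> * c \<kappa>') * (LINT x|lborel. ee (x \<bullet> (N k *\<^sub>R lam \<kappa> + N k' *\<^sub>R lam \<kappa>')) * complex_of_real (?\<rho> x)))"
      unfolding integral_complex_of_real[symmetric] by simp
    also have "\<dots> = 0" by (intro sum.neutral ballI) (simp only: sep[OF k] psi0_orthogonal mult_zero_right)
    finally show ?thesis by simp
  qed
  have eq: "(\<Sum>k\<in>I. U k x)\<^sup>2 * ?\<rho> x = (\<Sum>k\<in>I. \<Sum>k'\<in>I. U k x * U k' x * ?\<rho> x)" for x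
    unfolding power2_eq_square[of "\<Sum>k\<in>I. U k x"] sum_product by (simp only: sum_distrib_right)
  have "(\<integral>\<^sup>+x. ennreal ((\<Sum>k\<in>I. U k x)\<^sup>2 * ?\<rho> x) \<partial>lborel) = ennreal (LINT x|lborel. (\<Sum>k\<in>I. U k x)\<^sup>2 * ?\<rho> x)"
  proof (rule nn_integral_eq_integral)
    show "integrable lborel (\<lambda>x. (\<Sum>k\<in>I. U k x)\<^sup>2 * ?\<rho> x)" unfolding eq using int by (intro Bochner_Integration.integrable_sum) auto
  qed auto
  also have "(LINT x|lborel. (\<Sum>k\<in>I. U k x)\<^sup>2 * ?\<rho> x) = (\<Sum>k\<in>I. \<Sum>k'\<in>I. (LINT x|lborel. U k x * U k' x * ?\<rho> x))"
    unfolding eq using int by (simp add: Bochner_Integration.integral_sum Bochner_Integration.integrable_sum)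
  also have "\<dots> = (\<Sum>k\<in>I. (LINT x|lborel. U k x * U k x * ?\<rho> x))"
  proof (rule sum.cong[OF refl])
    fix k assume k: "k \<in> I"
    show "(\<Sum>k'\<in>I. (LINT x|lborel. U k x * U k' x * ?\<rho> x)) = (LINT x|lborel. U k x * U k x * ?\<rho> x)"
      using off k I by (subst sum.remove[OF I k]) (auto intro!: sum.neutral)
  qed
  also have "\<dots> \<le> (\<Sum>k\<in>I. (LINT x|lborel. B\<^sup>2 * ?\<rho> x))"
  proof (intro sum_mono integral_mono int)
    fix k x assume k: "k \<in> I"
    have "U k x * U k x = \<bar>U k x\<bar>\<^sup>2" by (simp add: power2_eq_square)
    also have "\<dots> \<le> B\<^sup>2" using U(2)[OF k, of x] by (intro power_mono) auto
    finally show "U k x * U k x * ?\<rho> x \<le> B\<^sup>2 * ?\<rho> x" by (rule mult_right_mono) simp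
  qed (use \<rho> in auto)
  also have "\<dots> = real (card I) * B\<^sup>2 * (LINT x|lborel. (norm (psi0 x))\<^sup>2)" using E by simp
  finally show ?thesis by (simp add: ennreal_leI)
qed

text \<open>Orthogonality holds for the weights |psi0(x - y)|^2, the estimates need the fixed weight
  \<open>wgt\<close>. Averaging the former over y against \<open>wgt\<close> dominates the latter,
  since \<open>psi0\<close> is bounded below on some ball.\<close>

lemma psi0_weight:
  "\<exists>C>0. \<forall>F b. F \<in> borel_measurable borel \<longrightarrow> (\<forall>x. 0 \<le> F x) \<longrightarrow> 0 \<le> b \<longrightarrow>
     (\<forall>y. (\<integral>\<^sup>+x. ennreal (F x * (norm (psi0 (x - y)))\<^sup>2) \<partial>lborel) \<le> ennreal b) \<longrightarrow>
     (\<integral>\<^sup>+x. ennreal (F x * wgt (2 * DIM('a)) 1 x) \<partial>lborel) \<le> ennreal (C * b)"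
proof -
  let ?M = "2 * DIM('a)"
  obtain x0 where x0: "psi0 x0 \<noteq> 0" using psi0_nonzero by blast
  obtain c r \<delta> where cr: "r > 0" "\<delta> > 0" "\<And>x. x \<in> ball c r \<Longrightarrow> \<delta> \<le> norm (psi0 x)"
    by (rule schwartz_nonzero_ball[OF psi0_schwartz x0]) (rule that)
  note [measurable] = schwartz_measurable[OF psi0_schwartz]
  define P where "P = (1 + (norm c + r)) ^ ?M"
  define m where "m = measure lborel (ball (0::'a) r)"
  have P: "P > 0" unfolding P_def using cr(1) by (intro zero_less_power add_pos_nonneg) auto
  have m: "m > 0" unfolding m_def using content_ball_pos cr(1) by simp
  define C0 where "C0 = P / (\<delta>\<^sup>2 * m)"
  have C0: "C0 > 0" using P m cr by (simp add: C0_def)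
  define J where "J = (LINT x|lborel. wgt ?M 1 (x::'a))"
  have J: "J > 0" unfolding J_def by (rule wgt_integral_pos) simp
  have w0: "0 \<le> wgt ?M 1 x" for x :: 'a using wgt_pos[of 1 ?M x] by simp
  have pt: "ennreal (wgt ?M 1 x) \<le> ennreal C0 * (\<integral>\<^sup>+y. ennreal ((norm (psi0 (x - y)))\<^sup>2 * wgt ?M 1 y) \<partial>lborel)" for x
  proof -
    have "ennreal (\<delta>\<^sup>2 * (wgt ?M 1 x / P)) * emeasure lborel (ball (x - c) r) = (\<integral>\<^sup>+y. ennreal (\<delta>\<^sup>2 * (wgt ?M 1 x / P)) * indicator (ball (x - c) r) y \<partial>lborel)"
      by (simp add: nn_integral_cmult_indicator)
    also have "\<dots> \<le> (\<integral>\<^sup>+y. ennreal ((norm (psi0 (x - y)))\<^sup>2 * wgt ?M 1 y) \<partial>lborel)"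
    proof (rule nn_integral_mono)
      fix y
      show "ennreal (\<delta>\<^sup>2 * (wgt ?M 1 x / P)) * indicator (ball (x - c) r) y \<le> ennreal ((norm (psi0 (x - y)))\<^sup>2 * wgt ?M 1 y)"
      proof (cases "y \<in> ball (x - c) r")
        case True
        then have d: "norm (x - y - c) < r" by (simp add: dist_norm algebra_simps)
        then have "x - y \<in> ball c r" by (simp add: dist_norm norm_minus_commute)
        then have 1: "\<delta>\<^sup>2 \<le> (norm (psi0 (x - y)))\<^sup>2" using cr by (intro power_mono) auto
        have "norm (y - x) \<le> norm c + r" using d norm_triangle_ineq[of "x - y - c" c] by (simp add: norm_minus_commute)
        then have "(1 + 1 * norm (y - x)) ^ ?M \<le> P" unfolding P_def by (intro power_mono) auto
        then have "wgt ?M 1 y * (1 + 1 * norm (y - x)) ^ ?M \<le> wgt ?M 1 y * P" using w0 by (rule mult_left_mono)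
        then have "wgt ?M 1 x \<le> wgt ?M 1 y * P" using wgt_peetre[of 1 1 ?M y "y - x"] by simp
        then have "wgt ?M 1 x / P \<le> wgt ?M 1 y" using P by (simp add: divide_le_eq)
        with 1 have "\<delta>\<^sup>2 * (wgt ?M 1 x / P) \<le> (norm (psi0 (x - y)))\<^sup>2 * wgt ?M 1 y" using w0 P by (intro mult_mono) auto
        then show ?thesis using True by (simp add: ennreal_leI)
      qed simp
    qed
    also have "emeasure lborel (ball (x - c) r) = ennreal m"
      using cr(1) emeasure_lborel_ball_finite[of "x - c" r] by (simp add: emeasure_eq_ennreal_measure m_def content_ball)
    finally have "ennreal C0 * (ennreal (\<delta>\<^sup>2 * (wgt ?M 1 x / P)) * ennreal m) \<le> ennreal C0 * (\<integral>\<^sup>+y. ennreal ((norm (psi0 (x - y)))\<^sup>2 * wgt ?M 1 y) \<partial>lborel)"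
      by (rule mult_left_mono) simp
    moreover have "ennreal C0 * (ennreal (\<delta>\<^sup>2 * (wgt ?M 1 x / P)) * ennreal m) = ennreal (wgt ?M 1 x)"
      using C0 P m cr w0[of x] by (simp add: ennreal_mult[symmetric] C0_def)
    ultimately show ?thesis by simp
  qed
  show ?thesis
  proof (intro exI[of _ "C0 * J"] conjI allI impI)
    show "C0 * J > 0" using C0 J by simp
    fix F :: "'a \<Rightarrow> real" and b :: real
    assume F[measurable]: "F \<in> borel_measurable borel" and F0: "\<forall>x. 0 \<le> F x" and b: "0 \<le> b"
      and le: "\<forall>y. (\<integral>\<^sup>+x. ennreal (F x * (norm (psi0 (x - y)))\<^sup>2) \<partial>lborel) \<le> ennreal b"
    have "(\<integral>\<^sup>+x. ennreal (F x * wgt ?M 1 x) \<partial>lborel) = (\<integral>\<^sup>+x. ennreal (F x) * ennreal (wgt ?M 1 x) \<partial>lborel)"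
      using F0 w0 by (simp add: ennreal_mult)
    also have "\<dots> \<le> (\<integral>\<^sup>+x. ennreal (F x) * (ennreal C0 * (\<integral>\<^sup>+y. ennreal ((norm (psi0 (x - y)))\<^sup>2 * wgt ?M 1 y) \<partial>lborel)) \<partial>lborel)"
      by (intro nn_integral_mono mult_left_mono pt) simp
    also have "\<dots> = (\<integral>\<^sup>+x. (\<integral>\<^sup>+y. ennreal (C0 * wgt ?M 1 y) * ennreal (F x * (norm (psi0 (x - y)))\<^sup>2) \<partial>lborel) \<partial>lborel)"
    proof (rule nn_integral_cong)
      fix x
      have "ennreal (F x) * (ennreal C0 * (\<integral>\<^sup>+y. ennreal ((norm (psi0 (x - y)))\<^sup>2 * wgt ?M 1 y) \<partial>lborel)) =
          (\<integral>\<^sup>+y. ennreal (F x * C0) * ennreal ((norm (psi0 (x - y)))\<^sup>2 * wgt ?M 1 y) \<partial>lborel)"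
        using F0 C0 by (subst nn_integral_cmult) (auto simp: ennreal_mult mult.assoc)
      also have "\<dots> = (\<integral>\<^sup>+y. ennreal (C0 * wgt ?M 1 y) * ennreal (F x * (norm (psi0 (x - y)))\<^sup>2) \<partial>lborel)"
        using F0 C0 w0 by (simp add: ennreal_mult[symmetric] mult_ac)
      finally show "ennreal (F x) * (ennreal C0 * (\<integral>\<^sup>+y. ennreal ((norm (psi0 (x - y)))\<^sup>2 * wgt ?M 1 y) \<partial>lborel)) =
          (\<integral>\<^sup>+y. ennreal (C0 * wgt ?M 1 y) * ennreal (F x * (norm (psi0 (x - y)))\<^sup>2) \<partial>lborel)" .
    qed
    also have "\<dots> = (\<integral>\<^sup>+y. (\<integral>\<^sup>+x. ennreal (C0 * wgt ?M 1 y) * ennreal (F x * (norm (psi0 (x - y)))\<^sup>2) \<partial>lborel) \<partial>lborel)"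
      by (rule lborel_pair.Fubini') (simp, measurable)
    also have "\<dots> \<le> (\<integral>\<^sup>+y. ennreal (C0 * wgt ?M 1 y) * ennreal b \<partial>(lborel :: 'a measure))"
      using le by (intro nn_integral_mono) (auto simp: nn_integral_cmult intro!: mult_left_mono)
    also have "\<dots> = (\<integral>\<^sup>+y. ennreal (C0 * b * wgt ?M 1 (y::'a)) \<partial>lborel)"
      using C0 b w0 by (simp add: ennreal_mult[symmetric] mult_ac)
    also have "\<dots> = ennreal (C0 * J * b)"
      using C0 b w0 wgt_integrable[where 'a='a, of ?M] by (subst nn_integral_eq_integral) (auto simp: J_def mult_ac)
    finally show "(\<integral>\<^sup>+x. ennreal (F x * wgt ?M 1 x) \<partial>lborel) \<le> ennreal (C0 * J * b)" .
  qed
qed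

text \<open>A Chebyshev argument. Where the sum is at most twice its mean there is nothing to do;
  elsewhere it exceeds the mean by at least the mean, which carries little weight by the fluctuation
  bound, and the trivial bound card I * 2^d suffices.\<close>

lemma fejer_moment:
  assumes n: "n \<ge> 1" and r: "r > 1"
  shows "\<exists>K0\<ge>1. \<forall>I::nat set. \<forall>N. finite I \<longrightarrow> K0 \<le> card I \<longrightarrow> (\<forall>k\<in>I. 0 < N k) \<longrightarrow>
     (\<forall>k\<in>I. \<forall>k'\<in>I. k < k' \<longrightarrow> N k * (real n * real DIM('a)) + 2 < N k') \<longrightarrow>
     (\<integral>\<^sup>+x. ennreal ((\<Sum>k\<in>I. fejer_prod n (N k *\<^sub>R x)) powr r * wgt (2 * DIM('a)) 1 (x::'a)) \<partial>lborel) \<le>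
       ennreal (2 * (2 * real (card I) * (2 / real n) ^ DIM('a)) powr r * (LINT x|lborel. wgt (2 * DIM('a)) 1 (x::'a)))"
proof -
  let ?M = "2 * DIM('a)"
  let ?E = "LINT x|lborel. (norm (psi0 x))\<^sup>2"
  define J where "J = (LINT x|lborel. wgt ?M 1 (x::'a))"
  have J: "J > 0" unfolding J_def by (rule wgt_integral_pos) simp
  define \<delta> where "\<delta> = (2 / real n) ^ DIM('a)"
  have \<delta>: "0 < \<delta>" "\<delta> \<le> 2 ^ DIM('a)" unfolding \<delta>_def using n by (auto intro!: power_mono simp: divide_le_eq)
  obtain C where C: "C > 0" "\<And>F b. F \<in> borel_measurable borel \<Longrightarrow> (\<And>x. 0 \<le> F x) \<Longrightarrow> 0 \<le> b \<Longrightarrow>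
     (\<And>y. (\<integral>\<^sup>+x. ennreal (F x * (norm (psi0 (x - y)))\<^sup>2) \<partial>lborel) \<le> ennreal b) \<Longrightarrow>
     (\<integral>\<^sup>+x. ennreal (F x * wgt ?M 1 x) \<partial>lborel) \<le> ennreal (C * b)"
    using psi0_weight by blast
  obtain S c and lam :: "('a \<Rightarrow> nat \<times> nat) \<Rightarrow> 'a" where S: "finite S" "\<And>\<kappa>. \<kappa> \<in> S \<Longrightarrow> 1 \<le> norm (lam \<kappa>)" "\<And>\<kappa>. \<kappa> \<in> S \<Longrightarrow> norm (lam \<kappa>) \<le> real n * real DIM('a)"
    "\<And>x. complex_of_real (fejer_prod n x - \<delta>) = (\<Sum>\<kappa>\<in>S. c \<kappa> * ee (x \<bullet> lam \<kappa>))"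
    using fejer_prod_expansion[OF n, where 'a='a] unfolding \<delta>_def by blast
  define A where "A = (2 ^ DIM('a)) powr r * C * 4 ^ DIM('a) * ?E / \<delta>\<^sup>2"
  \<comment> \<open>The exceptional part contributes K^r A / K, the main part (2 K \<delta>)^r J;
    for K >= \<open>K0\<close> the former is no larger, hence the factor 2 in the
    conclusion.\<close>
  define K0 where "K0 = max 1 (nat \<lceil>A / ((2 * \<delta>) powr r * J)\<rceil>)"
  have E0: "0 \<le> ?E" by (intro integral_nonneg_AE) auto
  have w0: "0 \<le> wgt ?M 1 x" for x :: 'a using wgt_pos[of 1 ?M x] by simp
  show ?thesis
  proof (intro exI[of _ K0] conjI allI impI)
    show "K0 \<ge> 1" by (simp add: K0_def)
    fix I :: "nat set" and N :: "nat \<Rightarrow> real"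
    assume I: "finite I" "K0 \<le> card I" and N: "\<forall>k\<in>I. 0 < N k" and sep: "\<forall>k\<in>I. \<forall>k'\<in>I. k < k' \<longrightarrow> N k * (real n * real DIM('a)) + 2 < N k'"
    define K where "K = real (card I)"
    have K: "K \<ge> 1" "A / ((2 * \<delta>) powr r * J) \<le> K"
    proof -
      have "real K0 \<le> K" unfolding K_def using I(2) by simp
      moreover have "1 \<le> real K0" "A / ((2 * \<delta>) powr r * J) \<le> real K0" unfolding K0_def by linarith+
      ultimately show "K \<ge> 1" "A / ((2 * \<delta>) powr r * J) \<le> K" by linarith+
    qed
    define X where "X x = (\<Sum>k\<in>I. fejer_prod n (N k *\<^sub>R x))" for x :: 'a
    define F where "F x = (X x - K * \<delta>)\<^sup>2" for x
    have Fs: "F x = (\<Sum>k\<in>I. fejer_prod n (N k *\<^sub>R x) - \<delta>)\<^sup>2" for x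
      by (simp add: F_def X_def sum_subtractf K_def)
    have Xm [measurable]: "X \<in> borel_measurable borel" unfolding X_def[abs_def] by measurable
    have Fm [measurable]: "F \<in> borel_measurable borel" unfolding F_def[abs_def] by measurable
    have X: "0 \<le> X x" "X x \<le> K * 2 ^ DIM('a)" for x
    proof -
      show "0 \<le> X x" unfolding X_def by (intro sum_nonneg fejer_prod_bounds(1) n)
      show "X x \<le> K * 2 ^ DIM('a)" unfolding X_def K_def by (intro sum_bounded_above fejer_prod_bounds(2) n)
    qed
    have fluct: "(\<integral>\<^sup>+x. ennreal (F x * wgt ?M 1 x) \<partial>lborel) \<le> ennreal (C * (K * 4 ^ DIM('a) * ?E))"
    proof (rule C(2)[OF Fm])
      fix y
      have "(\<integral>\<^sup>+x. ennreal (F x * (norm (psi0 (x - y)))\<^sup>2) \<partial>lborel) \<le> ennreal (real (card I) * (2 ^ DIM('a))\<^sup>2 * ?E)"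
        unfolding Fs
      proof (rule fluctuation_energy[OF I(1) S(1), where N = N and c = c and lam = lam])
        fix k assume k: "k \<in> I"
        show "(\<lambda>x. fejer_prod n (N k *\<^sub>R x) - \<delta>) \<in> borel_measurable borel" by measurable
        show "\<bar>fejer_prod n (N k *\<^sub>R x) - \<delta>\<bar> \<le> 2 ^ DIM('a)" for x :: 'a
          using fejer_prod_bounds[OF n, of "N k *\<^sub>R x"] \<delta> by (simp add: abs_le_iff)
        show "complex_of_real (fejer_prod n (N k *\<^sub>R x) - \<delta>) = (\<Sum>\<kappa>\<in>S. c \<kappa> * ee (x \<bullet> (N k *\<^sub>R lam \<kappa>)))" for x
          unfolding S(4) by simp
      next
        fix k k' \<kappa> \<kappa>' assume k: "k \<in> I" "k' \<in> I" "k \<noteq> k'" and \<kappa>: "\<kappa> \<in> S" "\<kappa>' \<in> S"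
        have *: "2 < norm (N i *\<^sub>R lam \<mu> + N j *\<^sub>R lam \<nu>)" if i: "i \<in> I" "j \<in> I" "i < j" and \<mu>: "\<mu> \<in> S" "\<nu> \<in> S" for i j \<mu> \<nu>
        proof -
          have "0 < N i" "0 < N j" using N i by auto
          then have "norm (N i *\<^sub>R lam \<mu>) \<le> N i * (real n * real DIM('a))" "N j * 1 \<le> norm (N j *\<^sub>R lam \<nu>)"
            using S(3)[OF \<mu>(1)] S(2)[OF \<mu>(2)] by (simp_all add: mult_left_mono)
          moreover have "norm (N j *\<^sub>R lam \<nu>) \<le> norm (N i *\<^sub>R lam \<mu> + N j *\<^sub>R lam \<nu>) + norm (N i *\<^sub>R lam \<mu>)"
            using norm_triangle_ineq4[of "N i *\<^sub>R lam \<mu> + N j *\<^sub>R lam \<nu>" "N i *\<^sub>R lam \<mu>"] by simp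
          ultimately show ?thesis using sep[rule_format, OF i] by linarith
        qed
        show "2 < norm (N k *\<^sub>R lam \<kappa> + N k' *\<^sub>R lam \<kappa>')"
        proof (cases "k < k'")
          case True
          then show ?thesis using * k \<kappa> by blast
        next
          case False
          then have "k' < k" using k(3) by simp
          then show ?thesis using *[OF k(2,1) _ \<kappa>(2,1)] by (simp add: add.commute)
        qed
      qed
      then show "(\<integral>\<^sup>+x. ennreal (F x * (norm (psi0 (x - y)))\<^sup>2) \<partial>lborel) \<le> ennreal (K * 4 ^ DIM('a) * ?E)"
        by (simp add: K_def power2_eq_square power_mult_distrib[symmetric])
    qed (use K E0 in \<open>auto simp: F_def\<close>)
    \<comment> \<open>Trivial bound for the r-th power, divided by the least value of
      \<open>F\<close> on the exceptional set.\<close>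
    define D where "D = (K * 2 ^ DIM('a)) powr r / (K * \<delta>)\<^sup>2"
    have D: "0 \<le> D" by (simp add: D_def)
    have pt: "X x powr r \<le> (2 * K * \<delta>) powr r + D * F x" for x
    proof (cases "X x \<le> 2 * K * \<delta>")
      case True
      then have "X x powr r \<le> (2 * K * \<delta>) powr r" using X[of x] r by (intro powr_mono2) auto
      then show ?thesis using D by (simp add: F_def add_increasing2)
    next
      case False
      have "K * \<delta> > 0" using K \<delta> by simp
      then have "(K * \<delta>)\<^sup>2 \<le> F x" unfolding F_def using False by (intro power_mono) auto
      then have "1 \<le> F x / (K * \<delta>)\<^sup>2" using K(1) \<delta>(1) by (simp add: le_divide_eq)
      then have "(K * 2 ^ DIM('a)) powr r * 1 \<le> (K * 2 ^ DIM('a)) powr r * (F x / (K * \<delta>)\<^sup>2)" by (rule mult_left_mono) simp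
      moreover have "X x powr r \<le> (K * 2 ^ DIM('a)) powr r" using X[of x] r by (intro powr_mono2) auto
      ultimately have "X x powr r \<le> D * F x" by (simp add: D_def)
      then show ?thesis by (simp add: add_increasing)
    qed
    have "(\<integral>\<^sup>+x. ennreal (X x powr r * wgt ?M 1 x) \<partial>lborel) \<le> (\<integral>\<^sup>+x. (ennreal ((2 * K * \<delta>) powr r * wgt ?M 1 x) + ennreal D * ennreal (F x * wgt ?M 1 x)) \<partial>lborel)"
    proof (rule nn_integral_mono)
      fix x
      have "X x powr r * wgt ?M 1 x \<le> ((2 * K * \<delta>) powr r + D * F x) * wgt ?M 1 x" by (rule mult_right_mono[OF pt w0])
      then have "X x powr r * wgt ?M 1 x \<le> (2 * K * \<delta>) powr r * wgt ?M 1 x + D * (F x * wgt ?M 1 x)" by (simp add: algebra_simps)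
      moreover have "0 \<le> F x * wgt ?M 1 x" using w0 by (simp add: F_def)
      ultimately show "ennreal (X x powr r * wgt ?M 1 x) \<le> ennreal ((2 * K * \<delta>) powr r * wgt ?M 1 x) + ennreal D * ennreal (F x * wgt ?M 1 x)"
        using D w0 by (simp add: ennreal_mult[symmetric] ennreal_plus[symmetric] ennreal_leI del: ennreal_plus)
    qed
    also have "\<dots> = (\<integral>\<^sup>+x. ennreal ((2 * K * \<delta>) powr r * wgt ?M 1 (x::'a)) \<partial>lborel) + ennreal D * (\<integral>\<^sup>+x. ennreal (F x * wgt ?M 1 x) \<partial>lborel)"
      by (simp add: nn_integral_add nn_integral_cmult)
    also have "(\<integral>\<^sup>+x. ennreal ((2 * K * \<delta>) powr r * wgt ?M 1 (x::'a)) \<partial>lborel) = ennreal ((2 * K * \<delta>) powr r * J)"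
      using w0 wgt_integrable[where 'a='a, of ?M] by (subst nn_integral_eq_integral) (auto simp: J_def)
    also have "ennreal D * (\<integral>\<^sup>+x. ennreal (F x * wgt ?M 1 x) \<partial>lborel) \<le> ennreal D * ennreal (C * (K * 4 ^ DIM('a) * ?E))"
      by (intro mult_left_mono fluct) simp
    also have "\<dots> = ennreal (D * (C * (K * 4 ^ DIM('a) * ?E)))" using D C E0 K by (simp add: ennreal_mult)
    also have "D * (C * (K * 4 ^ DIM('a) * ?E)) = K powr r * (A / K)"
      using K \<delta> by (simp add: D_def A_def powr_mult field_simps power2_eq_square)
    also have "ennreal (K powr r * (A / K)) \<le> ennreal ((2 * K * \<delta>) powr r * J)"
    proof (rule ennreal_leI)
      have "A / K \<le> (2 * \<delta>) powr r * J" using K \<delta> J by (simp add: field_simps)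
      then have "K powr r * (A / K) \<le> K powr r * ((2 * \<delta>) powr r * J)" by (rule mult_left_mono) simp
      then show "K powr r * (A / K) \<le> (2 * K * \<delta>) powr r * J" using K(1) \<delta>(1) by (simp add: powr_mult mult_ac)
    qed
    also have "ennreal ((2 * K * \<delta>) powr r * J) + ennreal ((2 * K * \<delta>) powr r * J) = ennreal (2 * (2 * K * \<delta>) powr r * J)"
      using J by (simp add: ennreal_plus[symmetric] del: ennreal_plus)
    finally show "(\<integral>\<^sup>+x. ennreal ((\<Sum>k\<in>I. fejer_prod n (N k *\<^sub>R x)) powr r * wgt ?M 1 (x::'a)) \<partial>lborel) \<le>
       ennreal (2 * (2 * real (card I) * (2 / real n) ^ DIM('a)) powr r * (LINT x|lborel. wgt ?M 1 (x::'a)))"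
      by (simp add: X_def K_def \<delta>_def J_def)
  qed
qed

end

subsection \<open>Lacunary combs\<close>

lemma separated_indices:
  "\<exists>I::nat set. finite I \<and> card I = K \<and> (\<forall>k\<in>I. g + a \<le> k) \<and> (\<forall>k\<in>I. \<forall>k'\<in>I. k < k' \<longrightarrow> k + g \<le> k')"
proof (cases "g = 0")
  case True
  show ?thesis
    by (rule exI[of _ "(\<lambda>i. i + a) ` {..<K}"]) (auto simp: True card_image inj_on_def)
next
  case False
  let ?f = "\<lambda>i. (i + 1) * g + a"
  have inj: "?f i = ?f j \<Longrightarrow> i = j" for i j using False by simp
  have "inj_on ?f {..<K}" by (rule inj_onI) (rule inj)
  then have card: "card (?f ` {..<K}) = K" by (simp only: card_image card_lessThan)
  have sep: "?f i + g \<le> ?f j" if "?f i < ?f j" for i j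
  proof -
    have "i < j"
    proof (rule ccontr)
      assume "\<not> i < j"
      then have "(j + 1) * g \<le> (i + 1) * g" by (intro mult_le_mono1) simp
      then show False using that by simp
    qed
    then have "(i + 2) * g \<le> (j + 1) * g" by (intro mult_le_mono1) simp
    then show ?thesis by simp
  qed
  show ?thesis
  proof (rule exI[of _ "?f ` {..<K}"], intro conjI ballI impI card)
    show "g + a \<le> k" if "k \<in> ?f ` {..<K}" for k using that by auto
    show "k + g \<le> k'" if "k \<in> ?f ` {..<K}" "k' \<in> ?f ` {..<K}" "k < k'" for k k'
    proof -
      have "\<exists>i. k = ?f i" "\<exists>j. k' = ?f j" using that(1,2) by auto
      then obtain i j where ij: "k = ?f i" "k' = ?f j" by (elim exE)
      show ?thesis using that(3) unfolding ij by (rule sep)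
    qed
  qed simp
qed

text \<open>Peetre's inequality for the periodic weight: \<open>gap\<close> is Lipschitz with
  constant 2 pi d, and the dilations contribute A B.\<close>

lemma gap_peetre:
  assumes "2 * pi * real DIM('a) * (A * B) \<le> D" "0 \<le> A" "0 \<le> B"
  shows "1 / (1 + A * gap (B *\<^sub>R (x - z))) ^ N \<le> 1 / (1 + A * gap (B *\<^sub>R x)) ^ N * (1 + D * norm (z::'a::euclidean_space)) ^ N"
proof -
  let ?g = "A * gap (B *\<^sub>R (x - z))"
  have g: "0 \<le> ?g" using assms gap_nonneg by (intro mult_nonneg_nonneg) auto
  have "gap (B *\<^sub>R x) \<le> gap (B *\<^sub>R (x - z)) + 2 * pi * real DIM('a) * (B * norm z)"
    using gap_shift[of "B *\<^sub>R x" "B *\<^sub>R z"] assms by (simp add: scaleR_diff_right)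
  then have "A * gap (B *\<^sub>R x) \<le> ?g + (2 * pi * real DIM('a) * (A * B)) * norm z"
    using mult_left_mono[OF _ assms(2)] by (fastforce simp: algebra_simps)
  also have "\<dots> \<le> ?g + D * norm z" using assms by (intro add_left_mono mult_right_mono) auto
  finally have "1 + A * gap (B *\<^sub>R x) \<le> (1 + ?g) + D * norm z" by simp
  also have "\<dots> \<le> (1 + ?g) * (1 + D * norm z)"
  proof -
    have "0 \<le> 2 * pi * real DIM('a) * (A * B)" using assms by simp
    then have "0 \<le> D" using assms(1) by linarith
    then have "0 \<le> ?g * (D * norm z)" using g by (intro mult_nonneg_nonneg[OF g]) simp
    then show ?thesis by (simp add: algebra_simps)
  qed
  finally have "(1 + A * gap (B *\<^sub>R x)) ^ N \<le> ((1 + ?g) * (1 + D * norm z)) ^ N"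
    using assms gap_nonneg[of "B *\<^sub>R x"] by (intro power_mono) auto
  moreover have "0 < (1 + A * gap (B *\<^sub>R x)) ^ N" using assms gap_nonneg[of "B *\<^sub>R x"] by (intro zero_less_power add_pos_nonneg) auto
  moreover have "0 < (1 + ?g) ^ N" using g by (intro zero_less_power add_pos_nonneg) auto
  ultimately show ?thesis unfolding power_mult_distrib by (simp add: field_simps)
qed

context lp_decomposition
begin

text \<open>By Poisson summation this is the periodisation of \<Phi>(n x): bumps of width 1/n at the
  lattice points, written as a trigonometric polynomial. The cube of size 2n contains all lattice
  points where \<open>theta\<close> is nonzero.\<close>

definition bumps :: "nat \<Rightarrow> 'a \<Rightarrow> complex" where
  "bumps n x = of_real (1 / real n ^ DIM('a)) * (\<Sum>v\<in>cube (2 * n). theta (v /\<^sub>R real n) * ee (x \<bullet> v))"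

text \<open>Bumps of width 2^-(M+L) at spacing 2^-M under the envelope \<open>psi0\<close>.\<close>

definition blob :: "nat \<Rightarrow> nat \<Rightarrow> 'a \<Rightarrow> complex" where
  "blob L M x = bumps (2 ^ L) (2 ^ M *\<^sub>R x) * psi0 x"

definition blob_coeff :: "nat \<Rightarrow> 'a \<Rightarrow> complex" where
  "blob_coeff L v = of_real (1 / (2 ^ L) ^ DIM('a)) * theta (v /\<^sub>R 2 ^ L)"

lemma blob_expansion: "blob L M = (\<lambda>x. \<Sum>v\<in>cube (2 * 2 ^ L). blob_coeff L v * mode (2 ^ M *\<^sub>R v) x)"
  by (simp add: fun_eq_iff blob_def bumps_def blob_coeff_def mode_def sum_distrib_left sum_distrib_right mult_ac)

lemma blob_schwartz: "blob L M \<in> schwartz"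
  unfolding blob_expansion by (intro schwartz_sum schwartz_cmult mode_schwartz)

lemma fourier_blob: "fourier (blob L M) \<xi> = (\<Sum>v\<in>cube (2 * 2 ^ L). blob_coeff L v * fourier psi0 (\<xi> - 2 ^ M *\<^sub>R v))"
  unfolding blob_expansion by (subst fourier_sum) (simp_all only: schwartz_cmult mode_schwartz fourier_cmult fourier_mode)

lemma lp_proj_blob: "piece l (blob L M) x = (\<Sum>v\<in>cube (2 * 2 ^ L). blob_coeff L v * piece l (mode (2 ^ M *\<^sub>R v)) x)"
  unfolding blob_expansion by (rule lp_proj_sum[OF mode_schwartz])

lemma blob_support:
  assumes "fourier (blob L M) \<xi> \<noteq> 0"
  obtains v where "v \<in> lattice" "norm v \<le> 2 * 2 ^ L" "norm (\<xi> - 2 ^ M *\<^sub>R v) \<le> 1"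
proof -
  obtain v where v: "v \<in> cube (2 * 2 ^ L)" "blob_coeff L v * fourier psi0 (\<xi> - 2 ^ M *\<^sub>R v) \<noteq> 0"
    using assms unfolding fourier_blob by (meson sum.not_neutral_contains_not_neutral)
  have "theta (v /\<^sub>R 2 ^ L) \<noteq> 0" using v(2) by (auto simp: blob_coeff_def)
  then have "\<not> 2 \<le> norm (v /\<^sub>R 2 ^ L)" using theta_0 by blast
  then have "norm v \<le> 2 * 2 ^ L" by (simp add: field_simps)
  moreover have "norm (\<xi> - 2 ^ M *\<^sub>R v) \<le> 1" using v(2) psi0_support by auto
  ultimately show ?thesis using that v(1) by (auto simp: cube_def)
qed

lemma blob_support_norm:
  assumes "fourier (blob L M) \<xi> \<noteq> 0" shows "norm \<xi> \<le> 2 ^ (M + L + 2)"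
proof (rule blob_support[OF assms])
  fix v :: 'a assume v: "norm v \<le> 2 * 2 ^ L" "norm (\<xi> - 2 ^ M *\<^sub>R v) \<le> 1"
  have "norm \<xi> \<le> norm (\<xi> - 2 ^ M *\<^sub>R v) + norm (2 ^ M *\<^sub>R v)" using norm_triangle_ineq[of "\<xi> - 2 ^ M *\<^sub>R v" "2 ^ M *\<^sub>R v"] by simp
  also have "\<dots> \<le> 1 + 2 ^ M * (2 * 2 ^ L)" using v by (intro add_mono) auto
  also have "\<dots> \<le> 2 ^ (M + L + 2)" using one_le_power[of "2::real" "M + L"] by (simp add: power_add mult_ac)
  finally show ?thesis .
qed

text \<open>The nonzero lattice frequencies of the array lie between 2^M and 2^(M+L+1). The term v =
  0 has its spectrum in the unit ball, which no band l >= 1 meets.\<close>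

lemma blob_far:
  assumes l: "l \<ge> 1" and far: "M + L + 3 \<le> l \<or> l + 2 \<le> M"
  shows "lp_hat l \<xi> * fourier (blob L M) \<xi> = 0"
proof (rule ccontr)
  assume *: "lp_hat l \<xi> * fourier (blob L M) \<xi> \<noteq> 0"
  then have nz: "lp_hat l \<xi> \<noteq> 0" "fourier (blob L M) \<xi> \<noteq> 0" by auto
  note s = lp_hat_support[OF nz(1)]
  from far show False
  proof
    assume "M + L + 3 \<le> l"
    then have "(2::real) ^ (M + L + 3) \<le> 2 ^ l" by (rule power_increasing) simp
    then have "2 * 2 ^ (M + L + 2) \<le> (2::real) ^ l" by (simp add: power_add)
    then show False using s(2)[OF l] blob_support_norm[OF nz(2)] by linarith
  next
    assume "l + 2 \<le> M"
    then have M: "(2::real) ^ (l + 2) \<le> 2 ^ M" by (rule power_increasing) simp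
    have l2: "(2::real) \<le> 2 ^ l" using power_increasing[OF l, of "2::real"] by simp
    show False
    proof (rule blob_support[OF nz(2)])
      fix v :: 'a assume v: "v \<in> lattice" "norm (\<xi> - 2 ^ M *\<^sub>R v) \<le> 1"
      show False
      proof (cases "v = 0")
        case True
        then show False using v(2) s(2)[OF l] l2 by simp
      next
        case False
        have "2 ^ M * 1 \<le> 2 ^ M * norm v" using lattice_norm_ge_1[OF v(1) False] by (intro mult_left_mono) auto
        moreover have "2 ^ M * norm v \<le> norm \<xi> + norm (\<xi> - 2 ^ M *\<^sub>R v)" using norm_triangle_ineq4[of \<xi> "\<xi> - 2 ^ M *\<^sub>R v"] by simp
        ultimately have "2 ^ M \<le> norm \<xi> + 1" using v(2) by linarith
        then show False using M s(1) l2 by (simp add: power_add)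
      qed
    qed
  qed
qed

text \<open>Band M + t sees at most (16 * 2^t)^d lattice frequencies, each with a coefficient of
  order 2^(-dL) and a piece bounded uniformly by \<open>lp_proj_mode_bound\<close>.\<close>

lemma lp_proj_blob_bound:
  "\<exists>C>0. \<forall>L M t x. 1 \<le> t \<longrightarrow> norm (piece (M + t) (blob L M) x) \<le> C * 2 ^ (DIM('a) * t) / 2 ^ (DIM('a) * L) * wgt R 1 x"
proof -
  obtain C1 where C1: "C1 > 0" "\<And>l u x. l \<ge> 1 \<Longrightarrow> norm (piece l (mode u) x) \<le> C1 * wgt R 1 x"
    using lp_proj_mode_bound[of R] by blast
  obtain C2 where C2: "C2 > 0" "\<And>x. norm (theta x) \<le> C2" using schwartz_bounded[OF theta] by blast
  have "norm (piece (M + t) (blob L M) x) \<le> (C2 * C1 * 16 ^ DIM('a)) * 2 ^ (DIM('a) * t) / 2 ^ (DIM('a) * L) * wgt R 1 x"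
    if t: "1 \<le> t" for L M t x
  proof -
    let ?l = "M + t"
    let ?c = "cube (2 * 2 ^ L) :: 'a set"
    let ?d = "cube (2 ^ (t + 2)) :: 'a set"
    have l: "1 \<le> ?l" using t by simp
    have w0: "0 \<le> wgt R 1 x" using wgt_pos[of 1 R x] by simp
    have "piece ?l (blob L M) x = (\<Sum>v\<in>?c \<inter> ?d. blob_coeff L v * piece ?l (mode (2 ^ M *\<^sub>R v)) x)"
      unfolding lp_proj_blob
    proof (rule sum.mono_neutral_right[OF finite_cube])
      show "\<forall>v\<in>?c - (?c \<inter> ?d). blob_coeff L v * piece ?l (mode (2 ^ M *\<^sub>R v)) x = 0"
      proof
        fix v assume v: "v \<in> ?c - (?c \<inter> ?d)"
        have "lp_hat ?l \<xi> * fourier (mode (2 ^ M *\<^sub>R v)) \<xi> = 0" for \<xi>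
        proof (rule ccontr)
          assume "\<not> ?thesis"
          then have nz: "lp_hat ?l \<xi> \<noteq> 0" "fourier psi0 (\<xi> - 2 ^ M *\<^sub>R v) \<noteq> 0" by (auto simp: fourier_mode)
          have "norm (2 ^ M *\<^sub>R v) \<le> norm \<xi> + norm (\<xi> - 2 ^ M *\<^sub>R v)" using norm_triangle_ineq4[of \<xi> "\<xi> - 2 ^ M *\<^sub>R v"] by simp
          also have "\<dots> \<le> 2 * 2 ^ ?l + 1" using lp_hat_support(1)[OF nz(1)] psi0_support[OF nz(2)] by simp
          also have "\<dots> \<le> 2 ^ M * 2 ^ (t + 2)" using one_le_power[of "2::real" "M + t"] by (simp add: power_add)
          finally have "norm v \<le> 2 ^ (t + 2)" by simp
          then have "v \<in> ?d" using v by (intro cube_norm) (auto simp: cube_def)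
          then show False using v by auto
        qed
        then show "blob_coeff L v * piece ?l (mode (2 ^ M *\<^sub>R v)) x = 0"
          using lp_proj_vanish[OF mode_schwartz] by simp
      qed
    qed auto
    also have "norm \<dots> \<le> (\<Sum>v\<in>?c \<inter> ?d. (C2 / 2 ^ (DIM('a) * L)) * (C1 * wgt R 1 x))"
    proof (intro sum_norm_le)
      fix v :: 'a
      have "norm (blob_coeff L v) \<le> C2 / 2 ^ (DIM('a) * L)"
        using C2(2)[of "v /\<^sub>R 2 ^ L"] by (simp add: blob_coeff_def norm_mult norm_divide norm_power power_mult[symmetric] mult.commute divide_right_mono)
      then show "norm (blob_coeff L v * piece ?l (mode (2 ^ M *\<^sub>R v)) x) \<le> (C2 / 2 ^ (DIM('a) * L)) * (C1 * wgt R 1 x)"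
        unfolding norm_mult using C1(2)[OF l] C2(1) by (intro mult_mono) auto
    qed
    also have "\<dots> = real (card (?c \<inter> ?d)) * ((C2 / 2 ^ (DIM('a) * L)) * (C1 * wgt R 1 x))" by simp
    also have "\<dots> \<le> (16 ^ DIM('a) * 2 ^ (DIM('a) * t)) * ((C2 / 2 ^ (DIM('a) * L)) * (C1 * wgt R 1 x))"
    proof (rule mult_right_mono)
      have "card (?c \<inter> ?d) \<le> card ?d" by (intro card_mono finite_cube) auto
      also have "\<dots> = (2 * 2 ^ (t + 2) + 1) ^ DIM('a)" by (rule card_cube)
      also have "\<dots> \<le> (16 * 2 ^ t) ^ DIM('a)" using one_le_power[of "2::nat" t] by (intro power_mono) (auto simp: power_add)
      finally have "real (card (?c \<inter> ?d)) \<le> real ((16 * 2 ^ t) ^ DIM('a))" by (rule of_nat_mono)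
      then show "real (card (?c \<inter> ?d)) \<le> 16 ^ DIM('a) * 2 ^ (DIM('a) * t)"
        by (simp add: power_mult_distrib power_mult[symmetric] mult.commute)
    qed (use C1 C2 w0 in auto)
    finally show ?thesis by (simp add: mult_ac)
  qed
  then show ?thesis using C1 C2 by (intro exI[of _ "C2 * C1 * 16 ^ DIM('a)"]) auto
qed

text \<open>Around 2^t e1 there are about 2^(dt) lattice points at which the multiplier is at least
  1/2 and the coefficient is exactly 2^(-dL). For M >= 2 their spectra are disjoint, so the energies
  add.\<close>

lemma lp_proj_blob_energy:
  "\<exists>b0\<ge>1. \<exists>e0>0. \<forall>L M t. b0 \<le> t \<longrightarrow> t + 1 \<le> L \<longrightarrow> 2 \<le> M \<longrightarrow>
     e0 * 2 ^ (DIM('a) * t) / (2 ^ (DIM('a) * L))\<^sup>2 \<le> (LINT x|lborel. (norm (piece (M + t) (blob L M) x))\<^sup>2)"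
proof -
  obtain j0 where j0: "\<And>\<zeta>. norm (\<zeta> - e1) \<le> 1 / 2 ^ j0 \<Longrightarrow> 1 / 2 \<le> norm (phi_hat \<zeta>)" using phi_hat_near_e1 by blast
  \<comment> \<open>The d pays for passing from the cube to the norm, and j0 + 1 leaves half of the
    radius 2^-j0 for the spectrum of \<open>psi0\<close>.\<close>
  define b0 where "b0 = DIM('a) + j0 + 1"
  define E where "E = (LINT \<xi>|lborel. (norm (fourier psi0 \<xi>))\<^sup>2)"
  have E: "E > 0"
    unfolding E_def by (rule psi0_energy)
  have d2: "real DIM('a) \<le> 2 ^ DIM('a)" by (metis less_imp_le of_nat_less_two_power)
  define e0 where "e0 = E / 4 / 2 ^ (DIM('a) * b0)"
  have "e0 * 2 ^ (DIM('a) * t) / (2 ^ (DIM('a) * L))\<^sup>2 \<le> (LINT x|lborel. (norm (piece (M + t) (blob L M) x))\<^sup>2)"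
    if t: "b0 \<le> t" and L: "t + 1 \<le> L" and M: "2 \<le> M" for L M t
  proof -
    let ?l = "M + t"
    let ?F = "\<lambda>\<xi>. lp_hat ?l \<xi> * fourier (blob L M) \<xi>"
    define \<epsilon> where "\<epsilon> = 1 / (2 ^ (DIM('a) * L) :: real)"
    define S where "S = (\<lambda>\<mu>. 2 ^ t *\<^sub>R e1 + \<mu>) ` (cube (2 ^ (t - b0)) :: 'a set)"
    have finS: "finite S" unfolding S_def by (intro finite_imageI finite_cube)
    have cardS: "2 ^ (DIM('a) * t) / 2 ^ (DIM('a) * b0) \<le> real (card S)"
    proof -
      have "card S = (2 * 2 ^ (t - b0) + 1) ^ DIM('a)" unfolding S_def by (subst card_image) (auto simp: inj_on_def card_cube)
      moreover have "(2 ^ (t - b0)) ^ DIM('a) \<le> (2 * 2 ^ (t - b0) + 1 :: nat) ^ DIM('a)" by (intro power_mono) auto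
      ultimately have "real ((2 ^ (t - b0)) ^ DIM('a)) \<le> real (card S)" by (simp only: of_nat_le_iff)
      moreover have "real ((2 ^ (t - b0)) ^ DIM('a)) = 2 ^ (DIM('a) * t) / 2 ^ (DIM('a) * b0)"
      proof -
        have "(2::real) ^ (t - b0) = 2 ^ t / 2 ^ b0" using t by (simp add: power_diff)
        then have "real ((2 ^ (t - b0)) ^ DIM('a)) = (2 ^ t / 2 ^ b0) ^ DIM('a)" by (simp only: of_nat_power of_nat_numeral)
        then show ?thesis by (simp add: power_divide power_mult[symmetric] mult.commute)
      qed
      ultimately show ?thesis by simp
    qed
    have \<mu>: "norm \<mu> \<le> 2 ^ t / 2 ^ (j0 + 1)" if "\<mu> \<in> cube (2 ^ (t - b0))" for \<mu> :: 'a
    proof -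
      have "norm \<mu> \<le> (\<Sum>b\<in>Basis. \<bar>\<mu> \<bullet> b\<bar>)" by (rule norm_le_l1)
      also have "\<dots> \<le> (\<Sum>b\<in>(Basis::'a set). 2 ^ (t - b0))" using that by (intro sum_mono) (auto simp: cube_def)
      also have "\<dots> = real DIM('a) * (2 ^ t / 2 ^ b0)" using t by (simp add: power_diff)
      also have "\<dots> \<le> 2 ^ DIM('a) * (2 ^ t / 2 ^ b0)" using d2 by (intro mult_right_mono) auto
      also have "\<dots> = 2 ^ t / 2 ^ (j0 + 1)" by (simp add: b0_def power_add)
      finally show ?thesis .
    qed
    have Sv: "v \<in> cube (2 * 2 ^ L)" "norm v \<le> 2 ^ L" "blob_coeff L v = of_real \<epsilon>"
      "\<And>\<xi>. norm (\<xi> - 2 ^ M *\<^sub>R v) \<le> 1 \<Longrightarrow> 1 / 2 \<le> norm (lp_hat ?l \<xi>)" if v: "v \<in> S" for v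
    proof -
      obtain \<mu> where u: "\<mu> \<in> cube (2 ^ (t - b0))" "v = 2 ^ t *\<^sub>R e1 + \<mu>" using v by (auto simp: S_def)
      have n\<mu>: "norm \<mu> \<le> 2 ^ t / 2 ^ (j0 + 1)" by (rule \<mu>[OF u(1)])
      also have "\<dots> \<le> 2 ^ t" using one_le_power[of "2::real" "j0 + 1"] by (simp add: divide_le_eq)
      finally have "norm v \<le> 2 ^ t + 2 ^ t" unfolding u(2) using norm_triangle_ineq[of "2 ^ t *\<^sub>R e1" \<mu>] norm_e1 by simp
      also have "\<dots> = 2 ^ (t + 1)" by simp
      also have "\<dots> \<le> 2 ^ L" using L by (intro power_increasing) auto
      finally show nv: "norm v \<le> 2 ^ L" .
      have "(2 ^ t) *\<^sub>R e1 \<in> lattice" using lattice_scale[OF lattice_Basis[OF e1], of "2 ^ t"] by simp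
      then have "v \<in> lattice" unfolding u(2) using u(1) by (intro lattice_add) (auto simp: cube_def)
      then show "v \<in> cube (2 * 2 ^ L)" by (rule cube_norm) (rule order_trans[OF nv], simp)
      have "norm (v /\<^sub>R 2 ^ L) \<le> 1" using nv by (simp add: field_simps)
      then show "blob_coeff L v = of_real \<epsilon>"
        by (simp add: blob_coeff_def theta_1 \<epsilon>_def power_mult[symmetric] mult.commute)
      fix \<xi> assume \<xi>: "norm (\<xi> - 2 ^ M *\<^sub>R v) \<le> 1"
      have l: "?l \<noteq> 0" using M by simp
      have "norm (\<xi> /\<^sub>R 2 ^ ?l - e1) = norm ((\<xi> - 2 ^ M *\<^sub>R v) + 2 ^ M *\<^sub>R \<mu>) / 2 ^ ?l"
      proof -
        have "\<xi> /\<^sub>R 2 ^ ?l - e1 = ((\<xi> - 2 ^ M *\<^sub>R v) + 2 ^ M *\<^sub>R \<mu>) /\<^sub>R 2 ^ ?l"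
          by (simp add: u(2) scaleR_add_right scaleR_diff_right power_add) (simp add: field_simps)
        then show ?thesis by (simp add: divide_inverse mult.commute)
      qed
      also have "\<dots> \<le> (1 + 2 ^ M * (2 ^ t / 2 ^ (j0 + 1))) / 2 ^ ?l"
      proof (intro divide_right_mono order_trans[OF norm_triangle_ineq] add_mono \<xi>)
        show "norm (2 ^ M *\<^sub>R \<mu>) \<le> 2 ^ M * (2 ^ t / 2 ^ (j0 + 1))" unfolding norm_scaleR using n\<mu> by (intro mult_mono) auto
      qed simp
      also have "\<dots> = 1 / 2 ^ ?l + 1 / 2 ^ (j0 + 1)" by (simp add: add_divide_distrib power_add)
      also have "\<dots> \<le> 1 / 2 ^ (j0 + 1) + 1 / 2 ^ (j0 + 1)"
        using t by (intro add_right_mono divide_left_mono power_increasing) (auto simp: b0_def)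
      also have "\<dots> = 1 / 2 ^ j0" by simp
      finally have "1 / 2 \<le> norm (phi_hat (\<xi> /\<^sub>R 2 ^ ?l))" by (rule j0)
      then show "1 / 2 \<le> norm (lp_hat ?l \<xi>)" using l by (auto simp: lp_hat_def inverse_eq_divide)
    qed
    \<comment> \<open>Dilated lattice points are at least 4 apart, while each spectrum has radius
      1.\<close>
    have single: "w = v" if "v \<in> lattice" "w \<in> lattice" "fourier psi0 (\<xi> - 2 ^ M *\<^sub>R v) \<noteq> 0" "fourier psi0 (\<xi> - 2 ^ M *\<^sub>R w) \<noteq> 0" for v w \<xi>
    proof (rule ccontr)
      assume "w \<noteq> v"
      then have "1 \<le> norm (v - w)" using that by (intro lattice_norm_ge_1 lattice_diff) auto
      then have "2 ^ M * 1 \<le> 2 ^ M * norm (v - w)" by (rule mult_left_mono) simp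
      also have "2 ^ M * norm (v - w) = norm ((\<xi> - 2 ^ M *\<^sub>R w) - (\<xi> - 2 ^ M *\<^sub>R v))" 
      proof -
        have "(\<xi> - 2 ^ M *\<^sub>R w) - (\<xi> - 2 ^ M *\<^sub>R v) = 2 ^ M *\<^sub>R (v - w)" by (simp add: scaleR_diff_right)
        then show ?thesis by simp
      qed
      also have "\<dots> \<le> 1 + 1" using psi0_support[OF that(3)] psi0_support[OF that(4)] norm_triangle_ineq4[of "\<xi> - 2 ^ M *\<^sub>R w" "\<xi> - 2 ^ M *\<^sub>R v"] by linarith
      finally have "(2::real) ^ M \<le> 2" by simp
      moreover have "(2::real) ^ 2 \<le> 2 ^ M" using M by (rule power_increasing) simp
      ultimately show False by simp
    qed
    have pt: "(\<epsilon>\<^sup>2 / 4) * (\<Sum>v\<in>S. (norm (fourier psi0 (\<xi> - 2 ^ M *\<^sub>R v)))\<^sup>2) \<le> (norm (?F \<xi>))\<^sup>2" for \<xi>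
    proof (cases "\<exists>v\<in>S. fourier psi0 (\<xi> - 2 ^ M *\<^sub>R v) \<noteq> 0")
      case True
      then obtain v where v: "v \<in> S" "fourier psi0 (\<xi> - 2 ^ M *\<^sub>R v) \<noteq> 0" by blast
      note vl = Sv[OF v(1)]
      have vlat: "v \<in> lattice" using vl(1) by (simp add: cube_def)
      have oth: "fourier psi0 (\<xi> - 2 ^ M *\<^sub>R w) = 0" if "w \<in> lattice" "w \<noteq> v" for w
        using single[OF vlat that(1) v(2)] that(2) by blast
      have Sl: "w \<in> lattice" if "w \<in> S" for w using Sv(1)[OF that] by (simp add: cube_def)
      have 1: "(\<Sum>v\<in>S. (norm (fourier psi0 (\<xi> - 2 ^ M *\<^sub>R v)))\<^sup>2) = (norm (fourier psi0 (\<xi> - 2 ^ M *\<^sub>R v)))\<^sup>2"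
        using oth Sl by (subst sum.remove[OF finS v(1)]) (auto intro!: sum.neutral)
      have 2: "fourier (blob L M) \<xi> = of_real \<epsilon> * fourier psi0 (\<xi> - 2 ^ M *\<^sub>R v)"
        unfolding fourier_blob vl(3)[symmetric] using oth by (subst sum.remove[OF finite_cube vl(1)]) (auto intro!: sum.neutral simp: cube_def)
      have "1 / 2 \<le> norm (lp_hat ?l \<xi>)" by (rule vl(4)[OF psi0_support[OF v(2)]])
      then have "(1 / 2)\<^sup>2 \<le> (norm (lp_hat ?l \<xi>))\<^sup>2" by (rule power_mono) simp
      then have "(1 / 2)\<^sup>2 * (norm (of_real \<epsilon> * fourier psi0 (\<xi> - 2 ^ M *\<^sub>R v)))\<^sup>2 \<le> (norm (lp_hat ?l \<xi>))\<^sup>2 * (norm (of_real \<epsilon> * fourier psi0 (\<xi> - 2 ^ M *\<^sub>R v)))\<^sup>2"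
        by (rule mult_right_mono) simp
      then show ?thesis unfolding 1 2 by (simp add: norm_mult power_mult_distrib power_divide mult_ac)
    next
      case False
      then have "(\<Sum>v\<in>S. (norm (fourier psi0 (\<xi> - 2 ^ M *\<^sub>R v)))\<^sup>2) = 0" by (intro sum.neutral) auto
      then show ?thesis by simp
    qed
    have sq: "integrable lborel (\<lambda>\<xi>. (norm (fourier psi0 (\<xi> - u)))\<^sup>2)" for u
      by (intro schwartz_square_integrable schwartz_translate fourier_schwartz psi0_schwartz)
    have tr: "(LINT \<xi>|lborel. (norm (fourier psi0 (\<xi> - u)))\<^sup>2) = E" for u
      using integral_translate[of "\<lambda>\<xi>. (norm (fourier psi0 \<xi>))\<^sup>2" "- u"] schwartz_measurable[OF fourier_schwartz[OF psi0_schwartz]] by (simp add: E_def)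
    have "e0 * 2 ^ (DIM('a) * t) / (2 ^ (DIM('a) * L))\<^sup>2 = (\<epsilon>\<^sup>2 / 4) * (2 ^ (DIM('a) * t) / 2 ^ (DIM('a) * b0) * E)"
      by (simp add: e0_def \<epsilon>_def power_one_over field_simps)
    also have "\<dots> \<le> (\<epsilon>\<^sup>2 / 4) * (real (card S) * E)"
      using cardS E by (intro mult_left_mono mult_right_mono) auto
    also have "\<dots> = (LINT \<xi>|lborel. (\<epsilon>\<^sup>2 / 4) * (\<Sum>v\<in>S. (norm (fourier psi0 (\<xi> - 2 ^ M *\<^sub>R v)))\<^sup>2))"
      using sq by (simp add: Bochner_Integration.integral_sum tr)
    also have "\<dots> \<le> (LINT \<xi>|lborel. (norm (?F \<xi>))\<^sup>2)"
      using sq by (intro integral_mono pt schwartz_square_integrable schwartz_mult schwartz_imp_slow lp_hat_schwartz fourier_schwartz blob_schwartz) auto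
    also have "\<dots> = (LINT x|lborel. (norm (piece ?l (blob L M) x))\<^sup>2)"
      by (subst plancherel_norm[OF lp_proj_schwartz[OF blob_schwartz]]) (simp add: fourier_lp_proj blob_schwartz)
    finally show ?thesis .
  qed
  moreover have "e0 > 0" using E by (simp add: e0_def)
  moreover have "b0 \<ge> 1" by (simp add: b0_def)
  ultimately show ?thesis by blast
qed

text \<open>The pointwise bound H of order 2^(d(t-L)) gives |P|^2 <= H^(2-a) |P|^a w, so the energy
  bounds the weighted a-th moment from below even though a <= 1. The exponents combine as t - 2L +
  (a - 2)(t - L) = t(a - 1) - La.\<close>

lemma lp_proj_blob_lower:
  assumes a: "0 < a" "a \<le> 1"
  shows "\<exists>b0\<ge>1. \<exists>c>0. \<forall>L M t. b0 \<le> t \<longrightarrow> t + 1 \<le> L \<longrightarrow> 2 \<le> M \<longrightarrow>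
     ennreal (c * 2 powr (real DIM('a) * (real t * (a - 1) - real L * a))) \<le>
       (\<integral>\<^sup>+x. ennreal (norm (piece (M + t) (blob L M) x) powr a * wgt (2 * DIM('a)) 1 x) \<partial>lborel)"
proof -
  let ?R = "2 * DIM('a)"
  obtain C where C: "C > 0" "\<And>L M t x. 1 \<le> t \<Longrightarrow> norm (piece (M + t) (blob L M) x) \<le> C * 2 ^ (DIM('a) * t) / 2 ^ (DIM('a) * L) * wgt ?R 1 x"
    using lp_proj_blob_bound[of ?R] by blast
  obtain b0 e0 where be: "b0 \<ge> 1" "e0 > 0" "\<And>L M t. b0 \<le> t \<Longrightarrow> t + 1 \<le> L \<Longrightarrow> 2 \<le> M \<Longrightarrow>
     e0 * 2 ^ (DIM('a) * t) / (2 ^ (DIM('a) * L))\<^sup>2 \<le> (LINT x|lborel. (norm (piece (M + t) (blob L M) x))\<^sup>2)"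
    using lp_proj_blob_energy by blast
  have "ennreal (e0 * C powr (a - 2) * 2 powr (real DIM('a) * (real t * (a - 1) - real L * a))) \<le>
       (\<integral>\<^sup>+x. ennreal (norm (piece (M + t) (blob L M) x) powr a * wgt ?R 1 x) \<partial>lborel)"
    if t: "b0 \<le> t" and L: "t + 1 \<le> L" and M: "2 \<le> M" for L M t
  proof -
    let ?P = "piece (M + t) (blob L M)"
    let ?d = "real DIM('a)"
    have PS: "?P \<in> schwartz" by (intro lp_proj_schwartz blob_schwartz)
    note [measurable] = schwartz_measurable[OF PS]
    define H where "H = C * 2 powr (?d * (real t - real L))"
    have H: "H > 0" using C by (simp add: H_def)
    have e: "2 ^ (DIM('a) * t) / 2 ^ (DIM('a) * L) = 2 powr (?d * (real t - real L))"
      by (simp add: powr_diff powr_realpow[symmetric] right_diff_distrib)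
    have PH: "norm (?P x) \<le> H * wgt ?R 1 x" for x using C(2)[of t M L x] t be(1) unfolding H_def e[symmetric] by simp
    have pt: "(norm (?P x))\<^sup>2 \<le> H powr (2 - a) * (norm (?P x) powr a * wgt ?R 1 x)" for x
    proof (cases "?P x = 0")
      case False
      have w: "0 < wgt ?R 1 x" "wgt ?R 1 x \<le> 1" using wgt_pos[of 1 ?R x] wgt_le_1[of 1 ?R x] by auto
      have "(norm (?P x))\<^sup>2 = norm (?P x) powr a * norm (?P x) powr (2 - a)" using False by (simp add: powr_add[symmetric])
      also have "\<dots> \<le> norm (?P x) powr a * (H * wgt ?R 1 x) powr (2 - a)"
        using PH[of x] a by (intro mult_left_mono powr_mono2) auto
      also have "\<dots> = norm (?P x) powr a * (H powr (2 - a) * wgt ?R 1 x powr (2 - a))" using H w by (simp add: powr_mult)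
      also have "\<dots> \<le> norm (?P x) powr a * (H powr (2 - a) * wgt ?R 1 x powr 1)"
        using w a by (intro mult_left_mono powr_mono') auto
      finally show ?thesis using w by (simp add: mult_ac)
    qed simp
    have "ennreal (e0 * 2 ^ (DIM('a) * t) / (2 ^ (DIM('a) * L))\<^sup>2) \<le> ennreal (LINT x|lborel. (norm (?P x))\<^sup>2)"
      by (rule ennreal_leI[OF be(3)[OF t L M]])
    also have "\<dots> = (\<integral>\<^sup>+x. ennreal ((norm (?P x))\<^sup>2) \<partial>lborel)"
      by (rule nn_integral_eq_integral[symmetric]) (use schwartz_square_integrable[OF PS] in auto)
    also have "\<dots> \<le> (\<integral>\<^sup>+x. ennreal (H powr (2 - a) * (norm (?P x) powr a * wgt ?R 1 x)) \<partial>lborel)"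
      by (intro nn_integral_mono ennreal_leI pt)
    also have "\<dots> = ennreal (H powr (2 - a)) * (\<integral>\<^sup>+x. ennreal (norm (?P x) powr a * wgt ?R 1 x) \<partial>lborel)"
      by (simp add: ennreal_mult' nn_integral_cmult)
    finally have "ennreal (H powr (a - 2)) * ennreal (e0 * 2 ^ (DIM('a) * t) / (2 ^ (DIM('a) * L))\<^sup>2) \<le>
        ennreal (H powr (a - 2)) * (ennreal (H powr (2 - a)) * (\<integral>\<^sup>+x. ennreal (norm (?P x) powr a * wgt ?R 1 x) \<partial>lborel))"
      by (rule mult_left_mono) simp
    also have "\<dots> = (\<integral>\<^sup>+x. ennreal (norm (?P x) powr a * wgt ?R 1 x) \<partial>lborel)"
      using H by (simp add: mult.assoc[symmetric] ennreal_mult[symmetric] powr_add[symmetric])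
    also have "ennreal (H powr (a - 2)) * ennreal (e0 * 2 ^ (DIM('a) * t) / (2 ^ (DIM('a) * L))\<^sup>2) =
        ennreal (e0 * C powr (a - 2) * 2 powr (?d * (real t * (a - 1) - real L * a)))"
    proof -
      have e2: "2 ^ (DIM('a) * t) / (2 ^ (DIM('a) * L))\<^sup>2 = (2::real) powr (?d * real t - 2 * (?d * real L))"
        by (simp add: powr_diff powr_realpow[symmetric] power2_eq_square powr_add[symmetric] mult_ac)
      have "H powr (a - 2) * (e0 * 2 ^ (DIM('a) * t) / (2 ^ (DIM('a) * L))\<^sup>2) =
          e0 * C powr (a - 2) * (2 powr ((?d * (real t - real L)) * (a - 2)) * 2 powr (?d * real t - 2 * (?d * real L)))"
        unfolding times_divide_eq_right[symmetric] e2 H_def using C(1) by (simp add: powr_mult powr_powr)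
      also have "2 powr ((?d * (real t - real L)) * (a - 2)) * 2 powr (?d * real t - 2 * (?d * real L)) = (2::real) powr (?d * (real t * (a - 1) - real L * a))"
        unfolding powr_add[symmetric] by (simp add: algebra_simps)
      finally show ?thesis using be(2) by (simp add: ennreal_mult[symmetric])
    qed
    finally show ?thesis .
  qed
  moreover have "e0 * C powr (a - 2) > 0" using be C by simp
  ultimately show ?thesis using be(1) by blast
qed

lemma blob_bound:
  "\<exists>C>0. \<forall>L M x. norm (blob L M x) \<le> C * (1 / (1 + 2 ^ L * gap (2 ^ M *\<^sub>R x)) ^ N * wgt R 1 x)"
proof -
  obtain C1 where C1: "C1 > 0" "\<And>n x. n \<ge> 1 \<Longrightarrow> norm (bumps n x) \<le> C1 / (1 + real n * gap x) ^ N"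
    using lattice_sum_gap_decay[OF theta theta_0, of N] unfolding bumps_def by blast
  obtain C0 where C0: "C0 > 0" "\<And>x. norm (psi0 x) \<le> C0 / (1 + norm x) ^ R"
    using schwartz_bound[OF psi0_schwartz] by blast
  have "norm (blob L M x) \<le> (C1 * C0) * (1 / (1 + 2 ^ L * gap (2 ^ M *\<^sub>R x)) ^ N * wgt R 1 x)" for L M x
  proof -
    have "norm (blob L M x) \<le> (C1 / (1 + real (2 ^ L) * gap (2 ^ M *\<^sub>R x)) ^ N) * (C0 / (1 + norm x) ^ R)"
      unfolding blob_def norm_mult using C1(1) gap_nonneg[of "2 ^ M *\<^sub>R x"] by (intro mult_mono C1(2) C0(2)) auto
    then show ?thesis by (simp add: wgt_def)
  qed
  then show ?thesis using C1 C0 by (intro exI[of _ "C1 * C0"]) auto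
qed

end

lemma inverse_power_powr_le:
  fixes y t :: real
  assumes "0 \<le> y" "real M \<le> real R * t"
  shows "(1 / (1 + y) ^ R) powr t \<le> 1 / (1 + y) ^ M"
proof -
  have y: "1 + y > 0" using assms by linarith
  have "(1 / (1 + y) ^ R) powr t = (1 + y) powr - (real R * t)"
    using y by (simp add: powr_realpow[symmetric] powr_minus_divide[symmetric] powr_powr)
  also have "\<dots> \<le> (1 + y) powr - real M" using assms by (intro powr_mono) auto
  also have "\<dots> = 1 / (1 + y) ^ M" using y by (simp add: powr_minus powr_realpow field_simps)
  finally show ?thesis .
qed

context lp_decomposition
begin

text \<open>The gap makes consecutive dilation factors grow by 2^(L+d+4), more than the frequencies
  of the Fejer products, bounded by 2^L d, can bridge. The lower bound on k leaves room for the
  subtraction in \<open>scale\<close>.\<close>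

definition spread :: "nat \<Rightarrow> nat set \<Rightarrow> bool" where
  "spread L I \<longleftrightarrow> finite I \<and> (\<forall>k\<in>I. (L + DIM('a) + 4) + (L + DIM('a) + 5) \<le> k) \<and>
     (\<forall>k\<in>I. \<forall>k'\<in>I. k < k' \<longrightarrow> k + (L + DIM('a) + 4) \<le> k')"

text \<open>The offset makes the majorant of the array vary slowly at scale 2^-k, since 2 pi d <=
  2^(d+5), and it also keeps the spectrum below 2^k / 8.\<close>

definition scale :: "nat \<Rightarrow> nat \<Rightarrow> nat" where
  "scale L k = k - (L + DIM('a) + 5)"

definition comb :: "real \<Rightarrow> nat \<Rightarrow> nat \<Rightarrow> 'a \<Rightarrow> complex" where
  "comb s L k x = of_real (2 powr (- s * real k)) * blob L (scale L k) x"

lemma scale: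
  assumes "spread L I" "k \<in> I"
  shows "scale L k + (L + DIM('a) + 5) = k" "L + DIM('a) + 4 \<le> scale L k"
  using assms by (auto simp: spread_def scale_def)

lemma comb_schwartz: "comb s L k \<in> schwartz"
  unfolding comb_def[abs_def] by (intro schwartz_cmult blob_schwartz)

lemma comb_admissible:
  assumes I: "spread L I" shows "admissible I (comb s L)"
  unfolding admissible_def
proof (intro conjI ballI allI impI)
  show "finite I" using I by (simp add: spread_def)
  fix k assume k: "k \<in> I"
  show "4 \<le> k" using I k by (auto simp: spread_def)
  show "comb s L k \<in> schwartz" by (rule comb_schwartz)
  fix \<xi> assume "fourier (comb s L k) \<xi> \<noteq> 0"
  then have "fourier (blob L (scale L k)) \<xi> \<noteq> 0" unfolding comb_def[abs_def] fourier_cmult by auto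
  then have "norm \<xi> \<le> 2 ^ (scale L k + L + 2)" by (rule blob_support_norm)
  also have "\<dots> \<le> 2 ^ (k - 3)" using scale[OF I k] by (intro power_increasing) auto
  also have "\<dots> = 2 ^ k / 8" using scale[OF I k] power_diff[of "2::real" 3 k] by simp
  finally show "norm \<xi> \<le> 2 ^ k / 8" .
qed

text \<open>The q-th powers of the majorants are dominated by Fejer products, whose sum over K
  scales behaves like its mean K (2 / 2^L)^d in L^(p/q). The threshold \<open>K0\<close> depends on
  L, so L has to be fixed first.\<close>

lemma comb_input:
  assumes q: "q > 0" "q \<noteq> \<infinity>" and p: "p > q" "p \<noteq> \<infinity>"
  shows "\<exists>Z>0. \<forall>L. \<exists>K0\<ge>1. \<forall>I. spread L I \<longrightarrow> K0 \<le> card I \<longrightarrow>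
     triebel (s + m) p q (dist_of (modulated m I (comb s L))) \<le>
       ennreal (Z * (real (card I) / 2 ^ (DIM('a) * L)) powr (1 / enn2real q))"
proof -
  let ?d = "DIM('a)"
  define a where "a = enn2real q"
  define P where "P = enn2real p"
  have p0: "p > 0" using q(1) p(1) by (rule less_trans)
  have a: "a > 0" using enn2real_pos[OF q] by (simp add: a_def)
  have P: "P > 0" using enn2real_pos[OF p0 p(2)] by (simp add: P_def)
  have "a < P" unfolding a_def P_def using p q by (intro enn2real_less_iff[THEN iffD2]) (auto simp: top.not_eq_extremum)
  then have r: "P / a > 1" using a by simp
  \<comment> \<open>N makes the a-th power of the periodic decay comparable to the lower bound of
    the Fejer product, and R makes the p-th power of the envelope at most the weight in
    \<open>fejer_moment\<close>.\<close>
  define N where "N = nat \<lceil>2 * real ?d / a\<rceil>"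
  define R where "R = nat \<lceil>2 * real ?d / P\<rceil>"
  have N: "real (2 * ?d) \<le> real N * a"
  proof -
    have "2 * real ?d / a \<le> real N" unfolding N_def by (rule real_nat_ceiling_ge)
    then show ?thesis using a by (simp add: field_simps)
  qed
  have R: "real (2 * ?d) \<le> real R * P"
  proof -
    have "2 * real ?d / P \<le> real R" unfolding R_def by (rule real_nat_ceiling_ge)
    then show ?thesis using P by (simp add: field_simps)
  qed
  obtain Cb where Cb: "Cb > 0" "\<And>L M x. norm (blob L M x) \<le> Cb * (1 / (1 + 2 ^ L * gap (2 ^ M *\<^sub>R x)) ^ N * wgt R 1 x)"
    using blob_bound[of N R] by blast
  obtain D where D: "D > 0" "\<forall>I G w. admissible I G \<longrightarrow> (\<forall>k\<in>I. \<forall>x. norm (G k x) \<le> w k x) \<longrightarrow>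
     (\<forall>k\<in>I. \<forall>x z. w k (x - z) \<le> w k x * (1 + 2 ^ k * norm z) ^ (N + R)) \<longrightarrow>
     localized s m (modulated m I G) D I w"
    using modulated_lp_proj[where M = "N + R"] by blast
  define J where "J = (LINT x|lborel. wgt (2 * ?d) 1 (x::'a))"
  have J: "J > 0" unfolding J_def by (rule wgt_integral_pos) simp
  define Y where "Y = D * Cb"
  have Y: "Y > 0" using D Cb by (simp add: Y_def)
  \<comment> \<open>The 3 counts the bands that see one index, and 4^d comes from the lower bound of
    the Fejer product.\<close>
  define A where "A = 3 * Y powr a * 4 ^ ?d"
  have A: "A > 0" using Y by (simp add: A_def)
  define Z where "Z = (A * (2 * 2 ^ ?d)) powr (1 / a) * (2 * J) powr (1 / P)"
  have Z: "Z > 0" using A J by (simp add: Z_def)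
  have "\<exists>K0\<ge>1. \<forall>I. spread L I \<longrightarrow> K0 \<le> card I \<longrightarrow>
     triebel (s + m) p q (dist_of (modulated m I (comb s L))) \<le>
       ennreal (Z * (real (card I) / 2 ^ (?d * L)) powr (1 / a))" for L
  proof -
    obtain K0 where K0: "K0 \<ge> 1" "\<forall>I::nat set. \<forall>N. finite I \<longrightarrow> K0 \<le> card I \<longrightarrow> (\<forall>k\<in>I. 0 < N k) \<longrightarrow>
     (\<forall>k\<in>I. \<forall>k'\<in>I. k < k' \<longrightarrow> N k * (real (2 ^ L) * real DIM('a)) + 2 < N k') \<longrightarrow>
     (\<integral>\<^sup>+x. ennreal ((\<Sum>k\<in>I. fejer_prod (2 ^ L) (N k *\<^sub>R x)) powr (P / a) * wgt (2 * DIM('a)) 1 (x::'a)) \<partial>lborel) \<le>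
       ennreal (2 * (2 * real (card I) * (2 / real (2 ^ L)) ^ DIM('a)) powr (P / a) * (LINT x|lborel. wgt (2 * DIM('a)) 1 (x::'a)))"
      using fejer_moment[of "2 ^ L" "P / a", OF _ r] by auto
    show ?thesis
    proof (intro exI[of _ K0] conjI K0(1) allI impI)
      fix I assume I: "spread L I" and card: "K0 \<le> card I"
      define K where "K = real (card I)"
      have K: "K \<ge> 1" using card K0(1) by (simp add: K_def)
      have fin: "finite I" using I by (simp add: spread_def)
      have ne: "I \<noteq> {}" using card K0(1) by auto
      have k4: "4 \<le> k" if "k \<in> I" for k using I that by (auto simp: spread_def)
      have sparse: "\<forall>k\<in>I. \<forall>k'\<in>I. k < k' \<longrightarrow> k + 4 \<le> k'" using I by (fastforce simp: spread_def)
      define \<Omega> where "\<Omega> k x = 1 / (1 + 2 ^ L * gap (2 ^ scale L k *\<^sub>R x)) ^ N * wgt R 1 x" for k and x :: 'a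
      define w where "w k x = 2 powr (- s * real k) * (Cb * \<Omega> k x)" for k and x :: 'a
      have \<Omega>0: "0 \<le> \<Omega> k x" for k x
        unfolding \<Omega>_def using gap_nonneg[of "2 ^ scale L k *\<^sub>R x"] wgt_pos[of 1 R x] by (intro mult_nonneg_nonneg) auto
      have bd: "localized s m (modulated m I (comb s L)) D I w"
      proof (rule D(2)[rule_format, OF comb_admissible[OF I]])
        fix k x assume k: "k \<in> I"
        show "norm (comb s L k x) \<le> w k x"
          unfolding comb_def w_def norm_mult \<Omega>_def norm_of_real by (intro mult_mono Cb(2)) auto
        fix z
        have "2 * pi * real ?d * (2 ^ L * 2 ^ scale L k) \<le> 2 ^ k"
        proof -
          have "pi \<le> 4" using pi_less_4 by simp
          moreover have "real ?d \<le> 2 ^ ?d" by (metis less_imp_le of_nat_less_two_power)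
          ultimately have "2 * pi * real ?d \<le> 2 * 4 * 2 ^ ?d" by (intro mult_mono) auto
          also have "\<dots> \<le> 2 ^ (?d + 5)" by (simp add: power_add)
          finally have "2 * pi * real ?d * (2 ^ L * 2 ^ scale L k) \<le> 2 ^ (?d + 5) * (2 ^ L * 2 ^ scale L k)" by (rule mult_right_mono) simp
          also have "\<dots> = 2 ^ (scale L k + (L + ?d + 5))" by (simp only: power_add mult_ac)
          finally show ?thesis unfolding scale(1)[OF I k] .
        qed
        then have "1 / (1 + 2 ^ L * gap (2 ^ scale L k *\<^sub>R (x - z))) ^ N \<le> 1 / (1 + 2 ^ L * gap (2 ^ scale L k *\<^sub>R x)) ^ N * (1 + 2 ^ k * norm z) ^ N"
          by (rule gap_peetre) auto
        moreover have "wgt R 1 (x - z) \<le> wgt R 1 x * (1 + 2 ^ k * norm z) ^ R" by (rule wgt_peetre) auto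
        ultimately have "\<Omega> k (x - z) \<le> (1 / (1 + 2 ^ L * gap (2 ^ scale L k *\<^sub>R x)) ^ N * (1 + 2 ^ k * norm z) ^ N) * (wgt R 1 x * (1 + 2 ^ k * norm z) ^ R)"
          unfolding \<Omega>_def using gap_nonneg[of "2 ^ scale L k *\<^sub>R x"] wgt_pos[of 1 R "x - z"]
          by (intro mult_mono) (auto intro!: mult_nonneg_nonneg divide_nonneg_nonneg)
        also have "\<dots> = \<Omega> k x * (1 + 2 ^ k * norm z) ^ (N + R)" by (simp add: \<Omega>_def power_add mult_ac)
        finally have "2 powr (- s * real k) * Cb * \<Omega> k (x - z) \<le> 2 powr (- s * real k) * Cb * (\<Omega> k x * (1 + 2 ^ k * norm z) ^ (N + R))"
          using Cb(1) by (intro mult_left_mono) auto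
        then show "w k (x - z) \<le> w k x * (1 + 2 ^ k * norm z) ^ (N + R)" by (simp add: w_def mult.assoc)
      qed
      note nb = nbhd[OF fin ne k4]
      define u where "u k x = Y * \<Omega> k x" for k x
      have u0: "0 \<le> u k x" for k x using Y \<Omega>0 by (simp add: u_def)
      define near where "near l = {k\<in>I. k \<le> l + 1 \<and> l \<le> k + 1}" for l
      define b where "b l x = (\<Sum>k\<in>near l. u k x)" for l x
      have near: "near l = {} \<or> (\<exists>k. near l = {k})" for l
      proof -
        have "k = k'" if "k \<in> near l" "k' \<in> near l" for k k'
        proof (rule ccontr)
          assume "k \<noteq> k'"
          then have "k + 4 \<le> k' \<or> k' + 4 \<le> k" using sparse that by (metis (no_types, lifting) near_def mem_Collect_eq nat_neq_iff)
          then show False using that by (auto simp: near_def)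
        qed
        then show ?thesis by blast
      qed
      have b0: "0 \<le> b l x" for l x unfolding b_def using u0 by (intro sum_nonneg)
      \<comment> \<open>At most one majorant is active in each band, so the power passes through the
        sum.\<close>
      have ba: "b l x powr a = (\<Sum>k\<in>near l. u k x powr a)" for l x
        using near[of l] a by (auto simp: b_def)
      have bl: "2 powr ((s + m) * real l) * norm (piece l (modulated m I (comb s L)) x) \<le> b l x" if "l \<ge> 1" for l x
      proof -
        have "D * (\<Sum>k\<in>near l. 2 powr (s * real k) * w k x) = b l x"
          unfolding b_def sum_distrib_left by (intro sum.cong refl) (simp add: u_def w_def Y_def powr_minus field_simps)
        then show ?thesis using conjunct2[OF bd, rule_format, OF that, of x] by (simp add: near_def)
      qed
      define X where "X x = (\<Sum>k\<in>I. fejer_prod (2 ^ L) (2 ^ scale L k *\<^sub>R x))" for x :: 'a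
      have X0: "0 \<le> X x" for x unfolding X_def by (intro sum_nonneg fejer_prod_bounds(1)) auto
      define V where "V x = A * wgt R 1 x powr a * X x" for x :: 'a
      have V0: "0 \<le> V x" for x using A X0 by (simp add: V_def)
      have ua: "u k x powr a \<le> Y powr a * (4 ^ ?d * fejer_prod (2 ^ L) (2 ^ scale L k *\<^sub>R x)) * wgt R 1 x powr a" for k x
      proof -
        let ?y = "2 ^ L * gap (2 ^ scale L k *\<^sub>R x)"
        have y: "0 \<le> ?y" by (simp add: gap_nonneg)
        have "u k x powr a = Y powr a * (1 / (1 + ?y) ^ N) powr a * wgt R 1 x powr a"
          unfolding u_def \<Omega>_def by (simp only: powr_mult mult.assoc)
        also have "\<dots> \<le> Y powr a * (1 / (1 + ?y) ^ (2 * ?d)) * wgt R 1 x powr a"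
          by (intro mult_right_mono mult_left_mono inverse_power_powr_le y N) auto
        also have "1 / (1 + ?y) ^ (2 * ?d) \<le> 4 ^ ?d * fejer_prod (2 ^ L) (2 ^ scale L k *\<^sub>R x)"
          using mult_left_mono[OF fejer_prod_bounds(3)[of "2 ^ L" "2 ^ scale L k *\<^sub>R x"], of "4 ^ ?d"] by simp
        finally show ?thesis using Y by (simp add: mult_left_mono mult_right_mono)
      qed
      have sum_le: "(\<Sum>l\<in>nbhd I. b l x powr a) \<le> V x" for x
      proof -
        have "(\<Sum>l\<in>nbhd I. b l x powr a) = (\<Sum>k\<in>I. \<Sum>l\<in>{l\<in>nbhd I. k \<le> l + 1 \<and> l \<le> k + 1}. u k x powr a)"
          unfolding ba near_def by (rule sum.swap_restrict[OF nb(1) fin])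
        also have "\<dots> \<le> (\<Sum>k\<in>I. 3 * u k x powr a)"
        proof (rule sum_mono)
          fix k
          have "card {l\<in>nbhd I. k \<le> l + 1 \<and> l \<le> k + 1} \<le> card {k - 1..k + 1}" by (intro card_mono) auto
          also have "\<dots> \<le> 3" by simp
          finally have "real (card {l\<in>nbhd I. k \<le> l + 1 \<and> l \<le> k + 1}) * u k x powr a \<le> 3 * u k x powr a" by (intro mult_right_mono) auto
          then show "(\<Sum>l\<in>{l\<in>nbhd I. k \<le> l + 1 \<and> l \<le> k + 1}. u k x powr a) \<le> 3 * u k x powr a" by simp
        qed
        also have "\<dots> \<le> (\<Sum>k\<in>I. 3 * (Y powr a * (4 ^ ?d * fejer_prod (2 ^ L) (2 ^ scale L k *\<^sub>R x)) * wgt R 1 x powr a))"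
          by (intro sum_mono mult_left_mono ua) auto
        also have "\<dots> = V x" by (simp add: V_def A_def X_def sum_distrib_left mult_ac)
        finally show ?thesis .
      qed
      have "triebel (s + m) p q (dist_of (modulated m I (comb s L))) =
          Lp_norm lborel p (\<lambda>x. Lp_norm (count_space {1..}) q (\<lambda>l. ennreal (2 powr ((s + m) * real l) * norm (piece l (modulated m I (comb s L)) x))))"
        using p bd by (simp add: triebel_lizorkin_norm_def Lp_norm_zero)
      also have "\<dots> \<le> Lp_norm lborel p (\<lambda>x. ennreal (V x powr (1 / a)))"
      proof (rule Lp_norm_mono)
        fix x
        have "Lp_norm (count_space {1..}) q (\<lambda>l. ennreal (2 powr ((s + m) * real l) * norm (piece l (modulated m I (comb s L)) x))) \<le>
            ennreal ((\<Sum>l\<in>nbhd I. b l x powr enn2real q) powr (1 / enn2real q))"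
        proof (rule lq_sum_le[OF q nb(1,3)])
          fix l :: nat assume l: "l \<in> {1..}" "l \<notin> nbhd I"
          show "ennreal (2 powr ((s + m) * real l) * norm (piece l (modulated m I (comb s L)) x)) = 0"
            using modulated_sparse(1)[OF conjunct2[OF bd] sparse l(2)] l(1) by simp
        next
          fix l assume "l \<in> nbhd I"
          then have "l \<ge> 1" by (simp add: nbhd_def)
          then show "ennreal (2 powr ((s + m) * real l) * norm (piece l (modulated m I (comb s L)) x)) \<le> ennreal (b l x)"
            by (intro ennreal_leI bl)
        qed (auto intro: b0)
        also have "\<dots> \<le> ennreal (V x powr (1 / a))"
          unfolding a_def[symmetric] using a by (intro ennreal_leI powr_mono2 sum_le sum_nonneg) auto
        finally show "Lp_norm (count_space {1..}) q (\<lambda>l. ennreal (2 powr ((s + m) * real l) * norm (piece l (modulated m I (comb s L)) x))) \<le> ennreal (V x powr (1 / a))" .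
      qed (use p in auto)
      also have "\<dots> \<le> ennreal (Z * (K / 2 ^ (?d * L)) powr (1 / a))"
      proof (rule Lp_norm_le[OF p0 p(2)])
        have "(\<integral>\<^sup>+x. ennreal ((V x powr (1 / a)) powr enn2real p) \<partial>lborel) \<le> (\<integral>\<^sup>+x. ennreal (A powr (P / a)) * ennreal (X x powr (P / a) * wgt (2 * ?d) 1 x) \<partial>lborel)"
        proof (rule nn_integral_mono)
          fix x
          have "(V x powr (1 / a)) powr P = V x powr (P / a)" by (simp add: powr_powr)
          also have "\<dots> = A powr (P / a) * (wgt R 1 x powr P * X x powr (P / a))"
            using A X0 a wgt_pos[of 1 R x] by (simp add: V_def powr_mult powr_powr mult.assoc)
          also have "\<dots> \<le> A powr (P / a) * (wgt (2 * ?d) 1 x * X x powr (P / a))"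
            using inverse_power_powr_le[of "norm x" "2 * ?d" R P] R by (intro mult_left_mono mult_right_mono) (auto simp: wgt_def)
          finally show "ennreal ((V x powr (1 / a)) powr enn2real p) \<le> ennreal (A powr (P / a)) * ennreal (X x powr (P / a) * wgt (2 * ?d) 1 x)"
            unfolding P_def[symmetric] using wgt_pos[of 1 "2 * ?d" x] by (simp add: ennreal_mult[symmetric] mult.commute ennreal_leI)
        qed
        also have "\<dots> = ennreal (A powr (P / a)) * (\<integral>\<^sup>+x. ennreal (X x powr (P / a) * wgt (2 * ?d) 1 x) \<partial>lborel)"
          unfolding X_def by (intro nn_integral_cmult) measurable
        also have "\<dots> \<le> ennreal (A powr (P / a)) * ennreal (2 * (2 * K * (2 / 2 ^ L) ^ ?d) powr (P / a) * J)"
        proof (rule mult_left_mono)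
          have sep: "2 ^ scale L k * (real (2 ^ L) * real ?d) + 2 < 2 ^ scale L k'" if k: "k \<in> I" "k' \<in> I" "k < k'" for k k'
          proof -
            have "k + (L + ?d + 4) \<le> k'" using I k by (auto simp: spread_def)
            then have "scale L k + L + ?d + 4 \<le> scale L k'" using scale(1)[OF I k(1)] scale(1)[OF I k(2)] by linarith
            then have "(2::real) ^ (scale L k + L + ?d + 4) \<le> 2 ^ scale L k'" by (rule power_increasing) simp
            moreover have "2 ^ scale L k * (real (2 ^ L) * real ?d) \<le> 2 ^ scale L k * (2 ^ L * 2 ^ ?d)"
              using of_nat_less_two_power[of ?d, where 'a=real] by (intro mult_left_mono) auto
            moreover have "(1::real) \<le> 2 ^ scale L k * (2 ^ L * 2 ^ ?d)"
              using one_le_power[of "2::real" "scale L k + (L + ?d)"] by (simp only: power_add)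
            moreover have "(2::real) ^ (scale L k + L + ?d + 4) = 16 * (2 ^ scale L k * (2 ^ L * 2 ^ ?d))" by (simp add: power_add)
            ultimately show ?thesis by linarith
          qed
          have "(\<integral>\<^sup>+x. ennreal (X x powr (P / a) * wgt (2 * ?d) 1 x) \<partial>lborel) \<le> ennreal (2 * (2 * real (card I) * (2 / real (2 ^ L)) ^ ?d) powr (P / a) * J)"
            unfolding X_def J_def using sep by (intro K0(2)[rule_format, OF fin card]) auto
          then show "(\<integral>\<^sup>+x. ennreal (X x powr (P / a) * wgt (2 * ?d) 1 x) \<partial>lborel) \<le> ennreal (2 * (2 * K * (2 / 2 ^ L) ^ ?d) powr (P / a) * J)"
            by (simp add: K_def)
        qed simp
        also have "\<dots> = ennreal ((Z * (K / 2 ^ (?d * L)) powr (1 / a)) powr enn2real p)"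
        proof -
          have "2 * K * (2 / 2 ^ L) ^ ?d = (2 * 2 ^ ?d) * (K / 2 ^ (?d * L))"
            by (simp add: power_divide power_mult[symmetric] mult.commute)
          then have "A powr (P / a) * (2 * (2 * K * (2 / 2 ^ L) ^ ?d) powr (P / a) * J) = (A * (2 * 2 ^ ?d)) powr (P / a) * (2 * J) * (K / 2 ^ (?d * L)) powr (P / a)"
            using A K by (simp only: powr_mult) simp
          also have "\<dots> = (Z * (K / 2 ^ (?d * L)) powr (1 / a)) powr P"
            using P J unfolding Z_def by (simp add: powr_mult powr_powr)
          finally show ?thesis using J by (simp add: ennreal_mult[symmetric] P_def[symmetric])
        qed
        finally show "(\<integral>\<^sup>+x. ennreal ((V x powr (1 / a)) powr enn2real p) \<partial>lborel) \<le> ennreal ((Z * (K / 2 ^ (?d * L)) powr (1 / a)) powr enn2real p)" .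
      qed (use Z in auto)
      finally show "triebel (s + m) p q (dist_of (modulated m I (comb s L))) \<le> ennreal (Z * (real (card I) / 2 ^ (?d * L)) powr (1 / a))"
        by (simp add: K_def)
    qed
  qed
  then show ?thesis using Z unfolding a_def by blast
qed

text \<open>Each of the K arrays is visible in T bands, all different, and each band contributes at
  least a constant times 2^(-dL) to the weighted integral of q-th powers. Since p/q >= 1,
  \<open>powr_moment_lower\<close> turns the total into an L^p bound.\<close>

lemma comb_output:
  assumes q: "q > 0" "q \<le> 1" and p: "p > q" "p \<noteq> \<infinity>" and s: "s \<le> real DIM('a) / enn2real q - real DIM('a)"
  shows "\<exists>b0. \<exists>Z>0. \<forall>T I. T \<ge> 1 \<longrightarrow> spread (b0 + 1 + T) I \<longrightarrow> I \<noteq> {} \<longrightarrow>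
     ennreal (Z * (real (card I) * real T / 2 ^ (DIM('a) * (b0 + 1 + T))) powr (1 / enn2real q)) \<le>
       triebel s p q (dist_of (\<lambda>x. \<Sum>k\<in>I. comb s (b0 + 1 + T) k x))"
proof -
  let ?d = "real DIM('a)"
  let ?W = "wgt (2 * DIM('a)) 1 :: 'a \<Rightarrow> real"
  define a where "a = enn2real q"
  define P where "P = enn2real p"
  have qf: "q \<noteq> \<infinity>" using q(2) ennreal_one_less_top by (metis infinity_ennreal_def not_le)
  have p0: "p > 0" using q(1) p(1) by (rule less_trans)
  have a: "a > 0" "a \<le> 1"
  proof -
    show "a > 0" using enn2real_pos[OF q(1) qf] by (simp add: a_def)
    show "a \<le> 1" using enn2real_mono[OF q(2)] by (simp add: a_def)
  qed
  have P: "P > 0" using enn2real_pos[OF p0 p(2)] by (simp add: P_def)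
  have "a < P" unfolding a_def P_def using p qf by (intro enn2real_less_iff[THEN iffD2]) (auto simp: top.not_eq_extremum)
  then have r: "P / a \<ge> 1" using a by simp
  have sa: "s * a \<le> ?d * (1 - a)"
  proof -
    have "s * a \<le> (?d / a - ?d) * a" using s a by (intro mult_right_mono) (auto simp: a_def)
    then show ?thesis using a by (simp add: left_diff_distrib right_diff_distrib)
  qed
  obtain b0 c where b0: "b0 \<ge> 1" and c: "c > 0" and low: "\<And>L M t. b0 \<le> t \<Longrightarrow> t + 1 \<le> L \<Longrightarrow> 2 \<le> M \<Longrightarrow>
     ennreal (c * 2 powr (?d * (real t * (a - 1) - real L * a))) \<le>
       (\<integral>\<^sup>+x. ennreal (norm (piece (M + t) (blob L M) x) powr a * ?W x) \<partial>lborel)"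
    using lp_proj_blob_lower[OF a] by blast
  define J where "J = (LINT x|lborel. ?W x)"
  have J: "J > 0" unfolding J_def by (rule wgt_integral_pos) simp
  \<comment> \<open>The extra power of 2 pays for the offset d + 5 between k and the frequency range
    of the array.\<close>
  define c' where "c' = c * 2 powr (- (?d * (1 - a) * (?d + 5)))"
  have c': "c' > 0" using c by (simp add: c'_def)
  define Z where "Z = J powr (1 / P) * (c' / (2 * J)) powr (1 / a)"
  have Z: "Z > 0" using J c' by (simp add: Z_def)
  have "ennreal (Z * (real (card I) * real T / 2 ^ (DIM('a) * (b0 + 1 + T))) powr (1 / a)) \<le>
       triebel s p q (dist_of (\<lambda>x. \<Sum>k\<in>I. comb s (b0 + 1 + T) k x))"
    if T: "T \<ge> 1" and I: "spread (b0 + 1 + T) I" and ne: "I \<noteq> {}" for T I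
  proof -
    define L where "L = b0 + 1 + T"
    have I': "spread L I" using I by (simp add: L_def)
    have fin: "finite I" using I by (simp add: spread_def)
    \<comment> \<open>These offsets satisfy t + 2 <= L, so the bands stay inside the range of their
      own array.\<close>
    define TT where "TT = {b0..<b0 + T}"
    have tL: "b0 \<le> t" "t + 2 \<le> L" if "t \<in> TT" for t using that by (auto simp: TT_def L_def)
    define f where "f = (\<lambda>(k, t). scale L k + t)"
    define u where "u l x = 2 powr (s * real l) * norm (piece l (\<lambda>x. \<Sum>k\<in>I. comb s L k x) x)" for l x
    have u0: "0 \<le> u l x" for l x by (simp add: u_def)
    have apart: "scale L k + L + DIM('a) + 4 \<le> scale L k'" if "k \<in> I" "k' \<in> I" "k < k'" for k k'
    proof -
      have "k + (L + DIM('a) + 4) \<le> k'" using I' that by (auto simp: spread_def)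
      then show ?thesis using scale(1)[OF I' that(1)] scale(1)[OF I' that(2)] by linarith
    qed
    have inj: "inj_on f (I \<times> TT)"
    proof (rule inj_onI)
      fix y z assume y: "y \<in> I \<times> TT" "z \<in> I \<times> TT" "f y = f z"
      obtain k t k' t' where yz: "y = (k, t)" "z = (k', t')" by (cases y, cases z) auto
      have t: "t + 2 \<le> L" "t' + 2 \<le> L" using y tL by (auto simp: yz)
      have eq: "scale L k + t = scale L k' + t'" using y(3) by (simp add: yz f_def)
      have "k = k'"
      proof (rule ccontr)
        assume "k \<noteq> k'"
        then consider "k < k'" | "k' < k" by linarith
        then show False using apart[of k k'] apart[of k' k] y t eq by cases (auto simp: yz)
      qed
      then show "y = z" using eq by (simp add: yz)
    qed
    have proj: "piece (scale L k + t) (\<lambda>x. \<Sum>k\<in>I. comb s L k x) x =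
        of_real (2 powr (- s * real k)) * piece (scale L k + t) (blob L (scale L k)) x" if k: "k \<in> I" and t: "t \<in> TT" for k t x
    proof -
      have "piece (scale L k + t) (blob L (scale L k')) x = 0" if k': "k' \<in> I" "k' \<noteq> k" for k'
      proof (rule lp_proj_vanish[OF blob_schwartz blob_far])
        show "1 \<le> scale L k + t" using scale(2)[OF I' k] by simp
        consider "k < k'" | "k' < k" using k'(2) by linarith
        then show "scale L k' + L + 3 \<le> scale L k + t \<or> scale L k + t + 2 \<le> scale L k'"
          using apart[of k k'] apart[of k' k] k k'(1) tL[OF t] by cases auto
      qed
      then have "(\<Sum>k'\<in>I - {k}. of_real (2 powr (- s * real k')) * piece (scale L k + t) (blob L (scale L k')) x) = 0"
        by (intro sum.neutral) auto
      then show ?thesis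
        unfolding comb_def lp_proj_sum[OF blob_schwartz] by (subst sum.remove[OF fin k]) simp
    qed
    have um [measurable]: "u l \<in> borel_measurable borel" for l
    proof -
      have "(\<lambda>x. \<Sum>k\<in>I. comb s L k x) \<in> schwartz" by (intro schwartz_sum comb_schwartz)
      note [measurable] = schwartz_measurable[OF lp_proj_schwartz[OF this]]
      show ?thesis unfolding u_def[abs_def] by measurable
    qed
    have W0: "0 \<le> ?W x" for x using wgt_pos[of 1 "2 * DIM('a)" x] by simp
    have piece: "ennreal (c' / 2 ^ (DIM('a) * L)) \<le> (\<integral>\<^sup>+x. ennreal (u (scale L k + t) x powr a * ?W x) \<partial>lborel)" if k: "k \<in> I" and t: "t \<in> TT" for k t
    proof -
      let ?l = "scale L k + t"
      let ?Q = "piece ?l (blob L (scale L k))"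
      have Qm [measurable]: "?Q \<in> borel_measurable borel" by (intro schwartz_measurable lp_proj_schwartz blob_schwartz)
      have lk: "real ?l - real k = real t - real L - (?d + 5)" using scale(1)[OF I' k] by linarith
      have ux: "u ?l x powr a = 2 powr (s * a * (real t - real L - (?d + 5))) * norm (?Q x) powr a" for x
      proof -
        have "u ?l x = 2 powr (s * (real ?l - real k)) * norm (?Q x)"
        proof -
          have "2 powr (s * (real ?l - real k)) = 2 powr (s * real ?l) * 2 powr (- s * real k)"
            unfolding powr_add[symmetric] by (simp add: algebra_simps)
          then show ?thesis unfolding u_def proj[OF k t] norm_mult by simp
        qed
        then have "u ?l x powr a = 2 powr (s * (real ?l - real k) * a) * norm (?Q x) powr a" by (simp add: powr_mult powr_powr)
        then show ?thesis unfolding lk by (simp add: mult_ac)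
      qed
      \<comment> \<open>Here s a <= d (1 - a) is used: multiplied by the negative number t - L - (d
        + 5), it cancels the dependence on t and leaves 2^(-dL).\<close>
      have e: "- (?d * real L) - ?d * (1 - a) * (?d + 5) \<le> s * a * (real t - real L - (?d + 5)) + ?d * (real t * (a - 1) - real L * a)"
      proof -
        have "real t - real L - (?d + 5) \<le> 0" using tL[OF t] by simp
        then have "(?d * (1 - a)) * (real t - real L - (?d + 5)) \<le> s * a * (real t - real L - (?d + 5))" using sa by (rule mult_right_mono_neg[rotated])
        moreover have "(?d * (1 - a)) * (real t - real L - (?d + 5)) + ?d * (real t * (a - 1) - real L * a) = - (?d * real L) - ?d * (1 - a) * (?d + 5)"
          by (simp add: algebra_simps)
        ultimately show ?thesis by linarith
      qed
      have "c' / 2 ^ (DIM('a) * L) = c * 2 powr (- (?d * real L) - ?d * (1 - a) * (?d + 5))"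
      proof -
        have "c' / 2 ^ (DIM('a) * L) = c * (2 powr (- (?d * real L)) * 2 powr (- (?d * (1 - a) * (?d + 5))))"
          by (simp add: c'_def powr_minus_divide powr_realpow[symmetric])
        then show ?thesis by (simp add: powr_add[symmetric])
      qed
      also have "\<dots> \<le> c * 2 powr (s * a * (real t - real L - (?d + 5)) + ?d * (real t * (a - 1) - real L * a))"
        using c e by (intro mult_left_mono powr_mono) auto
      finally have "ennreal (c' / 2 ^ (DIM('a) * L)) \<le> ennreal (2 powr (s * a * (real t - real L - (?d + 5))) * (c * 2 powr (?d * (real t * (a - 1) - real L * a))))"
        by (intro ennreal_leI) (simp add: powr_add mult_ac)
      also have "\<dots> = ennreal (2 powr (s * a * (real t - real L - (?d + 5)))) * ennreal (c * 2 powr (?d * (real t * (a - 1) - real L * a)))"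
        using c by (simp add: ennreal_mult)
      also have "\<dots> \<le> ennreal (2 powr (s * a * (real t - real L - (?d + 5)))) * (\<integral>\<^sup>+x. ennreal (norm (?Q x) powr a * ?W x) \<partial>lborel)"
        using tL[OF t] scale(2)[OF I' k] by (intro mult_left_mono low) auto
      also have "\<dots> = (\<integral>\<^sup>+x. ennreal (2 powr (s * a * (real t - real L - (?d + 5)))) * ennreal (norm (?Q x) powr a * ?W x) \<partial>lborel)"
        by (intro nn_integral_cmult[symmetric]) measurable
      also have "\<dots> = (\<integral>\<^sup>+x. ennreal (u ?l x powr a * ?W x) \<partial>lborel)"
        using W0 by (simp add: ux ennreal_mult[symmetric] mult.assoc)
      finally show ?thesis .
    qed
    define U where "U x = (\<Sum>l\<in>f ` (I \<times> TT). u l x powr a)" for x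
    have U0: "0 \<le> U x" for x unfolding U_def by (intro sum_nonneg) auto
    have Um [measurable]: "U \<in> borel_measurable borel" unfolding U_def[abs_def] by measurable
    define A where "A = real (card I) * real T * (c' / 2 ^ (DIM('a) * L))"
    have cI: "real (card I) > 0" using fin ne by (simp add: card_gt_0_iff)
    have A: "A > 0" using cI T c' by (simp add: A_def)
    have "ennreal A = ennreal (\<Sum>y\<in>I \<times> TT. c' / 2 ^ (DIM('a) * L))"
      by (simp add: A_def TT_def card_cartesian_product)
    also have "\<dots> = (\<Sum>y\<in>I \<times> TT. ennreal (c' / 2 ^ (DIM('a) * L)))"
      using c' by (intro sum_ennreal[symmetric]) auto
    also have "\<dots> \<le> (\<Sum>y\<in>I \<times> TT. (\<integral>\<^sup>+x. ennreal (u (f y) x powr a * ?W x) \<partial>lborel))"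
      using piece by (intro sum_mono) (auto simp: f_def)
    also have "\<dots> = (\<integral>\<^sup>+x. (\<Sum>y\<in>I \<times> TT. ennreal (u (f y) x powr a * ?W x)) \<partial>lborel)"
      by (intro nn_integral_sum[symmetric]) measurable
    also have "\<dots> = (\<integral>\<^sup>+x. ennreal (U x * ?W x) \<partial>lborel)"
    proof (rule nn_integral_cong)
      fix x
      have "(\<Sum>y\<in>I \<times> TT. ennreal (u (f y) x powr a * ?W x)) = ennreal (\<Sum>y\<in>I \<times> TT. u (f y) x powr a * ?W x)"
        using W0 by (intro sum_ennreal) auto
      also have "(\<Sum>y\<in>I \<times> TT. u (f y) x powr a * ?W x) = U x * ?W x"
        unfolding U_def sum.reindex[OF inj] by (simp add: sum_distrib_right)
      finally show "(\<Sum>y\<in>I \<times> TT. ennreal (u (f y) x powr a * ?W x)) = ennreal (U x * ?W x)" .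
    qed
    finally have AU: "ennreal A \<le> (\<integral>\<^sup>+x. ennreal (U x * ?W x) \<partial>lborel)" .
    have "ennreal (J * (A / (2 * J)) powr (P / a)) \<le> (\<integral>\<^sup>+x. ennreal (U x powr (P / a)) \<partial>lborel)"
      unfolding J_def
    proof (rule powr_moment_lower[OF _ _ _ _ _ _ r A AU])
      show "integrable lborel ?W" by (rule wgt_integrable) simp
      show "(LINT x|lborel. ?W x) > 0" using J by (simp add: J_def)
    qed (use W0 U0 wgt_le_1[of 1 "2 * DIM('a)"] in auto)
    then have I1: "ennreal ((Z * (real (card I) * real T / 2 ^ (DIM('a) * L)) powr (1 / a)) powr enn2real p) \<le> (\<integral>\<^sup>+x. ennreal ((U x powr (1 / a)) powr enn2real p) \<partial>lborel)"
    proof -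
      assume *: "ennreal (J * (A / (2 * J)) powr (P / a)) \<le> (\<integral>\<^sup>+x. ennreal (U x powr (P / a)) \<partial>lborel)"
      have "A / (2 * J) = (c' / (2 * J)) * (real (card I) * real T / 2 ^ (DIM('a) * L))" by (simp add: A_def mult_ac)
      then have "J * (A / (2 * J)) powr (P / a) = (Z * (real (card I) * real T / 2 ^ (DIM('a) * L)) powr (1 / a)) powr P"
        using J P c' unfolding Z_def by (simp only: powr_mult powr_powr) (simp add: mult.assoc)
      then show ?thesis using * by (simp add: powr_powr P_def[symmetric])
    qed
    have "ennreal (Z * (real (card I) * real T / 2 ^ (DIM('a) * L)) powr (1 / a)) \<le> Lp_norm lborel p (\<lambda>x. ennreal (U x powr (1 / a)))"
      by (rule Lp_norm_ge[OF p0 p(2) _ _ I1]) (use Z in auto)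
    also have "\<dots> \<le> Lp_norm lborel p (\<lambda>x. Lp_norm (count_space {1..}) q (\<lambda>l. ennreal (u l x)))"
    proof (rule Lp_norm_mono)
      fix x
      show "ennreal (U x powr (1 / a)) \<le> Lp_norm (count_space {1..}) q (\<lambda>l. ennreal (u l x))"
        unfolding U_def a_def
      proof (rule lq_sum_ge[OF q(1) qf _ _ u0])
        show "finite (f ` (I \<times> TT))" using fin by (simp add: TT_def)
        show "f ` (I \<times> TT) \<subseteq> {1..}" using scale(2)[OF I'] by (force simp: f_def)
      qed
    qed (use p in auto)
    also have "\<dots> \<le> triebel s p q (dist_of (\<lambda>x. \<Sum>k\<in>I. comb s L k x))"
      using p(2) by (simp add: triebel_lizorkin_norm_def u_def)
    finally show ?thesis unfolding L_def .
  qed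
  then show ?thesis using Z unfolding a_def by blast
qed

text \<open>Input and output share the factor (K / 2^(dL))^(1/q); the output has T^(1/q) >= T in
  addition. T is chosen from C, then L from T, then the number of arrays from L.\<close>

lemma lacunary_combs:
  assumes q: "q > 0" "q \<le> 1" and p: "p > q" "p \<noteq> \<infinity>" and s: "s \<le> real DIM('a) / enn2real q - real DIM('a)"
  shows "unbounded m (triebel (s + m) p q) (triebel s p q)"
proof (rule operator_norm_modulated[where NY = "triebel s p q", OF _ triebel_lizorkin_norm_zero])
  fix C :: real assume C: "C > 0"
  have qf: "q \<noteq> \<infinity>" using q(2) ennreal_one_less_top by (metis infinity_ennreal_def not_le)
  obtain Z1 where Z1: "Z1 > 0" "\<forall>L. \<exists>K0\<ge>1. \<forall>I. spread L I \<longrightarrow> K0 \<le> card I \<longrightarrow>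
     triebel (s + m) p q (dist_of (modulated m I (comb s L))) \<le>
       ennreal (Z1 * (real (card I) / 2 ^ (DIM('a) * L)) powr (1 / enn2real q))"
    using comb_input[OF q(1) qf p] by blast
  obtain b0 Z2 where Z2: "Z2 > 0" "\<forall>T I. T \<ge> 1 \<longrightarrow> spread (b0 + 1 + T) I \<longrightarrow> I \<noteq> {} \<longrightarrow>
     ennreal (Z2 * (real (card I) * real T / 2 ^ (DIM('a) * (b0 + 1 + T))) powr (1 / enn2real q)) \<le>
       triebel s p q (dist_of (\<lambda>x. \<Sum>k\<in>I. comb s (b0 + 1 + T) k x))"
    using comb_output[OF q p s] by blast
  define T where "T = nat \<lceil>C * Z1 / Z2\<rceil> + 1"
  have T: "T \<ge> 1" "C * Z1 < Z2 * real T"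
  proof -
    have "C * Z1 / Z2 \<le> real (nat \<lceil>C * Z1 / Z2\<rceil>)" by (rule real_nat_ceiling_ge)
    then have "C * Z1 / Z2 < real T" by (simp add: T_def)
    then show "C * Z1 < Z2 * real T" using Z2(1) by (simp add: field_simps)
  qed (simp add: T_def)
  define L where "L = b0 + 1 + T"
  obtain K0 where K0: "K0 \<ge> 1" "\<forall>I. spread L I \<longrightarrow> K0 \<le> card I \<longrightarrow>
     triebel (s + m) p q (dist_of (modulated m I (comb s L))) \<le>
       ennreal (Z1 * (real (card I) / 2 ^ (DIM('a) * L)) powr (1 / enn2real q))"
    using Z1(2) by blast
  obtain I :: "nat set" where I: "card I = K0" "spread L I"
    using separated_indices[of K0 "L + DIM('a) + 4" "L + DIM('a) + 5"] unfolding spread_def by blast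
  have ne: "I \<noteq> {}" using I(1) K0(1) by auto
  let ?A = "Z1 * (real K0 / 2 ^ (DIM('a) * L)) powr (1 / enn2real q)"
  let ?B = "Z2 * (real K0 * real T / 2 ^ (DIM('a) * L)) powr (1 / enn2real q)"
  have "C * ?A < ?B"
  proof -
    have a: "1 \<le> 1 / enn2real q" using enn2real_pos[OF q(1) qf] enn2real_mono[OF q(2)] by simp
    have pos: "0 < (real K0 / 2 ^ (DIM('a) * L)) powr (1 / enn2real q)" using K0(1) by simp
    have "C * Z1 < Z2 * real T powr (1 / enn2real q)"
    proof -
      have "real T powr 1 \<le> real T powr (1 / enn2real q)" using T(1) a by (intro powr_mono) auto
      then have "Z2 * real T \<le> Z2 * real T powr (1 / enn2real q)" using Z2(1) T(1) by simp
      then show ?thesis using T(2) by linarith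
    qed
    then have "(C * Z1) * (real K0 / 2 ^ (DIM('a) * L)) powr (1 / enn2real q) < (Z2 * real T powr (1 / enn2real q)) * (real K0 / 2 ^ (DIM('a) * L)) powr (1 / enn2real q)"
      using pos by (rule mult_strict_right_mono)
    moreover have "(real K0 * real T / 2 ^ (DIM('a) * L)) powr (1 / enn2real q) = real T powr (1 / enn2real q) * (real K0 / 2 ^ (DIM('a) * L)) powr (1 / enn2real q)"
      by (simp add: powr_mult[symmetric] mult.commute)
    ultimately show ?thesis by (simp add: mult.assoc)
  qed
  moreover have "triebel (s + m) p q (dist_of (modulated m I (comb s L))) \<le> ennreal ?A"
    using K0(2)[rule_format, OF I(2)] I(1) by simp
  moreover have "ennreal ?B \<le> triebel s p q (dist_of (\<lambda>x. \<Sum>k\<in>I. comb s L k x))"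
    using Z2(2)[rule_format, OF T(1) I(2)[unfolded L_def] ne] I(1) by (simp add: L_def)
  moreover have "0 \<le> ?A" using Z1(1) by simp
  ultimately show "exceeds C m (triebel (s + m) p q) (triebel s p q)"
    using comb_admissible[OF I(2)] by blast
qed

end

theorem theorem2p6:
  fixes \<phi> \<Phi> :: "real ^ 'd \<Rightarrow> complex"
    and p q :: ennreal
    and m s :: real
  assumes "littlewood_paley \<phi> \<Phi>"
    and "0 < p" and "0 < q"
  shows
    "((p < \<infinity> \<or> (p = \<infinity> \<and> q = \<infinity>)) \<and> s \<le> tau2 CARD('d) p q \<longrightarrow>
       (\<exists>a \<in> symbols11 m. operator_norm (psdo_graph \<phi> \<Phi> a)
          (triebel_lizorkin_norm \<phi> \<Phi> (s + m) p q) (triebel_lizorkin_norm \<phi> \<Phi> s p q) = \<infinity>)) \<and>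
     (s \<le> tau1 CARD('d) p \<longrightarrow>
       (\<exists>a \<in> symbols11 m. operator_norm (psdo_graph \<phi> \<Phi> a)
          (besov_norm \<phi> \<Phi> (s + m) p q) (besov_norm \<phi> \<Phi> s p q) = \<infinity>))"
proof -
  interpret lp_decomposition \<phi> \<Phi> by (rule lp_decomposition.intro) (rule assms(1))
  have d: "DIM(real ^ 'd) = CARD('d)" by simp
  show ?thesis
  proof (intro conjI impI; (elim conjE)?)
    assume pq: "p < \<infinity> \<or> p = \<infinity> \<and> q = \<infinity>" and s: "s \<le> tau2 CARD('d) p q"
    show "\<exists>a\<in>symbols11 m. operator_norm (psdo_graph \<phi> \<Phi> a)
        (triebel_lizorkin_norm \<phi> \<Phi> (s + m) p q) (triebel_lizorkin_norm \<phi> \<Phi> s p q) = \<infinity>"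
    proof (cases "p = \<infinity>")
      case True
      then have q: "q = \<infinity>" using pq by simp
      \<comment> \<open>The minimum in \<open>tau2\<close> is 1, so the critical index is 0, and the
        norm is the Besov one by convention.\<close>
      then have "s \<le> 0" using s True by (simp add: tau2_def)
      moreover have "triebel_lizorkin_norm \<phi> \<Phi> \<sigma> p q = besov_norm \<phi> \<Phi> \<sigma> p q" for \<sigma>
        using True by (simp add: fun_eq_iff triebel_lizorkin_norm_def)
      ultimately show ?thesis using coherent(1)[OF assms(2), of q] q by simp
    next
      case p: False
      \<comment> \<open>The cases record which of 1, p, q is the minimum. A tie p = q <= 1 goes to
        the spikes, because the combs rely on p/q > 1.\<close>
      consider "q \<le> 1" "q < p" | "p \<le> 1" "p \<le> q" | "1 < p" "1 < q" by force
      then show ?thesis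
      proof cases
        case 1
        then have "min 1 (min p q) = q" by (simp add: min.absorb2 less_imp_le)
        then have "s \<le> real DIM(real ^ 'd) / enn2real q - real DIM(real ^ 'd)" using s by (simp add: tau2_def d)
        then show ?thesis using lacunary_combs[OF assms(3) 1 p] by blast
      next
        case 2
        then have "min 1 (min p q) = p" by (simp add: min_def)
        then have "s \<le> real DIM(real ^ 'd) / enn2real p - real DIM(real ^ 'd)" using s by (simp add: tau2_def d)
        then show ?thesis using single_spike(2)[OF assms(2,3) _ p] by blast
      next
        case 3
        then have "min 1 (min p q) = 1" by (simp add: min.absorb1 less_imp_le)
        then have "s \<le> 0" using s by (simp add: tau2_def)
        then show ?thesis using coherent(2)[OF assms(2) 3(2) _ p] by blast
      qed
    qed
  next
    assume s: "s \<le> tau1 CARD('d) p"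
    show "\<exists>a\<in>symbols11 m. operator_norm (psdo_graph \<phi> \<Phi> a)
        (besov_norm \<phi> \<Phi> (s + m) p q) (besov_norm \<phi> \<Phi> s p q) = \<infinity>"
    proof (cases "p \<le> 1")
      case True
      then have s': "s \<le> real DIM(real ^ 'd) / enn2real p - real DIM(real ^ 'd)" using s by (simp add: tau1_def d min_def)
      show ?thesis
        using single_spike(1)[OF assms(2,3) s'] coherent_spikes[OF assms(2) s'] by (cases "q = \<infinity>") simp_all
    next
      case False
      then have p: "1 < p" by simp
      then have "s \<le> 0" using s by (simp add: tau1_def min.absorb1 less_imp_le)
      \<comment> \<open>Coherent bumps gain K against K^(1/q), which grows only for q > 1; for q <=
        1 the gain comes from n^(1/q) against n^(1/p).\<close>
      then show ?thesis
        using coherent(1)[OF assms(2)] translated_waves[OF p assms(3)] by (cases "q \<le> 1") (simp_all add: not_le)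
    qed
  qed
qed

end
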